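(* Let $\rho\in\mathcal B-\mathcal P$ be arbitrary and let $\Gamma=\rho(\mathbb Z/3*\mathbb Z/2)\subset \mathrm{Isom}(X)$. Then there are two infinite embedded patterns $Y_{\rho,1}$ and $Y_{\rho,2}$ of geodesics in $X$ such that $\Gamma\subset \mathrm{Isom}(Y_{\rho,1})$ and $\Gamma\subset\mathrm{Isom}(Y_{\rho,2})$, both with finite index. In the generic case (that is, for all $\rho$ in some open dense subset of $\mathcal B-\mathcal P$) one has $\Gamma=\mathrm{Isom}(Y_{\rho,1})=\mathrm{Isom}(Y_{\rho,2})$, and $Y_{\rho,1}$ and $Y_{\rho,2}$ are not isometric to each other. Finally, for $k=1,2$ the pattern of flats containing the geodesics of $Y_{\rho,k}$ is embedded.
   Context: **The space $X$.** $X=SL_3(\mathbb R)/SO(3)$, viewed as the space of unit-volume ellipsoids in $\mathbb R^3$ centered at the origin, with its $SL_3(\mathbb R)$-invariant Riemannian metric. $\mathrm{Isom}(X)$ is generated by $SL_3(\mathbb R)$ and by the standard polarity $\Delta$, the order-2 isometry sending the ellipsoid with principal axes along the coordinate axes of semi-lengths $a,b,c$ to the one with semi-lengths $1/a,1/b,1/c$. Elements of $SL_3(\mathbb R)$ are called projective transformations, the remaining isometries dualities; an elliptic polarity is a conjugate of $\Delta$ (an order-2 isometry with a unique fixed point, reversing every geodesic through it). The standard flat is the set of ellipsoids $E(a,b,c)$, $abc=1$, with principal axes along the coordinate axes and semi-lengths $a,b,c$; it is a Euclidean plane, and a flat is any image of it under an isometry. Through the origin of the standard flat there are three medial geodesics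 ($a=1$, $b=1$ or $c=1$); a medial geodesic is an image of one of these under an isometry of $X$ or a geodesic in a flat parallel to such a geodesic in the same flat. Each medial geodesic lies in a unique flat. **Patterns.** A pattern of geodesics is a collection of medial geodesics in $X$; it is embedded if distinct geodesics in it are disjoint. A pattern of flats is embedded if distinct flats in it are disjoint. The pattern of flats containing $Y$ is the set of flats which contain the geodesics of $Y$. $\mathrm{Isom}(Y)$ is the group of isometries of $X$ which preserve the collection $Y$. Two patterns are isometric if some isometry of $X$ carries one to the other. **Representations.** Let $\sigma_3,\sigma_2$ be the generators of orders $3$ and $2$ of $\mathbb Z/3*\mathbb Z/2$. $\mathcal{DFR}$ is the space of $\mathrm{Isom}(X)$-conjugacy classes of discrete faithful representations $\rho:\mathbb Z/3*\mathbb Z/2\to\mathrm{Isom}(X)$ such that $\rho(\sigma_2)$ has a unique fixed point in $X$. **Pappus representations.** Let $\mathbb P$ be the real projective plane; $xy$ denotes the line through points $x,y$. A convex marked box $M=(p,q,r,s;t,b)$ is a convex quadrilateral in $\mathbb P$ with vertices $p,q,r,s$ in cyclic order, together with a point $t$ (the top) in the interior of the side $pq$ and a point $b$ (the bottom) in the interior of the side $rs$; $(p,q,r,s;t,b)$ and $(q,p,s,r;t,b)$ are the same marked box. Put $\mathbf i(M)=(s,r,p,q;b,t)$, $\mathbf t(M)=(p,q,tr\cap bq,ts\cap bp;\,t,\,pr\cap qs)$, $\mathbf b(M)=(tr\cap bq,ts\cap bp,s,r;\,pr\cap qs,\,b)$ (marked boxes by Pappus's Theorem). There is an order-3 projective transformation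 $T_M$ with $\mathbf i(M)\to\mathbf t(M)\to\mathbf b(M)\to\mathbf i(M)$, and a unique elliptic polarity $\delta_M$ with $p\mapsto bq$, $q\mapsto bp$, $r\mapsto ts$, $s\mapsto tr$, $t\mapsto rs$, $b\mapsto pq$. The Pappus representation of $M$ is given by $\rho(\sigma_3)=T_M$, $\rho(\sigma_2)=\delta_M$. $\mathcal P\subset\mathcal{DFR}$ is the set of (classes of) Pappus representations. **Barbot component.** $\mathcal B$ is the connected component of $\mathcal{DFR}$ containing $\mathcal P$. *)

theory Defs
  imports "HOL-Analysis.Analysis" "HOL-Algebra.Bij" "HOL-Algebra.Coset"
begin

section \<open>The symmetric space\<close>

type_synonym mat3 = "real^3^3"

definition SL3 :: "mat3 set" where
  "SL3 = {g. det g = 1}"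

text \<open>
  The ellipsoid \<open>g B\<close>, the image of the closed unit ball \<open>B\<close> under \<open>g \<in> SL3\<close>, is encoded by the
  positive definite matrix \<open>g g\<^sup>T\<close>, which determines it:
  \<open>g B = {v. v \<bullet> ((g g\<^sup>T)\<^sup>-\<^sup>1 v) \<le> 1}\<close>, and \<open>g g\<^sup>T = h h\<^sup>T\<close> iff \<open>g\<^sup>-\<^sup>1 h \<in> SO(3)\<close>.
\<close>

definition X :: "mat3 set" where
  "X = {g ** transpose g |g. g \<in> SL3}"

text \<open>
  At \<open>P\<close> the invariant metric is \<open>\<langle>U, V\<rangle> = tr (P\<^sup>-\<^sup>1 U P\<^sup>-\<^sup>1 V)\<close>; it is unique up to a constant factor,
  on which nothing below depends.  The infimum is over \<open>C\<^sup>1\<close> paths on the closed interval, whose speed is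
  continuous: for mere piecewise \<open>C\<^sup>1\<close> paths in the sense of the library the speed may fail to be
  integrable, in which case \<open>integral\<close> is 0.
\<close>

definition riem_length :: "(real \<Rightarrow> mat3) \<Rightarrow> real" where
  "riem_length c = integral {0..1}
     (\<lambda>t. let V = matrix_inv (c t) ** vector_derivative c (at t) in sqrt (trace (V ** V)))"

definition riem_dist :: "mat3 \<Rightarrow> mat3 \<Rightarrow> real" where
  "riem_dist P Q = Inf {riem_length c |c. c C1_differentiable_on {0..1} \<and>
     c ` {0..1} \<subseteq> X \<and> c 0 = P \<and> c 1 = Q}"

definition isom_group :: "(mat3 \<Rightarrow> mat3) monoid" where
  "isom_group = BijGroup X
     \<lparr>carrier := {f \<in> Bij X. \<forall>P\<in>X. \<forall>Q\<in>X. riem_dist (f P) (f Q) = riem_dist P Q}\<rparr>"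

abbreviation IsomX :: "(mat3 \<Rightarrow> mat3) set" where
  "IsomX \<equiv> carrier isom_group"

lemma subgroup_IsomX: "subgroup IsomX (BijGroup X)"
proof -
  interpret B: group "BijGroup X" by (rule group_BijGroup)
  have car: "carrier (BijGroup X) = Bij X"
    by (simp add: BijGroup_def)
  show ?thesis
  proof
    show "IsomX \<subseteq> carrier (BijGroup X)"
      by (auto simp: isom_group_def BijGroup_def)
  next
    fix f g assume fg: "f \<in> IsomX" "g \<in> IsomX"
    then have b: "f \<in> Bij X" "g \<in> Bij X" by (auto simp: isom_group_def)
    have "g P \<in> X" if "P \<in> X" for P
      using Bij_imp_funcset[OF b(2)] that by blast
    with fg b show "f \<otimes>\<^bsub>BijGroup X\<^esub> g \<in> IsomX"
      by (auto simp: isom_group_def BijGroup_def compose_Bij compose_eq)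
  next
    show "\<one>\<^bsub>BijGroup X\<^esub> \<in> IsomX"
      by (auto simp: isom_group_def BijGroup_def id_Bij)
  next
    fix f assume f: "f \<in> IsomX"
    then have b: "f \<in> Bij X" by (auto simp: isom_group_def)
    have i: "inv\<^bsub>BijGroup X\<^esub> f = (\<lambda>x\<in>X. inv_into X f x)"
      by (rule inv_BijGroup[OF b])
    have bb: "bij_betw f X X" using b by (simp add: Bij_def)
    have "riem_dist (inv_into X f P) (inv_into X f Q) = riem_dist P Q" if "P \<in> X" "Q \<in> X" for P Q
    proof -
      have "inv_into X f P \<in> X" "inv_into X f Q \<in> X"
        using that b by (auto intro: Bij_inv_into_mem)
      moreover have "f (inv_into X f P) = P" "f (inv_into X f Q) = Q"
        using bb that by (auto simp: bij_betw_inv_into_right)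
      ultimately show ?thesis
        using f unfolding isom_group_def by fastforce
    qed
    then show "inv\<^bsub>BijGroup X\<^esub> f \<in> IsomX"
      using restrict_inv_into_Bij[OF b] by (simp add: i isom_group_def)
  qed
qed

lemma group_isom_group: "group isom_group"
  using group.subgroup_imp_group[OF group_BijGroup subgroup_IsomX]
  by (simp add: isom_group_def)

text \<open>On isometries, pointwise convergence is the usual (compact-open) topology.\<close>

definition isom_topology :: "(mat3 \<Rightarrow> mat3) topology" where
  "isom_topology = subtopology (product_topology (\<lambda>_. top_of_set X) X) IsomX"

text \<open>Projective transformations and dualities, as maps of ellipsoids.\<close>

definition proj_isom :: "mat3 \<Rightarrow> mat3 \<Rightarrow> mat3" where
  "proj_isom g = (\<lambda>P\<in>X. g ** P ** transpose g)"

text \<open>Inverting \<open>P\<close> passes to the polar dual ellipsoid: same axes, inverse semi-lengths.\<close>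

definition std_polarity :: "mat3 \<Rightarrow> mat3" where
  "std_polarity = (\<lambda>P\<in>X. matrix_inv P)"

definition dual_isom :: "mat3 \<Rightarrow> mat3 \<Rightarrow> mat3" where
  "dual_isom g = compose X (proj_isom g) std_polarity"

definition elliptic_polarities :: "(mat3 \<Rightarrow> mat3) set" where
  "elliptic_polarities =
     {f \<otimes>\<^bsub>isom_group\<^esub> std_polarity \<otimes>\<^bsub>isom_group\<^esub> inv\<^bsub>isom_group\<^esub> f |f. f \<in> IsomX}"


section \<open>Flats, medial geodesics and patterns\<close>

definition E :: "real \<Rightarrow> real \<Rightarrow> real \<Rightarrow> mat3" where
  "E a b c = (\<chi> i j. if i = j then (vector [a\<^sup>2, b\<^sup>2, c\<^sup>2] :: real^3) $ i else 0)"

definition std_flat :: "mat3 set" where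
  "std_flat = {E a b c |a b c. 0 < a \<and> 0 < b \<and> 0 < c \<and> a * b * c = 1}"

definition std_medials :: "mat3 set set" where
  "std_medials =
     {{E 1 b c |b c. 0 < b \<and> 0 < c \<and> b * c = 1},
      {E a 1 c |a c. 0 < a \<and> 0 < c \<and> a * c = 1},
      {E a b 1 |a b. 0 < a \<and> 0 < b \<and> a * b = 1}}"

definition is_flat :: "mat3 set \<Rightarrow> bool" where
  "is_flat F \<longleftrightarrow> (\<exists>f\<in>IsomX. F = f ` std_flat)"

text \<open>Complete geodesics of \<open>X\<close> are globally minimizing, as \<open>X\<close> is complete, simply connected and
  nonpositively curved.\<close>

definition is_geodesic :: "mat3 set \<Rightarrow> bool" where
  "is_geodesic l \<longleftrightarrow> (\<exists>c :: real \<Rightarrow> mat3. range c = l \<and> l \<subseteq> X \<and>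
     (\<forall>s t. riem_dist (c s) (c t) = \<bar>s - t\<bar>))"

definition parallel_in :: "mat3 set \<Rightarrow> mat3 set \<Rightarrow> mat3 set \<Rightarrow> bool" where
  "parallel_in F l m \<longleftrightarrow> is_geodesic l \<and> is_geodesic m \<and> l \<subseteq> F \<and> m \<subseteq> F \<and> (l = m \<or> l \<inter> m = {})"

definition medial_geodesic :: "mat3 set \<Rightarrow> bool" where
  "medial_geodesic m \<longleftrightarrow> (\<exists>l0\<in>std_medials. \<exists>f\<in>IsomX.
     m = f ` l0 \<or> (\<exists>F. is_flat F \<and> parallel_in F (f ` l0) m))"

definition geodesic_pattern :: "mat3 set set \<Rightarrow> bool" where
  "geodesic_pattern Y \<longleftrightarrow> (\<forall>l\<in>Y. medial_geodesic l)"

definition embedded :: "mat3 set set \<Rightarrow> bool" where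
  "embedded Y \<longleftrightarrow> (\<forall>l\<in>Y. \<forall>m\<in>Y. l \<noteq> m \<longrightarrow> l \<inter> m = {})"

definition flat_pattern :: "mat3 set set \<Rightarrow> mat3 set set" where
  "flat_pattern Y = {F. is_flat F \<and> (\<exists>l\<in>Y. l \<subseteq> F)}"

definition IsomY :: "mat3 set set \<Rightarrow> (mat3 \<Rightarrow> mat3) set" where
  "IsomY Y = {f \<in> IsomX. (`) f ` Y = Y}"

definition isometric_patterns :: "mat3 set set \<Rightarrow> mat3 set set \<Rightarrow> bool" where
  "isometric_patterns Y Z \<longleftrightarrow> (\<exists>f\<in>IsomX. (`) f ` Y = Z)"

text \<open>\<open>H\<close> and \<open>K\<close> are meant to be subgroups of \<open>IsomX\<close>.\<close>

definition finite_index_in :: "(mat3 \<Rightarrow> mat3) set \<Rightarrow> (mat3 \<Rightarrow> mat3) set \<Rightarrow> bool" where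
  "finite_index_in H K \<longleftrightarrow> H \<subseteq> K \<and> finite (rcosets\<^bsub>isom_group\<lparr>carrier := K\<rparr>\<^esub> H)"


section \<open>The free product of cyclic groups of orders 3 and 2\<close>

text \<open>
  Given by its presentation \<open>\<langle>\<sigma>\<^sub>3, \<sigma>\<^sub>2 | \<sigma>\<^sub>3\<^sup>3, \<sigma>\<^sub>2\<^sup>2\<rangle>\<close>.  Positive words suffice, since the relators make both
  generators invertible.
\<close>

datatype gen = S3 | S2

inductive word_eq :: "gen list \<Rightarrow> gen list \<Rightarrow> bool" where
  refl: "word_eq u u"
| sym: "word_eq u v \<Longrightarrow> word_eq v u"
| trans: "word_eq u v \<Longrightarrow> word_eq v w \<Longrightarrow> word_eq u w"
| cong: "word_eq u v \<Longrightarrow> word_eq u' v' \<Longrightarrow> word_eq (u @ u') (v @ v')"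
| cube: "word_eq [S3, S3, S3] []"
| square: "word_eq [S2, S2] []"

quotient_type z3z2 = "gen list" / word_eq
  by (intro equivpI reflpI sympI transpI) (blast intro: word_eq.intros)+

lift_definition word_mult :: "z3z2 \<Rightarrow> z3z2 \<Rightarrow> z3z2" is "(@)"
  by (rule word_eq.cong)

lift_definition word_one :: z3z2 is "[]" .

lift_definition \<sigma>3 :: z3z2 is "[S3]" .

lift_definition \<sigma>2 :: z3z2 is "[S2]" .

definition Z3Z2 :: "z3z2 monoid" where
  "Z3Z2 = \<lparr>carrier = UNIV, mult = word_mult, one = word_one\<rparr>"

lemma word_left_inverse: "\<exists>v. word_eq (v @ u) []"
proof (induction u)
  case Nil
  show ?case using word_eq.refl[of "[]"] by auto
next
  case (Cons x u)
  then obtain v where v: "word_eq (v @ u) []" by blast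
  obtain y where y: "word_eq (y @ [x]) []"
    using word_eq.cube word_eq.square by (cases x) (metis append_Cons append_Nil)+
  have "word_eq ((v @ (y @ [x])) @ u) ((v @ []) @ u)"
    by (intro word_eq.cong word_eq.refl y)
  with v have "word_eq ((v @ y) @ x # u) []"
    by (auto intro: word_eq.trans)
  then show ?case by blast
qed

lemma group_Z3Z2: "group Z3Z2"
proof (rule groupI)
  fix x assume "x \<in> carrier Z3Z2"
  have "\<exists>y. word_mult y x = word_one"
    by transfer (rule word_left_inverse)
  then show "\<exists>y\<in>carrier Z3Z2. y \<otimes>\<^bsub>Z3Z2\<^esub> x = \<one>\<^bsub>Z3Z2\<^esub>"
    by (simp add: Z3Z2_def)
next
  fix x y z
  show "x \<otimes>\<^bsub>Z3Z2\<^esub> y \<otimes>\<^bsub>Z3Z2\<^esub> z = x \<otimes>\<^bsub>Z3Z2\<^esub> (y \<otimes>\<^bsub>Z3Z2\<^esub> z)"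
    unfolding Z3Z2_def monoid.simps by transfer (simp add: word_eq.refl)
next
  fix x
  show "\<one>\<^bsub>Z3Z2\<^esub> \<otimes>\<^bsub>Z3Z2\<^esub> x = x"
    unfolding Z3Z2_def monoid.simps by transfer (simp add: word_eq.refl)
qed (simp_all add: Z3Z2_def)


section \<open>Representations\<close>

definition df_reps :: "(z3z2 \<Rightarrow> mat3 \<Rightarrow> mat3) set" where
  "df_reps = {\<rho> \<in> hom Z3Z2 isom_group. inj \<rho> \<and>
     subtopology isom_topology (range \<rho>) = discrete_topology (range \<rho>) \<and>
     (\<exists>!P. P \<in> X \<and> \<rho> \<sigma>2 P = P)}"

definition conj_class :: "(z3z2 \<Rightarrow> mat3 \<Rightarrow> mat3) \<Rightarrow> (z3z2 \<Rightarrow> mat3 \<Rightarrow> mat3) set" where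
  "conj_class \<rho> =
     {\<lambda>w. f \<otimes>\<^bsub>isom_group\<^esub> \<rho> w \<otimes>\<^bsub>isom_group\<^esub> inv\<^bsub>isom_group\<^esub> f |f. f \<in> IsomX}"

definition DFR :: "(z3z2 \<Rightarrow> mat3 \<Rightarrow> mat3) set set" where
  "DFR = conj_class ` df_reps"

definition rep_topology :: "(z3z2 \<Rightarrow> mat3 \<Rightarrow> mat3) topology" where
  "rep_topology = subtopology (product_topology (\<lambda>_. isom_topology) UNIV) df_reps"

definition DFR_topology :: "(z3z2 \<Rightarrow> mat3 \<Rightarrow> mat3) set topology" where
  "DFR_topology =
     topology (\<lambda>U. U \<subseteq> DFR \<and> openin rep_topology {\<rho> \<in> df_reps. conj_class \<rho> \<in> U})"

lemma topspace_rep_topology: "topspace rep_topology = df_reps"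
proof -
  have "IsomX \<subseteq> (\<Pi>\<^sub>E P\<in>X. X)"
  proof
    fix f assume "f \<in> IsomX"
    then have "f \<in> Bij X" by (simp add: isom_group_def)
    then show "f \<in> (\<Pi>\<^sub>E P\<in>X. X)"
      unfolding PiE_def using Bij_imp_funcset Bij_imp_extensional by (intro IntI)
  qed
  then have "topspace isom_topology = IsomX"
    by (simp add: isom_topology_def Int_absorb1)
  moreover have "df_reps \<subseteq> (\<Pi>\<^sub>E w\<in>UNIV. IsomX)"
  proof
    fix \<rho> assume "\<rho> \<in> df_reps"
    then have "\<rho> \<in> hom Z3Z2 isom_group" by (simp only: df_reps_def mem_Collect_eq)
    then have "\<rho> w \<in> IsomX" for w by (rule hom_in_carrier) (simp add: Z3Z2_def)
    then show "\<rho> \<in> (\<Pi>\<^sub>E w\<in>UNIV. IsomX)" by (simp add: PiE_UNIV_domain)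
  qed
  ultimately show ?thesis
    by (simp only: rep_topology_def topspace_subtopology topspace_product_topology) blast
qed

lemma openin_DFR_topology:
  "openin DFR_topology U \<longleftrightarrow>
     U \<subseteq> DFR \<and> openin rep_topology {\<rho> \<in> df_reps. conj_class \<rho> \<in> U}"
proof -
  have "istopology (\<lambda>U. U \<subseteq> DFR \<and> openin rep_topology {\<rho> \<in> df_reps. conj_class \<rho> \<in> U})"
    unfolding istopology_def
  proof (intro conjI allI impI)
    fix U V
    assume "U \<subseteq> DFR \<and> openin rep_topology {\<rho> \<in> df_reps. conj_class \<rho> \<in> U}"
      and "V \<subseteq> DFR \<and> openin rep_topology {\<rho> \<in> df_reps. conj_class \<rho> \<in> V}"
    moreover have "{\<rho> \<in> df_reps. conj_class \<rho> \<in> U \<inter> V} =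
        {\<rho> \<in> df_reps. conj_class \<rho> \<in> U} \<inter> {\<rho> \<in> df_reps. conj_class \<rho> \<in> V}" by blast
    ultimately show "U \<inter> V \<subseteq> DFR" "openin rep_topology {\<rho> \<in> df_reps. conj_class \<rho> \<in> U \<inter> V}"
      by auto
  next
    fix \<K>
    assume K: "\<forall>U\<in>\<K>. U \<subseteq> DFR \<and> openin rep_topology {\<rho> \<in> df_reps. conj_class \<rho> \<in> U}"
    then show "\<Union>\<K> \<subseteq> DFR" by blast
    have "{\<rho> \<in> df_reps. conj_class \<rho> \<in> \<Union>\<K>} = (\<Union>U\<in>\<K>. {\<rho> \<in> df_reps. conj_class \<rho> \<in> U})"
      by blast
    with K show "openin rep_topology {\<rho> \<in> df_reps. conj_class \<rho> \<in> \<Union>\<K>}"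
      by auto
  qed
  then show ?thesis
    by (simp add: DFR_topology_def)
qed

lemma quotient_map_conj_class: "quotient_map rep_topology DFR_topology conj_class"
proof -
  have "{\<rho> \<in> df_reps. conj_class \<rho> \<in> DFR} = df_reps"
    by (auto simp: DFR_def)
  then have "openin DFR_topology DFR"
    using openin_topspace[of rep_topology]
    by (simp add: openin_DFR_topology topspace_rep_topology)
  then have "topspace DFR_topology = DFR"
    by (meson openin_DFR_topology openin_subset openin_topspace subset_antisym)
  then show ?thesis
    by (auto simp: quotient_map_def openin_DFR_topology topspace_rep_topology DFR_def)
qed


section \<open>Marked boxes and Pappus representations\<close>

text \<open>
  Points and lines of the projective plane are the linear subspaces of \<open>real^3\<close> of dimension 1 and 2,
  so that intersecting two lines is set intersection.
\<close>

type_synonym psub = "(real^3) set"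

definition join :: "psub \<Rightarrow> psub \<Rightarrow> psub" where
  "join x y = span (x \<union> y)"

datatype 'a box = Box 'a 'a 'a 'a 'a 'a

fun box_i :: "'a box \<Rightarrow> 'a box" where
  "box_i (Box p q r s t b) = Box s r p q b t"

fun box_t :: "psub box \<Rightarrow> psub box" where
  "box_t (Box p q r s t b) =
     Box p q (join t r \<inter> join b q) (join t s \<inter> join b p) t (join p r \<inter> join q s)"

fun box_b :: "psub box \<Rightarrow> psub box" where
  "box_b (Box p q r s t b) =
     Box (join t r \<inter> join b q) (join t s \<inter> join b p) s r (join p r \<inter> join q s) b"

fun box_swap :: "'a box \<Rightarrow> 'a box" where
  "box_swap (Box p q r s t b) = Box q p s r t b"

definition same_box :: "'a box \<Rightarrow> 'a box \<Rightarrow> bool" where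
  "same_box M N \<longleftrightarrow> N = M \<or> N = box_swap M"

text \<open>Four points of an affine plane are the vertices, in cyclic order, of a convex quadrilateral iff
  they are in general position and the two diagonals cross.\<close>

definition convex_quad :: "real^3 \<Rightarrow> real^3 \<Rightarrow> real^3 \<Rightarrow> real^3 \<Rightarrow> bool" where
  "convex_quad p q r s \<longleftrightarrow>
     \<not> collinear {p, q, r} \<and> \<not> collinear {q, r, s} \<and> \<not> collinear {r, s, p} \<and> \<not> collinear {s, p, q} \<and>
     open_segment p r \<inter> open_segment q s \<noteq> {}"

text \<open>A convex quadrilateral of the projective plane is one lying in some affine chart
  \<open>{v. n \<bullet> v = 1}\<close>.\<close>

definition convex_marked_box :: "psub box \<Rightarrow> bool" where
  "convex_marked_box M \<longleftrightarrow> (\<exists>n p q r s t b.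
     M = map_box (\<lambda>v. span {v}) (Box p q r s t b) \<and>
     (\<forall>v\<in>{p, q, r, s, t, b}. n \<bullet> v = 1) \<and>
     convex_quad p q r s \<and> t \<in> open_segment p q \<and> b \<in> open_segment r s)"

definition box_rotation :: "psub box \<Rightarrow> mat3 \<Rightarrow> bool" where
  "box_rotation M T \<longleftrightarrow> T \<in> SL3 \<and> T \<noteq> mat 1 \<and> T ** T ** T = mat 1 \<and>
     same_box (box_t M) (map_box ((`) ((*v) T)) (box_i M)) \<and>
     same_box (box_b M) (map_box ((`) ((*v) T)) (box_t M)) \<and>
     same_box (box_i M) (map_box ((`) ((*v) T)) (box_b M))"

text \<open>The standard polarity acts on the projective plane by orthogonal complement.\<close>

definition dual_act :: "mat3 \<Rightarrow> psub \<Rightarrow> psub" where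
  "dual_act g W = (*v) g ` (W\<^sup>\<bottom>)"

fun box_polarity :: "psub box \<Rightarrow> mat3 \<Rightarrow> bool" where
  "box_polarity (Box p q r s t b) g \<longleftrightarrow> g \<in> SL3 \<and> dual_isom g \<in> elliptic_polarities \<and>
     dual_act g p = join b q \<and> dual_act g q = join b p \<and>
     dual_act g r = join t s \<and> dual_act g s = join t r \<and>
     dual_act g t = join r s \<and> dual_act g b = join p q"

definition pappus_rep :: "psub box \<Rightarrow> (z3z2 \<Rightarrow> mat3 \<Rightarrow> mat3) \<Rightarrow> bool" where
  "pappus_rep M \<rho> \<longleftrightarrow> \<rho> \<in> hom Z3Z2 isom_group \<and>
     (\<exists>T. box_rotation M T \<and> \<rho> \<sigma>3 = proj_isom T) \<and>
     (\<exists>g. box_polarity M g \<and> \<rho> \<sigma>2 = dual_isom g)"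

definition Pappus :: "(z3z2 \<Rightarrow> mat3 \<Rightarrow> mat3) set set" where
  "Pappus = {conj_class \<rho> |\<rho>. \<exists>M. convex_marked_box M \<and> pappus_rep M \<rho>}"

definition Barbot :: "(z3z2 \<Rightarrow> mat3 \<Rightarrow> mat3) set set" where
  "Barbot = (THE C. C \<in> connected_components_of DFR_topology \<and> Pappus \<subseteq> C)"

end

theory Submission
  imports Defs
begin

text \<open>
  For every faithful \<open>\<rho>\<close> such that \<open>\<rho> \<sigma>2\<close> has a unique fixed point there are two non-isometric patterns whose symmetry group is
  exactly \<open>\<Gamma> = range \<rho>\<close> (\<open>representation_patterns\<close>). So the whole of \<open>Barbot - Pappus\<close> serves as the open dense set.

  \<^bold>\<open>The patterns.\<close> By \<open>isometry_classification\<close> an isometry of \<open>X\<close> is given by a matrix, as a projective transformation or as a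
  duality. Two flats \<open>g F\<close> and \<open>g' F\<close>, with \<open>F\<close> the standard flat, can only meet if a polynomial \<open>incid\<close> in \<open>g\<^sup>-\<^sup>1 g'\<close> vanishes. For
  \<open>h\<close> other than the identity, \<open>incid (g\<^sup>-\<^sup>1 h g)\<close> vanishes for all \<open>g\<close> only if \<open>h\<close> is a projective involution; there are no exceptions
  among dualities. Now \<open>\<Gamma>\<close> is countable, and it contains no projective involution: an involution of the free product is conjugate to \<open>\<sigma>2\<close>,
  and an involution with a unique fixed point is a duality (\<open>faithful_rep_no_projective_involution\<close>). So by Baire's theorem there are flats
  \<open>g1 F\<close>, \<open>g2 F\<close> all of whose distinct translates under \<open>\<Gamma>\<close> are disjoint (\<open>generic_pair_exists\<close>). Draw in \<open>g1 F\<close> three parallel medial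
  geodesics at offsets \<open>0, 1, a1\<close>, in \<open>g2 F\<close> three at offsets \<open>0, 1, a2\<close>, and take all translates under \<open>\<Gamma>\<close>. This pattern and its
  pattern of flats are embedded and \<open>\<Gamma>\<close>-invariant. An isometry that preserves it maps flats to flats and lines to lines; as
  dualities reverse offsets, and the offsets are chosen asymmetric, it is up to \<open>\<Gamma>\<close> a projective transformation that preserves the
  three lines in \<open>g1 F\<close>, and also one that preserves those in \<open>g2 F\<close>. For flats in generic relative position this leaves only \<open>\<Gamma>\<close>
  (\<open>symmetry_trivial\<close>), whence \<open>IsomY\<close> of the pattern is \<open>\<Gamma>\<close>. Different offsets give a second, non-isometric pattern.

  \<^bold>\<open>Isometries.\<close> The triangular factorization gives retractions of \<open>X\<close> to a flat that do not increase distances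
  (\<open>horo_contracts\<close>). They determine the distance within a flat, the uniqueness of geodesics, and the directions that span flat sectors.
  Hence an isometry fixing the round ball induces a linear isometry of the symmetric traceless matrices which preserves the set of
  singular directions up to sign, and which is conjugation by a rotation up to sign (\<open>isometry_fixing_one\<close>).

  \<^bold>\<open>The component.\<close> \<open>Barbot\<close> is defined by a definite description, which is meaningful because the Pappus classes are a nonempty
  connected subset of \<open>DFR\<close> (\<open>Barbot_component\<close>). A projective transformation makes any convex marked box a square with top and bottom
  given by two parameters \<open>t, b\<close> between -1 and 1 (\<open>normalization\<close>), the rotation and the polarity of a box are unique, and both
  depend continuously on \<open>t\<close> and \<open>b\<close>. That these representations are discrete and faithful is shown by playing ping-pong with the
  cones \<open>regA\<close> and \<open>regB\<close> simultaneously on points and, through the polarity, on lines (\<open>box_rep_df\<close>).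
\<close>

section \<open>Linear algebra of 3 by 3 matrices\<close>

text \<open>The action of matrices on quadratic forms, and thereby on ellipsoids.\<close>

abbreviation congruence :: "mat3 \<Rightarrow> mat3 \<Rightarrow> mat3" (infixr "\<star>" 75) where
  "g \<star> P \<equiv> g ** P ** transpose g"

lemma mat3_eq_iff:
  "A = B \<longleftrightarrow> A$1$1 = B$1$1 \<and> A$1$2 = B$1$2 \<and> A$1$3 = B$1$3 \<and>
     A$2$1 = B$2$1 \<and> A$2$2 = B$2$2 \<and> A$2$3 = B$2$3 \<and>
     A$3$1 = B$3$1 \<and> A$3$2 = B$3$2 \<and> A$3$3 = B$3$3" for A B :: mat3
  by (auto simp: vec_eq_iff forall_3)

lemma vec3_eq_iff: "x = y \<longleftrightarrow> x$1 = y$1 \<and> x$2 = y$2 \<and> x$3 = y$3" for x y :: "real^3"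
  by (auto simp: vec_eq_iff forall_3)

lemma mult3: "(A ** B)$i$j = A$i$1 * B$1$j + A$i$2 * B$2$j + A$i$3 * B$3$j" for A B :: mat3
  by (simp add: matrix_matrix_mult_def sum_3)

lemma vmult3: "(A *v x)$i = A$i$1 * x$1 + A$i$2 * x$2 + A$i$3 * x$3" for A :: mat3
  by (simp add: matrix_vector_mult_def sum_3)

lemma transpose_entry [simp]: "transpose A $ i $ j = A $ j $ i"
  by (simp add: transpose_def)

lemma mat1_entry: "(mat 1 :: mat3) $ i $ j = (if i = j then 1 else 0)"
  by (simp add: mat_def)

lemma trace3: "trace A = A$1$1 + A$2$2 + A$3$3" for A :: mat3
  by (simp add: trace_def sum_3)

lemma inner3: "x \<bullet> y = x$1 * y$1 + x$2 * y$2 + x$3 * y$3" for x y :: "real^3"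
  by (simp add: inner_vec_def sum_3)

definition m3 :: "real \<Rightarrow> real \<Rightarrow> real \<Rightarrow> real \<Rightarrow> real \<Rightarrow> real \<Rightarrow> real \<Rightarrow> real \<Rightarrow> real \<Rightarrow> mat3" where
  "m3 a b c d e f g h i = vector [vector [a, b, c], vector [d, e, f], vector [g, h, i]]"

lemma m3_entry [simp]:
  "m3 a b c d e f g h i $ 1 $ 1 = a" "m3 a b c d e f g h i $ 1 $ 2 = b" "m3 a b c d e f g h i $ 1 $ 3 = c"
  "m3 a b c d e f g h i $ 2 $ 1 = d" "m3 a b c d e f g h i $ 2 $ 2 = e" "m3 a b c d e f g h i $ 2 $ 3 = f"
  "m3 a b c d e f g h i $ 3 $ 1 = g" "m3 a b c d e f g h i $ 3 $ 2 = h" "m3 a b c d e f g h i $ 3 $ 3 = i"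
  by (simp_all add: m3_def)

definition adj :: "mat3 \<Rightarrow> mat3" where
  "adj A = m3
    (A$2$2 * A$3$3 - A$2$3 * A$3$2) (A$1$3 * A$3$2 - A$1$2 * A$3$3) (A$1$2 * A$2$3 - A$1$3 * A$2$2)
    (A$2$3 * A$3$1 - A$2$1 * A$3$3) (A$1$1 * A$3$3 - A$1$3 * A$3$1) (A$1$3 * A$2$1 - A$1$1 * A$2$3)
    (A$2$1 * A$3$2 - A$2$2 * A$3$1) (A$1$2 * A$3$1 - A$1$1 * A$3$2) (A$1$1 * A$2$2 - A$1$2 * A$2$1)"

lemma adj_mult: "adj A ** A = det A *\<^sub>R mat 1" "A ** adj A = det A *\<^sub>R mat 1"
  by (simp_all add: mat3_eq_iff mult3 adj_def det_3 mat1_entry algebra_simps)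

lemma scaleR_mult [simp]: "(c *\<^sub>R A) ** B = c *\<^sub>R (A ** B)" "A ** (c *\<^sub>R B) = c *\<^sub>R (A ** B)" for A B :: mat3
  by (simp_all add: mat3_eq_iff mult3 algebra_simps)

lemma transpose_scaleR [simp]: "transpose (c *\<^sub>R A) = c *\<^sub>R transpose A" for A :: mat3
  by (simp add: mat3_eq_iff)

lemma det_scaleR: "det (c *\<^sub>R A) = c ^ 3 * det A" for A :: mat3
  by (simp add: det_3 algebra_simps power3_eq_cube)

lemma matrix_inv_unique_left:
  fixes A B :: mat3
  assumes "B ** A = mat 1"
  shows "matrix_inv A = B"
proof -
  have B: "A ** B = mat 1" using assms matrix_left_right_inverse by blast
  then have "\<exists>C. A ** C = mat 1 \<and> C ** A = mat 1" using assms by blast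
  then have "A ** matrix_inv A = mat 1 \<and> matrix_inv A ** A = mat 1"
    unfolding matrix_inv_def by (rule someI_ex)
  then have "B ** (A ** matrix_inv A) = B" by simp
  then show ?thesis by (simp add: matrix_mul_assoc assms)
qed

lemma matrix_inv_adj: "det A \<noteq> 0 \<Longrightarrow> matrix_inv A = (1 / det A) *\<^sub>R adj A" for A :: mat3
  by (rule matrix_inv_unique_left) (simp add: adj_mult)

lemma matrix_inv_mult:
  fixes A :: mat3
  assumes "det A \<noteq> 0" shows "matrix_inv A ** A = mat 1" "A ** matrix_inv A = mat 1"
  using assms by (simp_all add: matrix_inv_adj adj_mult)

lemma det_matrix_inv: "det A \<noteq> 0 \<Longrightarrow> det (matrix_inv A) = 1 / det A" for A :: mat3
  using arg_cong[OF matrix_inv_mult(1), of A det] by (simp add: det_mul field_simps)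

lemma matrix_inv_prod:
  fixes A B :: mat3
  assumes "det A \<noteq> 0" "det B \<noteq> 0"
  shows "matrix_inv (A ** B) = matrix_inv B ** matrix_inv A"
proof (rule matrix_inv_unique_left)
  have "matrix_inv B ** matrix_inv A ** (A ** B) = matrix_inv B ** (matrix_inv A ** A) ** B"
    by (simp add: matrix_mul_assoc)
  then show "matrix_inv B ** matrix_inv A ** (A ** B) = mat 1"
    using assms by (simp add: matrix_inv_mult)
qed

lemma matrix_inv_transpose3: "det A \<noteq> 0 \<Longrightarrow> matrix_inv (transpose A) = transpose (matrix_inv A)" for A :: mat3
  by (rule matrix_inv_unique_left) (metis matrix_inv_mult(2) matrix_transpose_mul transpose_mat)

lemma matrix_cancel_left: "det A \<noteq> 0 \<Longrightarrow> A ** B = A ** C \<longleftrightarrow> B = C" for A :: mat3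
  by (metis matrix_inv_mult(1) matrix_mul_assoc matrix_mul_lid)

lemma matrix_cancel_right: "det A \<noteq> 0 \<Longrightarrow> B ** A = C ** A \<longleftrightarrow> B = C" for A :: mat3
  by (metis matrix_inv_mult(2) matrix_mul_assoc matrix_mul_rid)

lemma SL3_mult: "g \<in> SL3 \<Longrightarrow> h \<in> SL3 \<Longrightarrow> g ** h \<in> SL3"
  by (simp add: SL3_def det_mul)

lemma SL3_inv: "g \<in> SL3 \<Longrightarrow> matrix_inv g \<in> SL3"
  by (simp add: SL3_def det_matrix_inv)

lemma SL3_transpose: "g \<in> SL3 \<Longrightarrow> transpose g \<in> SL3"
  by (simp add: SL3_def)

lemma SL3_one: "mat 1 \<in> SL3"
  by (simp add: SL3_def)

lemma SL3_det: "g \<in> SL3 \<Longrightarrow> det g = 1"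
  by (simp add: SL3_def)

definition dg :: "real^3 \<Rightarrow> mat3" where
  "dg x = m3 (x$1) 0 0 0 (x$2) 0 0 0 (x$3)"

definition ex :: "real^3 \<Rightarrow> mat3" where
  "ex x = m3 (exp (x$1)) 0 0 0 (exp (x$2)) 0 0 0 (exp (x$3))"

definition sum0 :: "(real^3) set" where
  "sum0 = {x. x$1 + x$2 + x$3 = 0}"

lemma det_ex: "x \<in> sum0 \<Longrightarrow> det (ex x) = 1"
  by (simp add: det_3 ex_def sum0_def flip: exp_add)

lemma transpose_ex [simp]: "transpose (ex x) = ex x"
  by (simp add: mat3_eq_iff ex_def)

lemma ex_add: "ex x ** ex y = ex (x + y)"
  by (simp add: mat3_eq_iff ex_def mult3 exp_add)

lemma ex_0 [simp]: "ex 0 = mat 1"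
  by (simp add: mat3_eq_iff ex_def mat1_entry)

lemma ex_inj: "ex x = ex y \<longleftrightarrow> x = y"
  by (auto simp: mat3_eq_iff ex_def vec3_eq_iff)

lemma matrix_inv_ex: "matrix_inv (ex x) = ex (- x)"
  by (rule matrix_inv_unique_left) (simp add: ex_add)

lemma sum0_closed [simp]:
  "0 \<in> sum0" "x \<in> sum0 \<Longrightarrow> c *\<^sub>R x \<in> sum0" "x \<in> sum0 \<Longrightarrow> - x \<in> sum0"
  "x \<in> sum0 \<Longrightarrow> y \<in> sum0 \<Longrightarrow> x + y \<in> sum0" "x \<in> sum0 \<Longrightarrow> y \<in> sum0 \<Longrightarrow> x - y \<in> sum0"
  by (simp_all add: sum0_def) (simp flip: distrib_left)

text \<open>A maximum point \<open>v\<close> of the quadratic form on the unit sphere; the component of \<open>A v\<close> orthogonal to \<open>v\<close> would be a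
  direction of ascent.\<close>

lemma symmetric_eigenvector:
  fixes A :: mat3
  assumes A: "transpose A = A"
  shows "\<exists>v l. norm v = 1 \<and> A *v v = l *\<^sub>R v"
proof -
  let ?Q = "\<lambda>x. x \<bullet> (A *v x)"
  have "continuous_on (sphere 0 1) ?Q"
    by (intro continuous_intros matrix_vector_mult_linear_continuous_on)
  moreover have "axis 1 1 \<in> sphere (0 :: real^3) 1" by simp
  ultimately obtain v where v: "norm v = 1" "\<And>x. norm x = 1 \<Longrightarrow> ?Q x \<le> ?Q v"
    using continuous_attains_sup[OF compact_sphere, of "0::real^3" 1 ?Q] by auto
  define l where "l = ?Q v"
  have Qle: "?Q x \<le> l * (norm x)\<^sup>2" for x
  proof (cases "x = 0")
    case False
    have "?Q (x /\<^sub>R norm x) \<le> l" unfolding l_def using False by (intro v) simp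
    moreover have "?Q (x /\<^sub>R norm x) = ?Q x / (norm x)\<^sup>2"
      by (simp add: matrix_vector_mult_scaleR power2_eq_square divide_inverse mult.assoc mult.commute)
    ultimately have "?Q x / (norm x)\<^sup>2 \<le> l" by simp
    with False show ?thesis by (simp add: pos_divide_le_eq)
  qed simp
  have sym: "x \<bullet> (A *v y) = y \<bullet> (A *v x)" for x y
    by (metis A dot_lmul_matrix inner_commute transpose_matrix_vector)
  define w where "w = A *v v - l *\<^sub>R v"
  have wv: "w \<bullet> v = 0"
    using v(1) by (simp add: w_def inner_diff_left inner_diff_right l_def inner_commute norm_eq_1)
  define d where "d = ?Q w - l * (norm w)\<^sup>2"
  define c where "c = w \<bullet> (A *v v)"
  have ineq: "2 * s * c + s\<^sup>2 * d \<le> 0" for s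
  proof -
    have "?Q (v + s *\<^sub>R w) = l + 2 * s * c + s\<^sup>2 * ?Q w"
      by (simp add: matrix_vector_right_distrib matrix_vector_mult_scaleR inner_add_left inner_add_right
          l_def c_def sym[of v w] power2_eq_square algebra_simps)
    moreover have "(norm (v + s *\<^sub>R w))\<^sup>2 = 1 + s\<^sup>2 * (norm w)\<^sup>2"
      using wv v(1) unfolding power2_norm_eq_inner
      by (simp add: inner_add_left inner_add_right inner_commute norm_eq_1 power2_eq_square)
    ultimately show ?thesis using Qle[of "v + s *\<^sub>R w"]
      by (simp add: d_def algebra_simps)
  qed
  have "c = 0"
  proof (rule ccontr)
    assume c: "c \<noteq> 0"
    define m where "m = \<bar>d\<bar> + 1"
    have m: "m > 0" "d \<ge> - m" by (auto simp: m_def)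
    have "2 * (c/m) * c + (c/m)\<^sup>2 * d \<ge> 2 * (c/m) * c + (c/m)\<^sup>2 * (- m)"
      using m by (intro add_left_mono mult_left_mono) auto
    also have "2 * (c/m) * c + (c/m)\<^sup>2 * (- m) = c\<^sup>2 / m"
      using m by (simp add: field_simps power2_eq_square)
    finally have "c\<^sup>2 / m \<le> 0" using ineq[of "c/m"] by linarith
    moreover have "c\<^sup>2 / m > 0" using c m by simp
    ultimately show False by linarith
  qed
  have "w \<bullet> w = c - l * (w \<bullet> v)"
    unfolding c_def by (subst (2) w_def) (simp add: inner_diff_right)
  with \<open>c = 0\<close> wv have "w = 0" by simp
  then have "A *v v = l *\<^sub>R v" by (simp add: w_def)
  with v show ?thesis by blast
qed

text \<open>The Jacobi rotation: the off-diagonal entry changes sign under a quarter turn.\<close>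

lemma rotation_zeroing_offdiagonal:
  fixes x y z :: real
  shows "\<exists>c s. c\<^sup>2 + s\<^sup>2 = 1 \<and> (c\<^sup>2 - s\<^sup>2) * y + c * s * (z - x) = 0"
proof -
  define f where "f = (\<lambda>u. ((cos u)\<^sup>2 - (sin u)\<^sup>2) * y + cos u * sin u * (z - x))"
  have cont: "continuous_on {0..pi/2} f" unfolding f_def by (intro continuous_intros)
  have f: "f 0 = y" "f (pi/2) = - y" by (simp_all add: f_def)
  have "\<exists>u. f u = 0"
  proof (cases "y \<le> 0")
    case True
    then show ?thesis using IVT'[of f 0 0 "pi/2"] cont f by auto
  next
    case False
    then show ?thesis using IVT2'[of f "pi/2" 0 0] cont f by auto
  qed
  then obtain u where "f u = 0" by blast
  then show ?thesis by (intro exI[of _ "cos u"] exI[of _ "sin u"]) (simp add: f_def)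
qed

lemma rotation_SL3: "rotation_matrix k \<Longrightarrow> k ** transpose k = mat 1 \<and> transpose k ** k = mat 1 \<and> k \<in> SL3"
  by (simp add: rotation_matrix_def orthogonal_matrix_def SL3_def)

lemma symmetric_diagonalization:
  fixes A :: mat3
  assumes A: "transpose A = A"
  shows "\<exists>k x. rotation_matrix k \<and> A = k \<star> dg x"
proof -
  obtain v l where v: "norm v = 1" "A *v v = l *\<^sub>R v" using symmetric_eigenvector[OF A] by blast
  have "2 \<le> CARD(3)" by simp
  from rotation_matrix_exists_basis[OF this v(1)] obtain k1 where
    k1: "rotation_matrix k1" "k1 *v (axis 1 1) = v" by blast
  note k1o = rotation_SL3[OF k1(1)]
  define B where "B = transpose k1 ** A ** k1"
  have Bs: "transpose B = B" by (simp add: B_def matrix_transpose_mul A matrix_mul_assoc)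
  have "B *v axis 1 1 = transpose k1 *v (A *v (k1 *v axis 1 1))"
    by (simp add: B_def matrix_vector_mul_assoc matrix_mul_assoc)
  also have "\<dots> = l *\<^sub>R (transpose k1 *v (k1 *v axis 1 1))"
    by (simp only: k1(2) v matrix_vector_mult_scaleR)
  also have "\<dots> = l *\<^sub>R axis 1 1"
    using k1o by (simp only: matrix_vector_mul_assoc) simp
  finally have "B *v axis 1 1 = l *\<^sub>R axis 1 1" .
  then have B0: "B$2$1 = 0" "B$3$1 = 0" by (auto simp: vec3_eq_iff vmult3 axis_def)
  have "B$i$j = B$j$i" for i j using Bs by (metis transpose_entry)
  with B0 have B1: "B$1$2 = 0" "B$1$3 = 0" "B$3$2 = B$2$3" by simp_all
  obtain c s where cs: "c\<^sup>2 + s\<^sup>2 = 1" "(c\<^sup>2 - s\<^sup>2) * B$2$3 + c * s * (B$3$3 - B$2$2) = 0"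
    using rotation_zeroing_offdiagonal by blast
  define k2 where "k2 = m3 1 0 0 0 c (- s) 0 s c"
  have k2o: "k2 ** transpose k2 = mat 1" "transpose k2 ** k2 = mat 1" "det k2 = 1"
    using cs(1) by (simp_all add: mat3_eq_iff mult3 mat1_entry k2_def power2_eq_square det_3 algebra_simps)
  then have k2: "rotation_matrix k2" by (simp add: rotation_matrix_def orthogonal_matrix_def)
  define C where "C = transpose k2 ** B ** k2"
  define x where "x = (\<chi> i. C$i$i)"
  have "C = dg x"
  proof -
    have "C$2$3 = (c\<^sup>2 - s\<^sup>2) * B$2$3 + c * s * (B$3$3 - B$2$2)" "C$3$2 = (c\<^sup>2 - s\<^sup>2) * B$2$3 + c * s * (B$3$3 - B$2$2)"
      using B0 B1 by (simp_all add: C_def mult3 k2_def power2_eq_square algebra_simps)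
    moreover have "C$1$2 = 0" "C$1$3 = 0" "C$2$1 = 0" "C$3$1 = 0"
      using B0 B1 by (simp_all add: C_def mult3 k2_def)
    ultimately show ?thesis using cs by (simp add: mat3_eq_iff dg_def x_def)
  qed
  moreover have "A = (k1 ** k2) \<star> C"
  proof -
    have "(k1 ** k2) \<star> C = k1 ** (k2 ** transpose k2) ** B ** (k2 ** transpose k2) ** transpose k1"
      by (simp only: C_def matrix_transpose_mul matrix_mul_assoc)
    also have "\<dots> = (k1 ** transpose k1) ** A ** (k1 ** transpose k1)"
      unfolding k2o by (simp add: B_def matrix_mul_assoc)
    finally show ?thesis using k1o by simp
  qed
  moreover have "rotation_matrix (k1 ** k2)"
    using k1 k2 by (auto simp: rotation_matrix_def orthogonal_matrix_mul det_mul)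
  ultimately show ?thesis by blast
qed

section \<open>Ellipsoids and the invariant distance\<close>

lemma conj_entry_diag: "(k \<star> dg x)$i$j = k$i$1 * x$1 * k$j$1 + k$i$2 * x$2 * k$j$2 + k$i$3 * x$3 * k$j$3" for k :: mat3
  by (simp add: mult3 dg_def)

lemma X_symmetric: "P \<in> X \<Longrightarrow> transpose P = P"
  by (auto simp: X_def matrix_transpose_mul)

lemma X_det: "P \<in> X \<Longrightarrow> det P = 1"
  by (auto simp: X_def SL3_def det_mul)

lemma X_inv_adj: "P \<in> X \<Longrightarrow> matrix_inv P = adj P"
  by (simp add: matrix_inv_adj X_det)

lemma X_act: "P \<in> X \<Longrightarrow> g \<in> SL3 \<Longrightarrow> g ** P ** transpose g \<in> X"
proof -
  assume "P \<in> X" "g \<in> SL3"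
  then obtain h where h: "P = h ** transpose h" "h \<in> SL3" by (auto simp: X_def)
  have "g \<star> P = (g ** h) ** transpose (g ** h)"
    by (simp add: h matrix_transpose_mul matrix_mul_assoc)
  with h \<open>g \<in> SL3\<close> show ?thesis unfolding X_def using SL3_mult by blast
qed

lemma SL3_act_one: "g \<in> SL3 \<Longrightarrow> g ** transpose g \<in> X"
  by (auto simp: X_def)

lemma one_in_X: "mat 1 \<in> X"
  using SL3_act_one[OF SL3_one] by simp

lemma X_positive:
  assumes "P \<in> X" "v \<noteq> 0" shows "v \<bullet> (P *v v) > 0"
proof -
  obtain g where g: "P = g ** transpose g" "det g = 1" using assms by (auto simp: X_def SL3_def)
  have "v \<bullet> (P *v v) = (transpose g *v v) \<bullet> (transpose g *v v)"
    unfolding g(1) by (metis dot_lmul_matrix matrix_vector_mul_assoc transpose_matrix_vector)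
  moreover have "transpose g *v v \<noteq> 0"
  proof
    assume "transpose g *v v = 0"
    then have "matrix_inv (transpose g) *v (transpose g *v v) = 0" by simp
    moreover have "matrix_inv (transpose g) *v (transpose g *v v) = v"
      unfolding matrix_vector_mul_assoc using g(2) by (simp add: matrix_inv_mult)
    ultimately show False using assms(2) by simp
  qed
  ultimately show ?thesis by simp
qed

lemma X_minors:
  assumes "P \<in> X"
  shows "P$1$1 > 0" "P$2$2 > 0" "P$3$3 > 0" "P$1$1 * P$2$2 - P$1$2 * P$1$2 > 0"
    "P$2$1 = P$1$2" "P$3$1 = P$1$3" "P$3$2 = P$2$3"
proof -
  have s: "P$i$j = P$j$i" for i j using X_symmetric[OF assms] by (metis transpose_entry)
  show "P$2$1 = P$1$2" "P$3$1 = P$1$3" "P$3$2 = P$2$3" by (rule s)+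
  have p: "v \<bullet> (P *v v) > 0" if "v$1 \<noteq> 0 \<or> v$2 \<noteq> 0 \<or> v$3 \<noteq> 0" for v
    by (rule X_positive[OF assms]) (use that in auto)
  show p1: "P$1$1 > 0" using p[of "vector [1,0,0]"] by (simp add: inner3 vmult3)
  show "P$2$2 > 0" using p[of "vector [0,1,0]"] by (simp add: inner3 vmult3)
  show "P$3$3 > 0" using p[of "vector [0,0,1]"] by (simp add: inner3 vmult3)
  have "P$1$1 * (P$1$1 * P$2$2 - P$1$2 * P$1$2) > 0"
    using p[of "vector [- P$1$2, P$1$1, 0]"] p1 s[of 2 1] by (simp add: inner3 vmult3 algebra_simps)
  then show "P$1$1 * P$2$2 - P$1$2 * P$1$2 > 0" using p1 by (simp add: zero_less_mult_iff)
qed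

lemma ex_half: "ex x = ex ((1/2) *\<^sub>R x) ** ex ((1/2) *\<^sub>R x)"
  by (simp add: ex_add flip: scaleR_add_left)

lemma ex_SL3: "x \<in> sum0 \<Longrightarrow> ex x \<in> SL3"
  by (simp add: SL3_def det_ex)

lemma ex_in_X: "x \<in> sum0 \<Longrightarrow> ex x \<in> X"
  using SL3_act_one[OF ex_SL3, of "(1/2) *\<^sub>R x"] by (simp flip: ex_half)

lemma dot_form: "x \<bullet> (h *v y) = (transpose h *v x) \<bullet> y" for h :: mat3
  by (simp only: inner3 vmult3 transpose_entry) (simp add: algebra_simps)

lemma positive_definite_spectral:
  assumes A: "transpose A = A" "det A = 1" and pos: "\<And>v. v \<noteq> 0 \<Longrightarrow> v \<bullet> (A *v v) > 0"
  shows "\<exists>k x. rotation_matrix k \<and> x \<in> sum0 \<and> A = k \<star> ex x"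
proof -
  obtain k y where k: "rotation_matrix k" "A = k \<star> dg y" using symmetric_diagonalization[OF A(1)] by blast
  note ko = rotation_SL3[OF k(1)]
  have "transpose k ** A ** k = (transpose k ** k) ** dg y ** (transpose k ** k)" unfolding k(2) by (simp add: matrix_mul_assoc)
  then have dgy: "dg y = transpose k ** (A ** k)" using ko by (simp add: matrix_mul_assoc)
  have p: "axis i 1 \<bullet> (dg y *v axis i 1) > 0" for i
  proof -
    let ?v = "k *v axis i 1"
    have "axis i 1 \<bullet> (dg y *v axis i 1) = axis i 1 \<bullet> (transpose k *v (A *v ?v))"
      unfolding dgy by (simp only: matrix_vector_mul_assoc)
    also have "\<dots> = ?v \<bullet> (A *v ?v)" unfolding dot_form[of _ "transpose k"] transpose_transpose ..
    finally have e: "axis i 1 \<bullet> (dg y *v axis i 1) = ?v \<bullet> (A *v ?v)" .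
    have "transpose k *v ?v \<noteq> 0" using ko by (simp only: matrix_vector_mul_assoc) simp
    then have "?v \<noteq> 0" by (metis matrix_vector_mult_0_right)
    then show ?thesis using pos e by simp
  qed
  have y: "y$1 > 0" "y$2 > 0" "y$3 > 0"
    using p[of 1] p[of 2] p[of 3] by (simp_all add: inner3 vmult3 axis_def dg_def)
  have "det A = det (dg y)" unfolding k(2) using ko by (simp add: det_mul SL3_def)
  then have d: "y$1 * y$2 * y$3 = 1" using A(2) by (simp add: dg_def det_3)
  define x where "x = (\<chi> i. ln (y$i))"
  have "ln (y$1 * y$2 * y$3) = ln (y$1) + ln (y$2) + ln (y$3)" using y by (simp add: ln_mult)
  then have "x \<in> sum0" using d by (simp add: sum0_def x_def)
  moreover have "dg y = ex x" using y by (simp add: dg_def ex_def x_def)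
  ultimately show ?thesis using k by metis
qed

lemma X_spectral: "P \<in> X \<Longrightarrow> \<exists>k x. rotation_matrix k \<and> x \<in> sum0 \<and> P = k \<star> ex x"
  using positive_definite_spectral X_symmetric X_det X_positive by blast

lemma positive_definite_in_X:
  assumes "transpose A = A" "det A = 1" "\<And>v. v \<noteq> 0 \<Longrightarrow> v \<bullet> (A *v v) > 0"
  shows "A \<in> X"
proof -
  obtain k x where k: "rotation_matrix k" "x \<in> sum0" "A = k \<star> ex x" using positive_definite_spectral[OF assms] by blast
  then show ?thesis using X_act[OF ex_in_X, of x k] rotation_SL3[OF k(1)] by simp
qed

text \<open>Move \<open>P\<close> to the round ball and diagonalize the image of \<open>Q\<close> by a rotation, which fixes the ball. Hence any two ellipsoids
  lie in a common flat.\<close>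

lemma simultaneous_diagonalization:
  assumes "P \<in> X" "Q \<in> X"
  shows "\<exists>g x. g \<in> SL3 \<and> x \<in> sum0 \<and> P = g ** transpose g \<and> Q = g \<star> ex x"
proof -
  obtain h where h: "P = h ** transpose h" "h \<in> SL3" using assms by (auto simp: X_def)
  define i where "i = matrix_inv h"
  have i: "i \<in> SL3" "h ** i = mat 1" "i ** h = mat 1"
    using h by (auto simp: i_def SL3_inv matrix_inv_mult SL3_det)
  have ti: "transpose i ** transpose h = mat 1"
    using i by (simp flip: matrix_transpose_mul)
  obtain k x where k: "rotation_matrix k" "x \<in> sum0" "i \<star> Q = k \<star> ex x"
    using X_spectral[OF X_act[OF assms(2) i(1)]] by blast
  note ko = rotation_SL3[OF k(1)]
  have "(h ** k) ** transpose (h ** k) = h \<star> (k ** transpose k)"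
    by (simp add: matrix_transpose_mul matrix_mul_assoc)
  then have "P = (h ** k) ** transpose (h ** k)" using ko h by simp
  moreover have "Q = (h ** k) \<star> ex x"
  proof -
    have "(h ** k) \<star> ex x = h \<star> (k ** ex x ** transpose k)"
      by (simp add: matrix_transpose_mul matrix_mul_assoc)
    also have "\<dots> = (h ** i) ** Q ** (transpose i ** transpose h)"
      unfolding k(3)[symmetric] by (simp add: matrix_mul_assoc)
    finally show ?thesis using i ti by simp
  qed
  ultimately show ?thesis using SL3_mult[OF h(2)] ko k(2) by blast
qed

lemma bounded_linear_entry: "bounded_linear (\<lambda>A :: mat3. A$i$j)"
  by (rule bounded_linear_compose[OF bounded_linear_vec_nth[of j] bounded_linear_vec_nth[of i]])

lemma has_vector_derivative_entries:
  "(c has_vector_derivative D) (at t) \<longleftrightarrow> (\<forall>i j. ((\<lambda>t. c t $ i $ j) has_real_derivative D $ i $ j) (at t))"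
  for c :: "real \<Rightarrow> mat3"
proof
  assume "(c has_vector_derivative D) (at t)"
  from bounded_linear.has_vector_derivative[OF bounded_linear_entry this]
  show "\<forall>i j. ((\<lambda>t. c t $ i $ j) has_real_derivative D $ i $ j) (at t)"
    by (simp add: has_real_derivative_iff_has_vector_derivative)
next
  assume *: "\<forall>i j. ((\<lambda>t. c t $ i $ j) has_real_derivative D $ i $ j) (at t)"
  show "(c has_vector_derivative D) (at t)"
    unfolding has_vector_derivative_def
  proof (subst has_derivative_componentwise_within, intro ballI)
    fix b :: mat3 assume "b \<in> Basis"
    then obtain i j where b: "b = axis i (axis j 1)"
      by (auto simp: Basis_vec_def)
    have "((\<lambda>t. c t $ i $ j) has_derivative (\<lambda>x. x * D $ i $ j)) (at t)"
      using * by (simp add: has_field_derivative_def mult_commute_abs)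
    then show "((\<lambda>x. c x \<bullet> b) has_derivative (\<lambda>x. (x *\<^sub>R D) \<bullet> b)) (at t)"
      by (simp add: b inner_axis)
  qed
qed

lemma continuous_entries:
  "continuous_on S c \<longleftrightarrow> (\<forall>i j. continuous_on S (\<lambda>t. c t $ i $ j))" for c :: "'a::topological_space \<Rightarrow> mat3"
proof
  assume "\<forall>i j. continuous_on S (\<lambda>t. c t $ i $ j)"
  then have "continuous_on S (\<lambda>t. \<chi> i. \<chi> j. c t $ i $ j)"
    by (intro continuous_on_vec_lambda) auto
  then show "continuous_on S c" by simp
qed (auto intro: continuous_intros)

lemma continuous_on_matrix_mult [continuous_intros]:
  fixes A B :: "'a::topological_space \<Rightarrow> mat3"
  assumes "continuous_on S A" "continuous_on S B"
  shows "continuous_on S (\<lambda>t. A t ** B t)"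
  unfolding continuous_entries[of S "\<lambda>t. A t ** B t"] mult3
  using assms by (intro allI continuous_intros)

lemma continuous_on_adj [continuous_intros]:
  fixes A :: "'a::topological_space \<Rightarrow> mat3"
  assumes "continuous_on S A"
  shows "continuous_on S (\<lambda>t. adj (A t))"
  unfolding continuous_entries[of S "\<lambda>t. adj (A t)"] forall_3
  unfolding adj_def m3_entry
  using assms by (intro conjI continuous_intros)

lemma continuous_on_trace [continuous_intros]:
  fixes A :: "'a::topological_space \<Rightarrow> mat3"
  assumes "continuous_on S A"
  shows "continuous_on S (\<lambda>t. trace (A t))"
  unfolding trace3 using assms by (intro continuous_intros)

lemma matrix_add_rdistrib3: "(A + B) ** C = A ** C + B ** C" for A B C :: mat3
  by (simp add: mat3_eq_iff mult3 algebra_simps)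

definition speed :: "mat3 \<Rightarrow> mat3 \<Rightarrow> real" where
  "speed P U = sqrt (trace ((matrix_inv P ** U) ** (matrix_inv P ** U)))"

lemma riem_length_speed: "riem_length c = integral {0..1} (\<lambda>t. speed (c t) (vector_derivative c (at t)))"
  by (simp add: riem_length_def speed_def Let_def)

definition path_in_X :: "mat3 \<Rightarrow> mat3 \<Rightarrow> (real \<Rightarrow> mat3) \<Rightarrow> (real \<Rightarrow> mat3) \<Rightarrow> bool" where
  "path_in_X P Q c D \<longleftrightarrow> (\<forall>t\<in>{0..1}. c t \<in> X \<and> (c has_vector_derivative D t) (at t)) \<and>
     continuous_on {0..1} D \<and> c 0 = P \<and> c 1 = Q"

lemma riem_dist_path:
  "riem_dist P Q = Inf {integral {0..1} (\<lambda>t. speed (c t) (D t)) |c D. path_in_X P Q c D}"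
proof -
  have len: "riem_length c = integral {0..1} (\<lambda>t. speed (c t) (D t))"
    if "\<forall>t\<in>{0..1}. (c has_vector_derivative D t) (at t)" for c D
    unfolding riem_length_speed
  proof (rule integral_cong)
    fix t :: real assume "t \<in> {0..1}"
    then have "vector_derivative c (at t) = D t" using that by (intro vector_derivative_at) blast
    then show "speed (c t) (vector_derivative c (at t)) = speed (c t) (D t)" by simp
  qed
  have "{riem_length c |c. c C1_differentiable_on {0..1} \<and> c ` {0..1} \<subseteq> X \<and> c 0 = P \<and> c 1 = Q}
      = {integral {0..1} (\<lambda>t. speed (c t) (D t)) |c D. path_in_X P Q c D}"
    (is "?A = ?B")
  proof (intro equalityI subsetI)
    fix l assume "l \<in> ?A"
    then obtain c where c: "l = riem_length c" "c C1_differentiable_on {0..1}" "c ` {0..1} \<subseteq> X" "c 0 = P" "c 1 = Q"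
      by blast
    then obtain D where "\<forall>t\<in>{0..1}. (c has_vector_derivative D t) (at t)" "continuous_on {0..1} D"
      unfolding C1_differentiable_on_def by blast
    with c len show "l \<in> ?B" unfolding path_in_X_def by blast
  next
    fix l assume "l \<in> ?B"
    then obtain c D where c: "l = integral {0..1} (\<lambda>t. speed (c t) (D t))" "path_in_X P Q c D" by blast
    then have "c C1_differentiable_on {0..1}" "l = riem_length c"
      using len[of c D] unfolding C1_differentiable_on_def path_in_X_def by auto
    with c show "l \<in> ?A" unfolding path_in_X_def by blast
  qed
  then show ?thesis by (simp add: riem_dist_def)
qed

lemma derivative_of_constant_on_unit_interval:
  assumes "(f has_real_derivative d) (at t)" "t \<in> {0..1}" "\<And>s. s \<in> {0..1} \<Longrightarrow> f s = k"
  shows "d = 0"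
proof -
  have "(f has_real_derivative d) (at t within {0..1})"
    using assms(1) by (rule has_field_derivative_at_within)
  moreover have "(f has_real_derivative 0) (at t within {0..1})"
    by (rule has_field_derivative_transform_within[where f="\<lambda>_. k" and d=1]) (use assms in auto)
  moreover have "at t within {0..1} \<noteq> bot"
    using assms(2) by (simp add: trivial_limit_within islimpt_Icc)
  ultimately show "d = 0"
    using has_field_derivative_unique by blast
qed

text \<open>Tangent vectors of \<open>X\<close> are symmetric, and trace-free relative to the base point as \<open>det = 1\<close> along the path.\<close>

lemma path_tangent:
  assumes c: "path_in_X P Q c D" and t: "t \<in> {0..1}"
  shows "D t $ i $ j = D t $ j $ i" "trace (adj (c t) ** D t) = 0"
proof -
  have d: "((\<lambda>t. c t $ i $ j) has_real_derivative D t $ i $ j) (at t)" for i j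
    using c t unfolding path_in_X_def has_vector_derivative_entries by blast
  have "((\<lambda>t. c t $ i $ j - c t $ j $ i) has_real_derivative D t $ i $ j - D t $ j $ i) (at t)"
    by (intro derivative_intros d)
  then have "D t $ i $ j - D t $ j $ i = 0"
  proof (rule derivative_of_constant_on_unit_interval[OF _ t])
    fix s :: real assume "s \<in> {0..1}"
    then have "c s \<in> X" using c by (simp add: path_in_X_def)
    from X_symmetric[OF this] show "c s $ i $ j - c s $ j $ i = 0"
      by (metis eq_iff_diff_eq_0 transpose_entry)
  qed
  then show "D t $ i $ j = D t $ j $ i" by simp
  have "((\<lambda>t. det (c t)) has_real_derivative trace (adj (c t) ** D t)) (at t)"
    unfolding det_3 trace3 mult3 adj_def m3_entry
    by (auto intro!: derivative_eq_intros d simp: algebra_simps)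
  then show "trace (adj (c t) ** D t) = 0"
    by (rule derivative_of_constant_on_unit_interval[OF _ t, where k=1])
       (use c in \<open>auto simp: path_in_X_def intro: X_det\<close>)
qed

lemma continuous_speed:
  assumes c: "path_in_X P Q c D"
  shows "continuous_on {0..1} (\<lambda>t. speed (c t) (D t))"
proof -
  have cc: "continuous_on {0..1} c"
    using c unfolding path_in_X_def
    by (meson continuous_at_imp_continuous_on has_vector_derivative_continuous)
  have cd: "continuous_on {0..1} D"
    using c unfolding path_in_X_def by simp
  have "continuous_on {0..1} (\<lambda>t. sqrt (trace ((adj (c t) ** D t) ** (adj (c t) ** D t))))"
    by (intro continuous_intros cc cd)
  then show ?thesis
    by (rule continuous_on_eq) (use c in \<open>auto simp: speed_def X_inv_adj path_in_X_def\<close>)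
qed

text \<open>The lengths of all paths between two points are the lengths of all paths between their images, so the infima agree.\<close>

lemma riem_dist_mono_map:
  assumes "\<And>c D P Q. path_in_X P Q c D \<Longrightarrow> \<exists>D'. path_in_X (f P) (f Q) (f \<circ> c) D' \<and>
       (\<forall>t\<in>{0..1}. speed (f (c t)) (D' t) = speed (c t) (D t))"
    and "\<And>c D P Q. path_in_X P Q c D \<Longrightarrow> \<exists>D'. path_in_X (g P) (g Q) (g \<circ> c) D' \<and>
       (\<forall>t\<in>{0..1}. speed (g (c t)) (D' t) = speed (c t) (D t))"
    and "g (f P) = P" "g (f Q) = Q"
  shows "riem_dist (f P) (f Q) = riem_dist P Q"
proof -
  have *: "{integral {0..1} (\<lambda>t. speed (c t) (D t)) |c D. path_in_X P Q c D} \<subseteq>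
        {integral {0..1} (\<lambda>t. speed (c t) (D t)) |c D. path_in_X (f P) (f Q) c D}"
    if f: "\<And>c D P Q. path_in_X P Q c D \<Longrightarrow> \<exists>D'. path_in_X (f P) (f Q) (f \<circ> c) D' \<and>
       (\<forall>t\<in>{0..1}. speed (f (c t)) (D' t) = speed (c t) (D t))" for f P Q
  proof
    fix l assume "l \<in> {integral {0..1} (\<lambda>t. speed (c t) (D t)) |c D. path_in_X P Q c D}"
    then obtain c D where c: "l = integral {0..1} (\<lambda>t. speed (c t) (D t))" "path_in_X P Q c D" by blast
    from f[OF c(2)] obtain D' where D': "path_in_X (f P) (f Q) (f \<circ> c) D'"
      "\<forall>t\<in>{0..1}. speed (f (c t)) (D' t) = speed (c t) (D t)" by blast
    then have "l = integral {0..1} (\<lambda>t. speed ((f \<circ> c) t) (D' t))"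
      unfolding c(1) by (intro integral_cong) simp
    with D' show "l \<in> {integral {0..1} (\<lambda>t. speed (c t) (D t)) |c D. path_in_X (f P) (f Q) c D}" by blast
  qed
  show ?thesis
    using *[OF assms(1), of P Q] *[OF assms(2), of "f P" "f Q"] assms(3,4)
    unfolding riem_dist_path by simp
qed

lemma path_act:
  assumes c: "path_in_X P Q c D" and g: "g \<in> SL3"
  shows "path_in_X (g \<star> P) (g \<star> Q) ((\<lambda>P. g \<star> P) \<circ> c) (\<lambda>t. g \<star> D t)"
    and "t \<in> {0..1} \<Longrightarrow> speed (g \<star> c t) (g \<star> D t) = speed (c t) (D t)"
proof -
  have "linear (\<lambda>P. g \<star> P)"
    by (rule linearI) (simp_all add: matrix_add_ldistrib matrix_add_rdistrib3)
  then have bl: "bounded_linear (\<lambda>P. g \<star> P)"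
    by (simp add: linear_conv_bounded_linear)
  have "continuous_on {0..1} (\<lambda>t. g \<star> D t)"
    using c unfolding path_in_X_def by (intro continuous_intros) auto
  moreover have "((\<lambda>t. g \<star> c t) has_vector_derivative g ** D t ** transpose g) (at t)"
    if "t \<in> {0..1}" for t
    using c that unfolding path_in_X_def by (intro bounded_linear.has_vector_derivative[OF bl]) auto
  ultimately show "path_in_X (g \<star> P) (g \<star> Q) ((\<lambda>P. g \<star> P) \<circ> c) (\<lambda>t. g \<star> D t)"
    using c X_act[OF _ g] by (auto simp: path_in_X_def o_def)
  assume "t \<in> {0..1}"
  then have ct: "det (c t) = 1" using c by (auto simp: path_in_X_def intro: X_det)
  define V where "V = matrix_inv (c t) ** D t"
  define h where "h = transpose g"
  have dh: "det h = 1" "det g = 1" using g by (simp_all add: h_def SL3_def)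
  have "matrix_inv (g ** c t ** h) = matrix_inv h ** matrix_inv (c t) ** matrix_inv g"
    using dh ct by (simp add: matrix_inv_prod det_mul matrix_mul_assoc)
  then have "matrix_inv (g ** c t ** h) ** (g ** D t ** h) = matrix_inv h ** matrix_inv (c t) ** (matrix_inv g ** g) ** D t ** h"
    by (simp add: matrix_mul_assoc)
  then have e: "matrix_inv (g ** c t ** h) ** (g ** D t ** h) = matrix_inv h ** V ** h"
    using dh by (simp add: matrix_inv_mult V_def matrix_mul_assoc)
  have "(matrix_inv h ** V ** h) ** (matrix_inv h ** V ** h) = matrix_inv h ** V ** (h ** matrix_inv h) ** V ** h"
    by (simp add: matrix_mul_assoc)
  also have "\<dots> = (matrix_inv h ** V ** V) ** h"
    using dh by (simp add: matrix_inv_mult)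
  finally have "trace ((matrix_inv h ** V ** h) ** (matrix_inv h ** V ** h)) = trace (h ** (matrix_inv h ** V ** V))"
    by (simp only: trace_mul_sym[of _ h])
  also have "\<dots> = trace (V ** V)"
    using dh by (simp add: matrix_mul_assoc matrix_inv_mult)
  finally show "speed (g \<star> c t) (g \<star> D t) = speed (c t) (D t)"
    by (simp add: speed_def e V_def flip: h_def)
qed

lemma riem_dist_act:
  assumes g: "g \<in> SL3"
  shows "riem_dist (g \<star> P) (g \<star> Q) = riem_dist P Q"
proof (rule riem_dist_mono_map[where f="\<lambda>P. g \<star> P" and g="\<lambda>P. matrix_inv g ** P ** transpose (matrix_inv g)"])
  have e: "matrix_inv g ** (g \<star> P) ** transpose (matrix_inv g) = P" for P
  proof -
    have "matrix_inv g ** (g \<star> P) ** transpose (matrix_inv g)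
      = (matrix_inv g ** g) \<star> P"
      by (simp only: matrix_transpose_mul matrix_mul_assoc)
    then show ?thesis using g by (simp add: matrix_inv_mult SL3_det)
  qed
  show "matrix_inv g ** (g \<star> P) ** transpose (matrix_inv g) = P"
    "matrix_inv g ** (g \<star> Q) ** transpose (matrix_inv g) = Q" by (rule e)+
next
  show "\<exists>D'. path_in_X (g \<star> P) (g \<star> Q) ((\<lambda>P. g \<star> P) \<circ> c) D' \<and>
       (\<forall>t\<in>{0..1}. speed (g \<star> c t) (D' t) = speed (c t) (D t))"
    if "path_in_X P Q c D" for c D P Q
    using path_act[OF that g] by blast
  show "\<exists>D'. path_in_X (matrix_inv g ** P ** transpose (matrix_inv g)) (matrix_inv g ** Q ** transpose (matrix_inv g))
         ((\<lambda>P. matrix_inv g ** P ** transpose (matrix_inv g)) \<circ> c) D' \<and>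
       (\<forall>t\<in>{0..1}. speed (matrix_inv g ** c t ** transpose (matrix_inv g)) (D' t) = speed (c t) (D t))"
    if "path_in_X P Q c D" for c D P Q
    using path_act[OF that SL3_inv[OF g]] by blast
qed

lemma X_adj: "P \<in> X \<Longrightarrow> adj P \<in> X"
proof -
  assume "P \<in> X"
  then obtain g where g: "P = g ** transpose g" "g \<in> SL3" by (auto simp: X_def)
  have "matrix_inv P = transpose (matrix_inv g) ** transpose (transpose (matrix_inv g))"
    using g by (simp add: matrix_inv_prod SL3_det matrix_inv_transpose3)
  then show "adj P \<in> X"
    using SL3_act_one[OF SL3_transpose[OF SL3_inv[OF g(2)]]] X_inv_adj[OF \<open>P \<in> X\<close>] by simp
qed

lemma adj_adj: "adj (adj P) = det P *\<^sub>R P"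
  by (simp add: mat3_eq_iff adj_def det_3 algebra_simps)

text \<open>The differential of inversion at \<open>P\<close> is \<open>U \<mapsto> - P\<^sup>-\<^sup>1 U P\<^sup>-\<^sup>1\<close>, which preserves \<open>tr (P\<^sup>-\<^sup>1 U P\<^sup>-\<^sup>1 U)\<close>.\<close>

lemma path_adj:
  assumes c: "path_in_X P Q c D"
  shows "\<exists>D'. path_in_X (adj P) (adj Q) (adj \<circ> c) D' \<and> (\<forall>t\<in>{0..1}. speed (adj (c t)) (D' t) = speed (c t) (D t))"
proof -
  have d: "((\<lambda>t. c t $ i $ j) has_real_derivative D t $ i $ j) (at t)" if "t \<in> {0..1}" for i j t
    using c that unfolding path_in_X_def has_vector_derivative_entries by blast
  have cc: "continuous_on {0..1} c"
    using c unfolding path_in_X_def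
    by (meson continuous_at_imp_continuous_on has_vector_derivative_continuous)
  define D' where "D' = (\<lambda>t. - (adj (c t) ** D t ** adj (c t)))"
  have "continuous_on {0..1} D'"
    unfolding D'_def using c unfolding path_in_X_def by (intro continuous_intros cc) auto
  moreover have "((\<lambda>t. adj (c t)) has_vector_derivative D' t) (at t)" if t: "t \<in> {0..1}" for t
  proof -
    have "\<exists>E. ((\<lambda>t. adj (c t)) has_vector_derivative E) (at t)"
    proof -
      have "\<forall>i j. \<exists>e. ((\<lambda>t. adj (c t) $ i $ j) has_real_derivative e) (at t)"
        unfolding forall_3 adj_def m3_entry
        by (intro conjI exI) (rule derivative_intros d[OF t])+
      then obtain e where "\<And>i j. ((\<lambda>t. adj (c t) $ i $ j) has_real_derivative e i j) (at t)" by metis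
      then have "((\<lambda>t. adj (c t)) has_vector_derivative (\<chi> i j. e i j)) (at t)"
        by (simp add: has_vector_derivative_entries)
      then show ?thesis by blast
    qed
    then obtain E where E: "((\<lambda>t. adj (c t)) has_vector_derivative E) (at t)" by blast
    have Ed: "((\<lambda>t. adj (c t) $ i $ j) has_real_derivative E $ i $ j) (at t)" for i j
      using E by (simp add: has_vector_derivative_entries)
    have "(E ** c t + adj (c t) ** D t) $ i $ j = 0" for i j
    proof (rule derivative_of_constant_on_unit_interval[OF _ t, where k="mat 1 $ i $ j"])
      show "((\<lambda>t. (adj (c t) ** c t) $ i $ j) has_real_derivative (E ** c t + adj (c t) ** D t) $ i $ j) (at t)"
        unfolding mult3 vector_add_component
        by (auto intro!: derivative_eq_intros d[OF t] Ed simp: algebra_simps)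
      show "(adj (c s) ** c s) $ i $ j = mat 1 $ i $ j" if "s \<in> {0..1}" for s
        using c that by (simp add: path_in_X_def X_det adj_mult)
    qed
    then have "E ** c t + adj (c t) ** D t = 0" by (simp add: vec_eq_iff)
    then have "(E ** c t + adj (c t) ** D t) ** adj (c t) = 0" by simp
    then have "E ** (c t ** adj (c t)) + adj (c t) ** D t ** adj (c t) = 0"
      by (simp add: matrix_add_rdistrib3 matrix_mul_assoc)
    moreover have "c t ** adj (c t) = mat 1" using c t by (simp add: path_in_X_def X_det adj_mult)
    ultimately have "E = D' t" unfolding D'_def by (simp add: eq_neg_iff_add_eq_0)
    then show ?thesis using E by simp
  qed
  ultimately have "path_in_X (adj P) (adj Q) (adj \<circ> c) D'"
    using c X_adj by (auto simp: path_in_X_def o_def)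
  moreover have "speed (adj (c t)) (D' t) = speed (c t) (D t)" if "t \<in> {0..1}" for t
  proof -
    have ct: "c t \<in> X" using c that by (simp add: path_in_X_def)
    have "matrix_inv (adj (c t)) = c t"
      using X_inv_adj[OF X_adj[OF ct]] X_det[OF ct] by (simp add: adj_adj)
    moreover have "c t ** D' t = - (D t ** adj (c t))"
    proof -
      have "c t ** D' t = - ((c t ** adj (c t)) ** D t ** adj (c t))"
        by (simp add: D'_def mat3_eq_iff mult3 algebra_simps)
      then show ?thesis using X_det[OF ct] by (simp add: adj_mult)
    qed
    ultimately have "matrix_inv (adj (c t)) ** D' t = - (D t ** adj (c t))" by simp
    moreover have "(- (D t ** adj (c t))) ** (- (D t ** adj (c t))) = D t ** (adj (c t) ** D t ** adj (c t))"
      by (simp add: mat3_eq_iff mult3 algebra_simps)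
    moreover have "trace (D t ** (adj (c t) ** D t ** adj (c t))) = trace ((adj (c t) ** D t) ** (adj (c t) ** D t))"
      by (subst trace_mul_sym) (simp add: matrix_mul_assoc)
    ultimately show ?thesis by (simp add: speed_def X_inv_adj[OF ct])
  qed
  ultimately show ?thesis by blast
qed

lemma riem_dist_adj:
  assumes "P \<in> X" "Q \<in> X" shows "riem_dist (adj P) (adj Q) = riem_dist P Q"
  using assms path_adj by (intro riem_dist_mono_map[where f=adj and g=adj]) (auto simp: adj_adj X_det)

section \<open>Horospherical coordinates and the distance in a flat\<close>

definition horo :: "mat3 \<Rightarrow> real^3" where
  "horo P = vector [ln (P$1$1), ln (P$1$1 * P$2$2 - P$1$2 * P$1$2) - ln (P$1$1),
     - ln (P$1$1 * P$2$2 - P$1$2 * P$1$2)]"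

lemma lower_triangular_factorization:
  assumes "P \<in> X"
  obtains a b c d e f where "P = m3 a 0 0 b d 0 c e f ** transpose (m3 a 0 0 b d 0 c e f)"
    "a > 0" "d > 0" "f > 0"
proof -
  note m = X_minors[OF assms]
  define M where "M = P$1$1 * P$2$2 - P$1$2 * P$1$2"
  define a where "a = sqrt (P$1$1)"
  define b where "b = P$1$2 / a"
  define c where "c = P$1$3 / a"
  define d where "d = sqrt (M / P$1$1)"
  define e where "e = (P$2$3 - b * c) / d"
  define f where "f = sqrt (1 / M)"
  have M: "M > 0" using m by (simp add: M_def)
  have pos: "a > 0" "d > 0" "f > 0" using m M by (simp_all add: a_def d_def f_def)
  have sq: "a * a = P$1$1" "d * d = M / P$1$1" "f * f = 1 / M"
    using m M by (simp_all add: a_def d_def f_def)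
  have ab: "a * b = P$1$2" "a * c = P$1$3" "d * e = P$2$3 - b * c"
    using pos by (simp_all add: b_def c_def e_def)
  have bb: "b * b = P$1$2 * P$1$2 / P$1$1" "c * c = P$1$3 * P$1$3 / P$1$1" "b * c = P$1$2 * P$1$3 / P$1$1"
    by (simp_all add: b_def c_def flip: sq(1))
  have bd: "b * b + d * d = P$2$2"
    using m by (simp add: bb sq M_def field_simps)
  have ee: "e * e = (P$2$3 - b * c) * (P$2$3 - b * c) / (M / P$1$1)"
    by (simp add: e_def flip: sq(2))
  have "c * c + e * e + f * f = P$3$3"
  proof -
    have "det P = 1" by (rule X_det[OF assms])
    then have det: "P$3$3 * M = 1 + P$1$1 * P$2$3 * P$2$3 + P$1$3 * P$1$3 * P$2$2 - 2 * P$1$2 * P$1$3 * P$2$3"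
      using m by (simp add: det_3 M_def algebra_simps)
    have "(c * c + e * e + f * f) * (M * P$1$1) =
       P$1$3 * P$1$3 * M + (P$1$1 * P$2$3 - P$1$2 * P$1$3) * (P$1$1 * P$2$3 - P$1$2 * P$1$3) + P$1$1"
      unfolding ee bb sq using m(1) M by (simp add: field_simps)
    also have "\<dots> = P$3$3 * M * P$1$1"
      unfolding det unfolding M_def by (simp add: algebra_simps)
    finally show ?thesis using m(1) M by simp
  qed
  with sq ab bd m have "P = m3 a 0 0 b d 0 c e f ** transpose (m3 a 0 0 b d 0 c e f)"
    by (simp add: mat3_eq_iff mult3 algebra_simps)
  with pos that show thesis by blast
qed

lemma trace_square_symmetric:
  fixes W :: mat3
  assumes "\<And>i j. W$i$j = W$j$i"
  shows "trace (W ** W) \<ge> W$1$1 * W$1$1 + W$2$2 * W$2$2 + W$3$3 * W$3$3"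
proof -
  have "trace (W ** W) = W$1$1 * W$1$1 + W$2$2 * W$2$2 + W$3$3 * W$3$3
      + 2 * (W$1$2)\<^sup>2 + 2 * (W$1$3)\<^sup>2 + 2 * (W$2$3)\<^sup>2"
    unfolding trace3 mult3 assms[of 2 1] assms[of 3 1] assms[of 3 2] by (simp add: power2_eq_square)
  moreover have "0 \<le> 2 * (W$1$2)\<^sup>2 + 2 * (W$1$3)\<^sup>2 + 2 * (W$2$3)\<^sup>2" by simp
  ultimately show ?thesis by linarith
qed

text \<open>In the frame of the triangular factor \<open>L\<close> the tangent vector is \<open>W = L\<^sup>-\<^sup>1 U L\<^sup>-\<^sup>T\<close>. The derivative of \<open>horo\<close> is the diagonal
  of \<open>W\<close>, and the speed is the norm of all of \<open>W\<close>.\<close>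

lemma horo_derivative_bound:
  assumes c: "path_in_X P Q c D" and t: "t \<in> {0..1}" and v: "norm v \<le> 1"
  shows "\<exists>d. ((\<lambda>t. v \<bullet> horo (c t)) has_real_derivative d) (at t) \<and> d \<le> speed (c t) (D t)"
proof -
  have ct: "c t \<in> X" using c t by (simp add: path_in_X_def)
  obtain l1 l21 l31 l2 l32 l3 where L: "c t = m3 l1 0 0 l21 l2 0 l31 l32 l3 ** transpose (m3 l1 0 0 l21 l2 0 l31 l32 l3)"
    "l1 > 0" "l2 > 0" "l3 > 0" by (rule lower_triangular_factorization[OF ct])
  define L where "L = m3 l1 0 0 l21 l2 0 l31 l32 l3"
  define K where "K = matrix_inv L"
  have dL: "det L \<noteq> 0" using L(2-4) by (simp add: L_def det_3)
  have KL: "K ** L = mat 1" "L ** K = mat 1" using dL by (simp_all add: K_def matrix_inv_mult)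
  have KLT: "transpose L ** transpose K = mat 1" "transpose K ** transpose L = mat 1"
    using KL by (simp_all flip: matrix_transpose_mul)
  have cL: "c t = L ** transpose L" using L(1) by (simp add: L_def)
  define U where "U = D t"
  define W where "W = K \<star> U"
  have UW: "U = L \<star> W"
  proof -
    have "L \<star> W = (L ** K) ** U ** (transpose K ** transpose L)"
      by (simp add: W_def matrix_mul_assoc)
    then show ?thesis using KL KLT by simp
  qed
  have Us: "U$i$j = U$j$i" for i j using path_tangent(1)[OF c t] by (simp add: U_def)
  then have "transpose U = U" by (simp add: vec_eq_iff)
  then have "transpose W = W" by (simp add: W_def matrix_transpose_mul matrix_mul_assoc)
  then have Ws: "W$i$j = W$j$i" for i j by (metis transpose_entry)
  have inv: "matrix_inv (c t) = transpose K ** K"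
  proof (rule matrix_inv_unique_left)
    have "transpose K ** K ** c t = transpose K ** (K ** L) ** transpose L"
      by (simp add: cL matrix_mul_assoc)
    then show "transpose K ** K ** c t = mat 1" using KL KLT by simp
  qed
  have V: "matrix_inv (c t) ** U = transpose K ** W ** transpose L"
  proof -
    have "transpose K ** W ** transpose L = transpose K ** K ** U ** (transpose K ** transpose L)"
      by (simp add: W_def matrix_mul_assoc)
    then show ?thesis using KLT by (simp add: inv matrix_mul_assoc)
  qed
  have trV: "trace (transpose K ** Z ** transpose L) = trace Z" for Z
  proof -
    have "trace (transpose K ** Z ** transpose L) = trace (transpose L ** (transpose K ** Z))"
      by (rule trace_mul_sym)
    then show ?thesis using KLT by (simp add: matrix_mul_assoc)
  qed
  have "(transpose K ** W ** transpose L) ** (transpose K ** W ** transpose L) =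
      transpose K ** W ** (transpose L ** transpose K) ** W ** transpose L"
    by (simp add: matrix_mul_assoc)
  also have "\<dots> = transpose K ** (W ** W) ** transpose L" using KLT by (simp add: matrix_mul_assoc)
  finally have "trace ((matrix_inv (c t) ** U) ** (matrix_inv (c t) ** U)) = trace (W ** W)"
    by (simp add: V trV)
  then have sp: "speed (c t) (D t) = sqrt (trace (W ** W))" by (simp add: speed_def U_def)
  have "trace (matrix_inv (c t) ** U) = 0"
    using path_tangent(2)[OF c t] by (simp add: U_def X_inv_adj[OF ct])
  then have tr0: "W$1$1 + W$2$2 + W$3$3 = 0" unfolding V trV by (simp add: trace3)
  define w where "w = (vector [W$1$1, W$2$2, W$3$3] :: real^3)"
  have "v \<bullet> w \<le> norm v * norm w" by (rule norm_cauchy_schwarz)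
  also have "\<dots> \<le> norm w" using v by (simp add: mult_left_le_one_le)
  also have "norm w \<le> speed (c t) (D t)"
    unfolding sp norm_eq_sqrt_inner using trace_square_symmetric[OF Ws]
    by (simp add: w_def inner3)
  finally have le: "v \<bullet> w \<le> speed (c t) (D t)" .
  have d: "((\<lambda>t. c t $ i $ j) has_real_derivative U $ i $ j) (at t)" for i j
    using c t unfolding path_in_X_def has_vector_derivative_entries U_def by blast
  note m = X_minors[OF ct]
  define m2 where "m2 = c t $1$1 * c t $2$2 - c t $1$2 * c t $1$2"
  have "((\<lambda>t. v \<bullet> horo (c t)) has_real_derivative
      v$1 * (U$1$1 / c t $1$1) + v$2 * ((U$1$1 * c t $2$2 + c t $1$1 * U$2$2 - 2 * c t $1$2 * U$1$2) / m2 - U$1$1 / c t $1$1)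
       - v$3 * ((U$1$1 * c t $2$2 + c t $1$1 * U$2$2 - 2 * c t $1$2 * U$1$2) / m2)) (at t)"
  proof -
    have 1: "((\<lambda>t. ln (c t $1$1)) has_real_derivative U$1$1 / c t $1$1) (at t)"
      using m(1) by (auto intro!: derivative_eq_intros d)
    have 2: "((\<lambda>t. ln (c t $1$1 * c t $2$2 - c t $1$2 * c t $1$2)) has_real_derivative
        (U$1$1 * c t $2$2 + c t $1$1 * U$2$2 - 2 * c t $1$2 * U$1$2) / m2) (at t)"
      unfolding m2_def by (rule derivative_eq_intros d m(4) HOL.refl)+
        (simp add: add_divide_distrib diff_divide_distrib algebra_simps)
    show ?thesis
      unfolding inner3 horo_def vector_3
      by (rule derivative_eq_intros 1 2 HOL.refl)+ (simp add: algebra_simps)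
  qed
  moreover have "U$1$1 / c t $1$1 = W$1$1"
    using L(2) unfolding UW cL by (simp add: mult3 L_def)
  moreover have "(U$1$1 * c t $2$2 + c t $1$1 * U$2$2 - 2 * c t $1$2 * U$1$2) / m2 = W$1$1 + W$2$2"
  proof -
    have "m2 = l1 * l1 * l2 * l2" by (simp add: m2_def cL mult3 L_def algebra_simps)
    moreover have "U$1$1 * c t $2$2 + c t $1$1 * U$2$2 - 2 * c t $1$2 * U$1$2 = l1 * l1 * l2 * l2 * (W$1$1 + W$2$2)"
      unfolding UW cL using Ws[of 2 1] by (simp add: mult3 L_def algebra_simps)
    ultimately show ?thesis using L(2,3) by simp
  qed
  ultimately have "((\<lambda>t. v \<bullet> horo (c t)) has_real_derivative
      v$1 * W$1$1 + v$2 * (W$1$1 + W$2$2 - W$1$1) - v$3 * (W$1$1 + W$2$2)) (at t)" by simp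
  moreover have "v$1 * W$1$1 + v$2 * (W$1$1 + W$2$2 - W$1$1) - v$3 * (W$1$1 + W$2$2) = v \<bullet> w"
  proof -
    have "W$3$3 = - (W$1$1 + W$2$2)" using tr0 by simp
    then show ?thesis unfolding inner3 w_def vector_3 by (simp only:) (simp add: algebra_simps)
  qed
  ultimately show ?thesis using le by metis
qed

text \<open>Integration of the previous bound: \<open>v \<bullet> horo\<close> is 1-Lipschitz for every \<open>v\<close> of norm at most 1.\<close>

lemma path_length_bound:
  assumes c: "path_in_X P Q c D" and v: "norm v \<le> 1"
  shows "v \<bullet> horo Q - v \<bullet> horo P \<le> integral {0..1} (\<lambda>t. speed (c t) (D t))"
proof -
  define d where "d = (\<lambda>t. SOME d. ((\<lambda>t. v \<bullet> horo (c t)) has_real_derivative d) (at t) \<and> d \<le> speed (c t) (D t))"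
  have d: "((\<lambda>t. v \<bullet> horo (c t)) has_real_derivative d t) (at t)" "d t \<le> speed (c t) (D t)" if "t \<in> {0..1}" for t
    using someI_ex[OF horo_derivative_bound[OF c that v]] by (simp_all add: d_def)
  have "(d has_integral (v \<bullet> horo (c 1) - v \<bullet> horo (c 0))) {0..1}"
  proof (rule fundamental_theorem_of_calculus)
    fix t :: real assume "t \<in> {0..1}"
    from has_field_derivative_at_within[OF d(1)[OF this]]
    show "((\<lambda>t. v \<bullet> horo (c t)) has_vector_derivative d t) (at t within {0..1})"
      by (simp add: has_real_derivative_iff_has_vector_derivative)
  qed simp
  moreover have "((\<lambda>t. speed (c t) (D t)) has_integral integral {0..1} (\<lambda>t. speed (c t) (D t))) {0..1}"
    by (intro integrable_integral integrable_continuous_interval continuous_speed[OF c])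
  ultimately have "v \<bullet> horo (c 1) - v \<bullet> horo (c 0) \<le> integral {0..1} (\<lambda>t. speed (c t) (D t))"
    by (rule has_integral_le) (rule d)
  then show ?thesis using c by (simp add: path_in_X_def)
qed

lemma flat_path:
  assumes x: "x \<in> sum0" and y: "y \<in> sum0"
  shows "\<exists>c D. path_in_X (ex x) (ex y) c D \<and> integral {0..1} (\<lambda>t. speed (c t) (D t)) = norm (y - x)"
proof -
  define z where "z = (\<lambda>t. x + t *\<^sub>R (y - x))"
  define c where "c = (\<lambda>t. ex (z t))"
  define D where "D = (\<lambda>t. m3 (exp (z t $ 1) * (y - x)$1) 0 0 0 (exp (z t $ 2) * (y - x)$2) 0 0 0 (exp (z t $ 3) * (y - x)$3))"
  have D: "D t = ex (z t) ** dg (y - x)" for t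
    by (simp add: mat3_eq_iff mult3 ex_def dg_def D_def)
  have z: "z t \<in> sum0" for t using x y by (simp add: z_def)
  have zi: "((\<lambda>t. z t $ i) has_real_derivative (y - x)$i) (at t)" for i t
    unfolding z_def by (auto intro!: derivative_eq_intros)
  have "(c has_vector_derivative D t) (at t)" for t
    unfolding has_vector_derivative_entries c_def D_def ex_def forall_3 m3_entry
    by (intro conjI DERIV_const) (rule derivative_eq_intros zi HOL.refl)+
  moreover have "continuous_on {0..1} D"
  proof -
    have zc: "continuous_on {0..1} (\<lambda>t. z t $ i)" for i unfolding z_def by (intro continuous_intros)
    show ?thesis
      unfolding continuous_entries D_def forall_3 m3_entry
      by (intro conjI continuous_intros zc)
  qed
  ultimately have p: "path_in_X (ex x) (ex y) c D"
    using z ex_in_X by (simp add: path_in_X_def c_def) (simp add: z_def)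
  have "speed (c t) (D t) = norm (y - x)" for t
  proof -
    have "matrix_inv (c t) ** D t = dg (y - x)"
      by (simp add: c_def D matrix_inv_ex matrix_mul_assoc ex_add)
    then show ?thesis
      by (simp add: speed_def trace3 mult3 dg_def norm_eq_sqrt_inner inner3)
  qed
  then show ?thesis using p by (intro exI[of _ c] exI[of _ D]) simp
qed

lemma horo_ex: "x \<in> sum0 \<Longrightarrow> horo (ex x) = x"
  by (simp add: horo_def ex_def vec3_eq_iff sum0_def ln_mult)

text \<open>\<open>horo\<close> records the diagonal of the triangular factor of \<open>P\<close>. It is the retraction of \<open>X\<close> onto the standard
  flat along the horospheres of one chamber at infinity, and such a retraction does not increase lengths;
  on the flat itself it is the identity. Hence the flat is isometric to the Euclidean plane.\<close>

lemma horo_contracts: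
  assumes P: "P \<in> X" and Q: "Q \<in> X"
  shows "norm (horo Q - horo P) \<le> riem_dist P Q"
proof -
  obtain g x where g: "g \<in> SL3" "x \<in> sum0" "P = g ** transpose g" "Q = g \<star> ex x"
    using simultaneous_diagonalization[OF P Q] by blast
  obtain c D where "path_in_X (ex 0) (ex x) c D" using flat_path[of 0 x] g by auto
  then have ne: "path_in_X P Q ((\<lambda>P. g \<star> P) \<circ> c) (\<lambda>t. g \<star> D t)"
    using path_act(1)[OF _ g(1), of "ex 0" "ex x" c D] g(3,4) by simp
  define w where "w = horo Q - horo P"
  define v where "v = w /\<^sub>R norm w"
  have v: "norm v \<le> 1" by (cases "w = 0") (simp_all add: v_def)
  have "norm w = v \<bullet> w"
    by (cases "w = 0") (simp_all add: v_def power2_eq_square flip: power2_norm_eq_inner)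
  also have "v \<bullet> w = v \<bullet> horo Q - v \<bullet> horo P" by (simp add: w_def inner_diff_right)
  also have "\<dots> \<le> riem_dist P Q"
    unfolding riem_dist_path
  proof (rule cInf_greatest)
    show "{integral {0..1} (\<lambda>t. speed (c t) (D t)) |c D. path_in_X P Q c D} \<noteq> {}" using ne by blast
  qed (use path_length_bound[OF _ v] in blast)
  finally show ?thesis by (simp add: w_def)
qed

lemma riem_dist_ex:
  assumes x: "x \<in> sum0" and y: "y \<in> sum0"
  shows "riem_dist (ex x) (ex y) = norm (y - x)"
proof (rule antisym)
  show "norm (y - x) \<le> riem_dist (ex x) (ex y)"
    using horo_contracts[OF ex_in_X[OF x] ex_in_X[OF y]] by (simp add: horo_ex x y)
  obtain c D where p: "path_in_X (ex x) (ex y) c D" "integral {0..1} (\<lambda>t. speed (c t) (D t)) = norm (y - x)"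
    using flat_path[OF x y] by blast
  have "bdd_below {integral {0..1} (\<lambda>t. speed (c t) (D t)) |c D. path_in_X (ex x) (ex y) c D}"
    using path_length_bound[where v=0] by (intro bdd_belowI[of _ 0]) auto
  then show "riem_dist (ex x) (ex y) \<le> norm (y - x)"
    unfolding riem_dist_path
  proof (rule cInf_lower[rotated])
    show "norm (y - x) \<in> {integral {0..1} (\<lambda>t. speed (c t) (D t)) |c D. path_in_X (ex x) (ex y) c D}"
      unfolding mem_Collect_eq using p by metis
  qed
qed

lemma riem_dist_flat:
  assumes "g \<in> SL3" "x \<in> sum0" "y \<in> sum0"
  shows "riem_dist (g \<star> ex x) (g \<star> ex y) = norm (y - x)"
  using assms by (simp add: riem_dist_act riem_dist_ex)

lemma SL3_inv_act:
  assumes "g \<in> SL3"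
  shows "matrix_inv g ** (g \<star> P) ** transpose (matrix_inv g) = P"
    "g \<star> (matrix_inv g ** P ** transpose (matrix_inv g)) = P"
proof -
  have "matrix_inv g ** (g \<star> P) ** transpose (matrix_inv g)
      = (matrix_inv g ** g) \<star> P"
    by (simp only: matrix_transpose_mul matrix_mul_assoc)
  then show "matrix_inv g ** (g \<star> P) ** transpose (matrix_inv g) = P"
    using assms by (simp add: matrix_inv_mult SL3_det)
  have "g \<star> (matrix_inv g ** P ** transpose (matrix_inv g))
      = (g ** matrix_inv g) \<star> P"
    by (simp only: matrix_transpose_mul matrix_mul_assoc)
  then show "g \<star> (matrix_inv g ** P ** transpose (matrix_inv g)) = P"
    using assms by (simp add: matrix_inv_mult SL3_det)
qed

lemma vector_on_segment:
  fixes v :: "'a::real_inner"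
  assumes "norm v \<le> s" "norm (y - v) \<le> norm y - s" "norm y > 0" "s \<ge> 0"
  shows "v = (s / norm y) *\<^sub>R y"
proof -
  have n: "norm y \<le> norm v + norm (y - v)" using norm_triangle_ineq[of v "y - v"] by simp
  then have e: "norm v = s" "norm (y - v) = norm y - s" using assms by linarith+
  have "norm (v + (y - v)) = norm v + norm (y - v)" using e by simp
  then have "norm v *\<^sub>R (y - v) = norm (y - v) *\<^sub>R v" by (rule iffD1[OF norm_triangle_eq])
  then have "s *\<^sub>R y = norm y *\<^sub>R v" using e by (simp add: algebra_simps)
  then have "v = (1 / norm y) *\<^sub>R (s *\<^sub>R y)" using assms(3) by simp
  then show ?thesis by simp
qed

text \<open>Uniqueness of geodesics. A point between \<open>ex 0\<close> and \<open>ex y\<close> is retracted to the same point of the flat by the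
  retractions that belong to different orderings of the axes. Comparing the leading minors shows that it has no
  off-diagonal entries.\<close>

lemma between_in_flat:
  assumes P: "P \<in> X" and y: "y \<in> sum0" "y \<noteq> 0"
    and b: "riem_dist (mat 1) P = s" "riem_dist P (ex y) = norm y - s"
  shows "P = ex ((s / norm y) *\<^sub>R y)"
proof -
  have s0: "s \<ge> 0" using horo_contracts[OF one_in_X P] b(1) norm_ge_zero order_trans by blast
  define r where "r = s / norm y"
  have key: "horo (g \<star> P) = r *\<^sub>R y'"
    if g: "g \<in> SL3" "g ** transpose g = mat 1" and y': "g \<star> ex y = ex y'" "norm y' = norm y" "y' \<in> sum0" for g y'
  proof -
    have gP: "g \<star> P \<in> X" using X_act[OF P g(1)] .
    have "horo (mat 1) = 0" using horo_ex[of 0] by simp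
    then have "norm (horo (g \<star> P)) \<le> riem_dist (g \<star> mat 1) (g \<star> P)"
      using horo_contracts[OF one_in_X gP] g(2) by simp
    then have 1: "norm (horo (g \<star> P)) \<le> s" using riem_dist_act[OF g(1), of "mat 1" P] b(1) by simp
    have "norm (y' - horo (g \<star> P)) \<le> riem_dist (g \<star> P) (g \<star> ex y)"
      using horo_contracts[OF gP ex_in_X[OF y'(3)]] by (simp add: y' horo_ex)
    then have 2: "norm (y' - horo (g \<star> P)) \<le> norm y' - s"
      using riem_dist_act[OF g(1), of P "ex y"] b(2) y' by simp
    show ?thesis using vector_on_segment[OF 1 2 _ s0] y(2) y'(2) by (simp add: r_def)
  qed
  define \<sigma>1 where "\<sigma>1 = m3 0 1 0 0 0 1 1 0 0"
  define \<sigma>2' where "\<sigma>2' = m3 0 0 1 1 0 0 0 1 0"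
  have SL: "\<sigma>1 \<in> SL3" "\<sigma>2' \<in> SL3" "\<sigma>1 ** transpose \<sigma>1 = mat 1" "\<sigma>2' ** transpose \<sigma>2' = mat 1"
    by (simp_all add: SL3_def \<sigma>1_def \<sigma>2'_def det_3 mat3_eq_iff mult3 mat1_entry)
  have y1: "\<sigma>1 \<star> ex y = ex (vector [y$2, y$3, y$1])"
    "\<sigma>2' \<star> ex y = ex (vector [y$3, y$1, y$2])"
    by (simp_all add: \<sigma>1_def \<sigma>2'_def mat3_eq_iff mult3 ex_def)
  have n1: "norm (vector [y$2, y$3, y$1] :: real^3) = norm y" "norm (vector [y$3, y$1, y$2] :: real^3) = norm y"
    by (simp_all add: norm_eq_sqrt_inner inner3 algebra_simps)
  have z1: "vector [y$2, y$3, y$1] \<in> sum0" "vector [y$3, y$1, y$2] \<in> sum0"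
    using y(1) by (simp_all add: sum0_def)
  have k0: "horo (mat 1 ** P ** transpose (mat 1)) = r *\<^sub>R y"
    by (rule key) (use y SL3_one in simp_all)
  note k1 = key[OF SL(1,3) y1(1) n1(1) z1(1)]
  note k2 = key[OF SL(2,4) y1(2) n1(2) z1(2)]
  note m = X_minors[OF P] note m1 = X_minors[OF X_act[OF P SL(1)]] note m2 = X_minors[OF X_act[OF P SL(2)]]
  have h0: "ln (P$1$1) = r * y$1" "ln (P$1$1 * P$2$2 - P$1$2 * P$1$2) = r * (y$1 + y$2)"
    using k0 by (simp_all add: horo_def vec3_eq_iff algebra_simps)
  have h1: "ln (P$2$2) = r * y$2" "ln (P$2$2 * P$3$3 - P$2$3 * P$2$3) = r * (y$2 + y$3)"
    using k1 by (simp_all add: horo_def vec3_eq_iff algebra_simps mult3 \<sigma>1_def)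
  have h2: "ln (P$3$3) = r * y$3" "ln (P$3$3 * P$1$1 - P$3$1 * P$3$1) = r * (y$3 + y$1)"
    using k2 by (simp_all add: horo_def vec3_eq_iff algebra_simps mult3 \<sigma>2'_def)
  have p: "P$2$2 * P$3$3 - P$2$3 * P$2$3 > 0" "P$3$3 * P$1$1 - P$3$1 * P$3$1 > 0"
    using m1(4) m2(4) by (simp_all add: mult3 \<sigma>1_def \<sigma>2'_def)
  have e: "P$1$1 = exp (r * y$1)" "P$2$2 = exp (r * y$2)" "P$3$3 = exp (r * y$3)"
    using h0(1) h1(1) h2(1) m(1-3) by (metis exp_ln)+
  have f: "P$1$1 * P$2$2 - P$1$2 * P$1$2 = P$1$1 * P$2$2" "P$2$2 * P$3$3 - P$2$3 * P$2$3 = P$2$2 * P$3$3"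
    "P$3$3 * P$1$1 - P$3$1 * P$3$1 = P$3$3 * P$1$1"
    using h0(2) h1(2) h2(2) m(4) p unfolding e by (metis exp_ln exp_add distrib_left)+
  then have "P$1$2 = 0" "P$2$3 = 0" "P$3$1 = 0" by simp_all
  then show ?thesis using e m(5-7) by (simp add: mat3_eq_iff ex_def r_def)
qed

section \<open>The logarithm on the space of ellipsoids\<close>

definition Sym0 :: "mat3 set" where
  "Sym0 = {U. transpose U = U \<and> trace U = 0}"

lemma Sym0_iff: "U \<in> Sym0 \<longleftrightarrow> U$2$1 = U$1$2 \<and> U$3$1 = U$1$3 \<and> U$3$2 = U$2$3 \<and> U$1$1 + U$2$2 + U$3$3 = 0"
  unfolding Sym0_def trace3 mem_Collect_eq mat3_eq_iff transpose_entry by metis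

lemma Sym0_entries: "U \<in> Sym0 \<Longrightarrow> U$2$1 = U$1$2 \<and> U$3$1 = U$1$3 \<and> U$3$2 = U$2$3 \<and> U$1$1 + U$2$2 + U$3$3 = 0"
  by (simp only: Sym0_iff)

lemma Sym0_closed [simp]:
  "0 \<in> Sym0" "U \<in> Sym0 \<Longrightarrow> c *\<^sub>R U \<in> Sym0" "U \<in> Sym0 \<Longrightarrow> - U \<in> Sym0"
  "U \<in> Sym0 \<Longrightarrow> V \<in> Sym0 \<Longrightarrow> U + V \<in> Sym0" "U \<in> Sym0 \<Longrightarrow> V \<in> Sym0 \<Longrightarrow> U - V \<in> Sym0"
  by (simp_all add: Sym0_iff algebra_simps) (simp flip: distrib_left)

lemma trace_conj:
  fixes k U :: mat3
  assumes "rotation_matrix k" shows "trace (k \<star> U) = trace U"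
proof -
  have "trace (k \<star> U) = trace (transpose k ** (k ** U))" by (rule trace_mul_sym)
  then show ?thesis using rotation_SL3[OF assms] by (simp add: matrix_mul_assoc)
qed

lemma rotation_transpose: "rotation_matrix k \<Longrightarrow> rotation_matrix (transpose k)"
  by (simp add: rotation_matrix_def orthogonal_matrix_def)

lemma rotation_mult: "rotation_matrix k \<Longrightarrow> rotation_matrix l \<Longrightarrow> rotation_matrix (k ** l)"
  for k l :: mat3
  by (auto simp: rotation_matrix_def orthogonal_matrix_mul det_mul)

lemma rotation_one: "rotation_matrix (mat 1)"
  by (simp add: rotation_matrix_def orthogonal_matrix_id)

lemma conj_inverse:
  fixes k U :: mat3
  assumes "rotation_matrix k"
  shows "transpose k ** (k \<star> U) ** k = U" "k \<star> (transpose k ** U ** k) = U"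
proof -
  note o = rotation_SL3[OF assms]
  have "transpose k ** (k \<star> U) ** k = (transpose k ** k) ** U ** (transpose k ** k)"
    "k \<star> (transpose k ** U ** k) = (k ** transpose k) ** U ** (k ** transpose k)"
    by (simp_all only: matrix_mul_assoc)
  then show "transpose k ** (k \<star> U) ** k = U" "k \<star> (transpose k ** U ** k) = U"
    using o by simp_all
qed

lemma conj_conj: "k \<star> (l ** U ** transpose l) = (k ** l) \<star> U" for k l U :: mat3
  by (simp add: matrix_transpose_mul matrix_mul_assoc)

lemma conj_Sym0:
  fixes k U :: mat3
  assumes "rotation_matrix k" "U \<in> Sym0" shows "k \<star> U \<in> Sym0"
  using assms by (simp add: Sym0_def trace_conj matrix_transpose_mul matrix_mul_assoc)

lemma dg_Sym0: "dg x \<in> Sym0 \<longleftrightarrow> x \<in> sum0"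
  by (simp add: Sym0_iff dg_def sum0_def)

lemma Sym0_spectral:
  assumes "U \<in> Sym0"
  shows "\<exists>k x. rotation_matrix k \<and> x \<in> sum0 \<and> U = k \<star> dg x"
proof -
  obtain k x where k: "rotation_matrix k" "U = k \<star> dg x"
    using symmetric_diagonalization[of U] assms by (auto simp: Sym0_def)
  have "trace (dg x) = 0" using trace_conj[OF k(1), of "dg x"] assms k(2) by (simp add: Sym0_def)
  then have "x \<in> sum0" by (simp add: trace3 dg_def sum0_def)
  with k show ?thesis by blast
qed

lemma inner_trace: "U \<bullet> V = trace (transpose U ** V)" for U V :: mat3
  by (simp add: inner_vec_def sum_3 trace3 mult3 algebra_simps)

lemma inner_conj:
  fixes k U V :: mat3
  assumes "rotation_matrix k" shows "(k \<star> U) \<bullet> (k \<star> V) = U \<bullet> V"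
proof -
  note o = rotation_SL3[OF assms]
  have "transpose (k \<star> U) ** (k \<star> V) = k ** transpose U ** (transpose k ** k) ** V ** transpose k"
    by (simp add: matrix_transpose_mul matrix_mul_assoc)
  then have "transpose (k \<star> U) ** (k \<star> V) = k \<star> (transpose U ** V)"
    using o by (simp add: matrix_mul_assoc)
  then show ?thesis by (simp add: inner_trace trace_conj[OF assms])
qed

lemma norm_conj: "rotation_matrix k \<Longrightarrow> norm (k \<star> U) = norm U" for k U :: mat3
  by (simp add: norm_eq_sqrt_inner inner_conj)

lemma norm_dg: "norm (dg x) = norm x"
  by (simp add: norm_eq_sqrt_inner inner_trace trace3 mult3 dg_def inner3)

lemma dg_arith: "dg x - dg y = dg (x - y)" "r *\<^sub>R dg x = dg (r *\<^sub>R x)" "dg x + dg y = dg (x + y)"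
  by (simp_all add: dg_def mat3_eq_iff)

lemma conj_arith: "k ** U ** l - k ** V ** l = k ** (U - V) ** l" "r *\<^sub>R (k ** U ** l) = k ** (r *\<^sub>R U) ** l"
  "k ** U ** l + k ** V ** l = k ** (U + V) ** l" for k U V l :: mat3
  by (simp_all add: mat3_eq_iff mult3 algebra_simps)

text \<open>\<open>expm U P\<close> says that \<open>P\<close> is the matrix exponential of the symmetric traceless \<open>U\<close>, by a common diagonalization.\<close>

definition expm :: "mat3 \<Rightarrow> mat3 \<Rightarrow> bool" where
  "expm U P \<longleftrightarrow> (\<exists>k x. rotation_matrix k \<and> x \<in> sum0 \<and> U = k \<star> dg x \<and> P = k \<star> ex x)"

lemma intertwine:
  fixes k l A B :: mat3
  assumes k: "rotation_matrix k" "rotation_matrix l"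
    and e: "k \<star> A = l \<star> B"
  shows "(transpose l ** k) ** A = B ** (transpose l ** k)"
proof -
  note o = rotation_SL3[OF k(1)] rotation_SL3[OF k(2)]
  have "(transpose l ** k) ** A = transpose l ** (k \<star> A) ** k"
    using o by (simp flip: matrix_mul_assoc)
  also have "\<dots> = (transpose l ** l) ** B ** transpose l ** k"
    by (simp add: e matrix_mul_assoc)
  finally show ?thesis using o by (simp add: matrix_mul_assoc)
qed

lemma untwine:
  fixes k l A B :: mat3
  assumes k: "rotation_matrix k" "rotation_matrix l"
    and e: "(transpose l ** k) ** A = B ** (transpose l ** k)"
  shows "k \<star> A = l \<star> B"
proof -
  note o = rotation_SL3[OF k(1)] rotation_SL3[OF k(2)]
  have "k \<star> A = l ** ((transpose l ** k) ** A) ** transpose k"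
    using o by (simp add: matrix_mul_assoc)
  also have "\<dots> = l \<star> B ** (k ** transpose k)"
    unfolding e by (simp add: matrix_mul_assoc)
  finally show ?thesis using o by simp
qed

lemma dg_ex_intertwine: "n ** dg x = dg y ** n \<longleftrightarrow> n ** ex x = ex y ** n"
proof -
  have "a * u = v * a \<longleftrightarrow> a * exp u = exp v * a" for a u v :: real by auto
  then show ?thesis unfolding mat3_eq_iff mult3 dg_def ex_def m3_entry by simp
qed

lemma expm_unique: "expm U P \<Longrightarrow> expm V Q \<Longrightarrow> U = V \<longleftrightarrow> P = Q"
proof -
  assume "expm U P" "expm V Q"
  then obtain k x l y where k: "rotation_matrix k" "U = k \<star> dg x" "P = k \<star> ex x"
    and l: "rotation_matrix l" "V = l \<star> dg y" "Q = l \<star> ex y"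
    unfolding expm_def by blast
  have "k \<star> A = l \<star> B \<longleftrightarrow> (transpose l ** k) ** A = B ** (transpose l ** k)" for A B
    using intertwine[OF k(1) l(1)] untwine[OF k(1) l(1)] by blast
  then show ?thesis unfolding k(2,3) l(2,3) using dg_ex_intertwine by blast
qed

definition Ex :: "mat3 \<Rightarrow> mat3" where "Ex U = (SOME P. expm U P)"
definition Lg :: "mat3 \<Rightarrow> mat3" where "Lg P = (SOME U. expm U P)"

lemma expm_Ex: "U \<in> Sym0 \<Longrightarrow> expm U (Ex U)"
  unfolding Ex_def using Sym0_spectral[of U] by (intro someI_ex[of "expm U"]) (auto simp: expm_def)

lemma expm_Lg: "P \<in> X \<Longrightarrow> expm (Lg P) P"
  unfolding Lg_def using X_spectral[of P] by (intro someI_ex[of "\<lambda>U. expm U P"]) (auto simp: expm_def)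

lemma expm_dest: "expm U P \<Longrightarrow> U \<in> Sym0" "expm U P \<Longrightarrow> P \<in> X"
  unfolding expm_def using X_act[OF ex_in_X] rotation_SL3 conj_Sym0 dg_Sym0 by blast+

lemma Ex_eqI: "expm U P \<Longrightarrow> Ex U = P"
  using expm_unique expm_Ex expm_dest by blast

lemma Lg_eqI: "expm U P \<Longrightarrow> Lg P = U"
  using expm_unique expm_Lg expm_dest by blast

lemma Ex_Lg: "P \<in> X \<Longrightarrow> Ex (Lg P) = P" and Lg_Ex: "U \<in> Sym0 \<Longrightarrow> Lg (Ex U) = U"
  using Ex_eqI expm_Lg Lg_eqI expm_Ex by blast+

lemma Lg_Sym0: "P \<in> X \<Longrightarrow> Lg P \<in> Sym0" and Ex_X: "U \<in> Sym0 \<Longrightarrow> Ex U \<in> X"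
  using expm_Lg expm_Ex expm_dest by blast+

lemma Ex_frame: "rotation_matrix k \<Longrightarrow> x \<in> sum0 \<Longrightarrow> Ex (k \<star> dg x) = k \<star> ex x"
  by (rule Ex_eqI) (auto simp: expm_def)

lemma Ex_conj:
  assumes "rotation_matrix k" "U \<in> Sym0"
  shows "Ex (k \<star> U) = k \<star> Ex U"
proof -
  obtain l x where l: "rotation_matrix l" "x \<in> sum0" "U = l \<star> dg x" using Sym0_spectral[OF assms(2)] by blast
  then show ?thesis
    using Ex_frame[OF rotation_mult[OF assms(1) l(1)] l(2)] Ex_frame[OF l(1,2)] by (simp add: conj_conj)
qed

lemma Ex_minus: "U \<in> Sym0 \<Longrightarrow> Ex (- U) = adj (Ex U)"
proof -
  assume U: "U \<in> Sym0"
  obtain l x where l: "rotation_matrix l" "x \<in> sum0" "U = l \<star> dg x" using Sym0_spectral[OF U] by blast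
  note o = rotation_SL3[OF l(1)]
  have "- U = l \<star> dg (- x)"
    using l(3) conj_arith(2)[of "-1" l "dg x" "transpose l"] dg_arith(2)[of "-1" x] by simp
  then have e: "Ex (- U) = l \<star> ex (- x)" using Ex_frame[OF l(1), of "- x"] l(2) by simp
  have "(l \<star> ex (- x)) ** (l \<star> ex x) = l ** ex (- x) ** (transpose l ** l) ** ex x ** transpose l"
    by (simp add: matrix_mul_assoc)
  also have "\<dots> = l \<star> (ex (- x) ** ex x)" using o by (simp add: matrix_mul_assoc)
  also have "\<dots> = mat 1" using o by (simp add: ex_add)
  finally have "matrix_inv (Ex U) = Ex (- U)" using e Ex_frame[OF l(1,2)] l(3) by (intro matrix_inv_unique_left) simp
  then show ?thesis using X_inv_adj[OF Ex_X[OF U]] by simp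
qed

lemma Ex_0: "Ex 0 = mat 1"
proof -
  have "dg 0 = 0" by (simp add: mat3_eq_iff dg_def)
  then show ?thesis using Ex_frame[OF rotation_one, of 0] by simp
qed

lemma dist_common_frame:
  assumes "rotation_matrix k" "x \<in> sum0" "y \<in> sum0"
  shows "riem_dist (Ex (k \<star> dg x)) (Ex (k \<star> dg y)) =
     norm (k \<star> dg x - k \<star> dg y)"
proof -
  have "riem_dist (Ex (k \<star> dg x)) (Ex (k \<star> dg y)) = norm (y - x)"
    using assms by (simp add: Ex_frame riem_dist_flat rotation_SL3)
  then show ?thesis
    using assms by (simp add: conj_arith norm_conj dg_arith norm_dg norm_minus_commute)
qed

lemma dist_one_Ex: "U \<in> Sym0 \<Longrightarrow> riem_dist (mat 1) (Ex U) = norm U"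
proof -
  assume "U \<in> Sym0"
  then obtain l x where l: "rotation_matrix l" "x \<in> sum0" "U = l \<star> dg x" using Sym0_spectral by blast
  have z: "dg 0 = 0" by (simp add: mat3_eq_iff dg_def)
  show ?thesis using dist_common_frame[OF l(1) _ l(2), of 0] l(3) z by (simp add: Ex_0)
qed

lemma dist_scaled: 
  assumes "U \<in> Sym0" shows "riem_dist (Ex (r *\<^sub>R U)) (Ex (s *\<^sub>R U)) = \<bar>r - s\<bar> * norm U"
proof -
  obtain l x where l: "rotation_matrix l" "x \<in> sum0" "U = l \<star> dg x" using Sym0_spectral[OF assms] by blast
  have "r *\<^sub>R U = l \<star> dg (r *\<^sub>R x)" for r by (simp add: l(3) conj_arith dg_arith)
  then have "riem_dist (Ex (r *\<^sub>R U)) (Ex (s *\<^sub>R U)) = norm (r *\<^sub>R U - s *\<^sub>R U)"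
    using dist_common_frame[OF l(1), of "r *\<^sub>R x" "s *\<^sub>R x"] l(2) by simp
  then show ?thesis by (simp flip: scaleR_diff_left)
qed

text \<open>In a common diagonalization the distance is the norm of \<open>x\<close> and \<open>\<delta>\<close> is the norm of \<open>exp x - 1\<close>.\<close>

lemma dist_infinitesimal:
  assumes P: "P \<in> X" and Q: "Q \<in> X"
    and d: "\<delta> = sqrt (trace ((adj P ** Q - mat 1) ** (adj P ** Q - mat 1)))" "\<delta> \<le> 1/2"
  shows "\<bar>riem_dist P Q - \<delta>\<bar> \<le> 2 * \<delta> * \<delta>"
proof -
  obtain g x where g: "g \<in> SL3" "x \<in> sum0" "P = g ** transpose g" "Q = g \<star> ex x"
    using simultaneous_diagonalization[OF P Q] by blast
  define h where "h = transpose g"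
  have h: "det h = 1" "det g = 1" using g(1) by (simp_all add: h_def SL3_def)
  define w where "w = (\<chi> i. exp (x$i) - 1)"
  have w: "ex x - mat 1 = dg w" by (simp add: mat3_eq_iff ex_def dg_def w_def mat1_entry)
  have "adj P = matrix_inv h ** matrix_inv g"
    using X_inv_adj[OF P] h by (simp add: g(3) matrix_inv_prod flip: h_def)
  then have "adj P ** Q = matrix_inv h ** (matrix_inv g ** g) ** ex x ** h"
    by (simp add: g(4) matrix_mul_assoc flip: h_def)
  then have "adj P ** Q = matrix_inv h ** ex x ** h" using h by (simp add: matrix_inv_mult)
  moreover have "mat 1 = matrix_inv h ** mat 1 ** h" using h by (simp add: matrix_inv_mult)
  ultimately have e: "adj P ** Q - mat 1 = matrix_inv h ** dg w ** h"
    unfolding w[symmetric] by (metis conj_arith(1))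
  have "(matrix_inv h ** dg w ** h) ** (matrix_inv h ** dg w ** h) = matrix_inv h ** dg w ** (h ** matrix_inv h) ** dg w ** h"
    by (simp add: matrix_mul_assoc)
  also have "\<dots> = (matrix_inv h ** dg w ** dg w) ** h" using h by (simp add: matrix_inv_mult)
  finally have "trace ((matrix_inv h ** dg w ** h) ** (matrix_inv h ** dg w ** h)) = trace (h ** (matrix_inv h ** dg w ** dg w))"
    by (simp only: trace_mul_sym[of _ h])
  also have "\<dots> = trace (dg w ** dg w)" using h by (simp add: matrix_mul_assoc matrix_inv_mult)
  also have "\<dots> = w \<bullet> w" by (simp add: trace3 mult3 dg_def inner3)
  finally have dw: "\<delta> = norm w" unfolding d(1) e by (simp add: norm_eq_sqrt_inner)
  have dist: "riem_dist P Q = norm x" using riem_dist_flat[OF g(1) _ g(2), of 0] g by simp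
  have "norm (x - w) \<le> norm ((2 * \<delta>) *\<^sub>R w)"
  proof (rule norm_le_componentwise_cart)
    fix i
    have wi: "\<bar>w$i\<bar> \<le> \<delta>" using component_le_norm_cart[of w i] dw by simp
    have "x$i = ln (1 + w$i)" by (simp add: w_def)
    then have "\<bar>x$i - w$i\<bar> \<le> 2 * (w$i)\<^sup>2"
      using abs_ln_one_plus_x_minus_x_bound[of "w$i"] wi d(2) by simp
    also have "(w$i)\<^sup>2 = \<bar>w$i\<bar> * \<bar>w$i\<bar>" by (simp add: power2_eq_square)
    also have "2 * (\<bar>w$i\<bar> * \<bar>w$i\<bar>) \<le> 2 * (\<delta> * \<bar>w$i\<bar>)"
      using wi by (intro mult_left_mono mult_right_mono) auto
    finally show "norm ((x - w)$i) \<le> norm (((2 * \<delta>) *\<^sub>R w)$i)"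
      by (simp add: abs_mult dw mult.assoc)
  qed
  then have "norm (x - w) \<le> 2 * \<delta> * \<delta>" by (simp add: dw)
  moreover have "\<bar>norm x - norm w\<bar> \<le> norm (x - w)" by (rule norm_triangle_ineq3)
  ultimately show ?thesis by (simp add: dist dw)
qed

lemma Ex_derivative:
  assumes "U \<in> Sym0"
  shows "((\<lambda>t. Ex (t *\<^sub>R U) $ i $ j) has_real_derivative U $ i $ j) (at 0)"
proof -
  obtain l x where l: "rotation_matrix l" "x \<in> sum0" "U = l \<star> dg x" using Sym0_spectral[OF assms] by blast
  have "r *\<^sub>R U = l \<star> dg (r *\<^sub>R x)" for r by (simp add: l(3) conj_arith dg_arith)
  then have e: "Ex (t *\<^sub>R U) = l \<star> ex (t *\<^sub>R x)" for t using Ex_frame[OF l(1)] l(2) by simp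
  have f: "(\<lambda>t. Ex (t *\<^sub>R U) $ i $ j) = (\<lambda>t. l$i$1 * exp (t * x$1) * l$j$1 + l$i$2 * exp (t * x$2) * l$j$2 + l$i$3 * exp (t * x$3) * l$j$3)"
    unfolding e by (simp add: mult3 ex_def)
  have u: "U $ i $ j = l$i$1 * x$1 * l$j$1 + l$i$2 * x$2 * l$j$2 + l$i$3 * x$3 * l$j$3"
    by (simp only: l(3) conj_entry_diag)
  show ?thesis unfolding f u
    by (auto intro!: derivative_eq_intros simp: algebra_simps)
qed

lemma trace_scaleR3: "trace (c *\<^sub>R A) = c * trace A" for A :: mat3
  by (simp add: trace3 algebra_simps)

text \<open>The metric at the round ball is recovered from distances, so an isometry fixing the ball induces a map of the
  tangent space that preserves the Euclidean norm of differences.\<close>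

lemma dist_tangent_limit:
  assumes U: "U \<in> Sym0" and V: "V \<in> Sym0"
  shows "((\<lambda>t. riem_dist (Ex (t *\<^sub>R U)) (Ex (t *\<^sub>R V)) / t) \<longlongrightarrow> norm (V - U)) (at_right 0)"
proof -
  define M where "M = (\<lambda>t. Ex (t *\<^sub>R (- U)) ** Ex (t *\<^sub>R V))"
  have adj: "adj (Ex (t *\<^sub>R U)) = Ex (t *\<^sub>R (- U))" for t
    using Ex_minus[of "t *\<^sub>R U"] U by simp
  have E0: "Ex (0 *\<^sub>R W) = mat 1" for W by (simp add: Ex_0)
  have MD: "((\<lambda>t. M t $ i $ j) has_real_derivative (V - U) $ i $ j) (at 0)" for i j
  proof -
    have "((\<lambda>t. M t $ i $ j) has_real_derivative (- U ** mat 1 + mat 1 ** V) $ i $ j) (at 0)"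
      unfolding M_def mult3 vector_add_component
      by (rule derivative_eq_intros Ex_derivative Sym0_closed U V HOL.refl)+ (simp add: Ex_0 mult3 algebra_simps)
    then show ?thesis by simp
  qed
  define N where "N = (\<lambda>t. (1/t) *\<^sub>R (M t - mat 1))"
  have M0: "M 0 = mat 1" by (simp add: M_def Ex_0)
  have N: "((\<lambda>t. N t $ i $ j) \<longlongrightarrow> (V - U) $ i $ j) (at_right 0)" for i j
  proof -
    have "((\<lambda>t. (M t $ i $ j - M 0 $ i $ j) / (t - 0)) \<longlongrightarrow> (V - U) $ i $ j) (at 0)"
      using MD[of i j] by (simp add: has_field_derivative_iff)
    then have "((\<lambda>t. (M t $ i $ j - M 0 $ i $ j) / (t - 0)) \<longlongrightarrow> (V - U) $ i $ j) (at_right 0)"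
      by (rule tendsto_within_subset) simp
    then show ?thesis by (simp add: N_def M0)
  qed
  define \<delta> where "\<delta> = (\<lambda>t. sqrt (trace ((M t - mat 1) ** (M t - mat 1))))"
  have "((\<lambda>t. sqrt (trace (N t ** N t))) \<longlongrightarrow> sqrt (trace ((V - U) ** (V - U)))) (at_right 0)"
    unfolding trace3 mult3 by (intro tendsto_real_sqrt tendsto_add tendsto_mult N)
  moreover have "sqrt (trace ((V - U) ** (V - U))) = norm (V - U)"
  proof -
    have "transpose (V - U) = V - U" using Sym0_closed(5)[OF V U] by (simp add: Sym0_def)
    then show ?thesis by (simp add: norm_eq_sqrt_inner inner_trace)
  qed
  moreover have "\<forall>\<^sub>F t in at_right 0. sqrt (trace (N t ** N t)) = \<delta> t / t"
  proof (rule eventually_at_rightI[of 0 1])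
    fix t :: real assume t: "t \<in> {0<..<1}"
    have "trace (N t ** N t) = (1/t)\<^sup>2 * trace ((M t - mat 1) ** (M t - mat 1))"
      by (simp add: N_def trace_scaleR3 power2_eq_square)
    then show "sqrt (trace (N t ** N t)) = \<delta> t / t"
      using t by (simp add: \<delta>_def real_sqrt_mult)
  qed simp
  ultimately have dt: "((\<lambda>t. \<delta> t / t) \<longlongrightarrow> norm (V - U)) (at_right 0)"
    using Lim_transform_eventually by fastforce
  have "((\<lambda>t. (\<delta> t / t) * t) \<longlongrightarrow> norm (V - U) * 0) (at_right 0)"
    by (intro tendsto_mult dt tendsto_ident_at)
  moreover have "\<forall>\<^sub>F t in at_right 0. (\<delta> t / t) * t = \<delta> t"
    by (rule eventually_at_rightI[of 0 1]) auto
  ultimately have d0: "(\<delta> \<longlongrightarrow> 0) (at_right 0)"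
    using Lim_transform_eventually by fastforce
  then have small: "\<forall>\<^sub>F t in at_right 0. \<delta> t < 1/2"
    by (rule order_tendstoD) simp
  have near: "\<forall>\<^sub>F t in at_right 0. norm (riem_dist (Ex (t *\<^sub>R U)) (Ex (t *\<^sub>R V)) / t - \<delta> t / t) \<le> 2 * (\<delta> t / t) * \<delta> t"
    using small eventually_at_right_less[of "0::real"]
  proof eventually_elim
    case (elim t)
    have "\<bar>riem_dist (Ex (t *\<^sub>R U)) (Ex (t *\<^sub>R V)) - \<delta> t\<bar> \<le> 2 * \<delta> t * \<delta> t"
      using elim U V by (intro dist_infinitesimal) (simp_all add: Ex_X \<delta>_def M_def adj)
    then have "\<bar>riem_dist (Ex (t *\<^sub>R U)) (Ex (t *\<^sub>R V)) - \<delta> t\<bar> / t \<le> 2 * \<delta> t * \<delta> t / t"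
      using elim by (intro divide_right_mono) auto
    then show ?case using elim by (simp add: abs_divide flip: diff_divide_distrib)
  qed
  have "((\<lambda>t. 2 * (\<delta> t / t) * \<delta> t) \<longlongrightarrow> 2 * norm (V - U) * 0) (at_right 0)"
    by (intro tendsto_mult tendsto_const dt d0)
  then have "((\<lambda>t. 2 * (\<delta> t / t) * \<delta> t) \<longlongrightarrow> 0) (at_right 0)" by simp
  from Lim_null_comparison[OF near this]
  have "((\<lambda>t. riem_dist (Ex (t *\<^sub>R U)) (Ex (t *\<^sub>R V)) / t - \<delta> t / t) \<longlongrightarrow> 0) (at_right 0)" .
  from tendsto_add[OF this dt] show ?thesis by simp
qed

section \<open>Commuting matrices and flat triangles\<close>

lemma Sym0_sorted_spectral:
  assumes "U \<in> Sym0"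
  shows "\<exists>k x. rotation_matrix k \<and> x \<in> sum0 \<and> x$1 \<le> x$2 \<and> x$2 \<le> x$3 \<and> U = k \<star> dg x"
proof -
  define G where "G = (\<lambda>a b c. \<exists>k. rotation_matrix k \<and> U = k \<star> dg (vector [a, b, c]))"
  define s12 where "s12 = m3 0 1 0 (-1) 0 0 0 0 1"
  define s23 where "s23 = m3 1 0 0 0 0 1 0 (-1) 0"
  have r: "rotation_matrix s12" "rotation_matrix s23"
    by (simp_all add: rotation_matrix_def orthogonal_matrix_def s12_def s23_def det_3 mat3_eq_iff mult3 mat1_entry)
  have e: "dg (vector [a, b, c]) = s12 \<star> dg (vector [b, a, c])"
     "dg (vector [a, b, c]) = s23 \<star> dg (vector [a, c, b])" for a b c
    by (simp_all add: dg_def s12_def s23_def mat3_eq_iff mult3)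
  have 12: "G b a c" if "G a b c" for a b c
    using that r(1) e(1)[of a b c] unfolding G_def by (metis conj_conj rotation_mult)
  have 23: "G a c b" if "G a b c" for a b c
    using that r(2) e(2)[of a b c] unfolding G_def by (metis conj_conj rotation_mult)
  obtain k x where k: "rotation_matrix k" "x \<in> sum0" "U = k \<star> dg x" using Sym0_spectral[OF assms] by blast
  have x: "x = vector [x$1, x$2, x$3]" by (simp add: vec3_eq_iff)
  have G: "G (x$1) (x$2) (x$3)" unfolding G_def using k x by metis
  have fin: ?thesis if "G a b c" "a \<le> b" "b \<le> c" "a + b + c = 0" for a b c
    using that unfolding G_def by (metis (mono_tags, lifting) mem_Collect_eq sum0_def vector_3)
  have s: "x$1 + x$2 + x$3 = 0" using k(2) by (simp add: sum0_def)
  consider "x$1 \<le> x$2" "x$2 \<le> x$3" | "x$2 \<le> x$1" "x$1 \<le> x$3" | "x$1 \<le> x$3" "x$3 \<le> x$2"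
    | "x$2 \<le> x$3" "x$3 \<le> x$1" | "x$3 \<le> x$1" "x$1 \<le> x$2" | "x$3 \<le> x$2" "x$2 \<le> x$1" by linarith
  then show ?thesis
  proof cases
    case 1 then show ?thesis using fin[OF G] s by simp
  next
    case 2 then show ?thesis using fin[OF 12[OF G]] s by simp
  next
    case 3 then show ?thesis using fin[OF 23[OF G]] s by simp
  next
    case 4 then show ?thesis using fin[OF 23[OF 12[OF G]]] s by simp
  next
    case 5 then show ?thesis using fin[OF 12[OF 23[OF G]]] s by simp
  next
    case 6 then show ?thesis using fin[OF 12[OF 23[OF 12[OF G]]]] s by simp
  qed
qed

lemma exp_tangent: "exp m * (1 + (u - m)) \<le> exp u" "exp u = exp m * (1 + (u - m)) \<Longrightarrow> u = m" for u m :: real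
proof -
  have e: "exp u = exp m * exp (u - m)" by (simp flip: exp_add)
  show "exp m * (1 + (u - m)) \<le> exp u" unfolding e by (intro mult_left_mono exp_ge_add_one_self) simp
  assume "exp u = exp m * (1 + (u - m))"
  then have "exp (u - m) = 1 + (u - m)" unfolding e by simp
  then have "ln (exp (u - m)) = exp (u - m) - 1" unfolding ln_exp by linarith
  then have "exp (u - m) = 1" using ln_eq_minus_one exp_gt_zero by blast
  then show "u = m" by simp
qed

text \<open>Jensen's inequality for the exponential function, with the case of equality.\<close>

lemma exp_weighted_mean:
  fixes a b c u v w :: real
  assumes "a \<ge> 0" "b \<ge> 0" "c \<ge> 0" "a + b + c = 1" and m: "m = a * u + b * v + c * w"
  shows "exp m \<le> a * exp u + b * exp v + c * exp w"
    and "exp m = a * exp u + b * exp v + c * exp w \<Longrightarrow> (a = 0 \<or> u = m) \<and> (b = 0 \<or> v = m) \<and> (c = 0 \<or> w = m)"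
proof -
  have i: "a * (exp m * (1 + (u - m))) \<le> a * exp u" "b * (exp m * (1 + (v - m))) \<le> b * exp v"
    "c * (exp m * (1 + (w - m))) \<le> c * exp w"
    using assms by (auto intro!: mult_left_mono exp_tangent(1))
  have "a * (exp m * (1 + (u - m))) + b * (exp m * (1 + (v - m))) + c * (exp m * (1 + (w - m)))
      = exp m * ((a + b + c) + (a * u + b * v + c * w) - (a + b + c) * m)" by (simp add: algebra_simps)
  also have "\<dots> = exp m" unfolding assms(4) m[symmetric] by simp
  finally have s: "a * (exp m * (1 + (u - m))) + b * (exp m * (1 + (v - m))) + c * (exp m * (1 + (w - m))) = exp m" .
  show "exp m \<le> a * exp u + b * exp v + c * exp w" using i s by linarith
  assume "exp m = a * exp u + b * exp v + c * exp w"
  with i s have "a * (exp m * (1 + (u - m))) = a * exp u" "b * (exp m * (1 + (v - m))) = b * exp v"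
    "c * (exp m * (1 + (w - m))) = c * exp w" by linarith+
  then show "(a = 0 \<or> u = m) \<and> (b = 0 \<or> v = m) \<and> (c = 0 \<or> w = m)"
    using exp_tangent(2)[of u m] exp_tangent(2)[of v m] exp_tangent(2)[of w m] by auto
qed

lemma rotation_rows:
  fixes l :: mat3
  assumes "rotation_matrix l"
  shows "l$i$1 * l$j$1 + l$i$2 * l$j$2 + l$i$3 * l$j$3 = (if i = j then 1 else 0)"
proof -
  have "(l ** transpose l)$i$j = mat 1$i$j" using rotation_SL3[OF assms] by simp
  then show ?thesis by (simp add: mult3 mat1_entry)
qed

text \<open>A diagonal entry of \<open>ex u\<close> in another frame is a weighted mean of the \<open>exp (u\<^sub>i)\<close> with the squares of a unit vector as
  weights. Equality in Jensen's inequality says that this vector is an eigenvector.\<close>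

lemma diagonal_entry_exp:
  fixes l :: mat3 and u :: "real^3"
  assumes l: "rotation_matrix l"
  defines "A \<equiv> l ** dg u ** transpose l" and "B \<equiv> l ** ex u ** transpose l"
  shows "exp (A$i$i) \<le> B$i$i" and "exp (A$i$i) = B$i$i \<Longrightarrow> i \<noteq> j \<Longrightarrow> A$i$j = 0"
proof -
  have B: "B$i$i = (l$i$1 * l$i$1) * exp (u$1) + (l$i$2 * l$i$2) * exp (u$2) + (l$i$3 * l$i$3) * exp (u$3)"
    by (simp add: B_def mult3 ex_def)
  have A: "A$i$j = l$i$1 * u$1 * l$j$1 + l$i$2 * u$2 * l$j$2 + l$i$3 * u$3 * l$j$3" for i j
    unfolding A_def by (rule conj_entry_diag)
  have Ai: "A$i$i = (l$i$1 * l$i$1) * u$1 + (l$i$2 * l$i$2) * u$2 + (l$i$3 * l$i$3) * u$3"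
    by (simp add: A)
  have one: "l$i$1 * l$i$1 + l$i$2 * l$i$2 + l$i$3 * l$i$3 = 1" using rotation_rows[OF l, of i i] by simp
  note w = exp_weighted_mean[OF _ _ _ one Ai]
  show "exp (A$i$i) \<le> B$i$i" unfolding B by (rule w(1)) simp_all
  assume "exp (A$i$i) = B$i$i" "i \<noteq> j"
  then have "l$i$1 = 0 \<or> u$1 = A$i$i" "l$i$2 = 0 \<or> u$2 = A$i$i" "l$i$3 = 0 \<or> u$3 = A$i$i"
    using w(2) unfolding B by auto
  then have "A$i$j = A$i$i * (l$i$1 * l$j$1 + l$i$2 * l$j$2 + l$i$3 * l$j$3)"
    unfolding A[of i j] by (auto simp: algebra_simps)
  then show "A$i$j = 0" using rotation_rows[OF l, of i j] \<open>i \<noteq> j\<close> by simp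
qed

text \<open>Two geodesics through a point that span a flat sector have commuting directions. The retraction along a
  chamber containing the second direction can only be sharp if the vectors of the flag are eigenvectors of the
  first, by the strict convexity of the exponential function.\<close>

lemma commute_of_flat_sector:
  assumes U: "U \<in> Sym0" and V: "V \<in> Sym0"
    and d: "\<And>r. r \<ge> 0 \<Longrightarrow> riem_dist (Ex U) (Ex (r *\<^sub>R V)) = norm (U - r *\<^sub>R V)"
  shows "U ** V = V ** U"
proof -
  obtain k v where k: "rotation_matrix k" "v \<in> sum0" "v$1 \<le> v$2" "v$2 \<le> v$3" "V = k \<star> dg v"
    using Sym0_sorted_spectral[OF V] by blast
  note ko = rotation_SL3[OF k(1)]
  define W where "W = transpose k ** U ** k"
  have W0: "W \<in> Sym0" using conj_Sym0[OF rotation_transpose[OF k(1)] U] by (simp add: W_def)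
  have UW: "U = k \<star> W" using conj_inverse(2)[OF k(1)] by (simp add: W_def)
  define P where "P = Ex W"
  have P: "P \<in> X" using Ex_X[OF W0] by (simp add: P_def)
  define h where "h = horo P"
  have ineq: "2 * r * (W \<bullet> dg v - v \<bullet> h) \<le> W \<bullet> W" if r: "r \<ge> 0" for r
  proof -
    have rV: "r *\<^sub>R V = k \<star> dg (r *\<^sub>R v)" by (simp add: k(5) conj_arith dg_arith)
    have ExrV: "Ex (r *\<^sub>R V) = k \<star> ex (r *\<^sub>R v)" unfolding rV using k(1,2) by (simp add: Ex_frame)
    have "norm (r *\<^sub>R v - h) \<le> riem_dist P (ex (r *\<^sub>R v))"
      using horo_contracts[OF P ex_in_X, of "r *\<^sub>R v"] k(2) by (simp add: horo_ex h_def)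
    also have "\<dots> = riem_dist (Ex U) (Ex (r *\<^sub>R V))"
      unfolding ExrV UW Ex_conj[OF k(1) W0] P_def using ko by (simp add: riem_dist_act)
    also have "\<dots> = norm (W - dg (r *\<^sub>R v))"
      unfolding d[OF r] unfolding rV UW conj_arith norm_conj[OF k(1)] ..
    finally have "(norm (r *\<^sub>R v - h))\<^sup>2 \<le> (norm (W - dg (r *\<^sub>R v)))\<^sup>2" by (intro power_mono) auto
    moreover have "(norm (r *\<^sub>R v - h))\<^sup>2 = r * r * (v \<bullet> v) - 2 * r * (v \<bullet> h) + h \<bullet> h"
      by (simp add: power2_norm_eq_inner inner_diff_left inner_diff_right inner_commute algebra_simps)
    moreover have "(norm (W - dg (r *\<^sub>R v)))\<^sup>2 = W \<bullet> W - 2 * r * (W \<bullet> dg v) + r * r * (dg v \<bullet> dg v)"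
      unfolding dg_arith(2)[symmetric]
      by (simp add: power2_norm_eq_inner inner_diff_left inner_diff_right inner_commute algebra_simps)
    moreover have "dg v \<bullet> dg v = v \<bullet> v" using norm_dg[of v] by (simp add: norm_eq_sqrt_inner)
    ultimately have "2 * r * (W \<bullet> dg v - v \<bullet> h) \<le> W \<bullet> W - h \<bullet> h" by (simp add: algebra_simps)
    then show ?thesis using inner_ge_zero[of h] by linarith
  qed
  have le: "W \<bullet> dg v \<le> v \<bullet> h"
  proof (rule ccontr)
    assume "\<not> W \<bullet> dg v \<le> v \<bullet> h"
    then have p: "W \<bullet> dg v - v \<bullet> h > 0" by simp
    have "2 * ((W \<bullet> W + 1) / (W \<bullet> dg v - v \<bullet> h)) * (W \<bullet> dg v - v \<bullet> h) \<le> W \<bullet> W"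
      using p by (intro ineq) simp
    then show False using p inner_ge_zero[of W] by simp
  qed
  obtain l u where l: "rotation_matrix l" "u \<in> sum0" "W = l \<star> dg u" using Sym0_spectral[OF W0] by blast
  have PE: "P = l \<star> ex u" unfolding P_def l(3) using l by (simp add: Ex_frame)
  have mW: "- W = l \<star> dg (- u)"
    using conj_arith(2)[of "-1" l "dg u" "transpose l"] dg_arith(2)[of "-1" u] by (simp add: l(3))
  have adjP: "adj P = l \<star> ex (- u)"
    using Ex_minus[OF W0] Ex_frame[OF l(1), of "- u"] l(2) by (simp add: P_def mW)
  note m = X_minors[OF P]
  define M where "M = P$1$1 * P$2$2 - P$1$2 * P$1$2"
  have M: "adj P $ 3 $ 3 = M" using m by (simp add: adj_def M_def)
  note w = Sym0_entries[OF W0]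
  have 1: "exp (W$1$1) \<le> P$1$1" "exp (W$1$1) = P$1$1 \<Longrightarrow> W$1$2 = 0 \<and> W$1$3 = 0"
    using diagonal_entry_exp[OF l(1), of u 1] unfolding l(3)[symmetric] PE[symmetric] by auto
  have 3: "exp (- W$3$3) \<le> M" "exp (- W$3$3) = M \<Longrightarrow> W$1$3 = 0 \<and> W$2$3 = 0"
    using diagonal_entry_exp(1)[OF l(1), of "- u" 3] diagonal_entry_exp(2)[OF l(1), of "- u" 3 1]
      diagonal_entry_exp(2)[OF l(1), of "- u" 3 2] w
    unfolding mW[symmetric] adjP[symmetric] M by auto
  define a where "a = ln (P$1$1) - W$1$1"
  define b where "b = ln M + W$3$3"
  have Mp: "M > 0" using m by (simp add: M_def)
  have a: "a \<ge> 0" "a = 0 \<Longrightarrow> W$1$2 = 0 \<and> W$1$3 = 0"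
  proof -
    show "a \<ge> 0" using 1(1) m(1) by (simp add: a_def ln_ge_iff)
    assume "a = 0"
    then have "W$1$1 = ln (P$1$1)" by (simp add: a_def)
    then have "exp (W$1$1) = P$1$1" using m(1) by simp
    then show "W$1$2 = 0 \<and> W$1$3 = 0" by (rule 1(2))
  qed
  have b: "b \<ge> 0" "b = 0 \<Longrightarrow> W$1$3 = 0 \<and> W$2$3 = 0"
  proof -
    have "ln M \<ge> - W$3$3" using 3(1) Mp by (simp add: ln_ge_iff)
    then show "b \<ge> 0" by (simp add: b_def)
    assume "b = 0"
    then have "- W$3$3 = ln M" by (simp add: b_def)
    then have "exp (- W$3$3) = M" using Mp by simp
    then show "W$1$3 = 0 \<and> W$2$3 = 0" by (rule 3(2))
  qed
  have "v \<bullet> h = (v$1 - v$2) * ln (P$1$1) + (v$2 - v$3) * ln M"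
    by (simp add: h_def horo_def inner3 M_def algebra_simps)
  moreover have "W \<bullet> dg v = (v$1 - v$2) * W$1$1 - (v$2 - v$3) * W$3$3"
  proof -
    have "W$2$2 = - W$1$1 - W$3$3" using w by linarith
    then show ?thesis by (simp add: inner_trace trace3 mult3 dg_def) (simp add: algebra_simps)
  qed
  ultimately have "(v$1 - v$2) * a + (v$2 - v$3) * b \<ge> 0" using le by (simp add: a_def b_def algebra_simps)
  moreover have "(v$1 - v$2) * a \<le> 0" "(v$2 - v$3) * b \<le> 0"
    using k(3,4) a(1) b(1) by (auto intro: mult_nonpos_nonneg)
  ultimately have "(v$1 - v$2) * a = 0" "(v$2 - v$3) * b = 0" by linarith+
  then have "v$1 = v$2 \<or> W$1$2 = 0 \<and> W$1$3 = 0" "v$2 = v$3 \<or> W$1$3 = 0 \<and> W$2$3 = 0"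
    using a(2) b(2) by auto
  then have comm: "W ** dg v = dg v ** W"
    using w by (auto simp: mat3_eq_iff mult3 dg_def)
  have "U ** V = k ** W ** (transpose k ** k) ** dg v ** transpose k"
    by (simp add: UW k(5) matrix_mul_assoc)
  also have "\<dots> = k \<star> (W ** dg v)" using ko by (simp add: matrix_mul_assoc)
  also have "\<dots> = k \<star> (dg v ** W)" by (simp only: comm)
  also have "\<dots> = k ** dg v ** (transpose k ** k) ** W ** transpose k" using ko by (simp add: matrix_mul_assoc)
  also have "\<dots> = V ** U" by (simp add: UW k(5) matrix_mul_assoc)
  finally show ?thesis .
qed

section \<open>Isometries fixing a point\<close>

definition fixing_isometry :: "(mat3 \<Rightarrow> mat3) \<Rightarrow> bool" where
  "fixing_isometry f \<longleftrightarrow> (\<forall>P\<in>X. f P \<in> X) \<and> (\<forall>P\<in>X. \<forall>Q\<in>X. riem_dist (f P) (f Q) = riem_dist P Q) \<and> f (mat 1) = mat 1"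

text \<open>The differential of \<open>f\<close> at the round ball in exponential coordinates, where isometries turn out to be linear.\<close>

definition tangent_map :: "(mat3 \<Rightarrow> mat3) \<Rightarrow> mat3 \<Rightarrow> mat3" where
  "tangent_map f U = Lg (f (Ex U))"

context
  fixes f assumes f: "fixing_isometry f"
begin

lemma fX: "P \<in> X \<Longrightarrow> f P \<in> X" and fd: "P \<in> X \<Longrightarrow> Q \<in> X \<Longrightarrow> riem_dist (f P) (f Q) = riem_dist P Q"
  and f1: "f (mat 1) = mat 1"
  using f by (auto simp: fixing_isometry_def)

lemma tangent_map_Sym0: "U \<in> Sym0 \<Longrightarrow> tangent_map f U \<in> Sym0"
  by (simp add: tangent_map_def Lg_Sym0 fX Ex_X)

lemma Ex_tangent_map: "U \<in> Sym0 \<Longrightarrow> Ex (tangent_map f U) = f (Ex U)"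
  by (simp add: tangent_map_def Ex_Lg fX Ex_X)

lemma norm_tangent_map: "U \<in> Sym0 \<Longrightarrow> norm (tangent_map f U) = norm U"
  using dist_one_Ex[of "tangent_map f U"] dist_one_Ex[of U] fd[OF one_in_X Ex_X, of U]
  by (simp add: tangent_map_Sym0 Ex_tangent_map f1)

text \<open>\<open>Ex (r U)\<close> lies between the ball and \<open>Ex U\<close>, and betweenness determines it on the image geodesic.\<close>

lemma tangent_map_shrink:
  assumes U: "U \<in> Sym0" and r: "0 \<le> r" "r \<le> 1"
  shows "tangent_map f (r *\<^sub>R U) = r *\<^sub>R tangent_map f U"
proof (cases "U = 0")
  case True
  then show ?thesis using norm_tangent_map[of 0] by simp
next
  case False
  obtain k y where k: "rotation_matrix k" "y \<in> sum0" "tangent_map f U = k \<star> dg y"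
    using Sym0_spectral[OF tangent_map_Sym0[OF U]] by blast
  note ko = rotation_SL3[OF k(1)]
  have ny: "norm y = norm U" using norm_tangent_map[OF U] by (simp add: k(3) norm_conj[OF k(1)] norm_dg)
  then have y0: "y \<noteq> 0" using False by auto
  define P where "P = f (Ex (r *\<^sub>R U))"
  have P: "P \<in> X" using U by (simp add: P_def fX Ex_X)
  define P' where "P' = transpose k ** P ** transpose (transpose k)"
  have kt: "transpose k \<in> SL3" using ko SL3_transpose by blast
  have P': "P' \<in> X" unfolding P'_def by (rule X_act[OF P kt])
  have "riem_dist (mat 1) P' = riem_dist (mat 1) P"
    using riem_dist_act[OF kt, of "mat 1" P] ko by (simp add: P'_def)
  also have "\<dots> = r * norm U"
    using fd[OF one_in_X Ex_X, of "r *\<^sub>R U"] dist_one_Ex[of "r *\<^sub>R U"] U r by (simp add: P_def f1)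
  finally have d1: "riem_dist (mat 1) P' = r * norm U" .
  have kPk: "k \<star> P' = P" using conj_inverse(2)[OF k(1), of P] by (simp add: P'_def)
  have "riem_dist P' (ex y) = riem_dist (k \<star> P') (k \<star> ex y)"
    using ko by (simp add: riem_dist_act)
  also have "k \<star> ex y = f (Ex U)"
    using Ex_tangent_map[OF U] Ex_frame[OF k(1,2)] k(3) by simp
  also have "riem_dist (k \<star> P') (f (Ex U)) = riem_dist (Ex (r *\<^sub>R U)) (Ex (1 *\<^sub>R U))"
    unfolding kPk P_def using U by (simp add: fd Ex_X)
  also have "\<dots> = (1 - r) * norm U" using dist_scaled[OF U, of r 1] r by simp
  finally have d2: "riem_dist P' (ex y) = norm y - r * norm U" by (simp add: ny algebra_simps)
  have "P' = ex (r *\<^sub>R y)"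
    using between_in_flat[OF P' k(2) y0 d1 d2] ny False by simp
  then have "P = Ex (r *\<^sub>R tangent_map f U)"
    using kPk Ex_frame[OF k(1), of "r *\<^sub>R y"] k(2) by (simp add: k(3) conj_arith dg_arith)
  then show ?thesis
    using U tangent_map_Sym0[OF U] by (simp add: tangent_map_def P_def Lg_Ex)
qed

lemma tangent_map_pos_scale:
  assumes U: "U \<in> Sym0" and r: "0 \<le> r"
  shows "tangent_map f (r *\<^sub>R U) = r *\<^sub>R tangent_map f U"
proof (cases "r \<le> 1")
  case False
  have "tangent_map f ((1/r) *\<^sub>R (r *\<^sub>R U)) = (1/r) *\<^sub>R tangent_map f (r *\<^sub>R U)"
    using U False by (intro tangent_map_shrink) auto
  then have "tangent_map f U = (1/r) *\<^sub>R tangent_map f (r *\<^sub>R U)" using False by simp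
  then show ?thesis using False by simp
qed (use tangent_map_shrink assms in auto)

lemma tangent_map_dist:
  assumes U: "U \<in> Sym0" and V: "V \<in> Sym0"
  shows "norm (tangent_map f V - tangent_map f U) = norm (V - U)"
proof (rule tendsto_unique)
  show "((\<lambda>t. riem_dist (Ex (t *\<^sub>R U)) (Ex (t *\<^sub>R V)) / t) \<longlongrightarrow> norm (V - U)) (at_right 0)"
    by (rule dist_tangent_limit[OF U V])
  show "((\<lambda>t. riem_dist (Ex (t *\<^sub>R U)) (Ex (t *\<^sub>R V)) / t) \<longlongrightarrow> norm (tangent_map f V - tangent_map f U)) (at_right 0)"
  proof (rule Lim_transform_eventually[OF dist_tangent_limit[OF tangent_map_Sym0[OF U] tangent_map_Sym0[OF V]]])
    show "\<forall>\<^sub>F t in at_right 0. riem_dist (Ex (t *\<^sub>R tangent_map f U)) (Ex (t *\<^sub>R tangent_map f V)) / t =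
      riem_dist (Ex (t *\<^sub>R U)) (Ex (t *\<^sub>R V)) / t"
    proof (rule eventually_at_rightI[of 0 1])
      fix t :: real assume "t \<in> {0<..<1}"
      then have "Ex (t *\<^sub>R tangent_map f W) = f (Ex (t *\<^sub>R W))" if "W \<in> Sym0" for W
        using tangent_map_pos_scale[OF that, of t] Ex_tangent_map[of "t *\<^sub>R W"] that by simp
      then show "riem_dist (Ex (t *\<^sub>R tangent_map f U)) (Ex (t *\<^sub>R tangent_map f V)) / t =
        riem_dist (Ex (t *\<^sub>R U)) (Ex (t *\<^sub>R V)) / t"
        using U V by (simp add: fd Ex_X)
    qed simp
  qed
qed simp

lemma tangent_map_inner:
  assumes U: "U \<in> Sym0" and V: "V \<in> Sym0"
  shows "tangent_map f U \<bullet> tangent_map f V = U \<bullet> V"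
proof -
  have polar: "A \<bullet> B = ((norm A)\<^sup>2 + (norm B)\<^sup>2 - (norm (B - A))\<^sup>2) / 2" for A B :: mat3
    by (simp add: power2_norm_eq_inner inner_diff_left inner_diff_right inner_commute)
  show ?thesis
    unfolding polar[of "tangent_map f U"] polar[of U]
    using tangent_map_dist[OF U V] norm_tangent_map[OF U] norm_tangent_map[OF V] by simp
qed

text \<open>A map of Euclidean spaces that preserves inner products is linear.\<close>

lemma tangent_map_linear:
  assumes U: "U \<in> Sym0" and V: "V \<in> Sym0"
  shows "tangent_map f (a *\<^sub>R U + b *\<^sub>R V) = a *\<^sub>R tangent_map f U + b *\<^sub>R tangent_map f V"
proof -
  let ?g = "tangent_map f"
  define W where "W = a *\<^sub>R U + b *\<^sub>R V"
  have W: "W \<in> Sym0" using U V by (simp add: W_def)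
  have "(norm (?g W - (a *\<^sub>R ?g U + b *\<^sub>R ?g V)))\<^sup>2 = (norm (W - (a *\<^sub>R U + b *\<^sub>R V)))\<^sup>2"
    unfolding power2_norm_eq_inner inner_diff_left inner_diff_right inner_add_left inner_add_right
      inner_scaleR_left inner_scaleR_right
    by (simp add: tangent_map_inner U V W)
  then show ?thesis by (simp add: W_def)
qed

lemma tangent_map_scale: "U \<in> Sym0 \<Longrightarrow> tangent_map f (a *\<^sub>R U) = a *\<^sub>R tangent_map f U"
  using tangent_map_linear[of U U a 0] by simp

lemma tangent_map_add: "U \<in> Sym0 \<Longrightarrow> V \<in> Sym0 \<Longrightarrow> tangent_map f (U + V) = tangent_map f U + tangent_map f V"
  using tangent_map_linear[of U V 1 1] by simp

lemma tangent_map_sector: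
  assumes A: "A \<in> Sym0" and B: "B \<in> Sym0" and r: "r \<ge> 0"
  shows "riem_dist (Ex (tangent_map f A)) (Ex (r *\<^sub>R tangent_map f B)) = riem_dist (Ex A) (Ex (r *\<^sub>R B))"
    "norm (tangent_map f A - r *\<^sub>R tangent_map f B) = norm (A - r *\<^sub>R B)"
  using fd[OF Ex_X[OF A] Ex_X[of "r *\<^sub>R B"]] tangent_map_dist[of "r *\<^sub>R B" A] A B
  by (simp_all add: Ex_tangent_map flip: tangent_map_scale)

end

text \<open>The singular directions: the exponentials of their multiples are ellipsoids of revolution with axis \<open>w\<close>.\<close>

definition sg :: "real^3 \<Rightarrow> mat3" where
  "sg w = (\<chi> i j. 3 * (w$i * w$j)) - mat 1"

lemma sg_entry: "sg w $ i $ j = 3 * (w$i * w$j) - (if i = j then 1 else 0)"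
  by (simp add: sg_def mat1_entry)

lemma unit_squares: "norm w = 1 \<longleftrightarrow> w$1 * w$1 + w$2 * w$2 + w$3 * w$3 = 1" for w :: "real^3"
  by (simp add: norm_eq_1 inner3)

lemma sg_Sym0: "norm w = 1 \<Longrightarrow> sg w \<in> Sym0"
  by (simp add: Sym0_iff sg_entry unit_squares mult.commute)

lemma sg_inner: "norm v = 1 \<Longrightarrow> norm w = 1 \<Longrightarrow> sg v \<bullet> sg w = 9 * (v \<bullet> w)\<^sup>2 - 3"
proof -
  assume v: "norm v = 1" "norm w = 1"
  have "sg v \<bullet> sg w = 9 * (v \<bullet> w)\<^sup>2 - 3 * (v \<bullet> v) - 3 * (w \<bullet> w) + 3"
    unfolding inner_trace trace3 mult3 transpose_entry sg_entry inner3 by (simp add: power2_eq_square algebra_simps)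
  then show ?thesis using v by (simp add: norm_eq_1)
qed

lemma sg_conj:
  assumes "rotation_matrix k" shows "k \<star> sg w = sg (k *v w)"
proof -
  have "k \<star> sg w = (\<chi> i j. 3 * ((k *v w)$i * (k *v w)$j)) - k ** transpose k"
    by (simp add: mat3_eq_iff mult3 vmult3 sg_entry algebra_simps)
  then show ?thesis using rotation_SL3[OF assms] by (simp add: sg_def)
qed

lemma sg_axis: "sg (axis 1 1) = dg (vector [2, -1, -1])" "sg (axis 3 1) = dg (vector [-1, -1, 2])" "sg (axis 2 1) = dg (vector [-1, 2, -1])"
  by (simp_all add: mat3_eq_iff sg_entry dg_def axis_def)

lemma norm_rotation: "rotation_matrix k \<Longrightarrow> norm (k *v w) = norm w" for w :: "real^3"
  by (simp add: rotation_matrix_def orthogonal_matrix_def norm_eq_sqrt_inner)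
     (metis dot_lmul_matrix matrix_vector_mul_assoc matrix_vector_mul_lid transpose_matrix_vector)

lemma commute_with_regular:
  assumes "x$1 \<noteq> x$2" "x$2 \<noteq> x$3" "x$1 \<noteq> x$3" "A ** dg x = dg x ** A"
  shows "A = dg (vector [A$1$1, A$2$2, A$3$3])"
  using assms by (simp add: mat3_eq_iff mult3 dg_def)

text \<open>A singular direction is one that commutes with two directions that do not commute with each other, so an
  isometry maps singular directions to singular directions.\<close>

lemma tangent_map_singular:
  assumes f: "fixing_isometry f" and v: "norm v = 1"
  shows "\<exists>s w. (s = 1 \<or> s = -1) \<and> norm w = 1 \<and> tangent_map f (sg v) = s *\<^sub>R sg w"
proof -
  let ?g = "tangent_map f"
  obtain k where k: "rotation_matrix k" "k *v axis 1 1 = v"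
    using rotation_matrix_exists_basis[OF _ v, where k=1] by auto
  note ko = rotation_SL3[OF k(1)]
  have V: "sg v = k \<star> dg (vector [2, -1, -1])"
    using sg_conj[OF k(1), of "axis 1 1"] k(2) sg_axis by simp
  have V0: "sg v \<in> Sym0" by (rule sg_Sym0[OF v])
  define m where "m = m3 0 0 0 0 0 1 0 1 (0::real)"
  define c where "c = sqrt (1/2 :: real)"
  have cc: "c * c = 1/2" by (simp add: c_def)
  define \<rho> where "\<rho> = m3 1 0 0 0 c (- c) 0 c c"
  have \<rho>: "rotation_matrix \<rho>"
    using cc by (simp add: rotation_matrix_def orthogonal_matrix_def \<rho>_def det_3 mat3_eq_iff mult3 mat1_entry)
  have mr: "m = \<rho> \<star> dg (vector [0, 1, -1])" "dg (vector [2, -1, -1]) = \<rho> \<star> dg (vector [2, -1, -1])"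
    using cc by (simp_all add: m_def \<rho>_def mat3_eq_iff mult3 dg_def)
  define U1 where "U1 = k \<star> dg (vector [0, 1, -1])"
  define U2 where "U2 = k \<star> m"
  have kr: "rotation_matrix (k ** \<rho>)" using k \<rho> rotation_mult by blast
  have U2r: "U2 = (k ** \<rho>) \<star> dg (vector [0, 1, -1])"
    "sg v = (k ** \<rho>) \<star> dg (vector [2, -1, -1])"
    by (simp_all add: U2_def mr(1) conj_conj) (simp add: V flip: mr(2) conj_conj)
  have s0: "vector [0, 1, -1] \<in> sum0" "vector [2, -1, -1] \<in> sum0" by (simp_all add: sum0_def)
  have U0: "U1 \<in> Sym0" "U2 \<in> Sym0"
    unfolding U1_def U2r(1) using k kr s0 by (simp_all add: conj_Sym0 dg_Sym0)
  have common: "riem_dist (Ex A) (Ex (r *\<^sub>R B)) = norm (A - r *\<^sub>R B)"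
    if "rotation_matrix q" "x \<in> sum0" "y \<in> sum0" "A = q \<star> dg x" "B = q \<star> dg y" for q x y A B r
    using dist_common_frame[OF that(1,2), of "r *\<^sub>R y"] that by (simp add: conj_arith dg_arith)
  have c1: "?g U1 ** ?g (sg v) = ?g (sg v) ** ?g U1"
    using common[OF k(1) s0 U1_def V] tangent_map_sector[OF f U0(1) V0]
    by (intro commute_of_flat_sector tangent_map_Sym0[OF f] U0 V0) simp
  have c2: "?g U2 ** ?g (sg v) = ?g (sg v) ** ?g U2"
    using common[OF kr s0 U2r] tangent_map_sector[OF f U0(2) V0]
    by (intro commute_of_flat_sector tangent_map_Sym0[OF f] U0 V0) simp
  obtain l x where l: "rotation_matrix l" "x \<in> sum0" "x$1 \<le> x$2" "x$2 \<le> x$3" "?g (sg v) = l \<star> dg x"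
    using Sym0_sorted_spectral[OF tangent_map_Sym0[OF f V0]] by blast
  note lo = rotation_SL3[OF l(1)]
  have "x$1 = x$2 \<or> x$2 = x$3"
  proof (rule ccontr)
    assume "\<not> ?thesis"
    then have ne: "x$1 \<noteq> x$2" "x$2 \<noteq> x$3" "x$1 \<noteq> x$3" using l(3,4) by auto
    have diag: "\<exists>y. y \<in> sum0 \<and> A = l \<star> dg y"
      if A: "A \<in> Sym0" "A ** ?g (sg v) = ?g (sg v) ** A" for A
    proof -
      define B where "B = transpose l ** A ** l"
      have B0: "B \<in> Sym0" using conj_Sym0[OF rotation_transpose[OF l(1)] A(1)] by (simp add: B_def)
      have AB: "A = l \<star> B" using conj_inverse(2)[OF l(1)] by (simp add: B_def)
      have "l \<star> (B ** dg x) = l ** B ** (transpose l ** l) ** dg x ** transpose l"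
        using lo by (simp add: matrix_mul_assoc)
      also have "\<dots> = A ** ?g (sg v)" by (simp add: AB l(5) matrix_mul_assoc)
      also have "\<dots> = l ** dg x ** (transpose l ** l) ** B ** transpose l"
        unfolding A(2) by (simp add: AB l(5) matrix_mul_assoc)
      also have "\<dots> = l \<star> (dg x ** B)" using lo by (simp add: matrix_mul_assoc)
      finally have "B ** dg x = dg x ** B" by (metis conj_inverse(1)[OF l(1)])
      from commute_with_regular[OF ne this] have "B = dg (vector [B$1$1, B$2$2, B$3$3])" .
      with B0 AB show ?thesis using dg_Sym0 by metis
    qed
    obtain y1 y2 where y: "y1 \<in> sum0" "?g U1 = l \<star> dg y1" "y2 \<in> sum0" "?g U2 = l \<star> dg y2"
      using diag[OF tangent_map_Sym0[OF f U0(1)] c1] diag[OF tangent_map_Sym0[OF f U0(2)] c2] by blast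
    have "U1 ** U2 = U2 ** U1"
      using common[OF l(1) y(1) y(3) y(2) y(4)] tangent_map_sector[OF f U0]
      by (intro commute_of_flat_sector U0) simp
    then have "transpose k ** (U1 ** U2) ** k = transpose k ** (U2 ** U1) ** k" by simp
    moreover have "transpose k ** (U1 ** U2) ** k = dg (vector [0, 1, -1]) ** m"
    proof -
      have "transpose k ** (U1 ** U2) ** k = (transpose k ** k) ** dg (vector [0, 1, -1]) ** (transpose k ** k) ** m ** (transpose k ** k)"
        by (simp add: U1_def U2_def matrix_mul_assoc)
      then show ?thesis using ko by simp
    qed
    moreover have "transpose k ** (U2 ** U1) ** k = m ** dg (vector [0, 1, -1])"
    proof -
      have "transpose k ** (U2 ** U1) ** k = (transpose k ** k) ** m ** (transpose k ** k) ** dg (vector [0, 1, -1]) ** (transpose k ** k)"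
        by (simp add: U1_def U2_def matrix_mul_assoc)
      then show ?thesis using ko by simp
    qed
    ultimately show False by (simp add: mat3_eq_iff mult3 dg_def m_def)
  qed
  moreover have "x \<bullet> x = 6"
  proof -
    have "(norm (?g (sg v)))\<^sup>2 = (norm (sg v))\<^sup>2" by (simp add: norm_tangent_map[OF f V0])
    also have "\<dots> = 6" unfolding power2_norm_eq_inner sg_inner[OF v v] using v by (simp add: norm_eq_1)
    finally show ?thesis by (simp add: l(5) norm_conj[OF l(1)] norm_dg power2_norm_eq_inner)
  qed
  moreover have "x$1 + x$2 + x$3 = 0" using l(2) by (simp add: sum0_def)
  ultimately have "x = vector [-1, -1, 2] \<or> x = - vector [2, -1, -1]"
  proof -
    assume *: "x$1 = x$2 \<or> x$2 = x$3" "x \<bullet> x = 6" "x$1 + x$2 + x$3 = 0"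
    show ?thesis
    proof (cases "x$1 = x$2")
      case True
      then have "x$3 = - 2 * x$2" using *(3) by simp
      then have "(x$2)\<^sup>2 = 1" using *(2) True by (simp add: inner3 power2_eq_square)
      then have "x$2 = -1" using l(4) \<open>x$3 = - 2 * x$2\<close> by (auto simp: power2_eq_1_iff)
      then show ?thesis using True \<open>x$3 = - 2 * x$2\<close> by (simp add: vec3_eq_iff)
    next
      case False
      then have e: "x$3 = x$2" "x$1 = - 2 * x$2" using *(1,3) by auto
      then have "(x$2)\<^sup>2 = 1" using *(2) by (simp add: inner3 power2_eq_square)
      then have "x$2 = 1" using l(3) e by (auto simp: power2_eq_1_iff)
      then show ?thesis using e by (simp add: vec3_eq_iff)
    qed
  qed
  then show ?thesis
  proof
    assume "x = vector [-1, -1, 2]"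
    then have "?g (sg v) = 1 *\<^sub>R sg (l *v axis 3 1)" using sg_conj[OF l(1), of "axis 3 1"] l(5) sg_axis by simp
    then show ?thesis using norm_rotation[OF l(1), of "axis 3 1"] by (intro exI[of _ 1] exI[of _ "l *v axis 3 1"]) simp
  next
    assume "x = - vector [2, -1, -1]"
    then have "dg x = (-1) *\<^sub>R dg (vector [2, -1, -1])" by (simp add: dg_arith)
    then have "?g (sg v) = (-1) *\<^sub>R sg (l *v axis 1 1)"
      unfolding l(5) conj_arith(2)[of "-1" l, symmetric]
      using sg_conj[OF l(1), of "axis 1 1"] sg_axis by (simp only: conj_arith(2)[symmetric])
    then show ?thesis using norm_rotation[OF l(1), of "axis 1 1"] by (intro exI[of _ "-1"] exI[of _ "l *v axis 1 1"]) simp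
  qed
qed


text \<open>The singular directions of orthogonal axes have inner product -3. By Bessel's inequality three singular directions
  up to sign can only have these inner products if the signs are equal.\<close>

lemma equal_signs:
  assumes w: "norm w1 = 1" "norm w2 = 1" "norm w3 = 1" and s: "s1 = 1 \<or> s1 = -1" "s2 = 1 \<or> s2 = -1" "s3 = 1 \<or> s3 = -1"
    and i: "(s1 *\<^sub>R sg w1) \<bullet> (s2 *\<^sub>R sg w2) = -3" "(s1 *\<^sub>R sg w1) \<bullet> (s3 *\<^sub>R sg w3) = -3"
      "(s2 *\<^sub>R sg w2) \<bullet> (s3 *\<^sub>R sg w3) = -3"
  shows "s1 = s2 \<and> s2 = s3"
proof -
  have bessel: "(a \<bullet> c)\<^sup>2 + (b \<bullet> c)\<^sup>2 \<le> 1" if "norm a = 1" "norm b = 1" "norm c = 1" "a \<bullet> b = 0" for a b c :: "real^3"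
  proof -
    define d where "d = c - (a \<bullet> c) *\<^sub>R a - (b \<bullet> c) *\<^sub>R b"
    have "0 \<le> d \<bullet> d" by simp
    also have "d \<bullet> d = 1 - (a \<bullet> c)\<^sup>2 - (b \<bullet> c)\<^sup>2"
      using that unfolding d_def
      by (simp add: inner_diff_left inner_diff_right norm_eq_1 inner_commute power2_eq_square algebra_simps)
    finally show ?thesis by simp
  qed
  have e: "s1 * s2 * (9 * (w1 \<bullet> w2)\<^sup>2 - 3) = -3" "s1 * s3 * (9 * (w1 \<bullet> w3)\<^sup>2 - 3) = -3" "s2 * s3 * (9 * (w2 \<bullet> w3)\<^sup>2 - 3) = -3"
    using i by (simp_all add: sg_inner w mult_ac)
  have b: "w1 \<bullet> w2 = 0 \<Longrightarrow> (w1 \<bullet> w3)\<^sup>2 + (w2 \<bullet> w3)\<^sup>2 \<le> 1"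
    "w1 \<bullet> w3 = 0 \<Longrightarrow> (w1 \<bullet> w2)\<^sup>2 + (w2 \<bullet> w3)\<^sup>2 \<le> 1"
    "w2 \<bullet> w3 = 0 \<Longrightarrow> (w1 \<bullet> w2)\<^sup>2 + (w1 \<bullet> w3)\<^sup>2 \<le> 1"
    using bessel[OF w] bessel[OF w(1,3,2)] bessel[OF w(2,3,1)] by (simp_all add: inner_commute)
  show ?thesis
    using s e b by auto
qed

definition axis_sum :: "real \<Rightarrow> real \<Rightarrow> real \<Rightarrow> mat3" where
  "axis_sum a b c = m3 0 a b a 0 c b c 0"

text \<open>The tangent map sends singular directions to singular ones up to a sign, which is the same for all directions of a
  suitable configuration; if it is negative, the polarity is involved. After a rotation \<open>k\<close> the tangent map fixes the singular directions of
  the coordinate axes. It then preserves the squares of the coordinates of the axes of singular directions, so that it can only change signs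
  of off-diagonal entries. The image of the space diagonal \<open>c\<close> shows that these signs come from a diagonal rotation \<open>D\<close>.\<close>

lemma isometry_fixing_one:
  assumes f: "fixing_isometry f"
  shows "\<exists>k. rotation_matrix k \<and> ((\<forall>P\<in>X. f P = k \<star> P) \<or> (\<forall>P\<in>X. f P = k \<star> adj P))"
proof -
  let ?g = "tangent_map f"
  note scale = tangent_map_scale[OF f] and add = tangent_map_add[OF f] and inn = tangent_map_inner[OF f]
  define Z where "Z = (\<lambda>s v. \<exists>w. norm w = 1 \<and> ?g (sg v) = s *\<^sub>R sg w)"
  have Z: "Z 1 v \<or> Z (-1) v" if "norm v = 1" for v
    using tangent_map_singular[OF f that] by (auto simp: Z_def)
  have triple: "s1 = s2 \<and> s2 = s3"
    if n: "norm v1 = 1" "norm v2 = 1" "norm v3 = 1" and o: "v1 \<bullet> v2 = 0" "v1 \<bullet> v3 = 0" "v2 \<bullet> v3 = 0"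
      and s: "s1 = 1 \<or> s1 = -1" "s2 = 1 \<or> s2 = -1" "s3 = 1 \<or> s3 = -1" and z: "Z s1 v1" "Z s2 v2" "Z s3 v3" for v1 v2 v3 s1 s2 s3
  proof -
    obtain w1 w2 w3 where w: "norm w1 = 1" "?g (sg v1) = s1 *\<^sub>R sg w1" "norm w2 = 1" "?g (sg v2) = s2 *\<^sub>R sg w2"
      "norm w3 = 1" "?g (sg v3) = s3 *\<^sub>R sg w3" using z unfolding Z_def by blast
    have "?g (sg a) \<bullet> ?g (sg b) = -3" if "norm a = 1" "norm b = 1" "a \<bullet> b = 0" for a b
      using inn[OF sg_Sym0 sg_Sym0, of a b] sg_inner[of a b] that by simp
    note g3 = this
    show ?thesis
      by (rule equal_signs[OF w(1,3,5) s]; unfold w(2,4,6)[symmetric]) (rule g3 n o)+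
  qed
  define q p u where "q = sqrt (1/2 :: real)" and "p = sqrt (1/3 :: real)" and "u = sqrt (1/6 :: real)"
  have qpu: "q * q = 1/2" "p * p = 1/3" "u * u = 1/6" by (simp_all add: q_def p_def u_def)
  define e1 e2 e3 where "e1 = (vector [1, 0, 0] :: real^3)" and "e2 = (vector [0, 1, 0] :: real^3)" and "e3 = (vector [0, 0, 1] :: real^3)"
  define a1 a2 a3 b1 b2 b3 where "a1 = (vector [0, q, q] :: real^3)" and "a2 = (vector [q, 0, q] :: real^3)" and "a3 = (vector [q, q, 0] :: real^3)"
    and "b1 = (vector [0, q, - q] :: real^3)" and "b2 = (vector [q, 0, - q] :: real^3)" and "b3 = (vector [q, - q, 0] :: real^3)"
  define c d where "c = (vector [p, p, p] :: real^3)" and "d = (vector [u, u, - 2 * u] :: real^3)"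
  note vdefs = e1_def e2_def e3_def a1_def a2_def a3_def b1_def b2_def b3_def c_def d_def
  have n: "norm e1 = 1" "norm e2 = 1" "norm e3 = 1" "norm a1 = 1" "norm a2 = 1" "norm a3 = 1"
    "norm b1 = 1" "norm b2 = 1" "norm b3 = 1" "norm c = 1" "norm d = 1"
    by (simp_all add: unit_squares vdefs qpu)
  obtain s where s: "s = 1 \<or> s = -1" "Z s e1" using Z[OF n(1)] by blast
  obtain s2 where s2: "s2 = 1 \<or> s2 = -1" "Z s2 e2" using Z[OF n(2)] by blast
  obtain s3 where s3: "s3 = 1 \<or> s3 = -1" "Z s3 e3" using Z[OF n(3)] by blast
  have "s = s2 \<and> s2 = s3" using triple[OF n(1,2,3) _ _ _ s(1) s2(1) s3(1) s(2) s2(2) s3(2)] by (simp add: vdefs inner3)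
  then have ze: "Z s e1" "Z s e2" "Z s e3" using s s2 s3 by auto
  \<comment> \<open>The sign passes from \<open>x\<close> to every direction \<open>v\<close> that together with \<open>x\<close> belongs to an orthogonal triple.\<close>
  have step: "Z s v"
    if *: "Z s x" "norm x = 1" "norm v = 1" "norm y = 1" "v \<bullet> x = 0" "v \<bullet> y = 0" "x \<bullet> y = 0" for v x y
  proof -
    obtain t where t: "t = 1 \<or> t = -1" "Z t v" using Z[OF *(3)] by blast
    obtain t' where t': "t' = 1 \<or> t' = -1" "Z t' y" using Z[OF *(4)] by blast
    have "t = s \<and> s = t'" using triple[OF *(3,2,4,5,6,7) t(1) s(1) t'(1) t(2) *(1) t'(2)] .
    then show ?thesis using t by simp
  qed
  have za: "Z s a1" "Z s a2" "Z s a3" "Z s b3"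
    using step[OF ze(1) n(1) n(4) n(7)] step[OF ze(2) n(2) n(5) n(8)] step[OF ze(3) n(3) n(6) n(9)] step[OF ze(3) n(3) n(9) n(6)]
    by (simp_all add: vdefs inner3)
  have zc: "Z s c" using step[OF za(4) n(9) n(10) n(11)] by (simp add: vdefs inner3)
  obtain w1 w2 w3 where w: "norm w1 = 1" "?g (sg e1) = s *\<^sub>R sg w1" "norm w2 = 1" "?g (sg e2) = s *\<^sub>R sg w2"
    "norm w3 = 1" "?g (sg e3) = s *\<^sub>R sg w3" using ze unfolding Z_def by blast
  have ss: "s * s = 1" using s by auto
  have ow: "w1 \<bullet> w2 = 0" "w1 \<bullet> w3 = 0" "w2 \<bullet> w3 = 0"
  proof -
    have "x \<bullet> y = 0" if "norm a = 1" "norm b = 1" "a \<bullet> b = 0" "norm x = 1" "norm y = 1" "?g (sg a) = s *\<^sub>R sg x" "?g (sg b) = s *\<^sub>R sg y" for a b x y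
    proof -
      have "(s * s) * (9 * (x \<bullet> y)\<^sup>2 - 3) = -3"
        using inn[OF sg_Sym0 sg_Sym0, of a b] sg_inner[of a b] that by (simp add: sg_inner)
      then show ?thesis by (simp add: ss)
    qed
    from this[OF n(1,2) _ w(1,3) w(2,4)] this[OF n(1,3) _ w(1,5) w(2,6)] this[OF n(2,3) _ w(3,5) w(4,6)]
    show "w1 \<bullet> w2 = 0" "w1 \<bullet> w3 = 0" "w2 \<bullet> w3 = 0" by (simp_all add: vdefs inner3)
  qed
  define k0 where "k0 = m3 (w1$1) (w2$1) (w3$1) (w1$2) (w2$2) (w3$2) (w1$3) (w2$3) (w3$3)"
  have "transpose k0 ** k0 = mat 1"
    using ow w(1,3,5) by (simp add: mat3_eq_iff mult3 mat1_entry k0_def unit_squares inner3 mult.commute)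
  then have k0: "orthogonal_matrix k0" by (simp add: orthogonal_matrix)
  then have dk0: "det k0 = 1 \<or> det k0 = -1" by (rule det_orthogonal_matrix)
  define k where "k = det k0 *\<^sub>R k0"
  have "orthogonal_matrix k" "det k = 1"
    using dk0 k0 by (auto simp: k_def orthogonal_matrix det_scaleR)
  then have k: "rotation_matrix k" by (simp add: rotation_matrix_def)
  have kw: "sg (k *v e1) = sg w1" "sg (k *v e2) = sg w2" "sg (k *v e3) = sg w3"
    using dk0 by (auto simp: mat3_eq_iff sg_entry vmult3 vdefs k_def k0_def)
  define h where "h = (\<lambda>U. transpose k ** (s *\<^sub>R ?g U) ** k)"
  have h_eq: "?g U = s *\<^sub>R (k \<star> h U)" for U
    unfolding h_def conj_inverse(2)[OF k] by (simp add: ss)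
  have h0: "h U \<in> Sym0" if "U \<in> Sym0" for U
    using conj_Sym0[OF rotation_transpose[OF k], of "s *\<^sub>R ?g U"] tangent_map_Sym0[OF f that] by (simp add: h_def)
  have hinn: "h U \<bullet> h V = U \<bullet> V" if "U \<in> Sym0" "V \<in> Sym0" for U V
    using inner_conj[OF rotation_transpose[OF k], of "s *\<^sub>R ?g U" "s *\<^sub>R ?g V"] inn[OF that] ss
    by (simp add: h_def flip: mult.assoc)
  have hs: "h (a *\<^sub>R U) = a *\<^sub>R h U" if "U \<in> Sym0" for a U
    using scale[OF that] by (simp add: h_def)
  have ha: "h (U + V) = h U + h V" if "U \<in> Sym0" "V \<in> Sym0" for U V
    using add[OF that] by (simp add: h_def scaleR_add_right matrix_add_ldistrib matrix_add_rdistrib3)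
  have hZ: "\<exists>w. norm w = 1 \<and> h (sg v) = sg w" if z: "Z s v" for v
  proof -
    obtain w where w: "norm w = 1" "?g (sg v) = s *\<^sub>R sg w" using z unfolding Z_def by blast
    have "h (sg v) = sg (transpose k *v w)"
      using sg_conj[OF rotation_transpose[OF k], of w] by (simp add: h_def w(2) ss)
    then show ?thesis using norm_rotation[OF rotation_transpose[OF k], of w] w(1) by metis
  qed
  have he: "h (sg e1) = sg e1" "h (sg e2) = sg e2" "h (sg e3) = sg e3"
  proof -
    have "h (sg x) = sg x" if "?g (sg x) = s *\<^sub>R sg y" "sg (k *v x) = sg y" for x y
    proof -
      have "k \<star> sg x = sg y" using that(2) sg_conj[OF k, of x] by simp
      then have "sg x = transpose k ** sg y ** k" using conj_inverse(1)[OF k, of "sg x"] by simp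
      then show ?thesis unfolding h_def that(1) by (simp only: scaleR_scaleR ss scaleR_one)
    qed
    then show "h (sg e1) = sg e1" "h (sg e2) = sg e2" "h (sg e3) = sg e3" using w kw by blast+
  qed
  have coord: "\<exists>w. w$1 * w$1 = v$1 * v$1 \<and> w$2 * w$2 = v$2 * v$2 \<and> w$3 * w$3 = v$3 * v$3 \<and> h (sg v) = sg w"
    if z: "Z s v" and nv: "norm v = 1" for v
  proof -
    obtain w where w: "norm w = 1" "h (sg v) = sg w" using hZ[OF z] by blast
    have i: "(w \<bullet> e)\<^sup>2 = (v \<bullet> e)\<^sup>2" if "norm e = 1" "h (sg e) = sg e" for e
      using hinn[OF sg_Sym0[OF nv] sg_Sym0[OF that(1)]] w sg_inner[OF w(1) that(1)] sg_inner[OF nv that(1)] that(2) by simp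
    have "w$1 * w$1 = v$1 * v$1" "w$2 * w$2 = v$2 * v$2" "w$3 * w$3 = v$3 * v$3"
      using i[OF n(1) he(1)] i[OF n(2) he(2)] i[OF n(3) he(3)] by (simp_all add: vdefs inner3 power2_eq_square)
    with w show ?thesis by blast
  qed
  have hd: "h (dg x) = dg x" if "x \<in> sum0" for x
  proof -
    have "dg x = (x$1 / 3) *\<^sub>R sg e1 + ((x$2 / 3) *\<^sub>R sg e2 + (x$3 / 3) *\<^sub>R sg e3)"
      using that by (simp add: mat3_eq_iff sg_entry dg_def vdefs sum0_def field_simps)
    then show ?thesis by (simp add: ha hs sg_Sym0 n he)
  qed
  have A0: "axis_sum a b c \<in> Sym0" for a b c by (simp add: Sym0_iff axis_sum_def)
  have A: "axis_sum a b c = a *\<^sub>R axis_sum 1 0 0 + (b *\<^sub>R axis_sum 0 1 0 + c *\<^sub>R axis_sum 0 0 1)" for a b c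
    by (simp add: mat3_eq_iff axis_sum_def)
  obtain x3 where x3: "x3$1 * x3$1 = 1/2" "x3$2 * x3$2 = 1/2" "x3$3 = 0" "h (sg a3) = sg x3"
    using coord[OF za(3) n(6)] by (auto simp: vdefs qpu)
  obtain x2 where x2: "x2$1 * x2$1 = 1/2" "x2$3 * x2$3 = 1/2" "x2$2 = 0" "h (sg a2) = sg x2"
    using coord[OF za(2) n(5)] by (auto simp: vdefs qpu)
  obtain x1 where x1: "x1$2 * x1$2 = 1/2" "x1$3 * x1$3 = 1/2" "x1$1 = 0" "h (sg a1) = sg x1"
    using coord[OF za(1) n(4)] by (auto simp: vdefs qpu)
  obtain x where x: "x$1 * x$1 = 1/3" "x$2 * x$2 = 1/3" "x$3 * x$3 = 1/3" "h (sg c) = sg x"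
    using coord[OF zc n(10)] by (auto simp: vdefs qpu)
  have v0: "vector [1/2, 1/2, -1] \<in> sum0" "vector [1/2, -1, 1/2] \<in> sum0" "vector [-1, 1/2, 1/2] \<in> sum0"
    by (simp_all add: sum0_def)
  have "h (sg a3) = dg (vector [1/2, 1/2, -1]) + (3/2) *\<^sub>R h (axis_sum 1 0 0)"
  proof -
    have "sg a3 = dg (vector [1/2, 1/2, -1]) + (3/2) *\<^sub>R axis_sum 1 0 0"
      by (simp add: mat3_eq_iff sg_entry dg_def axis_sum_def vdefs qpu)
    then show ?thesis using v0 by (simp add: ha hs A0 dg_Sym0 hd)
  qed
  then have h3: "h (axis_sum 1 0 0) = axis_sum (2 * (x3$1 * x3$2)) 0 0"
    unfolding x3(4) using x3(1-3) by (simp add: mat3_eq_iff sg_entry dg_def axis_sum_def mult.commute)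
  have "h (sg a2) = dg (vector [1/2, -1, 1/2]) + (3/2) *\<^sub>R h (axis_sum 0 1 0)"
  proof -
    have "sg a2 = dg (vector [1/2, -1, 1/2]) + (3/2) *\<^sub>R axis_sum 0 1 0"
      by (simp add: mat3_eq_iff sg_entry dg_def axis_sum_def vdefs qpu)
    then show ?thesis using v0 by (simp add: ha hs A0 dg_Sym0 hd)
  qed
  then have h2: "h (axis_sum 0 1 0) = axis_sum 0 (2 * (x2$1 * x2$3)) 0"
    unfolding x2(4) using x2(1-3) by (simp add: mat3_eq_iff sg_entry dg_def axis_sum_def mult.commute)
  have "h (sg a1) = dg (vector [-1, 1/2, 1/2]) + (3/2) *\<^sub>R h (axis_sum 0 0 1)"
  proof -
    have "sg a1 = dg (vector [-1, 1/2, 1/2]) + (3/2) *\<^sub>R axis_sum 0 0 1"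
      by (simp add: mat3_eq_iff sg_entry dg_def axis_sum_def vdefs qpu)
    then show ?thesis using v0 by (simp add: ha hs A0 dg_Sym0 hd)
  qed
  then have h1: "h (axis_sum 0 0 1) = axis_sum 0 0 (2 * (x1$2 * x1$3))"
    unfolding x1(4) using x1(1-3) by (simp add: mat3_eq_iff sg_entry dg_def axis_sum_def mult.commute)
  have hA: "h (axis_sum a b c) = axis_sum (a * (2 * (x3$1 * x3$2))) (b * (2 * (x2$1 * x2$3))) (c * (2 * (x1$2 * x1$3)))" for a b c
  proof -
    have "h (axis_sum a b c) = a *\<^sub>R axis_sum (2 * (x3$1 * x3$2)) 0 0 + (b *\<^sub>R axis_sum 0 (2 * (x2$1 * x2$3)) 0 + c *\<^sub>R axis_sum 0 0 (2 * (x1$2 * x1$3)))"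
      by (subst A) (simp add: ha hs A0 h1 h2 h3)
    then show ?thesis by (simp only:) (simp add: mat3_eq_iff axis_sum_def)
  qed
  have "sg c = axis_sum 1 1 1" by (simp add: mat3_eq_iff sg_entry axis_sum_def vdefs qpu)
  then have "sg x = axis_sum (2 * (x3$1 * x3$2)) (2 * (x2$1 * x2$3)) (2 * (x1$2 * x1$3))"
    using hA[of 1 1 1] x(4) by simp
  then have signs: "2 * (x3$1 * x3$2) = 3 * (x$1 * x$2)" "2 * (x2$1 * x2$3) = 3 * (x$1 * x$3)" "2 * (x1$2 * x1$3) = 3 * (x$2 * x$3)"
    by (simp_all add: mat3_eq_iff sg_entry axis_sum_def)
  define D0 where "D0 = sqrt 3 *\<^sub>R dg x"
  have D0: "transpose D0 ** D0 = mat 1"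
    using x(1-3) by (simp add: D0_def mat3_eq_iff mult3 dg_def mat1_entry)
  then have oD: "orthogonal_matrix D0" by (simp add: orthogonal_matrix)
  then have dD: "det D0 = 1 \<or> det D0 = -1" by (rule det_orthogonal_matrix)
  define D where "D = det D0 *\<^sub>R D0"
  have "orthogonal_matrix D" "det D = 1" using dD oD by (auto simp: D_def orthogonal_matrix det_scaleR)
  then have D: "rotation_matrix D" by (simp add: rotation_matrix_def)
  have hD: "h U = D \<star> U" if U: "U \<in> Sym0" for U
  proof -
    note u = Sym0_entries[OF U]
    define y where "y = (vector [U$1$1, U$2$2, U$3$3] :: real^3)"
    have y: "y \<in> sum0" using u by (simp add: y_def sum0_def)
    have "U = dg y + axis_sum (U$1$2) (U$1$3) (U$2$3)"
      using u by (simp add: mat3_eq_iff dg_def axis_sum_def y_def)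
    then have "h U = dg y + axis_sum (U$1$2 * (3 * (x$1 * x$2))) (U$1$3 * (3 * (x$1 * x$3))) (U$2$3 * (3 * (x$2 * x$3)))"
      using y by (metis A0 dg_Sym0 hA ha hd signs)
    also have "\<dots> = D0 \<star> U"
      using u x(1-3) by (simp add: D0_def mat3_eq_iff mult3 dg_def axis_sum_def y_def algebra_simps)
    also have "\<dots> = D \<star> U" using dD by (auto simp: D_def)
    finally show ?thesis .
  qed
  define l where "l = k ** D"
  have l: "rotation_matrix l" using rotation_mult[OF k D] by (simp add: l_def)
  have gU: "?g U = s *\<^sub>R (l \<star> U)" if "U \<in> Sym0" for U
    unfolding h_eq hD[OF that] l_def conj_conj ..
  have "f P = Ex (s *\<^sub>R (l \<star> Lg P))" if P: "P \<in> X" for P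
    using Ex_tangent_map[OF f Lg_Sym0[OF P]] gU[OF Lg_Sym0[OF P]] by (simp add: Ex_Lg P)
  then have fP: "f P = l \<star> Ex (s *\<^sub>R Lg P)" if P: "P \<in> X" for P
    using Ex_conj[OF l, of "s *\<^sub>R Lg P"] Lg_Sym0[OF P] P by simp
  from s(1) show ?thesis
  proof
    assume "s = 1"
    then show ?thesis using fP l by (auto simp: Ex_Lg)
  next
    assume "s = -1"
    then have "f P = l \<star> adj P" if "P \<in> X" for P
      using fP[OF that] Ex_minus[OF Lg_Sym0[OF that]] that by (simp add: Ex_Lg)
    then show ?thesis using l by blast
  qed
qed

section \<open>The isometry group\<close>

lemma proj_isom_apply: "P \<in> X \<Longrightarrow> proj_isom g P = g \<star> P"
  by (simp add: proj_isom_def)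

lemma dual_isom_apply: "g \<in> SL3 \<Longrightarrow> P \<in> X \<Longrightarrow> dual_isom g P = g \<star> adj P"
  by (simp add: dual_isom_def compose_def proj_isom_def std_polarity_def X_inv_adj X_adj)

lemma IsomX_I:
  assumes "f \<in> extensional X" "\<And>P. P \<in> X \<Longrightarrow> f P \<in> X" "\<And>P. P \<in> X \<Longrightarrow> g P \<in> X"
    "\<And>P. P \<in> X \<Longrightarrow> f (g P) = P" "\<And>P. P \<in> X \<Longrightarrow> g (f P) = P"
    "\<And>P Q. P \<in> X \<Longrightarrow> Q \<in> X \<Longrightarrow> riem_dist (f P) (f Q) = riem_dist P Q"
  shows "f \<in> IsomX"
proof -
  have "bij_betw f X X" by (rule bij_betwI[where g=g]) (use assms in auto)
  then have "f \<in> Bij X" using assms(1) by (simp add: Bij_def)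
  then show ?thesis using assms(6) by (simp add: isom_group_def)
qed

lemma proj_isom_IsomX:
  assumes g: "g \<in> SL3" shows "proj_isom g \<in> IsomX"
proof (rule IsomX_I[where g="proj_isom (matrix_inv g)"])
  show "proj_isom g \<in> extensional X" by (simp add: proj_isom_def)
qed (use g SL3_inv[OF g] in \<open>simp_all add: proj_isom_apply X_act SL3_inv_act riem_dist_act\<close>)

lemma dual_isom_IsomX:
  assumes g: "g \<in> SL3" shows "dual_isom g \<in> IsomX"
proof (rule IsomX_I[where g="\<lambda>P. adj (matrix_inv g ** P ** transpose (matrix_inv g))"])
  show "dual_isom g \<in> extensional X" by (simp add: dual_isom_def)
qed (use g SL3_inv[OF g] in \<open>simp_all add: dual_isom_apply X_act X_adj SL3_inv_act riem_dist_act riem_dist_adj adj_adj X_det\<close>)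

text \<open>As \<open>SL3\<close> is transitive on ellipsoids, one may assume that the round ball is fixed.\<close>

theorem isometry_classification:
  assumes f: "f \<in> IsomX"
  shows "\<exists>g\<in>SL3. f = proj_isom g \<or> f = dual_isom g"
proof -
  have fb: "bij_betw f X X" and fe: "f \<in> extensional X"
    and fd: "\<And>P Q. P \<in> X \<Longrightarrow> Q \<in> X \<Longrightarrow> riem_dist (f P) (f Q) = riem_dist P Q"
    using f by (auto simp: isom_group_def Bij_def)
  have fX: "f P \<in> X" if "P \<in> X" for P using fb that by (metis bij_betwE)
  obtain h where h: "h \<in> SL3" "f (mat 1) = h ** transpose h" using fX[OF one_in_X] by (auto simp: X_def)
  define i where "i = matrix_inv h"
  have i: "i \<in> SL3" using h SL3_inv by (simp add: i_def)
  define f' where "f' = (\<lambda>P. i \<star> f P)"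
  have "f' (mat 1) = mat 1"
    using SL3_inv_act(1)[OF h(1), of "mat 1"] by (simp add: f'_def i_def h(2))
  then have "fixing_isometry f'"
    using fX fd i by (simp add: fixing_isometry_def f'_def X_act riem_dist_act)
  then obtain k where k: "rotation_matrix k"
    "(\<forall>P\<in>X. f' P = k \<star> P) \<or> (\<forall>P\<in>X. f' P = k \<star> adj P)"
    using isometry_fixing_one by blast
  have ff': "f P = h \<star> f' P" for P using SL3_inv_act(2)[OF h(1)] by (simp add: f'_def i_def)
  have hk: "h ** k \<in> SL3" using h rotation_SL3[OF k(1)] SL3_mult by blast
  show ?thesis
  proof (intro bexI[OF _ hk])
    from k(2) show "f = proj_isom (h ** k) \<or> f = dual_isom (h ** k)"
    proof
      assume "\<forall>P\<in>X. f' P = k \<star> P"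
      then have "f = proj_isom (h ** k)"
        by (intro extensionalityI[OF fe, of "proj_isom (h ** k)"]) (simp_all add: proj_isom_def ff' conj_conj)
      then show ?thesis ..
    next
      assume *: "\<forall>P\<in>X. f' P = k \<star> adj P"
      have "f = dual_isom (h ** k)"
      proof (rule extensionalityI[OF fe, of "dual_isom (h ** k)"])
        show "dual_isom (h ** k) \<in> extensional X" by (simp add: dual_isom_def)
        show "f P = dual_isom (h ** k) P" if "P \<in> X" for P
          using * that hk by (simp add: dual_isom_apply ff' conj_conj)
      qed
      then show ?thesis ..
    qed
  qed
qed

section \<open>Generic points for polynomial conditions\<close>

abbreviation rpf :: "('a::euclidean_space \<Rightarrow> real) \<Rightarrow> bool" where
  "rpf \<equiv> real_polynomial_function"

text \<open>A nonzero polynomial is nonzero on a dense open set, so by Baire's theorem countably many of them have a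
  common point of non-vanishing.\<close>

lemma polynomial_nonzero_dense:
  fixes q :: "'a::euclidean_space \<Rightarrow> real"
  assumes q: "rpf q" and ne: "q x1 \<noteq> 0"
  shows "UNIV \<subseteq> closure {x. q x \<noteq> 0}"
proof
  fix x
  define l where "l = (\<lambda>t::real. x + t *\<^sub>R (x1 - x))"
  have "polynomial_function l"
    unfolding l_def by (intro polynomial_function_add polynomial_function_const polynomial_function_mult) auto
  then have "rpf (q \<circ> l)" using q by (rule real_polynomial_function_compose)
  then obtain a n where an: "q \<circ> l = (\<lambda>t. \<Sum>i\<le>n. a i * t^i)" using real_polynomial_function_imp_sum by blast
  have "(q \<circ> l) 1 \<noteq> 0" using ne by (simp add: l_def)
  then have "\<exists>k\<le>n. a k \<noteq> 0" unfolding an by (metis (mono_tags, lifting) atMost_iff mult_zero_left sum.neutral)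
  then have fin: "finite {t. (q \<circ> l) t = 0}" unfolding an using polyfun_finite_roots[of a n] by simp
  show "x \<in> closure {x. q x \<noteq> 0}"
  proof (rule closure_approachable[THEN iffD2], intro allI impI)
    fix e :: real assume e: "e > 0"
    define r where "r = e / (norm (x1 - x) + 1)"
    have r: "r > 0" using e by (simp add: r_def add_nonneg_pos)
    have "infinite {0<..<r}" using r by simp
    then obtain t where t: "0 < t" "t < r" "(q \<circ> l) t \<noteq> 0"
      using fin by (metis (mono_tags, lifting) finite_subset greaterThanLessThan_iff mem_Collect_eq subsetI)
    have "dist (l t) x = t * norm (x1 - x)" using t by (simp add: l_def dist_norm)
    also have "\<dots> \<le> r * norm (x1 - x)" using t by (intro mult_right_mono) auto
    also have "\<dots> < r * (norm (x1 - x) + 1)" using r by simp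
    also have "\<dots> = e" by (simp add: r_def add_nonneg_pos) (smt (verit) norm_ge_zero)
    finally show "\<exists>y\<in>{x. q x \<noteq> 0}. dist y x < e" using t(3) by (intro bexI[of _ "l t"]) auto
  qed
qed

lemma generic_point:
  fixes Q :: "('a::euclidean_space \<Rightarrow> real) set"
  assumes "countable Q" and Q: "\<And>q. q \<in> Q \<Longrightarrow> rpf q \<and> (\<exists>x. q x \<noteq> 0)"
  shows "\<exists>x. \<forall>q\<in>Q. q x \<noteq> 0"
proof -
  let ?G = "(\<lambda>q. {x. q x \<noteq> 0}) ` Q"
  have "UNIV \<subseteq> closure (\<Inter>?G)"
  proof (rule Baire)
    fix T assume "T \<in> ?G"
    then obtain q where q: "q \<in> Q" "T = {x. q x \<noteq> 0}" by blast
    have "continuous_on UNIV q" using Q[OF q(1)] continuous_real_polymonial_function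
      by (auto simp: continuous_on_eq_continuous_at)
    then have "open T" unfolding q(2) by (intro open_Collect_neq continuous_on_const)
    then show "openin (top_of_set UNIV) T \<and> UNIV \<subseteq> closure T"
      using Q[OF q(1)] polynomial_nonzero_dense[of q] unfolding q(2) by auto
  qed (use assms(1) in auto)
  then have "\<Inter>?G \<noteq> {}" by auto
  then show ?thesis by blast
qed

lemma generic_point_both:
  fixes p q :: "'a::euclidean_space \<Rightarrow> real"
  assumes "rpf p" "rpf q" "p x \<noteq> 0" "q y \<noteq> 0"
  shows "\<exists>z. p z \<noteq> 0 \<and> q z \<noteq> 0"
  using generic_point[of "{p, q}"] assms by auto

definition mpoly :: "('a::euclidean_space \<Rightarrow> mat3) \<Rightarrow> bool" where
  "mpoly f \<longleftrightarrow> (\<forall>i j. rpf (\<lambda>x. f x $ i $ j))"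

definition vpoly :: "('a::euclidean_space \<Rightarrow> real^3) \<Rightarrow> bool" where
  "vpoly f \<longleftrightarrow> (\<forall>i. rpf (\<lambda>x. f x $ i))"

named_theorems poly_intros

lemma rpf_const [poly_intros]: "rpf (\<lambda>x. c)"
  and rpf_add [poly_intros]: "rpf p \<Longrightarrow> rpf q \<Longrightarrow> rpf (\<lambda>x. p x + q x)"
  and rpf_mult [poly_intros]: "rpf p \<Longrightarrow> rpf q \<Longrightarrow> rpf (\<lambda>x. p x * q x)"
  and rpf_diff [poly_intros]: "rpf p \<Longrightarrow> rpf q \<Longrightarrow> rpf (\<lambda>x. p x - q x)"
  by auto

lemma mpoly_entry [poly_intros]: "mpoly f \<Longrightarrow> rpf (\<lambda>x. f x $ i $ j)"
  by (simp add: mpoly_def)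

lemma vpoly_entry [poly_intros]: "vpoly f \<Longrightarrow> rpf (\<lambda>x. f x $ i)"
  by (simp add: vpoly_def)

lemma mpoly_const [poly_intros]: "mpoly (\<lambda>x. A)" and vpoly_const [poly_intros]: "vpoly (\<lambda>x. v)"
  by (simp_all add: mpoly_def vpoly_def poly_intros)

lemma mpoly_linear: "bounded_linear f \<Longrightarrow> mpoly f"
  unfolding mpoly_def
  by (intro allI real_polynomial_function.intros(1)) (rule bounded_linear_compose[OF bounded_linear_entry])

lemma vpoly_linear: "bounded_linear f \<Longrightarrow> vpoly f"
  unfolding vpoly_def
  by (intro allI real_polynomial_function.intros(1)) (rule bounded_linear_compose[OF bounded_linear_vec_nth])

lemma mpoly_mult [poly_intros]:
  assumes "mpoly f" "mpoly g" shows "mpoly (\<lambda>x. f x ** g x)"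
  unfolding mpoly_def[of "\<lambda>x. f x ** g x"] mult3 by (intro allI poly_intros assms)

lemma mpoly_transpose [poly_intros]: "mpoly f \<Longrightarrow> mpoly (\<lambda>x. transpose (f x))"
  unfolding mpoly_def by simp

lemma mpoly_adj [poly_intros]: assumes "mpoly f" shows "mpoly (\<lambda>x. adj (f x))"
  unfolding mpoly_def[of "\<lambda>x. adj (f x)"] forall_3
  unfolding adj_def m3_entry by (intro conjI poly_intros assms)

lemma vpoly_mult [poly_intros]:
  assumes "mpoly f" "vpoly g" shows "vpoly (\<lambda>x. f x *v g x)"
  unfolding vpoly_def[of "\<lambda>x. f x *v g x"] vmult3 by (intro allI poly_intros assms)

lemma rpf_inner [poly_intros]:
  assumes "vpoly f" "vpoly g" shows "rpf (\<lambda>x. f x \<bullet> g x)"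
  unfolding inner3 by (intro poly_intros assms)

lemma rpf_det [poly_intros]: assumes "mpoly f" shows "rpf (\<lambda>x. det (f x))"
  unfolding det_3 by (intro poly_intros assms)

section \<open>The incidence polynomial of two flats\<close>

declare transpose_matrix_vector [simp del]

lemma cube_eq_1: "x ^ 3 = 1 \<Longrightarrow> x = 1" for x :: real
  using odd_real_root_power_cancel[of 3 x] by simp

text \<open>If \<open>M\<close> carries the standard flat to a flat that meets it, then \<open>M D M\<^sup>T\<close> is diagonal for some positive diagonal
  \<open>D\<close>. The three vanishing off-diagonal entries are linear equations for \<open>D\<close>; \<open>incid M\<close> is their determinant.\<close>

definition incid :: "mat3 \<Rightarrow> real" where
  "incid M = det (m3 (M$1$1 * M$2$1) (M$1$2 * M$2$2) (M$1$3 * M$2$3)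
                     (M$1$1 * M$3$1) (M$1$2 * M$3$2) (M$1$3 * M$3$3)
                     (M$2$1 * M$3$1) (M$2$2 * M$3$2) (M$2$3 * M$3$3))"

lemma rpf_incid [poly_intros]: assumes "mpoly f" shows "rpf (\<lambda>x. incid (f x))"
  unfolding incid_def
  unfolding det_3 m3_entry by (intro poly_intros assms)

lemma incid_scale: "incid (c *\<^sub>R M) = c ^ 6 * incid M"
  by (simp add: incid_def det_3 power_numeral_reduce algebra_simps)

lemma incid_eq_0:
  assumes "M \<star> ex x = ex y"
  shows "incid M = 0"
proof (rule ccontr)
  assume ne: "incid M \<noteq> 0"
  define N where "N = m3 (M$1$1 * M$2$1) (M$1$2 * M$2$2) (M$1$3 * M$2$3)
                     (M$1$1 * M$3$1) (M$1$2 * M$3$2) (M$1$3 * M$3$3)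
                     (M$2$1 * M$3$1) (M$2$2 * M$3$2) (M$2$3 * M$3$3)"
  define d where "d = (vector [exp (x$1), exp (x$2), exp (x$3)] :: real^3)"
  have "N *v d = 0"
  proof -
    have "(M \<star> ex x)$1$2 = 0" "(M \<star> ex x)$1$3 = 0" "(M \<star> ex x)$2$3 = 0"
      unfolding assms by (simp_all add: ex_def)
    then show ?thesis by (simp add: vec3_eq_iff vmult3 N_def d_def mult3 ex_def algebra_simps)
  qed
  moreover have "matrix_inv N ** N = mat 1" using ne by (intro matrix_inv_mult) (simp add: incid_def N_def)
  ultimately have "d = 0" by (metis matrix_vector_mul_assoc matrix_vector_mul_lid matrix_vector_mult_0_right)
  then have "d$1 = 0" by simp
  then show False by (simp add: d_def)
qed

definition cols :: "real^3 \<Rightarrow> real^3 \<Rightarrow> real^3 \<Rightarrow> mat3" where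
  "cols a b c = m3 (a$1) (b$1) (c$1) (a$2) (b$2) (c$2) (a$3) (b$3) (c$3)"

lemma mult_cols: "A ** cols a b c = cols (A *v a) (A *v b) (A *v c)"
  by (simp add: cols_def mat3_eq_iff mult3 vmult3)

lemma adj_mat_mult: "adj (A ** B) = adj B ** adj A"
  by (simp add: mat3_eq_iff adj_def mult3 algebra_simps)

lemma adj_transpose: "adj (transpose A) = transpose (adj A)"
  by (simp add: mat3_eq_iff adj_def algebra_simps)

lemma conj_by_adj:
  assumes "h ** g = g ** M" shows "adj g ** h ** g = det g *\<^sub>R M"
proof -
  have "adj g ** h ** g = adj g ** g ** M" using assms by (simp add: matrix_mul_assoc[symmetric])
  then show ?thesis by (simp add: adj_mult)
qed

lemma scalar_if_all_eigen:
  assumes e: "\<And>v w. det (cols v (A *v v) w) = 0"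
  shows "A = (A$1$1) *\<^sub>R mat 1"
proof -
  let ?e1 = "vector [1,0,0] :: real^3" and ?e2 = "vector [0,1,0] :: real^3" and ?e3 = "vector [0,0,1] :: real^3"
  have "A$2$1 = 0" "A$3$1 = 0" "A$1$2 = 0" "A$3$2 = 0" "A$1$3 = 0" "A$2$3 = 0"
    using e[of ?e1 ?e2] e[of ?e1 ?e3] e[of ?e2 ?e1] e[of ?e2 ?e3] e[of ?e3 ?e1] e[of ?e3 ?e2]
    by (simp_all add: cols_def det_3 vmult3)
  moreover from this have "A$1$1 = A$2$2" "A$1$1 = A$3$3"
    using e[of "vector [1,1,0]" ?e3] e[of "vector [1,0,1]" ?e2]
    by (simp_all add: cols_def det_3 vmult3)
  ultimately show ?thesis by (simp add: mat3_eq_iff mat1_entry)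
qed

lemma not_eigen:
  assumes "h \<in> SL3" "h \<noteq> mat 1"
  shows "\<exists>v w. det (cols v (h *v v) w) \<noteq> 0"
proof (rule ccontr)
  assume "\<not> ?thesis"
  then have h: "h = (h$1$1) *\<^sub>R mat 1" by (intro scalar_if_all_eigen) blast
  then have "det h = (h$1$1) ^ 3 * det (mat 1 :: mat3)" by (metis det_scaleR)
  then have "(h$1$1) ^ 3 = 1" using assms(1) by (simp add: SL3_def)
  then have "h$1$1 = 1" by (rule cube_eq_1)
  then show False using assms(2) h by simp
qed

lemma incid_companion: "incid (m3 a 0 \<alpha> 1 c \<beta> 0 1 \<gamma>) = - a * c * \<alpha> * \<gamma>"
  by (simp add: incid_def det_3)

text \<open>The identity behind the exceptional role of involutions: a rank-one perturbation of a scalar matrix has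
  vanishing incidence polynomial in every basis iff its square is scalar.\<close>

lemma incid_rank_one:
  assumes "\<And>i j. M$i$j = (if i = j then m else 0) + p$i * q$j"
  shows "incid M = - (p$1 * p$2 * p$3 * q$1 * q$2 * q$3) * m\<^sup>2 * (p$1 * q$1 + p$2 * q$2 + p$3 * q$3 + 2 * m)"
proof -
  define a b c where "a = M$1$1" and "b = M$2$2" and "c = M$3$3"
  define u v w where "u = p$1 * q$1" and "v = p$2 * q$2" and "w = p$3 * q$3"
  have abc: "a = m + u" "b = m + v" "c = m + w" by (simp_all add: a_def b_def c_def u_def v_def w_def assms)
  have o: "M$1$2 = p$1 * q$2" "M$1$3 = p$1 * q$3" "M$2$1 = p$2 * q$1" "M$2$3 = p$2 * q$3" "M$3$1 = p$3 * q$1" "M$3$2 = p$3 * q$2"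
    by (simp_all add: assms)
  have "incid M = (p$1 * p$2 * p$3 * q$1 * q$2 * q$3) * (a * c * (v - b) - b * c * (a - u) + w * (a * b - u * v))"
    unfolding incid_def det_3 m3_entry o a_def[symmetric] b_def[symmetric] c_def[symmetric] unfolding u_def v_def w_def
    by algebra
  also have "a * c * (v - b) - b * c * (a - u) + w * (a * b - u * v) = - (m\<^sup>2 * (u + v + w + 2 * m))"
    unfolding abc by (simp add: power2_eq_square algebra_simps)
  finally show ?thesis by (simp add: u_def v_def w_def)
qed

lemma mult_inv_vec: "det A \<noteq> 0 \<Longrightarrow> A *v (matrix_inv A *v x) = x" for A :: mat3
  by (simp add: matrix_vector_mul_assoc matrix_inv_mult)

lemma mult_vec_cancel: "det A \<noteq> 0 \<Longrightarrow> A *v x = A *v y \<Longrightarrow> x = y" for A :: mat3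
  by (metis matrix_inv_mult(1) matrix_vector_mul_assoc matrix_vector_mul_lid)

text \<open>In the basis of a cyclic vector \<open>h\<close> is a companion matrix \<open>M\<close>. The unipotent change of basis \<open>K\<close> turns it into a matrix
  \<open>C\<close> for which \<open>incid\<close> is the product of its entries off the zero pattern; \<open>a\<close> is taken so large that none of them vanishes.\<close>

lemma incid_conj_cyclic:
  assumes h: "h \<in> SL3" and v: "det (cols v (h *v v) (h *v (h *v v))) \<noteq> 0"
  shows "\<exists>g. incid (adj g ** h ** g) \<noteq> 0"
proof -
  define G where "G = cols v (h *v v) (h *v (h *v v))"
  define w where "w = matrix_inv G *v (h *v (h *v (h *v v)))"
  have Gw: "G *v w = h *v (h *v (h *v v))" unfolding w_def by (rule mult_inv_vec) (use v in \<open>simp add: G_def\<close>)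
  define M where "M = m3 0 0 (w$1) 1 0 (w$2) 0 1 (w$3)"
  have hG: "h ** G = G ** M"
  proof -
    have "M = cols (vector [0,1,0]) (vector [0,0,1]) w" by (simp add: M_def cols_def)
    then have "G ** M = cols (G *v vector [0,1,0]) (G *v vector [0,0,1]) (h *v (h *v (h *v v)))"
      by (simp add: mult_cols Gw)
    moreover have "G *v vector [0,1,0] = h *v v" "G *v vector [0,0,1] = h *v (h *v v)"
      by (simp_all add: vec3_eq_iff vmult3 G_def cols_def)
    ultimately show ?thesis by (simp only: G_def mult_cols)
  qed
  have "det h * det G = det G * det M" using arg_cong[OF hG, of det] by (simp add: det_mul)
  then have w1: "w$1 = 1" using v h by (simp add: SL3_def M_def det_3 G_def)
  define a where "a = \<bar>w$3\<bar> + \<bar>w$2\<bar> + 2"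
  define \<gamma> where "\<gamma> = w$3 - a - 1"
  define \<beta> where "\<beta> = a + w$2 + (a + 1) * \<gamma>"
  define \<alpha> where "\<alpha> = 1 + a * \<beta> - a * \<gamma>"
  have a: "a > 0" "a \<ge> 2" by (simp_all add: a_def)
  have g: "\<gamma> < 0" unfolding \<gamma>_def a_def using abs_ge_self[of "w$3"] abs_ge_zero[of "w$2"] by linarith
  have "\<alpha> < 0"
  proof -
    have "\<alpha> = 1 + a * (w$2) - a * (a * (a - w$3))"
      by (simp add: \<alpha>_def \<beta>_def \<gamma>_def algebra_simps)
    moreover have "a * (a - w$3) \<ge> a * (\<bar>w$2\<bar> + 2)" using a unfolding a_def by (intro mult_left_mono) auto
    moreover have "a * (\<bar>w$2\<bar> + 2) \<ge> 2 * (\<bar>w$2\<bar> + 2)" using a by (intro mult_right_mono) auto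
    ultimately have "\<alpha> \<le> 1 + a * (w$2) - a * (2 * (\<bar>w$2\<bar> + 2))"
      using a by (smt (verit) mult_left_mono)
    also have "\<dots> \<le> 1 - a * 4"
    proof -
      have "a * (w$2) \<le> a * \<bar>w$2\<bar>" "0 \<le> a * \<bar>w$2\<bar>" using a by (simp_all add: mult_left_mono)
      then show ?thesis by (simp add: algebra_simps)
    qed
    finally show ?thesis using a by linarith
  qed
  \<comment> \<open>The conjugate of \<open>M\<close> by this unipotent matrix has the shape required by \<open>incid_companion\<close>.\<close>
  define K where "K = m3 1 (- a) a 0 1 (- (a + 1)) 0 0 1"
  define C where "C = m3 a 0 \<alpha> 1 1 \<beta> 0 1 \<gamma>"
  have "M ** K = K ** C"
    by (simp add: mat3_eq_iff mult3 M_def K_def C_def w1 \<alpha>_def \<beta>_def \<gamma>_def algebra_simps)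
  then have "h ** (G ** K) = (G ** K) ** C"
    by (metis hG matrix_mul_assoc)
  then have "adj (G ** K) ** h ** (G ** K) = det (G ** K) *\<^sub>R C" by (rule conj_by_adj)
  moreover have "det K = 1" by (simp add: K_def det_3)
  moreover have "incid C \<noteq> 0" using a g \<open>\<alpha> < 0\<close> by (simp add: C_def incid_companion)
  ultimately show ?thesis using v by (intro exI[of _ "G ** K"]) (simp add: incid_scale det_mul G_def)
qed

text \<open>A generic basis makes all coordinates of the vector and the covector of the rank-one part nonzero.\<close>

lemma incid_rank_one_generic:
  assumes M: "\<And>i j. M$i$j = (if i = j then m else 0) + p$i * q$j" and m: "m \<noteq> 0"
    and p: "p$2 = 1" and q: "q$1 = 1" and ne: "p \<bullet> q + 2 * m \<noteq> 0"
  shows "\<exists>K. det K \<noteq> 0 \<and> incid (adj K ** M ** K) \<noteq> 0"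
proof -
  define Q where "Q = {\<lambda>K::mat3. det K} \<union> range (\<lambda>i K. (adj K *v p)$i) \<union> range (\<lambda>i K. (transpose K *v q)$i)"
  have id: "mpoly (\<lambda>K. K)" by (rule mpoly_linear) (rule bounded_linear_ident)
  have ex: "\<exists>K. \<forall>f\<in>Q. f K \<noteq> 0"
  proof (rule generic_point)
    show "countable Q" by (simp add: Q_def countable_finite)
    fix f assume "f \<in> Q"
    then consider "f = det" | i where "f = (\<lambda>K. (adj K *v p)$i)" | i where "f = (\<lambda>K. (transpose K *v q)$i)"
      unfolding Q_def by blast
    then show "rpf f \<and> (\<exists>x. f x \<noteq> 0)"
    proof cases
      case 1
      then show ?thesis using rpf_det[OF id] by (auto intro!: exI[of _ "mat 1"])
    next
      case 2
      let ?s1 = "m3 0 1 0 1 0 0 0 0 1" and ?s3 = "m3 1 0 0 0 0 1 0 1 0"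
      have "(adj ?s1 *v p)$1 = -1" "(adj (mat 1) *v p)$2 = 1" "(adj ?s3 *v p)$3 = -1"
        by (simp_all add: vmult3 adj_def p mat1_entry)
      then have "\<exists>K. (adj K *v p)$i \<noteq> 0" using exhaust_3[of i] by (metis one_neq_zero zero_neq_neg_one)
      then show ?thesis unfolding 2 by (auto intro!: poly_intros id)
    next
      case 3
      have "(transpose (m3 1 0 0 0 0 0 0 0 0) *v q)$1 = 1" "(transpose (m3 0 1 0 0 0 0 0 0 0) *v q)$2 = 1"
        "(transpose (m3 0 0 1 0 0 0 0 0 0) *v q)$3 = 1"
        by (simp_all add: vmult3 q)
      then have "\<exists>K. (transpose K *v q)$i \<noteq> 0" using exhaust_3[of i] by (metis one_neq_zero)
      then show ?thesis unfolding 3 by (auto intro!: poly_intros id)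
    qed
  qed
  obtain K where K: "det K \<noteq> 0" "\<And>i. (adj K *v p)$i \<noteq> 0" "\<And>i. (transpose K *v q)$i \<noteq> 0"
  proof -
    obtain K where K: "\<And>f. f \<in> Q \<Longrightarrow> f K \<noteq> 0" using ex by blast
    have "(\<lambda>K. det K) \<in> Q" "(\<lambda>K. (adj K *v p)$i) \<in> Q" "(\<lambda>K. (transpose K *v q)$i) \<in> Q" for i
      by (auto simp: Q_def)
    from K[OF this(1)] K[OF this(2)] K[OF this(3)] show ?thesis by (rule that)
  qed
  define P where "P = adj K *v p"
  define R where "R = transpose K *v q"
  have e: "(adj K ** M ** K)$i$j = (if i = j then m * det K else 0) + P$i * R$j" for i j
  proof -
    have "(adj K ** M ** K)$i$j = m * (adj K ** K)$i$j + P$i * R$j"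
      by (simp add: mult3 M P_def R_def vmult3 algebra_simps)
    then show ?thesis by (simp add: adj_mult mat1_entry)
  qed
  have "P$1 * R$1 + P$2 * R$2 + P$3 * R$3 = det K * (p \<bullet> q)"
    by (simp add: P_def R_def vmult3 adj_def det_3 inner3 algebra_simps)
  then have "incid (adj K ** M ** K) = - (P$1 * P$2 * P$3 * R$1 * R$2 * R$3) * (m * det K)\<^sup>2 * (det K * (p \<bullet> q + 2 * m))"
    unfolding incid_rank_one[OF e] by (simp add: algebra_simps)
  then have "incid (adj K ** M ** K) \<noteq> 0" using K m ne by (simp add: P_def R_def)
  with K(1) show ?thesis by blast
qed

text \<open>Without a cyclic vector the minimal polynomial has degree two, so \<open>h\<close> is a scalar plus a matrix of rank one.\<close>

lemma incid_conj_noncyclic: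
  assumes h: "h \<in> SL3" "h \<noteq> mat 1" "h ** h \<noteq> mat 1" and nc: "\<And>v. det (cols v (h *v v) (h *v (h *v v))) = 0"
  shows "\<exists>g. incid (adj g ** h ** g) \<noteq> 0"
proof -
  obtain v w where vw: "det (cols v (h *v v) w) \<noteq> 0" using not_eigen[OF h(1,2)] by blast
  define G where "G = cols v (h *v v) w"
  have dG: "det G \<noteq> 0" using vw by (simp add: G_def)
  define s where "s = matrix_inv G *v (h *v (h *v v))"
  define r where "r = matrix_inv G *v (h *v w)"
  have Gs: "G *v s = h *v (h *v v)" "G *v r = h *v w"
    unfolding s_def r_def by (rule mult_inv_vec[OF dG])+
  have "det (cols v (h *v v) (G *v s)) = s$3 * det G"
    by (simp add: cols_def det_3 vmult3 G_def algebra_simps)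
  then have s3: "s$3 = 0" using nc[of v] dG by (simp add: Gs)
  define d \<tau> x y \<mu> where "d = - s$1" and "\<tau> = s$2" and "x = r$1" and "y = r$2" and "\<mu> = r$3"
  define M where "M = m3 0 (- d) x 1 \<tau> y 0 0 \<mu>"
  have hG: "h ** G = G ** M"
  proof -
    have "M = cols (vector [0,1,0]) s r" by (simp add: M_def cols_def s3 d_def \<tau>_def x_def y_def \<mu>_def)
    then have "G ** M = cols (G *v vector [0,1,0]) (h *v (h *v v)) (h *v w)"
      by (simp add: mult_cols Gs)
    also have "G *v vector [0,1,0] = h *v v" by (simp add: vec3_eq_iff vmult3 G_def cols_def)
    finally show ?thesis by (simp only: G_def mult_cols)
  qed
  have "det h * det G = det G * det M" using arg_cong[OF hG, of det] by (simp add: det_mul)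
  then have det: "d * \<mu> = 1" using dG h by (simp add: SL3_def M_def det_3)
  have ncM: "det (cols u (M *v u) (M *v (M *v u))) = 0" for u
  proof -
    have 1: "h *v (G *v z) = G *v (M *v z)" for z by (simp add: matrix_vector_mul_assoc hG)
    have "cols (G *v u) (h *v (G *v u)) (h *v (h *v (G *v u))) = G ** cols u (M *v u) (M *v (M *v u))"
      by (simp add: 1 mult_cols)
    then have "det G * det (cols u (M *v u) (M *v (M *v u))) = 0" using nc[of "G *v u"] by (simp add: det_mul)
    then show ?thesis using dG by simp
  qed
  define E where "E = (\<lambda>\<alpha> \<beta>. (x - \<mu> * \<alpha> - d * \<beta>)\<^sup>2 + \<tau> * (x - \<mu> * \<alpha> - d * \<beta>) * (y + \<alpha> + (\<tau> - \<mu>) * \<beta>) + d * (y + \<alpha> + (\<tau> - \<mu>) * \<beta>)\<^sup>2)"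
  have E: "E \<alpha> \<beta> = 0" for \<alpha> \<beta>
  proof -
    have "det (cols (vector [\<alpha>, \<beta>, 1]) (M *v vector [\<alpha>, \<beta>, 1]) (M *v (M *v vector [\<alpha>, \<beta>, 1]))) = E \<alpha> \<beta>"
      by (simp add: cols_def det_3 vmult3 M_def E_def power2_eq_square algebra_simps)
    then show ?thesis using ncM by simp
  qed
  have "E 1 0 + E (-1) 0 - 2 * E 0 0 = 2 * (\<mu>\<^sup>2 - \<tau> * \<mu> + d)" by (simp add: E_def power2_eq_square algebra_simps)
  then have d: "d = \<tau> * \<mu> - \<mu> * \<mu>" by (simp add: E power2_eq_square)
  have fac: "(x + \<mu> * y) * (x + (\<tau> - \<mu>) * y + \<alpha> * (\<tau> - 2 * \<mu>)) = 0" for \<alpha>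
  proof -
    have "E \<alpha> 0 = (x + \<mu> * y) * (x + (\<tau> - \<mu>) * y + \<alpha> * (\<tau> - 2 * \<mu>))"
      unfolding E_def d by (simp add: power2_eq_square algebra_simps)
    then show ?thesis by (simp add: E)
  qed
  have xy: "x = - \<mu> * y"
  proof (rule ccontr)
    assume "x \<noteq> - \<mu> * y"
    then have "x + \<mu> * y \<noteq> 0" by simp
    then have "x + (\<tau> - \<mu>) * y = 0" "x + (\<tau> - \<mu>) * y + (\<tau> - 2 * \<mu>) = 0" using fac[of 0] fac[of 1] by simp_all
    then have "\<tau> = 2 * \<mu>" "x + (\<tau> - \<mu>) * y = 0" by simp_all
    then have "x + \<mu> * y = 0" by simp
    with \<open>x + \<mu> * y \<noteq> 0\<close> show False by simp
  qed
  define p where "p = (vector [- \<mu>, 1, 0] :: real^3)"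
  define q where "q = (vector [1, \<tau> - \<mu>, y] :: real^3)"
  have Mpq: "M$i$j = (if i = j then \<mu> else 0) + p$i * q$j" for i j
    using exhaust_3[of i] exhaust_3[of j] by (auto simp: M_def p_def q_def d xy algebra_simps)
  have "\<tau> \<noteq> 0"
  proof
    assume t: "\<tau> = 0"
    then have "\<mu> * \<mu> * \<mu> = -1" using det unfolding d by (simp add: algebra_simps)
    then have "(- \<mu>) ^ 3 = 1" by (simp add: power3_eq_cube)
    then have "- \<mu> = 1" by (rule cube_eq_1)
    then have m: "\<mu> = -1" by simp
    have "M ** M = mat 1" using t m xy by (simp add: mat3_eq_iff mult3 M_def d mat1_entry)
    have "h ** h ** G = G ** (M ** M)" by (metis hG matrix_mul_assoc)
    then have "(h ** h) ** G = mat 1 ** G" using \<open>M ** M = mat 1\<close> by simp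
    then have "h ** h = mat 1" using matrix_cancel_right[OF dG] by blast
    then show False using h(3) by blast
  qed
  moreover have "p \<bullet> q + 2 * \<mu> = \<tau>" by (simp add: p_def q_def inner3)
  ultimately have "\<exists>K. det K \<noteq> 0 \<and> incid (adj K ** M ** K) \<noteq> 0"
    using det by (intro incid_rank_one_generic[OF Mpq]) (auto simp: p_def q_def)
  then obtain K where K: "det K \<noteq> 0" "incid (adj K ** M ** K) \<noteq> 0" by blast
  have "adj (G ** K) ** h ** (G ** K) = adj K ** (adj G ** h ** G) ** K"
    by (simp add: adj_mat_mult matrix_mul_assoc)
  also have "\<dots> = det G *\<^sub>R (adj K ** M ** K)" by (simp add: conj_by_adj[OF hG])
  finally show ?thesis using K dG by (intro exI[of _ "G ** K"]) (simp add: incid_scale)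
qed

lemma incid_conj_nonzero:
  assumes "h \<in> SL3" "h \<noteq> mat 1" "h ** h \<noteq> mat 1"
  shows "\<exists>g. incid (adj g ** h ** g) \<noteq> 0"
  using incid_conj_cyclic[OF assms(1)] incid_conj_noncyclic[OF assms] by blast

text \<open>The vector product.\<close>

definition cr :: "real^3 \<Rightarrow> real^3 \<Rightarrow> real^3" where
  "cr a b = vector [a$2 * b$3 - a$3 * b$2, a$3 * b$1 - a$1 * b$3, a$1 * b$2 - a$2 * b$1]"

lemma vpoly_cr [poly_intros]: assumes "vpoly f" "vpoly g" shows "vpoly (\<lambda>x. cr (f x) (g x))"
  unfolding vpoly_def forall_3 cr_def vector_3 by (intro conjI poly_intros assms)

lemma cr_onto: "x \<noteq> 0 \<Longrightarrow> \<exists>a b c. c \<noteq> 0 \<and> cr a b = c *\<^sub>R x"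
proof -
  assume "x \<noteq> 0"
  then consider "x$1 \<noteq> 0" | "x$2 \<noteq> 0" | "x$3 \<noteq> 0" by (auto simp: vec3_eq_iff)
  then show ?thesis
  proof cases
    case 1
    have "cr (vector [- x$2, x$1, 0]) (vector [- x$3, 0, x$1]) = x$1 *\<^sub>R x" by (simp add: cr_def vec3_eq_iff)
    with 1 show ?thesis by blast
  next
    case 2
    have "cr (vector [0, - x$3, x$2]) (vector [x$2, - x$1, 0]) = x$2 *\<^sub>R x" by (simp add: cr_def vec3_eq_iff)
    with 2 show ?thesis by blast
  next
    case 3
    have "cr (vector [x$3, 0, - x$1]) (vector [0, x$3, - x$2]) = x$3 *\<^sub>R x" by (simp add: cr_def vec3_eq_iff)
    with 3 show ?thesis by blast
  qed
qed

definition rows :: "real^3 \<Rightarrow> real^3 \<Rightarrow> real^3 \<Rightarrow> mat3" where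
  "rows a b c = m3 (a$1) (a$2) (a$3) (b$1) (b$2) (b$3) (c$1) (c$2) (c$3)"

lemma rows_form: "rows a b c ** h ** transpose (rows a b c) =
   m3 (a \<bullet> (h *v a)) (a \<bullet> (h *v b)) (a \<bullet> (h *v c)) (b \<bullet> (h *v a)) (b \<bullet> (h *v b)) (b \<bullet> (h *v c))
      (c \<bullet> (h *v a)) (c \<bullet> (h *v b)) (c \<bullet> (h *v c))"
  by (simp add: rows_def mat3_eq_iff mult3 vmult3 inner3 algebra_simps)

lemma form_nonzero:
  fixes h :: mat3
  assumes "det h \<noteq> 0" shows "\<exists>x. x \<bullet> (h *v x) \<noteq> 0"
proof (rule ccontr)
  assume "\<not> ?thesis"
  then have z: "x \<bullet> (h *v x) = 0" for x by blast
  have 1: "h$1$1 = 0" "h$2$2 = 0" "h$3$3 = 0"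
    using z[of "vector [1,0,0]"] z[of "vector [0,1,0]"] z[of "vector [0,0,1]"] by (simp_all add: inner3 vmult3)
  have "h$2$1 = - h$1$2" "h$3$1 = - h$1$3" "h$3$2 = - h$2$3"
    using z[of "vector [1,1,0]"] z[of "vector [1,0,1]"] z[of "vector [0,1,1]"] 1 by (simp_all add: inner3 vmult3)
  then have "det h = 0" using 1 by (simp add: det_3)
  then show False using assms by simp
qed

lemma onto_of_det: "det h \<noteq> 0 \<Longrightarrow> \<exists>x. h *v x = y" for h :: mat3
  using mult_inv_vec by blast

text \<open>A duality \<open>h\<close> is a bilinear form, and changing the flat changes its basis. The basis vector \<open>a\<close> is orthogonal to \<open>h b\<close>
  and to \<open>h\<^sup>T c\<close>; then two entries of the form vanish and \<open>incid\<close> becomes the product of six other entries, which are nonzero for generic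
  \<open>b\<close> and \<open>c\<close> as \<open>h\<^sup>T x\<close> and \<open>h x\<close> are not always parallel.\<close>

lemma incid_form_nonsymmetric:
  fixes h :: mat3
  assumes h: "det h \<noteq> 0" and ns: "\<not> (\<forall>x. cr (transpose h *v x) (h *v x) = 0)"
  shows "\<exists>L. incid (L \<star> h) \<noteq> 0"
proof -
  have ht: "det (transpose h) \<noteq> 0" using h by simp
  define e1 where "e1 = (\<lambda>z :: (real^3) \<times> (real^3). cr (transpose h *v snd z) (h *v fst z))"
  define Q where "Q = {\<lambda>z. e1 z \<bullet> (h *v e1 z), \<lambda>z. fst z \<bullet> (h *v e1 z), \<lambda>z. fst z \<bullet> (h *v fst z),
    \<lambda>z. snd z \<bullet> (h *v fst z), \<lambda>z. e1 z \<bullet> (h *v snd z), \<lambda>z. snd z \<bullet> (h *v snd z)}"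
  have fs: "vpoly (\<lambda>z. fst z)" "vpoly (\<lambda>z. snd z)"
    by (rule vpoly_linear, rule bounded_linear_fst bounded_linear_snd)+
  have pe: "vpoly e1" unfolding e1_def by (intro poly_intros fs)
  obtain x where x: "x \<bullet> (h *v x) \<noteq> 0" using form_nonzero[OF h] by blast
  then have "x \<noteq> 0" by auto
  obtain u where u: "cr (transpose h *v u) (h *v u) \<noteq> 0" using ns by blast
  have "\<exists>z. \<forall>f\<in>Q. f z \<noteq> 0"
  proof (rule generic_point)
    show "countable Q" by (simp add: Q_def)
    have "\<exists>z. e1 z \<bullet> (h *v e1 z) \<noteq> 0"
    proof -
      obtain a b c where c: "c \<noteq> 0" "cr a b = c *\<^sub>R x" using cr_onto[OF \<open>x \<noteq> 0\<close>] by blast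
      obtain a' b' where "transpose h *v a' = a" "h *v b' = b" using onto_of_det[OF ht] onto_of_det[OF h] by blast
      then have "e1 (b', a') = c *\<^sub>R x" using c by (simp add: e1_def)
      then show ?thesis using c x by (intro exI[of _ "(b', a')"]) (simp add: matrix_vector_mult_scaleR)
    qed
    moreover have "\<exists>z. fst z \<bullet> (h *v e1 z) \<noteq> 0"
    proof -
      define w where "w = cr (transpose h *v u) (h *v u)"
      obtain y where y: "transpose h *v y = w" using onto_of_det[OF ht] by blast
      have "u \<bullet> (h *v e1 (u, y)) = - (w \<bullet> w)"
        unfolding dot_form by (simp add: e1_def y) (simp add: w_def cr_def inner3 algebra_simps)
      then show ?thesis using u by (intro exI[of _ "(u, y)"]) (simp add: w_def)
    qed
    moreover have "\<exists>z. e1 z \<bullet> (h *v snd z) \<noteq> 0"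
    proof -
      define w where "w = cr (transpose h *v u) (h *v u)"
      obtain y where y: "h *v y = w" using onto_of_det[OF h] by blast
      have "e1 (y, u) \<bullet> (h *v u) = - (w \<bullet> w)"
        by (simp add: e1_def y) (simp add: w_def cr_def inner3 algebra_simps)
      then show ?thesis using u by (intro exI[of _ "(y, u)"]) (simp add: w_def)
    qed
    moreover have "\<exists>z. snd z \<bullet> (h *v fst z) \<noteq> 0" "\<exists>z. fst z \<bullet> (h *v fst z) \<noteq> 0" "\<exists>z. snd z \<bullet> (h *v snd z) \<noteq> 0"
      using x by (auto intro!: exI[of _ "(x, x)"])
    moreover fix f assume "f \<in> Q"
    moreover have "rpf f"
      using \<open>f \<in> Q\<close> unfolding Q_def by (auto intro!: poly_intros pe fs)
    ultimately show "rpf f \<and> (\<exists>x. f x \<noteq> 0)" unfolding Q_def by blast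
  qed
  then obtain z where z: "\<forall>f\<in>Q. f z \<noteq> 0" by blast
  define a b c where "a = e1 z" and "b = fst z" and "c = snd z"
  have z0: "a \<bullet> (h *v b) = 0" "c \<bullet> (h *v a) = 0"
    unfolding a_def b_def c_def dot_form[of "snd z"] by (simp_all add: e1_def cr_def inner3 algebra_simps)
  have "incid (rows a b c ** h ** transpose (rows a b c)) =
     - ((a \<bullet> (h *v a)) * (b \<bullet> (h *v a)) * (a \<bullet> (h *v c)) * (c \<bullet> (h *v c)) * (b \<bullet> (h *v b)) * (c \<bullet> (h *v b)))"
    unfolding rows_form by (simp add: incid_def z0 det_3)
  then show ?thesis using z by (intro exI[of _ "rows a b c"]) (simp add: Q_def a_def b_def c_def)
qed

text \<open>The basis vectors \<open>b\<close> and \<open>c\<close> are chosen orthogonal with respect to the form, which turns \<open>incid\<close> into a product.\<close>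

lemma incid_form_symmetric:
  fixes h :: mat3
  assumes h: "det h \<noteq> 0" and sy: "transpose h = h"
  shows "\<exists>L. incid (L \<star> h) \<noteq> 0"
proof -
  define e3 where "e3 = (\<lambda>z :: (real^3) \<times> (real^3) \<times> (real^3). cr (h *v fst (snd z)) (snd (snd z)))"
  define Q where "Q = {\<lambda>z. fst z \<bullet> (h *v fst (snd z)), \<lambda>z. fst z \<bullet> (h *v e3 z), \<lambda>z. fst (snd z) \<bullet> (h *v fst (snd z)),
    \<lambda>z. e3 z \<bullet> (h *v e3 z)}"
  have fs: "vpoly (\<lambda>z. fst z)" "vpoly (\<lambda>z. fst (snd z))" "vpoly (\<lambda>z. snd (snd z))"
    by (rule vpoly_linear, intro bounded_linear_fst bounded_linear_snd bounded_linear_compose[OF bounded_linear_fst bounded_linear_snd]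
      bounded_linear_compose[OF bounded_linear_snd bounded_linear_snd])+
  have pe: "vpoly e3" unfolding e3_def by (intro poly_intros fs)
  obtain x where x: "x \<bullet> (h *v x) \<noteq> 0" using form_nonzero[OF h] by blast
  then have "x \<noteq> 0" by auto
  obtain a b c where c: "c \<noteq> 0" "cr a b = c *\<^sub>R x" using cr_onto[OF \<open>x \<noteq> 0\<close>] by blast
  obtain a' where a': "h *v a' = a" using onto_of_det[OF h] by blast
  have e3x: "e3 (y, a', b) = c *\<^sub>R x" for y using c a' by (simp add: e3_def)
  have "\<exists>z. \<forall>f\<in>Q. f z \<noteq> 0"
  proof (rule generic_point)
    show "countable Q" by (simp add: Q_def)
    have "\<exists>z. e3 z \<bullet> (h *v e3 z) \<noteq> 0"
      using c x e3x[of 0] by (intro exI[of _ "(0, a', b)"]) (simp add: matrix_vector_mult_scaleR)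
    moreover have "\<exists>z. fst z \<bullet> (h *v e3 z) \<noteq> 0"
      using c x e3x[of x] by (intro exI[of _ "(x, a', b)"]) (simp add: matrix_vector_mult_scaleR)
    moreover have "\<exists>z :: (real^3) \<times> (real^3) \<times> (real^3). fst z \<bullet> (h *v fst (snd z)) \<noteq> 0"
      "\<exists>z :: (real^3) \<times> (real^3) \<times> (real^3). fst (snd z) \<bullet> (h *v fst (snd z)) \<noteq> 0"
      using x by (auto intro!: exI[of _ "(x, x, x)"])
    moreover fix f assume "f \<in> Q"
    moreover have "rpf f"
      using \<open>f \<in> Q\<close> unfolding Q_def by (auto intro!: poly_intros pe fs)
    ultimately show "rpf f \<and> (\<exists>x. f x \<noteq> 0)" unfolding Q_def by blast
  qed
  then obtain z where z: "\<forall>f\<in>Q. f z \<noteq> 0" by blast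
  define a b c where "a = fst z" and "b = fst (snd z)" and "c = e3 z"
  have s: "u \<bullet> (h *v v) = v \<bullet> (h *v u)" for u v by (simp add: dot_form[of u] sy inner_commute)
  have "c \<bullet> (h *v b) = 0" unfolding b_def c_def e3_def by (simp add: cr_def inner3 algebra_simps)
  then have z0: "b \<bullet> (h *v c) = 0" "c \<bullet> (h *v b) = 0" using s by metis+
  have "incid (rows a b c ** h ** transpose (rows a b c)) =
     (b \<bullet> (h *v a)) * (c \<bullet> (h *v a)) * (a \<bullet> (h *v b)) * (b \<bullet> (h *v b)) * (a \<bullet> (h *v c)) * (c \<bullet> (h *v c))"
    unfolding rows_form by (simp add: incid_def z0 det_3)
  then show ?thesis using z s[of a b] s[of a c] by (intro exI[of _ "rows a b c"]) (simp add: Q_def a_def b_def c_def)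
qed

lemma incid_form_nonzero:
  assumes h: "h \<in> SL3" shows "\<exists>g. incid (adj g ** h ** transpose (adj g)) \<noteq> 0"
proof -
  have dh: "det h \<noteq> 0" using h by (simp add: SL3_def)
  have "\<exists>L. incid (L \<star> h) \<noteq> 0"
  proof (cases "\<forall>x. cr (transpose h *v x) (h *v x) = 0")
    case True
    define M where "M = matrix_inv h ** transpose h"
    have hM: "h ** M = transpose h" using dh by (simp add: M_def matrix_mul_assoc matrix_inv_mult)
    have "det (cols v (M *v v) w) = 0" for v w
    proof -
      have "h ** cols v (M *v v) w = cols (h *v v) (transpose h *v v) (h *v w)"
        by (simp add: mult_cols matrix_vector_mul_assoc hM)
      moreover have "det (cols (h *v v) (transpose h *v v) (h *v w)) = - (cr (transpose h *v v) (h *v v) \<bullet> (h *v w))"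
        by (simp add: cols_def det_3 cr_def inner3 algebra_simps)
      ultimately have "det h * det (cols v (M *v v) w) = 0" using True by (simp flip: det_mul)
      then show ?thesis using dh by simp
    qed
    then have "M = (M$1$1) *\<^sub>R mat 1" by (rule scalar_if_all_eigen)
    then have th: "transpose h = (M$1$1) *\<^sub>R h" using hM by (metis matrix_mul_rid scaleR_mult(2))
    then have "det h = (M$1$1) ^ 3 * det h" by (metis det_scaleR det_transpose)
    then have "(M$1$1) ^ 3 = 1" using dh by simp
    then have "M$1$1 = 1" by (rule cube_eq_1)
    then have "transpose h = h" using th by simp
    then show ?thesis by (rule incid_form_symmetric[OF dh])
  next
    case False
    then show ?thesis by (rule incid_form_nonsymmetric[OF dh])
  qed
  then obtain L where L: "incid (L \<star> h) \<noteq> 0" by blast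
  have id: "mpoly (\<lambda>K. K)" by (rule mpoly_linear) (rule bounded_linear_ident)
  have "\<exists>K. det K \<noteq> 0 \<and> incid (K \<star> h) \<noteq> 0"
    by (rule generic_point_both[where x="mat 1" and y=L]) (intro poly_intros id | simp add: L)+
  then obtain K where K: "det K \<noteq> 0" "incid (K \<star> h) \<noteq> 0" by blast
  then show ?thesis by (intro exI[of _ "adj K"]) (simp add: adj_adj incid_scale)
qed

lemma incid_test: "incid (m3 0 1 1 1 0 1 1 1 0) \<noteq> 0"
  by (simp add: incid_def det_3)

lemma incid_pair_nonzero:
  assumes h: "h \<in> SL3"
  shows "\<exists>g1 g2. incid (adj g1 ** h ** g2) \<noteq> 0" "\<exists>g1 g2. incid (adj g1 ** h ** transpose (adj g2)) \<noteq> 0"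
proof -
  define R where "R = m3 0 1 1 1 0 1 1 1 0"
  have dh: "det h \<noteq> 0" using h by (simp add: SL3_def)
  have a1: "adj (mat 1) = mat 1" by (simp add: mat3_eq_iff adj_def mat1_entry)
  have hR: "h ** (matrix_inv h ** R) = R" using dh by (simp add: matrix_mul_assoc matrix_inv_mult)
  show "\<exists>g1 g2. incid (adj g1 ** h ** g2) \<noteq> 0"
    using incid_test hR by (intro exI[of _ "mat 1"] exI[of _ "matrix_inv h ** R"]) (simp add: a1 R_def)
  define S where "S = matrix_inv h ** R"
  have "det R = 2" by (simp add: R_def det_3)
  then have "det S \<noteq> 0" using dh by (simp add: S_def det_mul det_matrix_inv)
  then show "\<exists>g1 g2. incid (adj g1 ** h ** transpose (adj g2)) \<noteq> 0"
    using incid_test hR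
    by (intro exI[of _ "mat 1"] exI[of _ "adj (transpose S)"]) (simp add: a1 adj_adj incid_scale flip: S_def R_def)
qed

section \<open>A polynomial obstruction to common symmetries of two flats\<close>

text \<open>Let \<open>A = g1\<^sup>-\<^sup>1 g2\<close> and \<open>B = g1\<^sup>-\<^sup>1 h g2\<close>. The cross ratio of four entries of a matrix in two rows and two columns does not
  change when rows and columns are scaled. \<open>quart\<close> compares the cross ratio of \<open>B\<close> in rows and columns 1 and 2 with that of \<open>A\<close> in rows
  \<open>a\<close>, 2 and columns \<open>b\<close>, 2, with denominators cleared. It vanishes if monomial matrices that fix the index 2 carry \<open>A\<close> to \<open>B\<close>.\<close>

definition quart :: "mat3 \<Rightarrow> 3 \<Rightarrow> 3 \<Rightarrow> mat3 \<Rightarrow> mat3 \<Rightarrow> real" where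
  "quart h a b g1 g2 = (let A = adj g1 ** g2; B = adj g1 ** h ** g2 in
     B$1$1 * B$2$2 * (A$a$2 * A$2$b) - B$1$2 * B$2$1 * (A$a$b * A$2$2))"

lemma quart_factor:
  assumes "h ** g = g ** H" "det g \<noteq> 0"
  shows "quart h a b g (g ** K) = det g ^ 4 * ((H ** K)$1$1 * (H ** K)$2$2 * (K$a$2 * K$2$b) - (H ** K)$1$2 * (H ** K)$2$1 * (K$a$b * K$2$2))"
proof -
  have "adj g ** (g ** K) = det g *\<^sub>R K" by (simp add: matrix_mul_assoc adj_mult)
  moreover have "adj g ** h ** (g ** K) = det g *\<^sub>R (H ** K)"
    using conj_by_adj[OF assms(1)] by (simp add: matrix_mul_assoc)
  ultimately show ?thesis by (simp add: quart_def power_numeral_reduce algebra_simps)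
qed

text \<open>With \<open>g2 = g1 K\<close> the polynomial is, up to a factor, one in \<open>K\<close> and the conjugate \<open>H\<close> of \<open>h\<close> by \<open>g1\<close>. A sparse \<open>K\<close> makes
  one of its two terms vanish and the other one not; for \<open>h \<noteq> 1\<close> and \<open>b = 1\<close> this uses a basis in which \<open>H\<close> has a nonzero entry in row
  1 and column 2.\<close>

lemma quart_nonzero:
  assumes h: "h \<in> SL3" and ab: "a = 1 \<or> a = 3" "b = 1 \<or> b = 3" and ne: "\<not> (h = mat 1 \<and> a = 1 \<and> b = 1)"
  shows "\<exists>g1 g2. quart h a b g1 g2 \<noteq> 0"
proof -
  have choose: "\<exists>k :: real^3. H$2$1 * k$1 + H$2$2 * k$2 + H$2$3 * k$3 \<noteq> 0 \<and> k$a \<noteq> 0" if H: "det H \<noteq> 0" for H :: mat3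
  proof -
    have r: "H$2$1 \<noteq> 0 \<or> H$2$2 \<noteq> 0 \<or> H$2$3 \<noteq> 0" using H by (auto simp: det_3)
    show ?thesis
    proof (cases "H$2$a = 0")
      case False
      then show ?thesis using ab(1) by (intro exI[of _ "axis a 1"]) (auto simp: axis_def)
    next
      case True
      then show ?thesis using ab(1) r
        by (intro exI[of _ "H$2 + axis a 1"]) (auto simp: axis_def sum_squares_eq_zero_iff)
    qed
  qed
  show ?thesis
  proof (cases "b = 3")
    case True
    have dh: "det h \<noteq> 0" using h by (simp add: SL3_def)
    obtain k2 where k2: "h$2$1 * k2$1 + h$2$2 * k2$2 + h$2$3 * k2$3 \<noteq> 0" "k2$a \<noteq> 0" using choose[OF dh] by blast
    define K where "K = cols (h$1) k2 (vector [0, 1, 0])"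
    have r1: "h$1$1 * h$1$1 + (h$1$2 * h$1$2 + h$1$3 * h$1$3) \<noteq> 0"
      using dh by (auto simp: det_3 add_nonneg_eq_0_iff)
    have "quart h a b (mat 1) (mat 1 ** K) \<noteq> 0"
      using k2 r1 ab(1) unfolding True
      by (subst quart_factor[where H=h]) (auto simp: K_def cols_def mult3 add.assoc)
    then show ?thesis by blast
  next
    case False
    then have b: "b = 1" using ab by blast
    show ?thesis
    proof (cases "h = mat 1")
      case True
      then have a: "a = 3" using ne ab b by blast
      have "quart h a b (mat 1) (mat 1 ** m3 1 0 0 1 1 0 0 1 0) \<noteq> 0"
        by (subst quart_factor[where H="mat 1"]) (simp_all add: True a b mult3 mat1_entry)
      then show ?thesis by blast
    next
      case False
      obtain v w where vw: "det (cols v (h *v v) w) \<noteq> 0" using not_eigen[OF h False] by blast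
      define g where "g = cols (h *v v) v w"
      have dg: "det g \<noteq> 0" using vw by (simp add: g_def cols_def det_3 algebra_simps)
      define H where "H = matrix_inv g ** h ** g"
      have gH: "h ** g = g ** H" using dg by (simp add: H_def matrix_mul_assoc matrix_inv_mult)
      have dH: "det H \<noteq> 0" using h dg by (simp add: H_def det_mul det_matrix_inv SL3_def)
      have "g ** H = cols (h *v (h *v v)) (h *v v) (h *v w)" unfolding gH[symmetric] unfolding g_def mult_cols ..
      then have "g *v (H *v vector [0,1,0]) = h *v v"
        by (simp add: matrix_vector_mul_assoc) (simp add: cols_def vec3_eq_iff vmult3)
      also have "h *v v = g *v vector [1,0,0]" by (simp add: g_def cols_def vec3_eq_iff vmult3)
      finally have "H *v vector [0,1,0] = vector [1,0,0]"
        by (rule mult_vec_cancel[OF dg])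
      then have H12: "H$1$2 = 1" by (simp add: vec3_eq_iff vmult3)
      obtain k2 where k2: "H$2$1 * k2$1 + H$2$2 * k2$2 + H$2$3 * k2$3 \<noteq> 0" "k2$a \<noteq> 0" using choose[OF dH] by blast
      define K where "K = cols (vector [0,1,0]) k2 0"
      have "quart h a b g (g ** K) \<noteq> 0"
        using k2 ab(1) dg H12 unfolding b
        by (subst quart_factor[OF gH dg]) (auto simp: K_def cols_def mult3 add.assoc)
      then show ?thesis by blast
    qed
  qed
qed

lemma rpf_quart: "mpoly f \<Longrightarrow> mpoly g \<Longrightarrow> rpf (\<lambda>x. quart h a b (f x) (g x))"
  unfolding quart_def Let_def by (intro poly_intros)

lemma quart_scale: "quart h a b (c *\<^sub>R g1) (d *\<^sub>R g2) = (c ^ 8 * d ^ 4) * quart h a b g1 g2"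
proof -
  have "adj (c *\<^sub>R g1) = c\<^sup>2 *\<^sub>R adj g1" by (simp add: mat3_eq_iff adj_def power2_eq_square algebra_simps)
  then show ?thesis by (simp add: quart_def Let_def power_numeral_reduce algebra_simps)
qed

text \<open>The conditions say in turn that distinct translates of one flat are disjoint, that translates of one are disjoint from those of the other,
  that an element of \<open>PH\<close> does not relate the two flats in the way excluded by \<open>quart\<close>, and that all entries of the relative position are
  nonzero.\<close>

definition generic_pair :: "mat3 set \<Rightarrow> mat3 set \<Rightarrow> mat3 \<Rightarrow> mat3 \<Rightarrow> bool" where
  "generic_pair PH DH g1 g2 \<longleftrightarrow>
     (\<forall>g\<in>{g1, g2}. (\<forall>h\<in>PH. h \<noteq> mat 1 \<longrightarrow> incid (adj g ** h ** g) \<noteq> 0) \<and> (\<forall>h\<in>DH. incid (adj g ** h ** transpose (adj g)) \<noteq> 0)) \<and>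
     (\<forall>h\<in>PH. incid (adj g1 ** h ** g2) \<noteq> 0) \<and> (\<forall>h\<in>DH. incid (adj g1 ** h ** transpose (adj g2)) \<noteq> 0) \<and>
     (\<forall>h\<in>PH. \<forall>a\<in>{1,3}. \<forall>b\<in>{1,3}. \<not> (h = mat 1 \<and> a = 1 \<and> b = 1) \<longrightarrow> quart h a b g1 g2 \<noteq> 0) \<and>
     (\<forall>i j. (adj g1 ** g2)$i$j \<noteq> 0)"

text \<open>Each condition is the non-vanishing of a polynomial in the entries of \<open>g1\<close> and \<open>g2\<close> that is not identically zero, and there are
  countably many of them. A generic point need not have determinant 1, but the conditions are homogeneous, so it can be rescaled.\<close>

lemma generic_pair_exists:
  assumes c: "countable PH" "countable DH" and SL: "PH \<subseteq> SL3" "DH \<subseteq> SL3"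
    and inv: "\<And>h. h \<in> PH \<Longrightarrow> h ** h = mat 1 \<Longrightarrow> h = mat 1"
  shows "\<exists>g1\<in>SL3. \<exists>g2\<in>SL3. generic_pair PH DH g1 g2"
proof -
  define F :: "(mat3 \<times> mat3 \<Rightarrow> real) set" where "F =
    {\<lambda>z. det (fst z), \<lambda>z. det (snd z)} \<union>
    (\<lambda>h z. incid (adj (fst z) ** h ** fst z)) ` (PH - {mat 1}) \<union> (\<lambda>h z. incid (adj (snd z) ** h ** snd z)) ` (PH - {mat 1}) \<union>
    (\<lambda>h z. incid (adj (fst z) ** h ** transpose (adj (fst z)))) ` DH \<union> (\<lambda>h z. incid (adj (snd z) ** h ** transpose (adj (snd z)))) ` DH \<union>
    (\<lambda>h z. incid (adj (fst z) ** h ** snd z)) ` PH \<union> (\<lambda>h z. incid (adj (fst z) ** h ** transpose (adj (snd z)))) ` DH \<union>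
    {\<lambda>z. quart h a b (fst z) (snd z) |h a b. h \<in> PH \<and> a \<in> {1,3} \<and> b \<in> {1,3} \<and> \<not> (h = mat 1 \<and> a = 1 \<and> b = 1)} \<union>
    {\<lambda>z. (adj (fst z) ** snd z) $ i $ j |i j. True}"
  have fs: "mpoly (\<lambda>z. fst z)" "mpoly (\<lambda>z. snd z)"
    by (rule mpoly_linear, rule bounded_linear_fst bounded_linear_snd)+
  have "\<exists>z. \<forall>f\<in>F. f z \<noteq> 0"
  proof (rule generic_point)
    have "countable ((\<lambda>(h, a, b) (z :: mat3 \<times> mat3). quart h a b (fst z) (snd z)) ` (PH \<times> UNIV \<times> UNIV))"
      using c by (intro countable_image countable_SIGMA) auto
    moreover have "{\<lambda>z. quart h a b (fst z) (snd z) |h a b. h \<in> PH \<and> a \<in> {1,3} \<and> b \<in> {1,3} \<and> \<not> (h = mat 1 \<and> a = 1 \<and> b = 1)}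
      \<subseteq> (\<lambda>(h, a, b) (z :: mat3 \<times> mat3). quart h a b (fst z) (snd z)) ` (PH \<times> UNIV \<times> UNIV)" (is "?A \<subseteq> ?B")
    proof
      fix q assume "q \<in> ?A"
      then obtain h a b where "q = (\<lambda>z. quart h a b (fst z) (snd z))" "h \<in> PH" by blast
      then show "q \<in> ?B" by (intro image_eqI[of _ _ "(h, a, b)"]) auto
    qed
    ultimately have c1: "countable ?A" by (rule countable_subset[rotated])
    have "countable ((\<lambda>(i, j) (z :: mat3 \<times> mat3). (adj (fst z) ** snd z) $ i $ j) ` UNIV)"
      by (intro countable_image) auto
    moreover have "{\<lambda>z. (adj (fst z) ** snd z) $ i $ j |i j. True}
      \<subseteq> (\<lambda>(i, j) (z :: mat3 \<times> mat3). (adj (fst z) ** snd z) $ i $ j) ` UNIV" (is "?C \<subseteq> ?D")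
    proof
      fix q assume "q \<in> ?C"
      then obtain i j where "q = (\<lambda>z. (adj (fst z) ** snd z) $ i $ j)" by blast
      then show "q \<in> ?D" by (intro image_eqI[of _ _ "(i, j)"]) auto
    qed
    ultimately have c2: "countable ?C" by (rule countable_subset[rotated])
    show "countable F" unfolding F_def using c c1 c2 by (intro countable_Un countable_image countable_Diff) auto
    fix f assume "f \<in> F"
    then consider "f = (\<lambda>z. det (fst z))" | "f = (\<lambda>z. det (snd z))"
      | h where "h \<in> PH" "h \<noteq> mat 1" "f = (\<lambda>z. incid (adj (fst z) ** h ** fst z))"
      | h where "h \<in> PH" "h \<noteq> mat 1" "f = (\<lambda>z. incid (adj (snd z) ** h ** snd z))"
      | h where "h \<in> DH" "f = (\<lambda>z. incid (adj (fst z) ** h ** transpose (adj (fst z))))"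
      | h where "h \<in> DH" "f = (\<lambda>z. incid (adj (snd z) ** h ** transpose (adj (snd z))))"
      | h where "h \<in> PH" "f = (\<lambda>z. incid (adj (fst z) ** h ** snd z))"
      | h where "h \<in> DH" "f = (\<lambda>z. incid (adj (fst z) ** h ** transpose (adj (snd z))))"
      | h a b where "h \<in> PH" "a \<in> {1,3}" "b \<in> {1,3}" "\<not> (h = mat 1 \<and> a = 1 \<and> b = 1)" "f = (\<lambda>z. quart h a b (fst z) (snd z))"
      | i j where "f = (\<lambda>z. (adj (fst z) ** snd z) $ i $ j)"
      unfolding F_def by (elim UnE) blast+
    moreover have "\<exists>a :: mat3. det a \<noteq> 0" by (rule exI[of _ "mat 1"]) simp
    ultimately show "rpf f \<and> (\<exists>x. f x \<noteq> 0)"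
    proof cases
      case 1 then show ?thesis using \<open>\<exists>a :: mat3. det a \<noteq> 0\<close> by (auto intro!: poly_intros fs)
    next
      case 2 then show ?thesis using \<open>\<exists>a :: mat3. det a \<noteq> 0\<close> by (auto intro!: poly_intros fs)
    next
      case (3 h)
      then have "\<exists>g. incid (adj g ** h ** g) \<noteq> 0" using incid_conj_nonzero[of h] inv[of h] SL by blast
      then show ?thesis using 3 by (auto intro!: poly_intros fs)
    next
      case (4 h)
      then have "\<exists>g. incid (adj g ** h ** g) \<noteq> 0" using incid_conj_nonzero[of h] inv[of h] SL by blast
      then show ?thesis using 4 by (auto intro!: poly_intros fs)
    next
      case (5 h)
      then have "\<exists>g. incid (adj g ** h ** transpose (adj g)) \<noteq> 0" using incid_form_nonzero[of h] SL by blast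
      then show ?thesis using 5 by (auto intro!: poly_intros fs)
    next
      case (6 h)
      then have "\<exists>g. incid (adj g ** h ** transpose (adj g)) \<noteq> 0" using incid_form_nonzero[of h] SL by blast
      then show ?thesis using 6 by (auto intro!: poly_intros fs)
    next
      case (7 h)
      then have "\<exists>g1 g2. incid (adj g1 ** h ** g2) \<noteq> 0" using incid_pair_nonzero(1)[of h] SL by blast
      then show ?thesis using 7 by (auto intro!: poly_intros fs)
    next
      case (8 h)
      then have "\<exists>g1 g2. incid (adj g1 ** h ** transpose (adj g2)) \<noteq> 0" using incid_pair_nonzero(2)[of h] SL by blast
      then show ?thesis using 8 by (auto intro!: poly_intros fs)
    next
      case (9 h a b)
      then have "\<exists>g1 g2. quart h a b g1 g2 \<noteq> 0" using quart_nonzero[of h a b] SL by auto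
      then show ?thesis using 9 by (auto intro!: rpf_quart fs)
    next
      case (10 i j)
      have "(adj (mat 1) ** (\<chi> i j. 1)) $ i $ j = (1 :: real)"
        using exhaust_3[of i] by (auto simp: mult3 adj_def mat1_entry)
      then have "\<exists>g1 g2. (adj g1 ** g2) $ i $ j \<noteq> 0" by (metis one_neq_zero)
      moreover have "rpf f" unfolding 10 by (rule mpoly_entry) (intro poly_intros fs)
      ultimately show ?thesis using 10 by auto
    qed
  qed
  then obtain k1 k2 where k: "\<And>f. f \<in> F \<Longrightarrow> f (k1, k2) \<noteq> 0" by auto
  have d: "det k1 \<noteq> 0" "det k2 \<noteq> 0" using k[of "\<lambda>z. det (fst z)"] k[of "\<lambda>z. det (snd z)"] by (auto simp: F_def)
  define c1 c2 where "c1 = 1 / root 3 (det k1)" and "c2 = 1 / root 3 (det k2)"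
  have c0: "c1 \<noteq> 0" "c2 \<noteq> 0" using d by (simp_all add: c1_def c2_def)
  have c3: "c1 ^ 3 * det k1 = 1" "c2 ^ 3 * det k2 = 1"
    using d by (simp_all add: c1_def c2_def power_one_over odd_real_root_pow)
  have adjs: "adj (c *\<^sub>R g) = c\<^sup>2 *\<^sub>R adj g" for c g by (simp add: mat3_eq_iff adj_def power2_eq_square algebra_simps)
  have "generic_pair PH DH k1 k2"
    unfolding generic_pair_def
  proof (intro conjI ballI allI impI)
    fix i j show "(adj k1 ** k2)$i$j \<noteq> 0"
      using k[of "\<lambda>z. (adj (fst z) ** snd z) $ i $ j"] unfolding F_def by (simp; blast)
  next
    fix h a b assume "h \<in> PH" "a \<in> {1,3::3}" "b \<in> {1,3::3}" "\<not> (h = mat 1 \<and> a = 1 \<and> b = 1)"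
    then have "(\<lambda>z. quart h a b (fst z) (snd z)) \<in> F" unfolding F_def by blast
    from k[OF this] show "quart h a b k1 k2 \<noteq> 0" by simp
  next
    fix g h assume g: "g \<in> {k1, k2}" and "h \<in> PH" "h \<noteq> mat 1"
    then have "(\<lambda>z. incid (adj (fst z) ** h ** fst z)) \<in> F" "(\<lambda>z. incid (adj (snd z) ** h ** snd z)) \<in> F" unfolding F_def by blast+
    from k[OF this(1)] k[OF this(2)] g show "incid (adj g ** h ** g) \<noteq> 0" by auto
  next
    fix g h assume g: "g \<in> {k1, k2}" and "h \<in> DH"
    then have "(\<lambda>z. incid (adj (fst z) ** h ** transpose (adj (fst z)))) \<in> F" "(\<lambda>z. incid (adj (snd z) ** h ** transpose (adj (snd z)))) \<in> F"
      unfolding F_def by blast+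
    from k[OF this(1)] k[OF this(2)] g show "incid (adj g ** h ** transpose (adj g)) \<noteq> 0" by auto
  next
    fix h assume "h \<in> PH"
    then have "(\<lambda>z. incid (adj (fst z) ** h ** snd z)) \<in> F" unfolding F_def by blast
    from k[OF this] show "incid (adj k1 ** h ** k2) \<noteq> 0" by simp
  next
    fix h assume "h \<in> DH"
    then have "(\<lambda>z. incid (adj (fst z) ** h ** transpose (adj (snd z)))) \<in> F" unfolding F_def by blast
    from k[OF this] show "incid (adj k1 ** h ** transpose (adj k2)) \<noteq> 0" by simp
  qed
  then have "generic_pair PH DH (c1 *\<^sub>R k1) (c2 *\<^sub>R k2)"
    using c0 by (auto simp: generic_pair_def adjs incid_scale quart_scale)
  moreover have "c1 *\<^sub>R k1 \<in> SL3" "c2 *\<^sub>R k2 \<in> SL3" using c3 by (simp_all add: SL3_def det_scaleR)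
  ultimately show ?thesis by blast
qed

section \<open>Composition of isometries\<close>

abbreviation icomp :: "(mat3 \<Rightarrow> mat3) \<Rightarrow> (mat3 \<Rightarrow> mat3) \<Rightarrow> mat3 \<Rightarrow> mat3" (infixl "\<cdot>" 70)
  where "f \<cdot> g \<equiv> f \<otimes>\<^bsub>isom_group\<^esub> g"

abbreviation iinv :: "(mat3 \<Rightarrow> mat3) \<Rightarrow> mat3 \<Rightarrow> mat3" where "iinv \<equiv> m_inv isom_group"

abbreviation ione :: "mat3 \<Rightarrow> mat3" where "ione \<equiv> \<one>\<^bsub>isom_group\<^esub>"

lemma IsomX_Bij: "f \<in> IsomX \<Longrightarrow> f \<in> Bij X"
  by (simp add: isom_group_def)

lemma IsomX_X: "f \<in> IsomX \<Longrightarrow> P \<in> X \<Longrightarrow> f P \<in> X"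
  by (rule funcset_mem[OF Bij_imp_funcset[OF IsomX_Bij]])

lemma isom_mult: "f \<in> IsomX \<Longrightarrow> g \<in> IsomX \<Longrightarrow> f \<cdot> g = compose X f g"
proof -
  assume "f \<in> IsomX" "g \<in> IsomX"
  then have "f \<in> Bij X" "g \<in> Bij X" by (simp_all add: IsomX_Bij)
  then show ?thesis by (simp add: isom_group_def BijGroup_def)
qed

lemma isom_mult_apply: "f \<in> IsomX \<Longrightarrow> g \<in> IsomX \<Longrightarrow> P \<in> X \<Longrightarrow> (f \<cdot> g) P = f (g P)"
  by (simp add: isom_mult compose_def)

lemma isom_one: "ione = proj_isom (mat 1)"
  by (auto simp: isom_group_def BijGroup_def proj_isom_def)

lemma isom_ext:
  assumes "f \<in> IsomX" "g \<in> IsomX" "\<And>P. P \<in> X \<Longrightarrow> f P = g P" shows "f = g"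
  using assms extensionalityI[of f X g] Bij_imp_extensional[OF IsomX_Bij] by blast

lemma isom_mult_image:
  assumes "f \<in> IsomX" "g \<in> IsomX" "S \<subseteq> X" shows "(f \<cdot> g) ` S = f ` g ` S"
  using isom_mult_apply[OF assms(1,2)] assms(3) by (auto simp: image_image subset_iff intro!: image_cong)

interpretation iso: group isom_group by (rule group_isom_group)

lemma proj_closed [simp]: "g \<in> SL3 \<Longrightarrow> proj_isom g \<in> IsomX" and dual_closed [simp]: "g \<in> SL3 \<Longrightarrow> dual_isom g \<in> IsomX"
  by (simp_all add: proj_isom_IsomX dual_isom_IsomX)

lemma SL3_adj: "g \<in> SL3 \<Longrightarrow> adj g = matrix_inv g"
  by (simp add: SL3_def matrix_inv_adj)

lemma adj_SL3 [simp]: "g \<in> SL3 \<Longrightarrow> adj g \<in> SL3"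
  by (simp add: SL3_adj SL3_inv)

lemma SL3_cancel: "g \<in> SL3 \<Longrightarrow> adj g ** g = mat 1" "g \<in> SL3 \<Longrightarrow> g ** adj g = mat 1"
  "g \<in> SL3 \<Longrightarrow> adj g ** (g ** M) = M" "g \<in> SL3 \<Longrightarrow> g ** (adj g ** M) = M"
  by (simp_all add: adj_mult SL3_def matrix_mul_assoc)

text \<open>\<open>ct g\<close> is the action of \<open>g\<close> on dual vectors.\<close>

definition ct :: "mat3 \<Rightarrow> mat3" where "ct g = transpose (adj g)"

lemma ct_SL3 [simp]: "g \<in> SL3 \<Longrightarrow> ct g \<in> SL3"
  by (simp add: ct_def SL3_transpose)

lemma ct_one [simp]: "ct (mat 1) = mat 1"
  by (simp add: ct_def adj_def mat3_eq_iff mat1_entry)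

lemma ct_mult: "ct (g ** h) = ct g ** ct h"
  by (simp add: ct_def adj_mat_mult matrix_transpose_mul)

lemma adj_conj: "adj (g \<star> P) = ct g ** adj P ** transpose (ct g)"
  by (simp add: adj_mat_mult ct_def adj_transpose matrix_mul_assoc)

lemma ct_ct: "g \<in> SL3 \<Longrightarrow> ct (ct g) = g"
  by (simp add: ct_def adj_transpose adj_adj SL3_def)

lemma proj_proj: "a \<in> SL3 \<Longrightarrow> b \<in> SL3 \<Longrightarrow> proj_isom a \<cdot> proj_isom b = proj_isom (a ** b)"
  by (rule isom_ext) (simp_all add: SL3_mult isom_mult_apply proj_isom_apply X_act conj_conj iso.m_closed)

lemma proj_dual: "a \<in> SL3 \<Longrightarrow> b \<in> SL3 \<Longrightarrow> proj_isom a \<cdot> dual_isom b = dual_isom (a ** b)"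
  by (rule isom_ext) (simp_all add: SL3_mult isom_mult_apply proj_isom_apply dual_isom_apply X_act X_adj conj_conj iso.m_closed)

lemma dual_proj: "a \<in> SL3 \<Longrightarrow> b \<in> SL3 \<Longrightarrow> dual_isom a \<cdot> proj_isom b = dual_isom (a ** ct b)"
  by (rule isom_ext) (simp_all add: SL3_mult isom_mult_apply proj_isom_apply dual_isom_apply X_act X_adj adj_conj conj_conj iso.m_closed)

lemma dual_dual: "a \<in> SL3 \<Longrightarrow> b \<in> SL3 \<Longrightarrow> dual_isom a \<cdot> dual_isom b = proj_isom (a ** ct b)"
  by (rule isom_ext) (simp_all add: SL3_mult isom_mult_apply proj_isom_apply dual_isom_apply X_act X_adj adj_conj adj_adj X_det conj_conj iso.m_closed)

lemma fixes_all_ellipsoids: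
  assumes n: "n \<in> SL3" and fix_all: "\<And>P. P \<in> X \<Longrightarrow> n ** P ** transpose n = P"
  shows "n = mat 1"
proof -
  have nn: "n ** transpose n = mat 1" using fix_all[OF one_in_X] by simp
  then have tn: "transpose n ** n = mat 1" using matrix_left_right_inverse by blast
  have "n \<star> ex (vector [1, 0, -1]) = ex (vector [1, 0, -1])"
    by (intro fix_all ex_in_X) (simp add: sum0_def)
  then have "n \<star> ex (vector [1, 0, -1]) ** n = ex (vector [1, 0, -1]) ** n" by simp
  then have "n ** ex (vector [1, 0, -1]) ** (transpose n ** n) = ex (vector [1, 0, -1]) ** n"
    by (simp only: matrix_mul_assoc)
  then have "n ** dg (vector [1, 0, -1]) = dg (vector [1, 0, -1]) ** n"
    unfolding tn by (simp add: dg_ex_intertwine)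
  then have d: "n = dg (vector [n$1$1, n$2$2, n$3$3])" by (rule commute_with_regular[rotated 3]) simp_all
  have o: "n$1$2 = 0" "n$1$3 = 0" "n$2$1 = 0" "n$2$3 = 0" "n$3$1 = 0" "n$3$2 = 0"
    by (subst d, simp add: dg_def)+
  define g1 where "g1 = m3 1 1 0 0 1 0 0 0 1"
  define g2 where "g2 = m3 1 0 0 0 1 1 0 0 1"
  have "g1 ** transpose g1 \<in> X" "g2 ** transpose g2 \<in> X"
    by (simp_all add: SL3_act_one SL3_def g1_def g2_def det_3)
  from fix_all[OF this(1)] fix_all[OF this(2)] nn
  have "n$1$1 * n$2$2 = 1" "n$2$2 * n$3$3 = 1" "n$1$1 * n$1$1 = 1" "n$2$2 * n$2$2 = 1"
    using o by (simp_all add: mat3_eq_iff mult3 g1_def g2_def mat1_entry)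
  then have e: "n$2$2 = n$1$1" "n$3$3 = n$1$1" by algebra+
  have "n$1$1 * n$1$1 * n$1$1 = 1" using n o e by (simp add: SL3_def det_3)
  then have "n$1$1 = 1" using cube_eq_1[of "n$1$1"] by (simp add: power3_eq_cube)
  then show ?thesis using o e by (simp add: mat3_eq_iff mat1_entry)
qed

lemma proj_inj:
  assumes "a \<in> SL3" "b \<in> SL3" "proj_isom a = proj_isom b" shows "a = b"
proof -
  have "adj b ** a = mat 1"
  proof (rule fixes_all_ellipsoids)
    show "adj b ** a \<in> SL3" using assms by (simp add: SL3_mult)
    fix P assume P: "P \<in> X"
    then have "a \<star> P = b \<star> P" using assms(3) by (metis proj_isom_apply)
    then show "adj b ** a ** P ** transpose (adj b ** a) = P"
      using assms(2) SL3_inv_act(1)[of b P] by (simp add: SL3_adj flip: conj_conj)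
  qed
  then have "b ** (adj b ** a) = b" by simp
  then show ?thesis unfolding SL3_cancel(4)[OF assms(2)] .
qed

lemma dual_inj:
  assumes "a \<in> SL3" "b \<in> SL3" "dual_isom a = dual_isom b" shows "a = b"
proof (rule proj_inj[OF assms(1,2)])
  have "proj_isom a = dual_isom a \<cdot> dual_isom (mat 1)" "proj_isom b = dual_isom b \<cdot> dual_isom (mat 1)"
    using assms(1,2) by (simp_all add: dual_dual SL3_one)
  then show "proj_isom a = proj_isom b" unfolding assms(3) by metis
qed

text \<open>A projective transformation equal to a duality would, up to a rotation, take every ellipsoid to its dual. But an elongated
  ellipsoid and its dual have different traces.\<close>

lemma proj_not_dual:
  assumes "a \<in> SL3" "b \<in> SL3" shows "proj_isom a \<noteq> dual_isom b"
proof
  assume e: "proj_isom a = dual_isom b"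
  define n where "n = adj a ** b"
  have n: "P = n \<star> adj P" if P: "P \<in> X" for P
  proof -
    have "a \<star> P = b \<star> adj P" using e assms P by (metis proj_isom_apply dual_isom_apply)
    then have "adj a ** (a \<star> P) ** transpose (adj a) = adj a ** (b \<star> adj P) ** transpose (adj a)" by simp
    then show ?thesis using assms(1) SL3_inv_act(1)[of a P] by (simp add: SL3_adj n_def conj_conj)
  qed
  have a1: "adj (mat 1) = mat 1" by (simp add: mat3_eq_iff adj_def mat1_entry)
  have "n ** transpose n = mat 1" using n[OF one_in_X] a1 by simp
  then have tn: "transpose n ** n = mat 1" using matrix_left_right_inverse by blast
  define x where "x = (vector [2 * ln 2, - ln 2, - ln 2] :: real^3)"
  have x: "x \<in> sum0" by (simp add: x_def sum0_def)
  have "trace (ex x) = trace (n \<star> adj (ex x))" using n[OF ex_in_X[OF x]] by simp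
  also have "\<dots> = trace (transpose n ** (n ** adj (ex x)))" by (rule trace_mul_sym)
  also have "\<dots> = trace (ex (- x))" using X_inv_adj[OF ex_in_X[OF x]] tn by (simp add: matrix_mul_assoc matrix_inv_ex)
  finally have "exp (2 * ln 2) + exp (- ln 2) + exp (- ln 2) = exp (- (2 * ln 2)) + exp (ln 2) + exp (ln (2::real))"
    by (simp add: trace3 ex_def x_def)
  moreover have "exp (2 * ln 2) = (4 :: real)" using exp_double[of "ln (2::real)"] by simp
  ultimately show False by (simp add: exp_minus)
qed

lemma IsomX_cases:
  assumes "f \<in> IsomX" obtains (proj) g where "g \<in> SL3" "f = proj_isom g" | (dual) g where "g \<in> SL3" "f = dual_isom g"
  using isometry_classification[OF assms] by blast

text \<open>Move the fixed ellipsoid to the round ball. The involution becomes symmetric, and the ellipsoids with its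
  eigenvectors as axes are fixed as well.\<close>

lemma involution_fixes_two:
  assumes g: "g \<in> SL3" "g ** g = mat 1" and P: "P \<in> X" "g \<star> P = P"
  shows "\<exists>Q\<in>X. Q \<noteq> P \<and> g ** Q ** transpose g = Q"
proof -
  obtain h where h: "h \<in> SL3" "P = h ** transpose h" using P by (auto simp: X_def)
  define k where "k = adj h ** g ** h"
  have hk: "h ** k = g ** h" using h by (simp add: k_def SL3_cancel flip: matrix_mul_assoc)
  have "h \<star> (k ** transpose k) = (h ** k) ** transpose (h ** k)"
    by (simp add: matrix_transpose_mul matrix_mul_assoc)
  also have "\<dots> = g \<star> P" unfolding hk by (simp add: h(2) matrix_transpose_mul matrix_mul_assoc)
  also have "\<dots> = h \<star> mat 1" using P(2) h(2) by simp
  finally have kk: "k ** transpose k = mat 1" using SL3_inv_act(1)[OF h(1)] by metis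
  have "k ** k = adj h ** (g ** g) ** h" using h by (simp add: k_def SL3_cancel flip: matrix_mul_assoc)
  then have k2: "k ** k = mat 1" using h g by (simp add: SL3_cancel)
  have "transpose k = k \<star> k" by (simp add: k2)
  also have "\<dots> = k" using kk by (simp flip: matrix_mul_assoc)
  finally have ks: "transpose k = k" .
  then obtain l y where l: "rotation_matrix l" "k = l \<star> dg y" using symmetric_diagonalization by blast
  note lo = rotation_SL3[OF l(1)]
  have "l \<star> (dg y ** dg y) = l ** dg y ** (transpose l ** l) ** dg y ** transpose l" using lo by (simp add: matrix_mul_assoc)
  also have "\<dots> = k ** k" by (simp add: l(2) matrix_mul_assoc)
  also have "\<dots> = l \<star> mat 1" using k2 lo by simp
  finally have yy: "dg y ** dg y = mat 1" by (metis conj_inverse(1)[OF l(1)])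
  define x where "x = (vector [1, -1, 0] :: real^3)"
  have x: "x \<in> sum0" by (simp add: x_def sum0_def)
  define R where "R = l \<star> ex x"
  have R: "R \<in> X" unfolding R_def using X_act[OF ex_in_X[OF x]] lo by blast
  have "k \<star> R = l ** dg y ** (transpose l ** l) ** ex x ** (transpose l ** l) ** dg y ** transpose l"
    unfolding ks by (simp add: l(2) R_def matrix_mul_assoc)
  also have "\<dots> = l \<star> (dg y ** ex x ** dg y)" using lo by (simp add: matrix_mul_assoc)
  also have "dg y ** ex x ** dg y = ex x" using yy by (simp add: mat3_eq_iff mult3 dg_def ex_def mat1_entry algebra_simps)
  finally have kR: "k \<star> R = R" by (simp add: R_def)
  define Q where "Q = h \<star> R"
  have "g \<star> Q = (g ** h) \<star> R" by (simp add: Q_def conj_conj)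
  also have "\<dots> = h \<star> (k ** R ** transpose k)" unfolding hk[symmetric] conj_conj ..
  finally have gQ: "g \<star> Q = Q" by (simp add: kR Q_def)
  have "Q \<noteq> P"
  proof
    assume "Q = P"
    then have "h \<star> R = h \<star> mat 1" by (simp add: Q_def h(2))
    then have "R = mat 1" using SL3_inv_act(1)[OF h(1)] by metis
    then have "l \<star> ex x = l \<star> ex 0" using lo by (simp add: R_def)
    then have "ex x = ex 0" by (metis conj_inverse(1)[OF l(1)])
    then have "x = 0" by (simp only: ex_inj)
    then show False by (simp add: x_def vec3_eq_iff)
  qed
  then show ?thesis using gQ X_act[OF R h(1)] by (auto simp: Q_def)
qed

section \<open>Words in the free product\<close>

fun winv :: "gen list \<Rightarrow> gen list" where
  "winv [] = []"
| "winv (S3 # u) = winv u @ [S3, S3]"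
| "winv (S2 # u) = winv u @ [S2]"

lemmas weq_trans [trans] = word_eq.trans and weq_sym = word_eq.sym and weq_cong = word_eq.cong and weq_refl = word_eq.refl

lemma weq_mid: "word_eq v v' \<Longrightarrow> word_eq (u @ v @ w) (u @ v' @ w)"
  by (intro weq_cong weq_refl)

lemma winv_left: "word_eq (winv u @ u) []"
proof (induction u rule: winv.induct)
  case 1 show ?case by (simp add: weq_refl)
next
  case (2 u)
  have "word_eq (winv u @ [S3, S3, S3] @ u) (winv u @ [] @ u)" by (rule weq_mid[OF word_eq.cube])
  from weq_trans[OF this] show ?case using 2 by simp
next
  case (3 u)
  have "word_eq (winv u @ [S2, S2] @ u) (winv u @ [] @ u)" by (rule weq_mid[OF word_eq.square])
  from weq_trans[OF this] show ?case using 3 by simp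
qed

lemma winv_right: "word_eq (u @ winv u) []"
proof (induction u rule: winv.induct)
  case 1 show ?case by (simp add: weq_refl)
next
  case (2 u)
  have "word_eq ([S3] @ (u @ winv u) @ [S3, S3]) ([S3] @ [] @ [S3, S3])" by (rule weq_mid[OF 2])
  from weq_trans[OF this] show ?case using word_eq.cube by simp
next
  case (3 u)
  have "word_eq ([S2] @ (u @ winv u) @ [S2]) ([S2] @ [] @ [S2])" by (rule weq_mid[OF 3])
  from weq_trans[OF this] show ?case using word_eq.square by simp
qed

text \<open>\<open>u\<close> and \<open>v\<close> represent conjugate elements.\<close>

definition cj :: "gen list \<Rightarrow> gen list \<Rightarrow> bool" where
  "cj u v \<longleftrightarrow> (\<exists>x. word_eq u (x @ v @ winv x))"

lemma winv_append: "winv (u @ v) = winv v @ winv u"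
  by (induction u rule: winv.induct) auto

lemma cj_weq: "word_eq u v \<Longrightarrow> cj u v"
  unfolding cj_def by (intro exI[of _ "[]"]) simp

lemma cj_trans: "cj u v \<Longrightarrow> cj v w \<Longrightarrow> cj u w"
proof -
  assume "cj u v" "cj v w"
  then obtain x y where "word_eq u (x @ v @ winv x)" "word_eq v (y @ w @ winv y)" unfolding cj_def by blast
  then have "word_eq u (x @ (y @ w @ winv y) @ winv x)" using weq_mid weq_trans by blast
  then show ?thesis unfolding cj_def by (intro exI[of _ "x @ y"]) (simp add: winv_append)
qed

lemma cj_rotate: "cj (x @ y) (y @ x)"
proof -
  have "word_eq ((x @ y) @ (x @ winv x)) ((x @ y) @ [])" by (intro weq_cong weq_refl winv_right)
  then show ?thesis unfolding cj_def by (intro exI[of _ x]) (simp add: weq_sym)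
qed

definition block :: "bool \<Rightarrow> gen list" where
  "block b = (if b then [S3, S2] else [S3, S3, S2])"

definition blocks :: "bool list \<Rightarrow> gen list" where
  "blocks bs = concat (map block bs)"

lemma blocks_simps [simp]: "blocks [] = []" "blocks (b # bs) = block b @ blocks bs" "blocks (bs @ cs) = blocks bs @ blocks cs"
  by (simp_all add: blocks_def)

text \<open>Reduced words alternate between the involution and a power of the rotation. Each power is grouped with the
  involution following it.\<close>

lemma normal_form:
  "\<exists>p bs q. (p = [] \<or> p = [S2]) \<and> (q = [] \<or> q = [S3] \<or> q = [S3, S3]) \<and> word_eq u (p @ blocks bs @ q)"
proof (induction u)
  case Nil
  show ?case by (intro exI[of _ "[]"]) (simp add: weq_refl)
next
  case (Cons x u)
  then obtain p bs q where p: "p = [] \<or> p = [S2]" and q: "q = [] \<or> q = [S3] \<or> q = [S3, S3]"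
    and u: "word_eq u (p @ blocks bs @ q)" by blast
  have xu: "word_eq (x # u) ([x] @ p @ blocks bs @ q)"
    using weq_cong[OF weq_refl[of "[x]"] u] by simp
  have fin: ?case if "word_eq ([x] @ p @ blocks bs @ q) (p' @ blocks bs' @ q')" "p' = [] \<or> p' = [S2]" "q' = [] \<or> q' = [S3] \<or> q' = [S3, S3]" for p' bs' q'
    using that weq_trans[OF xu] by blast
  show ?case
  proof (cases x)
    case S2
    show ?thesis
    proof (cases "p = []")
      case True then show ?thesis using S2 q by (intro fin[of "[S2]" bs q]) (simp_all add: weq_refl)
    next
      case False
      then show ?thesis using S2 p q weq_mid[OF word_eq.square, of "[]" "blocks bs @ q"] by (intro fin[of "[]" bs q]) simp_all
    qed
  next
    case S3
    show ?thesis
    proof (cases "p = []")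
      case False
      then show ?thesis using S3 p q by (intro fin[of "[]" "True # bs" q]) (simp_all add: weq_refl block_def)
    next
      case p0: True
      show ?thesis
      proof (cases bs)
        case (Cons b cs)
        show ?thesis
        proof (cases b)
          case True
          then show ?thesis using S3 p0 q Cons by (intro fin[of "[]" "False # cs" q]) (simp_all add: weq_refl block_def)
        next
          case False
          then show ?thesis using S3 p0 q Cons weq_mid[OF word_eq.cube, of "[]" "[S2] @ blocks cs @ q"]
            by (intro fin[of "[S2]" cs q]) (simp_all add: block_def)
        qed
      next
        case Nil
        from q consider "q = []" | "q = [S3]" | "q = [S3, S3]" by blast
        then show ?thesis
        proof cases
          case 1 then show ?thesis using S3 p0 Nil by (intro fin[of "[]" "[]" "[S3]"]) (simp_all add: weq_refl)
        next
          case 2 then show ?thesis using S3 p0 Nil by (intro fin[of "[]" "[]" "[S3, S3]"]) (simp_all add: weq_refl)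
        next
          case 3 then show ?thesis using S3 p0 Nil word_eq.cube by (intro fin[of "[]" "[]" "[]"]) simp_all
        qed
      qed
    qed
  qed
qed

text \<open>The modular group acts on integer vectors modulo sign. Up to sign, blocks act as \<open>(x, y) \<mapsto> (x + y, y)\<close> and
  \<open>(x, y) \<mapsto> (x, x + y)\<close>, so that they increase positive vectors.\<close>

fun iact :: "gen \<Rightarrow> int \<times> int \<Rightarrow> int \<times> int" where
  "iact S2 (x, y) = (- y, x)"
| "iact S3 (x, y) = (x - y, x)"

definition iacts :: "gen list \<Rightarrow> int \<times> int \<Rightarrow> int \<times> int" where
  "iacts u = foldr iact u"

lemma iacts_simps [simp]: "iacts [] p = p" "iacts (x # u) p = iact x (iacts u p)" "iacts (u @ v) p = iacts u (iacts v p)"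
  by (simp_all add: iacts_def)

definition pneg :: "int \<times> int \<Rightarrow> int \<times> int" where "pneg p = (- fst p, - snd p)"

lemma pneg_pneg [simp]: "pneg (pneg p) = p" by (simp add: pneg_def)

lemma iacts_neg: "iacts u (pneg p) = pneg (iacts u p)"
proof (induction u)
  case (Cons x u)
  then show ?case by (cases x; cases "iacts u p") (simp_all add: pneg_def)
qed simp

lemma iacts_weq: "word_eq u v \<Longrightarrow> iacts u = iacts v \<or> iacts u = pneg \<circ> iacts v"
proof (induction rule: word_eq.induct)
  case (sym u v) then show ?case by (auto simp: fun_eq_iff)
next
  case (trans u v w) then show ?case by (auto simp: fun_eq_iff)
next
  case (cong u v u' v') then show ?case by (auto simp: fun_eq_iff iacts_neg simp del: split_paired_All)
next
  case cube
  have "iacts [S3, S3, S3] = pneg \<circ> iacts []" by (auto simp: fun_eq_iff pneg_def)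
  then show ?case by blast
next
  case square
  have "iacts [S2, S2] = pneg \<circ> iacts []" by (auto simp: fun_eq_iff pneg_def)
  then show ?case by blast
qed simp

lemma blocks_grow:
  "\<exists>x y. x \<ge> 1 \<and> y \<ge> 1 \<and> x + y \<ge> 2 + int (length bs) \<and> (iacts (blocks bs) (1, 1) = (x, y) \<or> iacts (blocks bs) (1, 1) = pneg (x, y))"
proof (induction bs)
  case Nil then show ?case by (intro exI[of _ 1]) auto
next
  case (Cons b bs)
  then obtain x y where xy: "x \<ge> 1" "y \<ge> 1" "x + y \<ge> 2 + int (length bs)"
    "iacts (blocks bs) (1, 1) = (x, y) \<or> iacts (blocks bs) (1, 1) = pneg (x, y)" by blast
  show ?case
  proof (cases b)
    case True
    show ?thesis using xy True by (intro exI[of _ "x + y"] exI[of _ y]) (auto simp: block_def pneg_def)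
  next
    case False
    show ?thesis using xy False by (intro exI[of _ x] exI[of _ "x + y"]) (auto simp: block_def pneg_def)
  qed
qed

lemma blocks_nontrivial: "bs \<noteq> [] \<Longrightarrow> \<not> word_eq (blocks bs) []"
proof
  assume bs: "bs \<noteq> []" and "word_eq (blocks bs) []"
  then have "iacts (blocks bs) (1, 1) = (1, 1) \<or> iacts (blocks bs) (1, 1) = pneg (1, 1)"
    using iacts_weq[of "blocks bs" "[]"] by auto
  moreover have "length bs \<ge> 1" using bs by (cases bs) auto
  ultimately show False using blocks_grow[of bs] by (auto simp: pneg_def)
qed

text \<open>The cyclically reduced words, up to cyclic permutation of the letters.\<close>

definition cyclic_forms :: "gen list set" where
  "cyclic_forms = {[], [S2], [S3], [S3, S3]} \<union> blocks ` {bs. bs \<noteq> []}"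

lemma cyclic_reduction:
  "(\<exists>v\<in>cyclic_forms. cj ([S2] @ blocks bs) v) \<and> (\<exists>v\<in>cyclic_forms. cj ([S3] @ blocks bs) v) \<and> (\<exists>v\<in>cyclic_forms. cj ([S3, S3] @ blocks bs) v)"
proof (induction bs rule: length_induct)
  case (1 bs)
  show ?case
  proof (cases bs rule: rev_cases)
    case Nil
    then show ?thesis by (auto simp: cyclic_forms_def intro!: cj_weq weq_refl)
  next
    case (snoc cs c)
    have c: "\<exists>v\<in>cyclic_forms. cj ([S2] @ blocks bs) v"
    proof -
      define t where "t = (if c then [S3] else [S3, S3])"
      have bs: "blocks bs = (blocks cs @ t) @ [S2]" by (simp add: snoc block_def t_def)
      have "cj ([S2] @ blocks bs) (((blocks cs @ t) @ [S2]) @ [S2])" unfolding bs by (rule cj_rotate)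
      moreover have "cj (((blocks cs @ t) @ [S2]) @ [S2]) (blocks cs @ t)"
        using weq_mid[OF word_eq.square, of "blocks cs @ t" "[]"] by (intro cj_weq) simp
      moreover have "cj (blocks cs @ t) (t @ blocks cs)" by (rule cj_rotate)
      moreover have "\<exists>v\<in>cyclic_forms. cj (t @ blocks cs) v" using 1 snoc by (auto simp: t_def)
      ultimately show ?thesis using cj_trans by meson
    qed
    have "bs \<noteq> []" using snoc by simp
    then obtain d ds where ds: "bs = d # ds" using neq_Nil_conv[of bs] by blast
    have form: "blocks (e # ds) \<in> cyclic_forms" for e unfolding cyclic_forms_def by blast
    have rec: "\<exists>v\<in>cyclic_forms. cj ([S2] @ blocks ds) v" using 1 ds by auto
    have eqf: "\<exists>v\<in>cyclic_forms. cj u v" if "u = blocks (e # ds)" for u e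
      using form[of e] that cj_weq[OF weq_refl] by blast
    have eqr: "\<exists>v\<in>cyclic_forms. cj u v" if "word_eq u ([S2] @ blocks ds)" for u
      using rec cj_trans[OF cj_weq[OF that]] by blast
    have "\<exists>v\<in>cyclic_forms. cj ([S3] @ blocks bs) v"
    proof (cases d)
      case True then show ?thesis using ds by (intro eqf[of _ False]) (simp add: block_def)
    next
      case False then show ?thesis using ds weq_mid[OF word_eq.cube, of "[]" "[S2] @ blocks ds"] by (intro eqr) (simp add: block_def)
    qed
    moreover have "\<exists>v\<in>cyclic_forms. cj ([S3, S3] @ blocks bs) v"
    proof (cases d)
      case True then show ?thesis using ds weq_mid[OF word_eq.cube, of "[]" "[S2] @ blocks ds"] by (intro eqr) (simp add: block_def)
    next
      case False
      have "word_eq ([S3, S3] @ blocks bs) (blocks (True # ds))"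
        using False ds weq_mid[OF word_eq.cube, of "[]" "[S3, S2] @ blocks ds"] by (simp add: block_def)
      then show ?thesis using form[of True] cj_weq by blast
    qed
    ultimately show ?thesis using c by blast
  qed
qed

lemma conjugate_to_cyclic_form: "\<exists>v\<in>cyclic_forms. cj u v"
proof -
  obtain p bs q where p: "p = [] \<or> p = [S2]" and q: "q = [] \<or> q = [S3] \<or> q = [S3, S3]"
    and u: "word_eq u (p @ blocks bs @ q)" using normal_form by blast
  have r: "cj u (q @ p @ blocks bs)"
    using cj_trans[OF cj_weq[OF u]] cj_rotate[of "p @ blocks bs" q] by simp
  have "\<exists>v\<in>cyclic_forms. cj (q @ p @ blocks bs) v"
  proof (cases "p = []")
    case True
    show ?thesis
    proof (cases "q = [] \<and> bs \<noteq> []")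
      case True
      then have "q @ p @ blocks bs \<in> cyclic_forms" using \<open>p = []\<close> by (auto simp: cyclic_forms_def)
      then show ?thesis using cj_weq[OF weq_refl] by blast
    next
      case False
      then consider "q = []" "bs = []" | "q = [S3]" | "q = [S3, S3]" using q by blast
      then show ?thesis
      proof cases
        case 1
        then have "q @ p @ blocks bs \<in> cyclic_forms" using \<open>p = []\<close> by (simp add: cyclic_forms_def)
        then show ?thesis using cj_weq[OF weq_refl] by blast
      next
        case 2 then show ?thesis using \<open>p = []\<close> cyclic_reduction[of bs] by simp
      next
        case 3 then show ?thesis using \<open>p = []\<close> cyclic_reduction[of bs] by simp
      qed
    qed
  next
    case False
    then have p: "p = [S2]" using p by blast
    from q consider "q = []" | "q = [S3]" | "q = [S3, S3]" by blast
    then show ?thesis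
    proof cases
      case 1 then show ?thesis using p cyclic_reduction[of bs] by auto
    next
      case 2
      then have "q @ p @ blocks bs = blocks (True # bs)" using p by (simp add: block_def)
      then show ?thesis using cj_weq[OF weq_refl, of "blocks (True # bs)"] by (auto simp: cyclic_forms_def simp del: blocks_simps)
    next
      case 3
      then have "q @ p @ blocks bs = blocks (False # bs)" using p by (simp add: block_def)
      then show ?thesis using cj_weq[OF weq_refl, of "blocks (False # bs)"] by (auto simp: cyclic_forms_def simp del: blocks_simps)
    qed
  qed
  then show ?thesis using cj_trans[OF r] by blast
qed

lemma cj_trivial: "cj u v \<Longrightarrow> word_eq v [] \<Longrightarrow> word_eq u []"
proof -
  assume "cj u v" "word_eq v []"
  then obtain x where "word_eq u (x @ v @ winv x)" unfolding cj_def by blast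
  also have "word_eq (x @ v @ winv x) (x @ [] @ winv x)" by (rule weq_mid[OF \<open>word_eq v []\<close>])
  also have "word_eq (x @ [] @ winv x) []" using winv_right by simp
  finally show ?thesis .
qed

text \<open>The square of a nonempty product of blocks is again one, hence nontrivial, and the square of a rotation is nontrivial.\<close>

lemma involution_in_free_product:
  assumes "word_eq (w @ w) []"
  shows "word_eq w [] \<or> cj w [S2]"
proof -
  obtain v where v: "v \<in> cyclic_forms" "cj w v" using conjugate_to_cyclic_form by blast
  then obtain x where x: "word_eq w (x @ v @ winv x)" unfolding cj_def by blast
  have "word_eq (v @ v) []"
  proof -
    have "word_eq (v @ v) ([] @ v @ ([] @ v @ []))" by (simp add: weq_refl)
    also have "word_eq \<dots> ((winv x @ x) @ v @ ((winv x @ x) @ v @ (winv x @ x)))"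
      by (intro weq_cong weq_refl weq_sym[OF winv_left])
    also have "\<dots> = winv x @ ((x @ v @ winv x) @ (x @ v @ winv x)) @ x" by simp
    also have "word_eq \<dots> (winv x @ (w @ w) @ x)" by (intro weq_cong weq_refl weq_sym[OF x])
    also have "word_eq \<dots> (winv x @ [] @ x)" by (intro weq_cong weq_refl assms)
    also have "word_eq \<dots> []" using winv_left by simp
    finally show ?thesis by simp
  qed
  moreover have "word_eq [S3] []" if "word_eq [S3, S3] []"
    using weq_trans[OF weq_sym[OF weq_cong[OF that weq_refl[of "[S3]"]]]] word_eq.cube by simp
  moreover have "word_eq [S3, S3] []" if "word_eq [S3, S3, S3, S3] []"
  proof -
    have "word_eq [S3] []" using weq_trans[OF weq_sym[OF weq_cong[OF word_eq.cube weq_refl[of "[S3]"]]]] that by simp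
    then show ?thesis using weq_cong[of "[S3]" "[]" "[S3]" "[]"] by simp
  qed
  moreover have "\<not> word_eq (blocks bs @ blocks bs) []" if "bs \<noteq> []" for bs
    using blocks_nontrivial[of "bs @ bs"] that by simp
  ultimately have "word_eq v [] \<or> v = [S2]"
    using v(1) unfolding cyclic_forms_def by (auto simp: weq_refl)
  then show ?thesis using v(2) cj_trivial by blast
qed

lemma infinite_z3z2: "infinite (UNIV :: z3z2 set)"
proof
  assume fin: "finite (UNIV :: z3z2 set)"
  define f where "f = (\<lambda>n. abs_z3z2 (blocks (replicate n True)))"
  have val: "iacts (blocks (replicate n True)) (1, 1) = (1 + int n, 1) \<or> iacts (blocks (replicate n True)) (1, 1) = pneg (1 + int n, 1)" for n
    by (induction n) (auto simp: block_def pneg_def)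
  have "inj f"
  proof (rule injI)
    fix m n assume "f m = f n"
    then have "word_eq (blocks (replicate m True)) (blocks (replicate n True))" by (simp add: f_def z3z2.abs_eq_iff)
    define A where "A = (\<lambda>n. iacts (blocks (replicate n True)) (1, 1))"
    have "A m = A n \<or> A m = pneg (A n)"
      using iacts_weq[OF \<open>word_eq _ _\<close>] unfolding A_def by (metis comp_apply)
    then show "m = n" using val[of m] val[of n] by (auto simp: pneg_def A_def)
  qed
  then show False using fin finite_subset[of "range f" UNIV] range_inj_infinite by blast
qed

lemma countable_z3z2: "countable (UNIV :: z3z2 set)"
proof -
  have "countable (UNIV :: gen set)"
    by (rule countable_finite) (rule finite_subset[of _ "{S2, S3}"], auto intro: gen.exhaust)
  then have "countable (lists (UNIV :: gen set))" by (rule countable_lists)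
  then have "countable (abs_z3z2 ` (UNIV :: gen list set))" by (simp add: countable_image)
  moreover have "range abs_z3z2 = UNIV" by (metis Quotient_abs_rep Quotient_z3z2 surjI)
  ultimately show ?thesis by simp
qed

section \<open>Flats and their medial geodesics\<close>

definition flat :: "mat3 \<Rightarrow> mat3 set" where
  "flat g = {g \<star> ex x |x. x \<in> sum0}"

abbreviation med :: "real \<Rightarrow> real \<Rightarrow> real^3" where
  "med s \<tau> \<equiv> vector [s + \<tau>, - 2 * \<tau>, \<tau> - s]"

text \<open>The medial geodesics of the flat \<open>g\<close> in the direction where the middle semi-axis is constant; \<open>\<tau>\<close> is the offset from the
  one through the centre.\<close>

definition mline :: "mat3 \<Rightarrow> real \<Rightarrow> mat3 set" where
  "mline g \<tau> = {g \<star> ex (med s \<tau>) |s. True}"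

lemma medial_sum0 [simp]: "med s \<tau> \<in> sum0"
  by (simp add: sum0_def)

lemma mline_flat: "mline g \<tau> \<subseteq> flat g"
  using medial_sum0 by (auto simp: mline_def flat_def)

lemma flat_X: "g \<in> SL3 \<Longrightarrow> flat g \<subseteq> X"
  by (auto simp: flat_def X_act ex_in_X)

lemma mline_X: "g \<in> SL3 \<Longrightarrow> mline g \<tau> \<subseteq> X"
  using mline_flat flat_X by blast

lemma mline_nonempty: "mline g \<tau> \<noteq> {}"
  by (auto simp: mline_def)

lemma proj_flat: "a \<in> SL3 \<Longrightarrow> g \<in> SL3 \<Longrightarrow> proj_isom a ` flat g = flat (a ** g)"
proof -
  assume a: "a \<in> SL3" "g \<in> SL3"
  have "proj_isom a (g \<star> ex x) = (a ** g) \<star> ex x" if "x \<in> sum0" for x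
    using that a by (simp add: proj_isom_apply X_act ex_in_X conj_conj)
  then show ?thesis unfolding flat_def by (auto simp: image_iff) metis
qed

lemma proj_mline: "a \<in> SL3 \<Longrightarrow> g \<in> SL3 \<Longrightarrow> proj_isom a ` mline g \<tau> = mline (a ** g) \<tau>"
proof -
  assume a: "a \<in> SL3" "g \<in> SL3"
  have "proj_isom a (g \<star> ex x) = (a ** g) \<star> ex x" if "x \<in> sum0" for x
    using that a by (simp add: proj_isom_apply X_act ex_in_X conj_conj)
  note e = this[OF medial_sum0[of _ \<tau>]]
  show ?thesis
  proof
    show "proj_isom a ` mline g \<tau> \<subseteq> mline (a ** g) \<tau>" unfolding mline_def using e by blast
    show "mline (a ** g) \<tau> \<subseteq> proj_isom a ` mline g \<tau>" unfolding mline_def using e[symmetric] by blast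
  qed
qed

lemma dual_on_flat:
  assumes "a \<in> SL3" "g \<in> SL3" "x \<in> sum0"
  shows "dual_isom a (g \<star> ex x) = (a ** ct g) \<star> ex (- x)"
proof -
  have "adj (ex x) = ex (- x)" using X_inv_adj[OF ex_in_X[OF assms(3)]] by (simp add: matrix_inv_ex)
  then show ?thesis using assms by (simp add: dual_isom_apply X_act ex_in_X adj_conj conj_conj)
qed

lemma dual_flat: "a \<in> SL3 \<Longrightarrow> g \<in> SL3 \<Longrightarrow> dual_isom a ` flat g = flat (a ** ct g)"
proof -
  assume a: "a \<in> SL3" "g \<in> SL3"
  show ?thesis
  proof
    show "dual_isom a ` flat g \<subseteq> flat (a ** ct g)"
      unfolding flat_def using dual_on_flat[OF a] sum0_closed(3) by blast
    have "(a ** ct g) \<star> ex x = dual_isom a (g \<star> ex (- x))" if "x \<in> sum0" for x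
      using dual_on_flat[OF a, of "- x"] that by simp
    then show "flat (a ** ct g) \<subseteq> dual_isom a ` flat g"
      unfolding flat_def using sum0_closed(3) by blast
  qed
qed

text \<open>A duality reverses the coordinate that separates the parallel medial geodesics of a flat; this is what makes
  asymmetric families of parallels rigid under dualities.\<close>

lemma dual_mline: "a \<in> SL3 \<Longrightarrow> g \<in> SL3 \<Longrightarrow> dual_isom a ` mline g \<tau> = mline (a ** ct g) (- \<tau>)"
proof -
  assume a: "a \<in> SL3" "g \<in> SL3"
  have neg: "- (med s \<tau> :: real^3) = vector [- s + - \<tau>, - 2 * - \<tau>, - \<tau> - (- s)]" for s
    by (simp add: vec3_eq_iff)
  have e: "dual_isom a (g \<star> ex (med s \<tau>)) =
      (a ** ct g) \<star> ex (vector [- s + - \<tau>, - 2 * - \<tau>, - \<tau> - (- s)])" for s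
    using dual_on_flat[OF a medial_sum0[of s \<tau>]] unfolding neg .
  show ?thesis
  proof
    show "dual_isom a ` mline g \<tau> \<subseteq> mline (a ** ct g) (- \<tau>)" unfolding mline_def using e by blast
    have "(a ** ct g) \<star> ex (vector [s + - \<tau>, - 2 * - \<tau>, - \<tau> - s]) =
      dual_isom a (g \<star> ex (vector [- s + \<tau>, - 2 * \<tau>, \<tau> - (- s)]))" for s
      using e[of "- s"] by simp
    then show "mline (a ** ct g) (- \<tau>) \<subseteq> dual_isom a ` mline g \<tau>" unfolding mline_def by blast
  qed
qed

lemma std_flat_eq: "std_flat = flat (mat 1)"
proof
  show "std_flat \<subseteq> flat (mat 1)"
  proof
    fix P assume "P \<in> std_flat"
    then obtain a b c where p: "P = E a b c" "0 < a" "0 < b" "0 < c" "a * b * c = 1" by (auto simp: std_flat_def)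
    define x where "x = (vector [ln (a\<^sup>2), ln (b\<^sup>2), ln (c\<^sup>2)] :: real^3)"
    have "ln a + ln b + ln c = ln (a * b * c)" using p(2-4) by (simp add: ln_mult)
    also have "\<dots> = 0" using p(5) by simp
    finally have "x \<in> sum0" using p(2-4) by (simp add: sum0_def x_def ln_realpow)
    moreover have "P = ex x" using p by (simp add: E_def ex_def x_def mat3_eq_iff)
    ultimately show "P \<in> flat (mat 1)" by (auto simp: flat_def)
  qed
  show "flat (mat 1) \<subseteq> std_flat"
  proof
    fix P assume "P \<in> flat (mat 1)"
    then obtain x where x: "x \<in> sum0" "P = ex x" by (auto simp: flat_def)
    have "P = E (exp (x$1/2)) (exp (x$2/2)) (exp (x$3/2))"
      by (simp add: x E_def ex_def mat3_eq_iff flip: exp_double)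
    moreover have "exp (x$1/2) * exp (x$2/2) * exp (x$3/2) = exp ((x$1 + x$2 + x$3)/2)"
      by (simp add: add_divide_distrib flip: exp_add)
    ultimately show "P \<in> std_flat" using x(1) unfolding std_flat_def sum0_def
      by (intro CollectI exI[of _ "exp (x$1/2)"] exI[of _ "exp (x$2/2)"] exI[of _ "exp (x$3/2)"]) simp
  qed
qed

lemma std_medial: "mline (mat 1) 0 \<in> std_medials"
proof -
  have "mline (mat 1) 0 = {E a 1 c |a c. 0 < a \<and> 0 < c \<and> a * c = 1}"
  proof
    show "mline (mat 1) 0 \<subseteq> {E a 1 c |a c. 0 < a \<and> 0 < c \<and> a * c = 1}"
    proof
      fix P assume "P \<in> mline (mat 1) 0"
      then obtain s where s: "P = ex (vector [s, 0, - s])" by (auto simp: mline_def)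
      have "P = E (exp (s/2)) 1 (exp (- s/2))"
        by (simp add: s E_def ex_def mat3_eq_iff flip: exp_double)
      moreover have "exp (s/2) * exp (- s/2) = 1" by (simp flip: exp_add)
      ultimately show "P \<in> {E a 1 c |a c. 0 < a \<and> 0 < c \<and> a * c = 1}"
        by (intro CollectI exI[of _ "exp (s/2)"] exI[of _ "exp (- s/2)"]) simp
    qed
    show "{E a 1 c |a c. 0 < a \<and> 0 < c \<and> a * c = 1} \<subseteq> mline (mat 1) 0"
    proof
      fix P assume "P \<in> {E a 1 c |a c. 0 < a \<and> 0 < c \<and> a * c = 1}"
      then obtain a c where p: "P = E a 1 c" "0 < a" "0 < c" "a * c = 1" by blast
      have "c = inverse a" using p(4) by (metis inverse_unique)
      then have "P = ex (vector [2 * ln a, 0, - (2 * ln a)])"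
        using p by (simp add: E_def ex_def mat3_eq_iff exp_minus exp_double power_inverse)
      then show "P \<in> mline (mat 1) 0" by (auto simp: mline_def intro!: exI[of _ "2 * ln a"])
    qed
  qed
  then show ?thesis by (simp add: std_medials_def)
qed

lemma ex_shift:
  "ex (med s \<tau>) = ex (vector [\<tau>/2, - \<tau>, \<tau>/2]) ** ex (vector [s, 0, - s]) ** ex (vector [\<tau>/2, - \<tau>, \<tau>/2])"
  by (simp add: ex_add) (simp add: ex_inj vec3_eq_iff)

lemma medial_mline:
  assumes g: "g \<in> SL3" shows "medial_geodesic (mline g \<tau>)"
proof -
  define d where "d = ex (vector [\<tau>/2, - \<tau>, \<tau>/2])"
  have d: "d \<in> SL3" unfolding d_def by (intro ex_SL3) (simp add: sum0_def)
  have e: "g \<star> ex (med s \<tau>) = (g ** d) \<star> ex (vector [s, 0, - s])" for s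
    unfolding ex_shift d_def[symmetric] by (simp add: matrix_transpose_mul matrix_mul_assoc) (simp add: d_def)
  have "mline g \<tau> = mline (g ** d) 0" unfolding mline_def e by simp
  also have "\<dots> = proj_isom (g ** d) ` mline (mat 1) 0"
    using proj_mline[of "g ** d" "mat 1" 0] g d by (simp add: SL3_mult SL3_one)
  finally show ?thesis
    unfolding medial_geodesic_def using std_medial proj_closed[OF SL3_mult[OF g d]] by blast
qed

lemma is_flat_iff: "is_flat F \<longleftrightarrow> (\<exists>g\<in>SL3. F = flat g)"
proof
  assume "is_flat F"
  then obtain f where f: "f \<in> IsomX" "F = f ` flat (mat 1)" by (auto simp: is_flat_def std_flat_eq)
  from f(1) show "\<exists>g\<in>SL3. F = flat g"
  proof (cases rule: IsomX_cases)
    case (proj g)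
    then show ?thesis using f(2) by (auto simp: proj_flat SL3_one)
  next
    case (dual g)
    then show ?thesis using f(2) by (auto simp: dual_flat SL3_one)
  qed
next
  assume "\<exists>g\<in>SL3. F = flat g"
  then obtain g where g: "g \<in> SL3" "F = flat g" by blast
  then have "F = proj_isom g ` std_flat" by (simp add: std_flat_eq proj_flat SL3_one)
  then show "is_flat F" using g by (auto simp: is_flat_def)
qed

definition diagonal :: "mat3 \<Rightarrow> bool" where
  "diagonal M \<longleftrightarrow> M$1$2 = 0 \<and> M$1$3 = 0 \<and> M$2$1 = 0 \<and> M$2$3 = 0 \<and> M$3$1 = 0 \<and> M$3$2 = 0"

text \<open>The vanishing conditions say that every column has at most one nonzero entry.\<close>

definition monomial :: "mat3 \<Rightarrow> bool" where
  "monomial n \<longleftrightarrow> (\<forall>k. n$1$k * n$2$k = 0 \<and> n$1$k * n$3$k = 0 \<and> n$2$k * n$3$k = 0)"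

text \<open>A medial geodesic is regular: a matrix that carries it into diagonal matrices already carries the whole flat
  there.\<close>

lemma medial_into_diagonal:
  assumes d: "\<And>s. diagonal (n \<star> ex (med s \<tau>))"
  shows "monomial n"
proof -
  have z: "a = 0 \<and> b = 0 \<and> c = 0"
    if h: "\<And>s. a * exp (s + \<tau>) + b * exp (- 2 * \<tau>) + c * exp (\<tau> - s) = 0" for a b c :: real
  proof -
    define u v where "u = exp \<tau>" and "v = exp (- 2 * \<tau>)"
    have uv: "u > 0" "v > 0" by (simp_all add: u_def v_def)
    have l: "exp (ln 2 + \<tau>) = 2 * u" "exp (- ln 2 + \<tau>) = u / 2" "exp (\<tau> - ln 2) = u / 2" "exp (\<tau> - - ln 2) = 2 * u"
      by (simp_all add: u_def exp_add exp_diff exp_minus)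
    have 1: "a * u + b * v + c * u = 0" using h[of 0] by (simp add: u_def v_def)
    have 2: "a * (2 * u) + b * v + c * (u / 2) = 0" using h[of "ln 2"] unfolding l v_def[symmetric] .
    have 3: "a * (u / 2) + b * v + c * (2 * u) = 0" using h[of "- ln 2"] unfolding l v_def[symmetric] .
    have "4 * (a * u) + 2 * (b * v) + c * u = 0" "a * u + 2 * (b * v) + 4 * (c * u) = 0"
      using 2 3 by (simp_all add: algebra_simps)
    then have "a * u = c * u" by linarith
    then have ac: "a = c" using uv by simp
    have "a * u = 0" using 1 2 unfolding ac by (simp add: field_simps)
    then have "a = 0" using uv by simp
    then show ?thesis using ac 1 uv by simp
  qed
  have e: "(n \<star> ex (med s \<tau>))$i$j =
     (n$i$1 * n$j$1) * exp (s + \<tau>) + (n$i$2 * n$j$2) * exp (- 2 * \<tau>) + (n$i$3 * n$j$3) * exp (\<tau> - s)" for s i j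
    by (simp add: mult3 ex_def)
  have "n$i$1 * n$j$1 = 0 \<and> n$i$2 * n$j$2 = 0 \<and> n$i$3 * n$j$3 = 0" if "(i, j) \<in> {(1,2),(1,3),(2,3)}" for i j
  proof (rule z)
    fix s show "(n$i$1 * n$j$1) * exp (s + \<tau>) + (n$i$2 * n$j$2) * exp (- 2 * \<tau>) + (n$i$3 * n$j$3) * exp (\<tau> - s) = 0"
      using d[of s] that unfolding e[symmetric] diagonal_def by auto
  qed
  from this[of 1 2] this[of 1 3] this[of 2 3] show ?thesis unfolding monomial_def forall_3 by simp
qed

lemma monomial_flat:
  assumes n: "n \<in> SL3" "monomial n" and x: "x \<in> sum0"
  shows "\<exists>y\<in>sum0. n \<star> ex x = ex y"
proof -
  define M where "M = n \<star> ex x"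
  have M: "M \<in> X" using X_act[OF ex_in_X[OF x] n(1)] by (simp add: M_def)
  have "diagonal M"
  proof -
    have p: "n$1$k * n$2$k = 0" "n$1$k * n$3$k = 0" "n$2$k * n$3$k = 0" for k
      using n(2) unfolding monomial_def by blast+
    have q: "n$i$k * e * n$j$k = 0" if "n$i$k * n$j$k = 0" for i j k e using that by auto
    have p': "n$2$k * n$1$k = 0" "n$3$k * n$1$k = 0" "n$3$k * n$2$k = 0" for k
      using p[of k] by (simp_all add: mult.commute)
    show ?thesis unfolding diagonal_def M_def
      by (simp add: mult3 ex_def q[OF p(1)] q[OF p(2)] q[OF p(3)] q[OF p'(1)] q[OF p'(2)] q[OF p'(3)])
  qed
  note m = X_minors[OF M]
  define y where "y = (vector [ln (M$1$1), ln (M$2$2), ln (M$3$3)] :: real^3)"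
  have "M = ex y" using \<open>diagonal M\<close> m by (simp add: diagonal_def mat3_eq_iff ex_def y_def)
  moreover have "y \<in> sum0"
  proof -
    have "M$1$1 * M$2$2 * M$3$3 = 1" using X_det[OF M] \<open>diagonal M\<close> by (simp add: diagonal_def det_3)
    then have "ln (M$1$1 * M$2$2 * M$3$3) = 0" by simp
    then show ?thesis using m by (simp add: sum0_def y_def ln_mult)
  qed
  ultimately show ?thesis by (auto simp: M_def)
qed

lemma flat_subset:
  assumes g: "g \<in> SL3" and k: "k \<in> SL3" and mono: "monomial (adj g ** k)"
  shows "flat k \<subseteq> flat g"
proof
  fix P assume "P \<in> flat k"
  then obtain x where x: "x \<in> sum0" "P = k \<star> ex x" by (auto simp: flat_def)
  have n: "adj g ** k \<in> SL3" using g k by (simp add: SL3_mult)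
  obtain y where y: "y \<in> sum0" "(adj g ** k) \<star> ex x = ex y"
    using monomial_flat[OF n mono x(1)] by blast
  have gk: "g ** (adj g ** k) = k" using g by (rule SL3_cancel)
  have "P = g \<star> ((adj g ** k) ** ex x ** transpose (adj g ** k))"
    by (simp only: x(2) conj_conj gk)
  then show "P \<in> flat g" using y by (auto simp: flat_def)
qed

lemma monomial_inverse:
  assumes n: "n \<in> SL3" "monomial n" shows "monomial (adj n)"
proof -
  have d: "det n \<noteq> 0" using n by (simp add: SL3_def)
  have c: "(n$2$k = 0 \<and> n$3$k = 0) \<or> (n$1$k = 0 \<and> n$3$k = 0) \<or> (n$1$k = 0 \<and> n$2$k = 0)" for k
    using n(2) unfolding monomial_def mult_eq_0_iff by blast
  from c[of 1] c[of 2] c[of 3] d show ?thesis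
    by (elim disjE conjE) (simp_all add: monomial_def forall_3 adj_def det_3)
qed

lemma adj_mult_swap: "g \<in> SL3 \<Longrightarrow> adj (adj g ** k) = adj k ** g"
  by (simp add: adj_mat_mult adj_adj SL3_def)

lemma flat_eq_of_medial:
  assumes g: "g \<in> SL3" and k: "k \<in> SL3" and sub: "mline k \<tau> \<subseteq> flat g"
  shows "flat k = flat g" "monomial (adj g ** k)"
proof -
  have n: "adj g ** k \<in> SL3" using g k by (simp add: SL3_mult)
  have d: "diagonal ((adj g ** k) \<star> ex (med s \<tau>))" for s
  proof -
    have "k \<star> ex (med s \<tau>) \<in> flat g" using sub by (auto simp: mline_def)
    then obtain y where "k \<star> ex (med s \<tau>) = g \<star> ex y"
      by (auto simp: flat_def)
    then have "(adj g ** k) \<star> ex (med s \<tau>) = ex y"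
      using SL3_inv_act(1)[OF g] by (simp add: SL3_adj[OF g] flip: conj_conj)
    then show ?thesis by (simp add: diagonal_def ex_def)
  qed
  show mono: "monomial (adj g ** k)" by (rule medial_into_diagonal[OF d])
  have "monomial (adj k ** g)" using monomial_inverse[OF n mono] g by (simp add: adj_mult_swap)
  then show "flat k = flat g" using flat_subset[OF g k mono] flat_subset[OF k g] by blast
qed

text \<open>Monomial matrices whose permutation fixes the index 2: they preserve the parallel class of \<open>mline (mat 1)\<close>.\<close>

definition preserving :: "mat3 \<Rightarrow> bool" where
  "preserving n \<longleftrightarrow> n$1$2 = 0 \<and> n$3$2 = 0 \<and> n$2$1 = 0 \<and> n$2$3 = 0 \<and>
     (n$1$3 = 0 \<and> n$3$1 = 0 \<or> n$1$1 = 0 \<and> n$3$3 = 0)"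

lemma preserving_medials:
  assumes n: "n \<in> SL3" "preserving n" and c: "(n$2$2)\<^sup>2 = exp (- 2 * c)"
  shows "\<exists>t. t \<noteq> 0 \<and> (\<exists>v. \<forall>s. n \<star> ex (med s \<tau>) =
     ex (med (t * s + v) (\<tau> + c)))"
proof -
  have det: "det n = 1" using n by (simp add: SL3_def)
  have n22: "n$2$2 * n$2$2 * exp (- (2 * \<tau>)) = exp (- (2 * (\<tau> + c)))"
    using c by (simp add: power2_eq_square flip: exp_add)
  have q: "\<exists>v. a * a = exp (v + c) \<and> b * b = exp (c - v)" if ab: "(a * b * n$2$2)\<^sup>2 = 1" for a b
  proof -
    have "a \<noteq> 0" using ab by auto
    define v where "v = ln (a * a) - c"
    have "a * a > 0" using \<open>a \<noteq> 0\<close> not_real_square_gt_zero by blast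
    then have "a * a = exp (v + c)" by (simp add: v_def del: ln_mult)
    moreover have "(b * b) * ((a * a) * (n$2$2)\<^sup>2) = 1" using ab by (simp add: power2_eq_square algebra_simps)
    then have "(b * b) * exp (v - c) = 1" unfolding c calculation by (simp flip: exp_add)
    then have "b * b = inverse (exp (v - c))" by (metis inverse_unique mult.commute)
    then have "b * b = exp (c - v)" by (simp flip: exp_minus)
    ultimately show ?thesis by blast
  qed
  from n(2) consider "n$1$3 = 0" "n$3$1 = 0" | "n$1$1 = 0" "n$3$3 = 0" by (auto simp: preserving_def)
  then show ?thesis
  proof cases
    case 1
    then have "n$1$1 * n$3$3 * n$2$2 = 1" using det n(2) by (simp add: preserving_def det_3 algebra_simps)
    then obtain v where v: "n$1$1 * n$1$1 = exp (v + c)" "n$3$3 * n$3$3 = exp (c - v)"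
      using q[of "n$1$1" "n$3$3"] by auto
    have "n \<star> ex (med s \<tau>) =
       ex (med (1 * s + v) (\<tau> + c))" for s
    proof -
      have "n$1$1 * n$1$1 * exp (s + \<tau>) = exp (s + v + (\<tau> + c))" "n$3$3 * n$3$3 * exp (\<tau> - s) = exp (\<tau> + c - (s + v))"
        unfolding v by (simp_all add: algebra_simps flip: exp_add)
      then show ?thesis using 1 n(2) n22 by (simp add: preserving_def mat3_eq_iff mult3 ex_def mult_ac)
    qed
    then show ?thesis by (intro exI[of _ 1] conjI exI[of _ v]) auto
  next
    case 2
    then have "n$1$3 * n$3$1 * n$2$2 = -1" using det n(2) by (simp add: preserving_def det_3 algebra_simps)
    then obtain v where v: "n$1$3 * n$1$3 = exp (v + c)" "n$3$1 * n$3$1 = exp (c - v)"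
      using q[of "n$1$3" "n$3$1"] by auto
    have "n \<star> ex (med s \<tau>) =
       ex (med (-1 * s + v) (\<tau> + c))" for s
    proof -
      have "n$1$3 * n$1$3 * exp (\<tau> - s) = exp (- s + v + (\<tau> + c))" "n$3$1 * n$3$1 * exp (s + \<tau>) = exp (\<tau> + c - (- s + v))"
        unfolding v by (simp_all add: algebra_simps flip: exp_add)
      then show ?thesis using 2 n(2) n22 by (simp add: preserving_def mat3_eq_iff mult3 ex_def mult_ac)
    qed
    then show ?thesis by (intro exI[of _ "-1"] conjI exI[of _ v]) auto
  qed
qed

text \<open>The middle diagonal entry of \<open>n D n\<^sup>T\<close> is constant along a medial geodesic, while the other two exponentials vary. So the
  middle row of \<open>n\<close> is concentrated on the diagonal.\<close>

lemma medial_onto_medial: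
  assumes g: "g \<in> SL3" and k: "k \<in> SL3" and eq: "mline k \<tau>0 = mline g \<tau>1"
  shows "preserving (adj g ** k)" "mline k \<tau> = mline g (\<tau> + (\<tau>1 - \<tau>0))"
proof -
  define n where "n = adj g ** k"
  have n: "n \<in> SL3" using g k by (simp add: SL3_mult n_def)
  have gk: "g ** n = k" unfolding n_def using g by (rule SL3_cancel)
  have mono: "monomial n"
    using flat_eq_of_medial(2)[OF g k, of \<tau>0] eq mline_flat[of g \<tau>1] by (simp add: n_def)
  have im: "\<exists>t. n \<star> ex (med s \<tau>0) = ex (med t \<tau>1)" for s
  proof -
    have "k \<star> ex (med s \<tau>0) \<in> mline g \<tau>1" using eq by (auto simp: mline_def)
    then obtain t where "k \<star> ex (med s \<tau>0) = g \<star> ex (med t \<tau>1)"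
      by (auto simp: mline_def)
    then have "n \<star> ex (med s \<tau>0) = ex (med t \<tau>1)"
      using SL3_inv_act(1)[OF g] by (simp add: n_def SL3_adj[OF g] flip: conj_conj)
    then show ?thesis by blast
  qed
  have mid: "(n$2$1)\<^sup>2 * exp (s + \<tau>0) + (n$2$2)\<^sup>2 * exp (- 2 * \<tau>0) + (n$2$3)\<^sup>2 * exp (\<tau>0 - s) = exp (- 2 * \<tau>1)" for s
  proof -
    obtain t where "n \<star> ex (med s \<tau>0) = ex (med t \<tau>1)" using im by blast
    then have "(n \<star> ex (med s \<tau>0))$2$2 = ex (med t \<tau>1)$2$2" by simp
    then show ?thesis by (simp add: mult3 ex_def power2_eq_square algebra_simps)
  qed
  have 1: "n$2$1 = 0 \<and> n$2$3 = 0"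
  proof -
    define u where "u = exp \<tau>0"
    have u: "u > 0" by (simp add: u_def)
    have l: "exp (ln 2 + \<tau>0) = 2 * u" "exp (- ln 2 + \<tau>0) = u / 2" "exp (\<tau>0 - ln 2) = u / 2" "exp (\<tau>0 - - ln 2) = 2 * u" "exp (0 + \<tau>0) = u" "exp (\<tau>0 - 0) = u"
      by (simp_all add: u_def exp_add exp_diff exp_minus)
    have "((n$2$1)\<^sup>2 + (n$2$3)\<^sup>2) * u = 0" using mid[of 0] mid[of "ln 2"] mid[of "- ln 2"] unfolding l by (simp add: algebra_simps)
    then show ?thesis using u by (simp add: sum_power2_eq_zero_iff)
  qed
  have dn: "det n = 1" using n by (simp add: SL3_def)
  have n22: "n$2$2 \<noteq> 0" using 1 dn by (auto simp: det_3)
  then have 2: "n$1$2 = 0" "n$3$2 = 0" using mono by (auto simp: monomial_def)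
  have "n$1$3 = 0 \<and> n$3$1 = 0 \<or> n$1$1 = 0 \<and> n$3$3 = 0"
  proof -
    have "n$1$1 * n$3$1 = 0" "n$1$3 * n$3$3 = 0" using mono by (simp_all add: monomial_def)
    then show ?thesis using dn 1 2 by (auto simp: det_3)
  qed
  then have pn: "preserving n" using 1 2 by (simp add: preserving_def)
  then show "preserving (adj g ** k)" by (simp add: n_def)
  define c where "c = \<tau>1 - \<tau>0"
  have "(n$2$2)\<^sup>2 * exp (- 2 * \<tau>0) = exp (- 2 * \<tau>1)" using mid[of 0] 1 by simp
  then have "(n$2$2)\<^sup>2 = exp (- 2 * \<tau>1) * exp (2 * \<tau>0)" by (simp add: exp_minus field_simps)
  then have n2c: "(n$2$2)\<^sup>2 = exp (- 2 * c)" by (simp add: c_def algebra_simps flip: exp_add)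
  obtain t v where t: "t \<noteq> 0" and tv: "\<And>s. n \<star> ex (med s \<tau>) =
     ex (med (t * s + v) (\<tau> + c))"
    using preserving_medials[OF n pn n2c, of \<tau>] by blast
  have k_eq: "k \<star> ex (med s \<tau>) =
     g \<star> ex (med (t * s + v) (\<tau> + c))" for s
    unfolding tv[symmetric] conj_conj gk ..
  have k_eq': "g \<star> ex (med s (\<tau> + c)) =
     k \<star> ex (vector [(s - v) / t + \<tau>, - 2 * \<tau>, \<tau> - (s - v) / t])" for s
    unfolding k_eq using t by simp
  show "mline k \<tau> = mline g (\<tau> + (\<tau>1 - \<tau>0))"
    unfolding c_def[symmetric]
  proof
    show "mline k \<tau> \<subseteq> mline g (\<tau> + c)" unfolding mline_def using k_eq by blast
    show "mline g (\<tau> + c) \<subseteq> mline k \<tau>" unfolding mline_def using k_eq' by blast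
  qed
qed

lemma isom_flat:
  assumes "f \<in> IsomX" "g \<in> SL3" shows "\<exists>k\<in>SL3. f ` flat g = flat k \<and> (\<exists>\<epsilon>. (\<epsilon> = 1 \<or> \<epsilon> = -1) \<and> (\<forall>\<tau>. f ` mline g \<tau> = mline k (\<epsilon> * \<tau>)) \<and>
      (\<epsilon> = 1 \<longrightarrow> (\<exists>a\<in>SL3. f = proj_isom a \<and> k = a ** g)))"
  using assms(1)
proof (cases rule: IsomX_cases)
  case (proj a)
  have "a ** g \<in> SL3" "f ` flat g = flat (a ** g)" "\<forall>\<tau>. f ` mline g \<tau> = mline (a ** g) (1 * \<tau>)"
    using proj assms(2) by (simp_all add: SL3_mult proj_flat proj_mline)
  with proj show ?thesis by blast
next
  case (dual a)
  have "a ** ct g \<in> SL3" "f ` flat g = flat (a ** ct g)" "\<forall>\<tau>. f ` mline g \<tau> = mline (a ** ct g) (-1 * \<tau>)"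
    using dual assms(2) by (simp_all add: SL3_mult dual_flat dual_mline)
  moreover have "(-1::real) \<noteq> 1" by simp
  ultimately show ?thesis by metis
qed

lemma mline_disjoint:
  assumes g: "g \<in> SL3" and "mline g \<tau> \<inter> mline g \<tau>' \<noteq> {}"
  shows "\<tau> = \<tau>'"
proof -
  obtain s s' where "g \<star> ex (med s \<tau>) = g \<star> ex (med s' \<tau>')"
    using assms(2) by (auto simp: mline_def)
  then have "ex (med s \<tau>) = ex (med s' \<tau>')"
    using SL3_inv_act(1)[OF g] by metis
  then show ?thesis by (simp add: ex_inj vec3_eq_iff)
qed

lemma flats_meet_incid:
  assumes g: "g \<in> SL3" and "flat g \<inter> flat k \<noteq> {}"
  shows "incid (adj g ** k) = 0"
proof -
  obtain x y where "g \<star> ex y = k \<star> ex x" using assms(2) by (auto simp: flat_def)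
  then have "(adj g ** k) \<star> ex x = ex y"
    using SL3_inv_act(1)[OF g, of "ex y"] by (simp add: SL3_adj[OF g] flip: conj_conj)
  then show ?thesis by (rule incid_eq_0)
qed

section \<open>Patterns with a prescribed symmetry group\<close>

lemma supersets_meet: "A \<subseteq> B \<Longrightarrow> A' \<subseteq> B' \<Longrightarrow> A \<noteq> {} \<Longrightarrow> A = A' \<Longrightarrow> B \<inter> B' \<noteq> {}"
  by blast

text \<open>The gaps \<open>1\<close> and \<open>a - 1\<close> are in increasing order, so no reflection carries one such set into another, and a translation
  does so only if it is the identity.\<close>

lemma three_point_sets:
  fixes a b c \<epsilon> :: real
  assumes "a > 2" "b > 2" "\<epsilon> = 1 \<or> \<epsilon> = -1" "\<And>\<tau>. \<tau> \<in> {0, 1, a} \<Longrightarrow> \<epsilon> * \<tau> + c \<in> {0, 1, b}"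
  shows "\<epsilon> = 1 \<and> c = 0 \<and> a = b"
proof -
  have "c \<in> {0, 1, b}" "\<epsilon> + c \<in> {0, 1, b}" "\<epsilon> * a + c \<in> {0, 1, b}"
    using assms(4)[of 0] assms(4)[of 1] assms(4)[of a] by auto
  then show ?thesis using assms(1-3) by auto
qed

text \<open>\<open>pattern\<close> consists of the translates of three parallel medial geodesics in each of two flats. The offsets
  \<open>0\<close>, \<open>1\<close> and \<open>a\<close> determine \<open>a\<close> and admit no symmetry.\<close>

definition pattern :: "(mat3 \<Rightarrow> mat3) set \<Rightarrow> mat3 \<Rightarrow> mat3 \<Rightarrow> real \<Rightarrow> real \<Rightarrow> mat3 set set" where
  "pattern \<Gamma> g1 g2 a1 a2 = {f ` mline g \<tau> |f g \<tau>. f \<in> \<Gamma> \<and> (g = g1 \<and> \<tau> \<in> {0, 1, a1} \<or> g = g2 \<and> \<tau> \<in> {0, 1, a2})}"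

lemma one_image: "S \<subseteq> X \<Longrightarrow> ione ` S = S"
  unfolding isom_one by (force simp: proj_isom_apply image_iff subset_iff)

locale generic_flats =
  fixes \<Gamma> :: "(mat3 \<Rightarrow> mat3) set" and g1 g2 :: mat3
  assumes sub: "subgroup \<Gamma> isom_group" and g1: "g1 \<in> SL3" and g2: "g2 \<in> SL3"
    and gen: "generic_pair {h \<in> SL3. proj_isom h \<in> \<Gamma>} {h \<in> SL3. dual_isom h \<in> \<Gamma>} g1 g2"
begin

abbreviation Pat :: "real \<Rightarrow> real \<Rightarrow> mat3 set set" where "Pat \<equiv> pattern \<Gamma> g1 g2"

lemma \<Gamma>_IsomX: "f \<in> \<Gamma> \<Longrightarrow> f \<in> IsomX"
  using subgroup.subset[OF sub] by blast

lemma \<Gamma>_mult: "f \<in> \<Gamma> \<Longrightarrow> g \<in> \<Gamma> \<Longrightarrow> f \<cdot> g \<in> \<Gamma>"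
  by (rule subgroup.m_closed[OF sub])

lemma \<Gamma>_inv: "f \<in> \<Gamma> \<Longrightarrow> (iinv f) \<in> \<Gamma>"
  by (rule subgroup.m_inv_closed[OF sub])

lemma inv_image:
  assumes "f \<in> IsomX" "S \<subseteq> X" shows "iinv f ` f ` S = S" "f ` iinv f ` S = S"
proof -
  show "iinv f ` f ` S = S" "f ` iinv f ` S = S"
    using assms one_image[OF assms(2)] isom_mult_image[of "iinv f" f S] isom_mult_image[of f "iinv f" S]
    by simp_all
qed

lemma isom_inj_image:
  assumes "f \<in> IsomX" "S \<subseteq> X" "T \<subseteq> X" "f ` S = f ` T" shows "S = T"
  using inv_image(1)[OF assms(1)] assms by metis

lemma gSL: "g \<in> {g1, g2} \<Longrightarrow> g \<in> SL3"
  using g1 g2 by blast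

text \<open>By genericity \<open>incid\<close> does not vanish for two distinct translates, so they cannot meet.\<close>

lemma translate_disjoint:
  assumes e: "e \<in> \<Gamma>" and g: "g \<in> {g1, g2}" and k: "k \<in> {g1, g2}" and meet: "flat g \<inter> e ` flat k \<noteq> {}"
    and ord: "\<not> (g = g2 \<and> k = g1) \<or> g1 = g2"
  shows "g = k \<and> e = ione"
  using \<Gamma>_IsomX[OF e]
proof (cases rule: IsomX_cases)
  case (proj h)
  then have "incid (adj g ** (h ** k)) = 0"
    using meet flats_meet_incid[OF gSL[OF g]] proj_flat[OF proj(1) gSL[OF k]] by simp
  then have z: "incid (adj g ** h ** k) = 0" by (simp add: matrix_mul_assoc)
  have hP: "h \<in> {h \<in> SL3. proj_isom h \<in> \<Gamma>}" using proj e by simp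
  have "g = k"
  proof (rule ccontr)
    assume "g \<noteq> k"
    then have "g = g1" "k = g2" using g k ord by auto
    then show False using z gen hP unfolding generic_pair_def by blast
  qed
  moreover have "h = mat 1"
  proof (rule ccontr)
    assume "h \<noteq> mat 1"
    then show False using z gen hP g \<open>g = k\<close> unfolding generic_pair_def by blast
  qed
  ultimately show ?thesis using proj by (simp add: isom_one)
next
  case (dual h)
  then have "incid (adj g ** (h ** ct k)) = 0"
    using meet flats_meet_incid[OF gSL[OF g]] dual_flat[OF dual(1) gSL[OF k]] by simp
  then have z: "incid (adj g ** h ** transpose (adj k)) = 0" by (simp add: matrix_mul_assoc ct_def)
  have hD: "h \<in> {h \<in> SL3. dual_isom h \<in> \<Gamma>}" using dual e by simp
  have False
  proof (cases "g = k")
    case True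
    then show False using z gen hD g unfolding generic_pair_def by blast
  next
    case False
    then have "g = g1" "k = g2" using g k ord by auto
    then show False using z gen hD unfolding generic_pair_def by blast
  qed
  then show ?thesis ..
qed

lemma g1_neq_g2: "g1 \<noteq> g2"
proof
  assume "g1 = g2"
  then have "(adj g1 ** g2)$1$2 = (mat 1 :: mat3)$1$2" using SL3_cancel(1)[OF g1] by simp
  then show False using gen unfolding generic_pair_def by (simp add: mat1_entry)
qed

lemma translates_disjoint:
  assumes f: "f \<in> \<Gamma>" "f' \<in> \<Gamma>" and g: "g \<in> {g1, g2}" and k: "k \<in> {g1, g2}" and meet: "f ` flat g \<inter> f' ` flat k \<noteq> {}"
  shows "g = k \<and> f = f'"
proof -
  have main: "g = k \<and> f = f'" if f: "f \<in> \<Gamma>" "f' \<in> \<Gamma>" and g: "g \<in> {g1, g2}" and k: "k \<in> {g1, g2}"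
    and meet: "f ` flat g \<inter> f' ` flat k \<noteq> {}" and ord: "\<not> (g = g2 \<and> k = g1)" for f f' g k
  proof -
    define e where "e = (iinv f) \<cdot> f'"
    have e: "e \<in> \<Gamma>" using f by (simp add: e_def \<Gamma>_mult \<Gamma>_inv)
    have X: "flat g \<subseteq> X" "flat k \<subseteq> X" using flat_X gSL g k by blast+
    have "iinv f ` (f ` flat g \<inter> f' ` flat k) \<noteq> {}" using meet by simp
    then have "iinv f ` f ` flat g \<inter> iinv f ` f' ` flat k \<noteq> {}" by blast
    then have "flat g \<inter> e ` flat k \<noteq> {}"
      using inv_image(1)[OF \<Gamma>_IsomX[OF f(1)] X(1)] isom_mult_image[OF _ _ X(2), of "(iinv f)" f'] f \<Gamma>_IsomX \<Gamma>_inv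
      by (simp add: e_def)
    then have r: "g = k" "e = ione" using translate_disjoint[OF e g k] ord by blast+
    have "f \<cdot> e = f'" using f \<Gamma>_IsomX by (simp add: e_def flip: iso.m_assoc)
    then have "f = f'" using r(2) f \<Gamma>_IsomX by simp
    with r(1) show ?thesis by blast
  qed
  show ?thesis
  proof (cases "g = g2 \<and> k = g1")
    case False then show ?thesis using main[OF f g k meet] by blast
  next
    case True
    then have "\<not> (k = g2 \<and> g = g1)" using g1_neq_g2 by auto
    then show ?thesis using main[OF f(2,1) k g] meet by blast
  qed
qed

definition lines :: "real \<Rightarrow> real \<Rightarrow> mat3 \<Rightarrow> real set" where
  "lines a1 a2 g = (if g = g1 then {0, 1, a1} else {0, 1, a2})"

lemma pattern_eq: "Pat a1 a2 = {f ` mline g \<tau> |f g \<tau>. f \<in> \<Gamma> \<and> g \<in> {g1, g2} \<and> \<tau> \<in> lines a1 a2 g}"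
  unfolding pattern_def lines_def using g1_neq_g2 by fastforce

lemma pattern_D:
  assumes "l \<in> Pat a1 a2"
  obtains f g \<tau> where "f \<in> \<Gamma>" "g \<in> {g1, g2}" "\<tau> \<in> lines a1 a2 g" "l = f ` mline g \<tau>" "l \<subseteq> f ` flat g"
  using assms mline_flat unfolding pattern_eq by blast

lemma pattern_I: "f \<in> \<Gamma> \<Longrightarrow> g \<in> {g1, g2} \<Longrightarrow> \<tau> \<in> lines a1 a2 g \<Longrightarrow> f ` mline g \<tau> \<in> Pat a1 a2"
  unfolding pattern_eq by blast

lemma pattern_geodesics: "geodesic_pattern (Pat a1 a2)"
  unfolding geodesic_pattern_def
proof
  fix l assume "l \<in> Pat a1 a2"
  then obtain f g \<tau> where f: "f \<in> \<Gamma>" "g \<in> {g1, g2}" "l = f ` mline g \<tau>" by (rule pattern_D)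
  obtain k \<epsilon> where "k \<in> SL3" "f ` mline g \<tau> = mline k (\<epsilon> * \<tau>)"
    using isom_flat[OF \<Gamma>_IsomX[OF f(1)] gSL[OF f(2)]] by blast
  then show "medial_geodesic l" using f(3) medial_mline by simp
qed

lemma pattern_embedded: "embedded (Pat a1 a2)"
  unfolding embedded_def
proof (intro ballI impI)
  fix l m assume lm: "l \<in> Pat a1 a2" "m \<in> Pat a1 a2" "l \<noteq> m"
  obtain f g \<tau> where f: "f \<in> \<Gamma>" "g \<in> {g1, g2}" "l = f ` mline g \<tau>" "l \<subseteq> f ` flat g" using lm(1) by (rule pattern_D)
  obtain f' g' \<tau>' where f': "f' \<in> \<Gamma>" "g' \<in> {g1, g2}" "m = f' ` mline g' \<tau>'" "m \<subseteq> f' ` flat g'" using lm(2) by (rule pattern_D)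
  show "l \<inter> m = {}"
  proof (rule ccontr)
    assume ne: "l \<inter> m \<noteq> {}"
    then have "f ` flat g \<inter> f' ` flat g' \<noteq> {}" using f(4) f'(4) by blast
    from translates_disjoint[OF f(1) f'(1) f(2) f'(2) this] have e: "g = g'" "f = f'" by simp_all
    have fB: "inj_on f X" using IsomX_Bij[OF \<Gamma>_IsomX[OF f(1)]] by (simp add: Bij_def bij_betw_def)
    have "f ` (mline g \<tau> \<inter> mline g \<tau>') = l \<inter> m"
      unfolding f(3) f'(3) e(1)[symmetric] e(2)[symmetric]
      by (rule inj_on_image_Int[OF fB mline_X[OF gSL[OF f(2)]] mline_X[OF gSL[OF f(2)]]])
    then have "mline g \<tau> \<inter> mline g \<tau>' \<noteq> {}" using ne by auto
    then have "\<tau> = \<tau>'" by (rule mline_disjoint[OF gSL[OF f(2)]])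
    then show False using lm(3) f(3) f'(3) e by simp
  qed
qed

lemma flat_of_line:
  assumes F: "is_flat F" and f: "f \<in> \<Gamma>" "g \<in> {g1, g2}" and sub: "f ` mline g \<tau> \<subseteq> F"
  shows "F = f ` flat g"
proof -
  obtain k \<epsilon> where k: "k \<in> SL3" "f ` flat g = flat k" "f ` mline g \<tau> = mline k (\<epsilon> * \<tau>)"
    using isom_flat[OF \<Gamma>_IsomX[OF f(1)] gSL[OF f(2)]] by blast
  obtain h where h: "h \<in> SL3" "F = flat h" using F is_flat_iff by blast
  show ?thesis using flat_eq_of_medial(1)[OF h(1) k(1)] sub k h by simp
qed

lemma pattern_flats_embedded: "embedded (flat_pattern (Pat a1 a2))"
  unfolding embedded_def
proof (intro ballI impI)
  have key: "\<exists>f\<in>\<Gamma>. \<exists>g\<in>{g1, g2}. F = f ` flat g" if "F \<in> flat_pattern (Pat a1 a2)" for F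
  proof -
    obtain l where l: "is_flat F" "l \<in> Pat a1 a2" "l \<subseteq> F" using \<open>F \<in> _\<close> unfolding flat_pattern_def by blast
    obtain f g \<tau> where f: "f \<in> \<Gamma>" "g \<in> {g1, g2}" "l = f ` mline g \<tau>" using l(2) by (rule pattern_D)
    then show ?thesis using flat_of_line[OF l(1) f(1,2)] l(3) by blast
  qed
  fix F G assume FG: "F \<in> flat_pattern (Pat a1 a2)" "G \<in> flat_pattern (Pat a1 a2)" "F \<noteq> G"
  then obtain f g f' g' where "f \<in> \<Gamma>" "g \<in> {g1, g2}" "F = f ` flat g" "f' \<in> \<Gamma>" "g' \<in> {g1, g2}" "G = f' ` flat g'"
    using key[OF FG(1)] key[OF FG(2)] by blast
  then show "F \<inter> G = {}" using translates_disjoint[of f f' g g'] FG(3) by blast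
qed

lemma pattern_infinite: "infinite \<Gamma> \<Longrightarrow> infinite (Pat a1 a2)"
proof
  assume inf: "infinite \<Gamma>" and fin: "finite (Pat a1 a2)"
  have "inj_on (\<lambda>f. f ` mline g1 0) \<Gamma>"
  proof (rule inj_onI)
    fix f f' assume f: "f \<in> \<Gamma>" "f' \<in> \<Gamma>" "f ` mline g1 0 = f' ` mline g1 0"
    have "f ` flat g1 \<inter> f' ` flat g1 \<noteq> {}"
      by (rule supersets_meet[OF image_mono[OF mline_flat] image_mono[OF mline_flat] _ f(3)])
         (use mline_nonempty in blast)
    then show "f = f'" using translates_disjoint f by blast
  qed
  moreover have "(\<lambda>f. f ` mline g1 0) ` \<Gamma> \<subseteq> Pat a1 a2"
    using pattern_I[of _ g1 0 a1 a2] by (auto simp: lines_def)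
  ultimately show False using inf fin finite_subset finite_imageD by blast
qed

lemma \<Gamma>_preserves: "f \<in> \<Gamma> \<Longrightarrow> f \<in> IsomY (Pat a1 a2)"
proof -
  have sub: "(`) f ` Pat a1 a2 \<subseteq> Pat a1 a2" if "f \<in> \<Gamma>" for f
  proof
    fix m assume "m \<in> (`) f ` Pat a1 a2"
    then obtain l where l: "l \<in> Pat a1 a2" "m = f ` l" by blast
    obtain f' g \<tau> where f': "f' \<in> \<Gamma>" "g \<in> {g1, g2}" "\<tau> \<in> lines a1 a2 g" "l = f' ` mline g \<tau>" using l(1) by (rule pattern_D)
    have "m = (f \<cdot> f') ` mline g \<tau>"
      using isom_mult_image[OF \<Gamma>_IsomX[OF that] \<Gamma>_IsomX[OF f'(1)] mline_X[OF gSL[OF f'(2)]]] l(2) f'(4) by simp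
    then show "m \<in> Pat a1 a2" using pattern_I[OF \<Gamma>_mult[OF that f'(1)] f'(2,3)] by simp
  qed
  assume f: "f \<in> \<Gamma>"
  have "Pat a1 a2 \<subseteq> (`) f ` Pat a1 a2"
  proof
    fix l assume l: "l \<in> Pat a1 a2"
    obtain f' g \<tau> where f': "f' \<in> \<Gamma>" "g \<in> {g1, g2}" "l = f' ` mline g \<tau>" using l by (rule pattern_D)
    have lX: "l \<subseteq> X" using f' IsomX_X[OF \<Gamma>_IsomX[OF f'(1)]] mline_X[OF gSL[OF f'(2)]] by blast
    have "iinv f ` l \<in> Pat a1 a2" using sub[OF \<Gamma>_inv[OF f]] l by blast
    moreover have "l = f ` iinv f ` l" using inv_image(2)[OF \<Gamma>_IsomX[OF f] lX] by simp
    ultimately show "l \<in> (`) f ` Pat a1 a2" by blast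
  qed
  then show ?thesis using sub[OF f] \<Gamma>_IsomX[OF f] unfolding IsomY_def by blast
qed

text \<open>Up to an element of \<open>\<Gamma>\<close>, an isometry between two patterns maps the flat \<open>g\<close> to one of the flats \<open>g1\<close>, \<open>g2\<close>, and then its three
  lines to lines of the latter, as translates of the flats are disjoint. A duality would reflect the offsets.\<close>

lemma pattern_map:
  assumes f: "f \<in> IsomX" "(`) f ` Pat a1 a2 \<subseteq> Pat b1 b2"
    and big: "a1 > 2" "a2 > 2" "b1 > 2" "b2 > 2" and g: "g \<in> {g1, g2}"
  shows "\<exists>\<gamma>\<in>\<Gamma>. \<exists>k\<in>{g1, g2}. \<exists>a\<in>SL3. f = \<gamma> \<cdot> proj_isom a \<and> preserving (adj k ** (a ** g)) \<and>
     (if g = g1 then a1 else a2) = (if k = g1 then b1 else b2)"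
proof -
  have gS: "g \<in> SL3" using gSL[OF g] .
  obtain h \<epsilon> where h: "h \<in> SL3" "f ` flat g = flat h" "\<epsilon> = 1 \<or> \<epsilon> = -1" "\<And>\<tau>. f ` mline g \<tau> = mline h (\<epsilon> * \<tau>)"
    using isom_flat[OF f(1) gS] by blast
  have img: "f ` mline g \<tau> \<in> Pat b1 b2" if "\<tau> \<in> lines a1 a2 g" for \<tau>
  proof -
    have "mline g \<tau> \<in> Pat a1 a2"
      using pattern_I[OF subgroup.one_closed[OF sub] g that] one_image[OF mline_X[OF gS]] by simp
    then show ?thesis using f(2) by blast
  qed
  have "0 \<in> lines a1 a2 g" by (simp add: lines_def)
  from img[OF this] obtain \<gamma> k \<tau>1 where \<gamma>: "\<gamma> \<in> \<Gamma>" "k \<in> {g1, g2}" "\<tau>1 \<in> lines b1 b2 k" "f ` mline g 0 = \<gamma> ` mline k \<tau>1"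
    by (rule pattern_D)
  have kS: "k \<in> SL3" using gSL[OF \<gamma>(2)] .
  define e where "e = (iinv \<gamma>) \<cdot> f"
  have \<gamma>X: "\<gamma> \<in> IsomX" using \<Gamma>_IsomX[OF \<gamma>(1)] .
  have e: "e \<in> IsomX" using f(1) \<gamma>X by (simp add: e_def)
  have fe: "f = \<gamma> \<cdot> e" using f(1) \<gamma>X by (simp add: e_def flip: iso.m_assoc)
  have eim: "e ` S = (iinv \<gamma>) ` f ` S" if "S \<subseteq> X" for S
    unfolding e_def using isom_mult_image[OF _ f(1) that] \<gamma>X by simp
  obtain h \<epsilon> where h: "h \<in> SL3" "e ` flat g = flat h" "\<epsilon> = 1 \<or> \<epsilon> = -1" "\<And>\<tau>. e ` mline g \<tau> = mline h (\<epsilon> * \<tau>)"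
     "\<epsilon> = 1 \<longrightarrow> (\<exists>a\<in>SL3. e = proj_isom a \<and> h = a ** g)"
    using isom_flat[OF e gS] by blast
  have "mline h (\<epsilon> * 0) = mline k \<tau>1"
    using h(4)[of 0] eim[OF mline_X[OF gS]] \<gamma>(4) inv_image(1)[OF \<gamma>X mline_X[OF kS]] by metis
  from medial_onto_medial[OF kS h(1) this] have pres: "preserving (adj k ** h)"
    and ml: "\<And>\<tau>. mline h \<tau> = mline k (\<tau> + (\<tau>1 - \<epsilon> * 0))" by blast+
  have tr: "\<epsilon> * \<tau> + \<tau>1 \<in> lines b1 b2 k" if \<tau>: "\<tau> \<in> lines a1 a2 g" for \<tau>
  proof -
    obtain \<gamma>' k' \<tau>' where \<gamma>': "\<gamma>' \<in> \<Gamma>" "k' \<in> {g1, g2}" "\<tau>' \<in> lines b1 b2 k'" "f ` mline g \<tau> = \<gamma>' ` mline k' \<tau>'"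
      using img[OF \<tau>] by (rule pattern_D)
    have "f ` mline g \<tau> = \<gamma> ` e ` mline g \<tau>" using isom_mult_image[OF \<gamma>X e mline_X[OF gS]] fe by simp
    also have "\<dots> = \<gamma> ` mline k (\<epsilon> * \<tau> + \<tau>1)" by (simp add: h(4) ml)
    finally have eq: "\<gamma> ` mline k (\<epsilon> * \<tau> + \<tau>1) = \<gamma>' ` mline k' \<tau>'" using \<gamma>'(4) by simp
    have "\<gamma> ` flat k \<inter> \<gamma>' ` flat k' \<noteq> {}"
      by (rule supersets_meet[OF image_mono[OF mline_flat] image_mono[OF mline_flat] _ eq])
         (use mline_nonempty in blast)
    then have "k = k'" "\<gamma> = \<gamma>'" using translates_disjoint[OF \<gamma>(1) \<gamma>'(1) \<gamma>(2) \<gamma>'(2)] by blast+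
    then have "mline k (\<epsilon> * \<tau> + \<tau>1) = mline k \<tau>'"
      using isom_inj_image[OF \<gamma>X mline_X[OF kS] mline_X[OF kS]] eq by blast
    then have "\<epsilon> * \<tau> + \<tau>1 = \<tau>'" using mline_disjoint[OF kS] mline_nonempty by (metis inf.idem)
    then show ?thesis using \<gamma>'(3) \<open>k = k'\<close> by simp
  qed
  have "\<epsilon> = 1 \<and> \<tau>1 = 0 \<and> (if g = g1 then a1 else a2) = (if k = g1 then b1 else b2)"
  proof (rule three_point_sets)
    show "(if g = g1 then a1 else a2) > 2" "(if k = g1 then b1 else b2) > 2" using big by simp_all
    show "\<epsilon> = 1 \<or> \<epsilon> = -1" by (rule h(3))
    fix \<tau> assume "\<tau> \<in> {0, 1, if g = g1 then a1 else a2}"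
    then have "\<tau> \<in> lines a1 a2 g" by (simp add: lines_def split: if_splits)
    from tr[OF this] show "\<epsilon> * \<tau> + \<tau>1 \<in> {0, 1, if k = g1 then b1 else b2}"
      by (simp add: lines_def split: if_splits)
  qed
  then obtain a where "a \<in> SL3" "e = proj_isom a" "h = a ** g" "(if g = g1 then a1 else a2) = (if k = g1 then b1 else b2)"
    using h(5) by blast
  then show ?thesis using \<gamma>(1,2) fe pres by blast
qed

lemma same_pattern_index:
  assumes "a1 \<noteq> a2" "(if g = g1 then a1 else a2) = (if k = g1 then a1 else a2)" "g \<in> {g1, g2}" "k \<in> {g1, g2}"
  shows "g = k"
  using assms by (auto split: if_splits)

text \<open>A symmetry is, up to \<open>\<Gamma>\<close>, given by \<open>a\<close> preserving the first flat and, up to another element \<open>h\<close> of \<open>\<Gamma>\<close>,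
  by \<open>b\<close> preserving the second one. Since \<open>a = h b\<close>, the matrices \<open>g1\<^sup>-\<^sup>1 g2\<close> and \<open>g1\<^sup>-\<^sup>1 h g2\<close> agree up to monomial
  factors, which genericity only allows for \<open>h = 1\<close>.\<close>

lemma symmetry_trivial:
  assumes h: "h \<in> SL3" "proj_isom h \<in> \<Gamma>" and b: "b \<in> SL3"
    and p1: "preserving (adj g1 ** ((h ** b) ** g1))" and p2: "preserving (adj g2 ** (b ** g2))"
  shows "h ** b = mat 1"
proof -
  define K where "K = adj g1 ** g2"
  define H where "H = adj g1 ** h ** g2"
  define n where "n = adj g1 ** ((h ** b) ** g1)"
  define m where "m = adj g2 ** (b ** g2)"
  have pn: "preserving n" and pm: "preserving m" using p1 p2 by (simp_all add: n_def m_def)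
  have nS: "n \<in> SL3" "m \<in> SL3" using h b g1 g2 by (simp_all add: n_def m_def SL3_mult)
  have "n ** K = adj g1 ** h ** b ** (g1 ** (adj g1 ** g2))" by (simp add: n_def K_def matrix_mul_assoc)
  also have "\<dots> = adj g1 ** h ** b ** g2" by (simp only: SL3_cancel(4)[OF g1])
  finally have nK: "n ** K = adj g1 ** h ** b ** g2" .
  have "H ** m = adj g1 ** h ** (g2 ** (adj g2 ** (b ** g2)))" by (simp add: H_def m_def matrix_mul_assoc)
  also have "\<dots> = adj g1 ** h ** (b ** g2)" by (simp only: SL3_cancel(4)[OF g2])
  finally have nKHm: "n ** K = H ** m" using nK by (simp add: matrix_mul_assoc)
  have Kne: "K$i$j \<noteq> 0" for i j using gen by (simp add: generic_pair_def K_def)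
  obtain a where a: "a = 1 \<or> a = 3" "\<And>j. (n ** K)$1$j = n$1$a * K$a$j" "n$1$a \<noteq> 0"
  proof -
    have "n$1$1 = 0 \<longrightarrow> n$1$3 \<noteq> 0" using nS(1) pn by (auto simp: SL3_def det_3 preserving_def)
    with pn show ?thesis
      using that[of 1] that[of 3] by (auto simp: preserving_def mult3)
  qed
  have n2: "(n ** K)$2$j = n$2$2 * K$2$j" for j using pn by (simp add: preserving_def mult3)
  obtain c where c: "c = 1 \<or> c = 3" "\<And>i. (H ** m)$i$c = H$i$1 * m$1$c" "m$1$c \<noteq> 0"
  proof -
    have "m$1$1 = 0 \<longrightarrow> m$1$3 \<noteq> 0" using nS(2) pm by (auto simp: SL3_def det_3 preserving_def)
    with pm show ?thesis
      using that[of 1] that[of 3] by (auto simp: preserving_def mult3)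
  qed
  have m2: "(H ** m)$i$2 = H$i$2 * m$2$2" for i using pm by (simp add: preserving_def mult3)
  have m22: "m$2$2 \<noteq> 0" using nS(2) pm by (auto simp: SL3_def det_3 preserving_def)
  have e: "H$1$1 * m$1$c = n$1$a * K$a$c" "H$2$1 * m$1$c = n$2$2 * K$2$c"
     "H$1$2 * m$2$2 = n$1$a * K$a$2" "H$2$2 * m$2$2 = n$2$2 * K$2$2"
    using a(2)[of c] n2[of c] a(2)[of 2] n2[of 2] c(2)[of 1] c(2)[of 2] m2[of 1] m2[of 2] nKHm by simp_all
  have "(H$1$1 * m$1$c) * (H$2$2 * m$2$2) * (K$a$2 * K$2$c) = (H$1$2 * m$2$2) * (H$2$1 * m$1$c) * (K$a$c * K$2$2)"
    unfolding e by simp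
  then have "(m$1$c * m$2$2) * quart h a c g1 g2 = 0"
    by (simp add: quart_def Let_def K_def[symmetric] H_def[symmetric] algebra_simps)
  then have q: "quart h a c g1 g2 = 0" using c(3) m22 by simp
  have hm: "h = mat 1 \<and> a = 1 \<and> c = 1"
  proof (rule ccontr)
    assume ne: "\<not> ?thesis"
    have "quart h a c g1 g2 \<noteq> 0"
      using gen h a(1) c(1) ne unfolding generic_pair_def by blast
    then show False using q by simp
  qed
  then have HK: "H = K" by (simp add: H_def K_def)
  have n1: "n$1$3 = 0" "n$3$1 = 0"
    using pn hm a(3) by (auto simp: preserving_def)
  have m1: "m$1$3 = 0" "m$3$1 = 0"
    using pm hm c(3) by (auto simp: preserving_def)
  have nd: "(n ** K)$i$j = n$i$i * K$i$j" "(K ** m)$i$j = K$i$j * m$j$j" for i j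
    using pn pm n1 m1 exhaust_3[of i] exhaust_3[of j] by (auto simp: preserving_def mult3)
  have "n$i$i = m$j$j" for i j
    using nd[of i j] nKHm Kne[of i j] unfolding HK by simp
  then have nn: "n$1$1 = n$2$2" "n$3$3 = n$2$2" by metis+
  have "n = (n$2$2) *\<^sub>R mat 1" using pn n1 nn by (simp add: preserving_def mat3_eq_iff mat1_entry)
  moreover have "n$2$2 = 1"
  proof -
    have "(n$2$2) ^ 3 = 1" using nS(1) pn n1 nn by (simp add: SL3_def det_3 preserving_def power3_eq_cube)
    then show ?thesis by (rule cube_eq_1)
  qed
  ultimately have "n = mat 1" by simp
  moreover have "g1 ** n = (h ** b) ** g1" unfolding n_def by (rule SL3_cancel(4)[OF g1])
  ultimately have "(h ** b) ** g1 = mat 1 ** g1" by simp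
  then show ?thesis using g1 matrix_cancel_right[of g1 "h ** b" "mat 1"] by (simp add: SL3_def)
qed

text \<open>A symmetry agrees up to \<open>\<Gamma>\<close> with a projective transformation that preserves the lines in \<open>g1\<close>, and with one that preserves
  those in \<open>g2\<close>; as \<open>a1 \<noteq> a2\<close>, the two flats are not exchanged.\<close>

lemma IsomY_pattern:
  assumes a: "a1 > 2" "a2 > 2" "a1 \<noteq> a2"
  shows "IsomY (Pat a1 a2) = \<Gamma>"
proof
  let ?Y = "Pat a1 a2"
  show "\<Gamma> \<subseteq> IsomY ?Y" using \<Gamma>_preserves by blast
  show "IsomY ?Y \<subseteq> \<Gamma>"
  proof
    fix f assume "f \<in> IsomY ?Y"
    then have f: "f \<in> IsomX" "(`) f ` ?Y \<subseteq> ?Y" by (auto simp: IsomY_def)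
    obtain \<gamma> k q where \<gamma>: "\<gamma> \<in> \<Gamma>" "k \<in> {g1, g2}" "q \<in> SL3" "f = \<gamma> \<cdot> proj_isom q"
      "preserving (adj k ** (q ** g1))" "(if g1 = g1 then a1 else a2) = (if k = g1 then a1 else a2)"
      using pattern_map[OF f a(1,2) a(1,2), of g1] by blast
    have k: "k = g1" using same_pattern_index[OF a(3) \<gamma>(6)] \<gamma>(2) by blast
    have \<gamma>X: "\<gamma> \<in> IsomX" using \<Gamma>_IsomX[OF \<gamma>(1)] .
    have e: "proj_isom q = (iinv \<gamma>) \<cdot> f" using \<gamma>(3,4) \<gamma>X by (simp flip: iso.m_assoc)
    have "(`) (proj_isom q) ` ?Y \<subseteq> ?Y"
    proof
      fix m assume "m \<in> (`) (proj_isom q) ` ?Y"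
      then obtain l where l: "l \<in> ?Y" "m = proj_isom q ` l" by blast
      obtain f' g \<tau> where f': "f' \<in> \<Gamma>" "g \<in> {g1, g2}" "l = f' ` mline g \<tau>" using l(1) by (rule pattern_D)
      have lX: "l \<subseteq> X" using f' IsomX_X[OF \<Gamma>_IsomX[OF f'(1)]] mline_X[OF gSL[OF f'(2)]] by blast
      have "m = (iinv \<gamma>) ` f ` l" unfolding l(2) e using isom_mult_image[OF _ f(1) lX] \<gamma>X by simp
      moreover have "f ` l \<in> ?Y" using f(2) l(1) by blast
      moreover have "(`) ((iinv \<gamma>)) ` ?Y = ?Y" using \<Gamma>_preserves[OF \<Gamma>_inv[OF \<gamma>(1)]] by (simp add: IsomY_def)
      ultimately show "m \<in> ?Y" by blast
    qed
    then obtain \<delta> k' b where \<delta>: "\<delta> \<in> \<Gamma>" "k' \<in> {g1, g2}" "b \<in> SL3" "proj_isom q = \<delta> \<cdot> proj_isom b"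
      "preserving (adj k' ** (b ** g2))" "(if g2 = g1 then a1 else a2) = (if k' = g1 then a1 else a2)"
      using pattern_map[OF proj_closed[OF \<gamma>(3)] _ a(1,2) a(1,2), of g2] by blast
    have k': "k' = g2" using same_pattern_index[OF a(3) \<delta>(6)] \<delta>(2) by blast
    define h where "h = q ** adj b"
    have h: "h \<in> SL3" using \<gamma>(3) \<delta>(3) by (simp add: h_def SL3_mult)
    have "proj_isom h = proj_isom q \<cdot> proj_isom (adj b)" using \<gamma>(3) \<delta>(3) by (simp add: proj_proj h_def)
    also have "\<dots> = \<delta> \<cdot> (proj_isom b \<cdot> proj_isom (adj b))"
      unfolding \<delta>(4) using \<delta>(3) \<Gamma>_IsomX[OF \<delta>(1)] by (simp add: iso.m_assoc)
    also have "\<dots> = \<delta>"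
      using \<delta>(3) \<Gamma>_IsomX[OF \<delta>(1)] by (simp add: proj_proj SL3_cancel flip: isom_one)
    finally have hG: "proj_isom h \<in> \<Gamma>" using \<delta>(1) by simp
    have hb: "h ** b = q" using \<delta>(3) by (simp add: h_def SL3_cancel flip: matrix_mul_assoc)
    have "q = mat 1"
      using symmetry_trivial[OF h hG \<delta>(3)] \<gamma>(5) \<delta>(5) unfolding hb k k' by blast
    then have "f = \<gamma>" using \<gamma>(4) \<gamma>X by (simp flip: isom_one)
    then show "f \<in> \<Gamma>" using \<gamma>(1) by simp
  qed
qed

lemma patterns_not_isometric:
  assumes "a1 > 2" "a2 > 2" "b1 > 2" "b2 > 2" "a1 \<noteq> b1" "a1 \<noteq> b2"
  shows "\<not> isometric_patterns (Pat a1 a2) (Pat b1 b2)"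
proof
  assume "isometric_patterns (Pat a1 a2) (Pat b1 b2)"
  then obtain f where "f \<in> IsomX" "(`) f ` Pat a1 a2 \<subseteq> Pat b1 b2"
    unfolding isometric_patterns_def by blast
  from pattern_map[OF this assms(1-4), of g1] obtain k where "(if g1 = g1 then a1 else a2) = (if k = g1 then b1 else b2)" by blast
  then show False using assms(5,6) by (auto split: if_splits)
qed

end

lemma finite_index_self:
  assumes "subgroup \<Gamma> isom_group" shows "finite_index_in \<Gamma> \<Gamma>"
proof -
  interpret G: group "isom_group\<lparr>carrier := \<Gamma>\<rparr>" by (rule subgroup.subgroup_is_group[OF assms iso.group_axioms])
  have "subgroup \<Gamma> (isom_group\<lparr>carrier := \<Gamma>\<rparr>)" using G.subgroup_self by simp
  then have "rcosets\<^bsub>isom_group\<lparr>carrier := \<Gamma>\<rparr>\<^esub> \<Gamma> \<subseteq> {\<Gamma>}"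
    using G.coset_join2[of _ \<Gamma>] by (auto simp: RCOSETS_def)
  then show ?thesis unfolding finite_index_in_def using finite_subset by blast
qed

text \<open>Countability provides a pair of flats that is generic for all elements of \<open>\<Gamma>\<close> at once. For projective involutions \<open>incid\<close>
  vanishes identically, so they have to be absent.\<close>

theorem group_is_symmetry_group:
  assumes G: "subgroup \<Gamma> isom_group" "countable \<Gamma>" "infinite \<Gamma>"
    and inv: "\<And>h. h \<in> SL3 \<Longrightarrow> proj_isom h \<in> \<Gamma> \<Longrightarrow> h ** h = mat 1 \<Longrightarrow> h = mat 1"
  shows "\<exists>Y1 Y2. Y1 \<noteq> Y2 \<and>
        (\<forall>Y\<in>{Y1, Y2}. geodesic_pattern Y \<and> infinite Y \<and> embedded Y \<and>
          finite_index_in \<Gamma> (IsomY Y) \<and> embedded (flat_pattern Y)) \<and>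
        \<Gamma> = IsomY Y1 \<and> \<Gamma> = IsomY Y2 \<and> \<not> isometric_patterns Y1 Y2"
proof -
  let ?P = "{h \<in> SL3. proj_isom h \<in> \<Gamma>}" and ?D = "{h \<in> SL3. dual_isom h \<in> \<Gamma>}"
  have "inj_on proj_isom ?P" "inj_on dual_isom ?D"
    using proj_inj dual_inj by (auto intro!: inj_onI)
  moreover have "countable (proj_isom ` ?P)" "countable (dual_isom ` ?D)"
    by (rule countable_subset[OF _ G(2)]; blast)+
  ultimately have c: "countable ?P" "countable ?D" using countable_image_inj_on by blast+
  obtain g1 g2 where g: "g1 \<in> SL3" "g2 \<in> SL3" "generic_pair ?P ?D g1 g2"
    using generic_pair_exists[OF c] inv by blast
  interpret generic_flats \<Gamma> g1 g2 using G(1) g by (rule generic_flats.intro)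
  \<comment> \<open>\<open>pattern_map\<close> needs offsets larger than 2; four distinct ones separate the flats and the patterns.\<close>
  define Y1 where "Y1 = pattern \<Gamma> g1 g2 3 4"
  define Y2 where "Y2 = pattern \<Gamma> g1 g2 5 6"
  have I: "IsomY Y1 = \<Gamma>" "IsomY Y2 = \<Gamma>" unfolding Y1_def Y2_def by (rule IsomY_pattern; simp)+
  have ni: "\<not> isometric_patterns Y1 Y2" unfolding Y1_def Y2_def by (rule patterns_not_isometric) simp_all
  have "Y1 \<noteq> Y2"
  proof
    assume "Y1 = Y2"
    have "ione \<in> IsomY Y1" using I subgroup.one_closed[OF G(1)] by simp
    then have "isometric_patterns Y1 Y1" unfolding isometric_patterns_def IsomY_def by blast
    then show False using ni \<open>Y1 = Y2\<close> by simp
  qed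
  moreover have "\<forall>Y\<in>{Y1, Y2}. geodesic_pattern Y \<and> infinite Y \<and> embedded Y \<and>
          finite_index_in \<Gamma> (IsomY Y) \<and> embedded (flat_pattern Y)"
    using I finite_index_self[OF G(1)] G(3)
    by (auto simp: Y1_def Y2_def pattern_geodesics pattern_infinite pattern_embedded pattern_flats_embedded)
  ultimately show ?thesis using I ni by (intro exI[of _ Y1] exI[of _ Y2]) simp
qed

section \<open>Faithful representations\<close>

lemma rep_mult: "\<rho> \<in> hom Z3Z2 isom_group \<Longrightarrow> \<rho> (word_mult x y) = \<rho> x \<cdot> \<rho> y"
  using hom_mult[of \<rho> Z3Z2 isom_group x y] by (simp add: Z3Z2_def)

lemma rep_closed: "\<rho> \<in> hom Z3Z2 isom_group \<Longrightarrow> \<rho> x \<in> IsomX"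
  using hom_in_carrier[of \<rho> Z3Z2 isom_group x] by (simp add: Z3Z2_def)

lemma rep_group_hom: "\<rho> \<in> hom Z3Z2 isom_group \<Longrightarrow> group_hom Z3Z2 isom_group \<rho>"
  by (simp add: group_hom_def group_hom_axioms_def group_Z3Z2 group_isom_group)

lemma rep_one: "\<rho> \<in> hom Z3Z2 isom_group \<Longrightarrow> \<rho> word_one = ione"
  using group_hom.hom_one[OF rep_group_hom] by (simp add: Z3Z2_def)

lemma abs_z3z2_append: "abs_z3z2 (u @ v) = word_mult (abs_z3z2 u) (abs_z3z2 v)"
  by (simp add: word_mult.abs_eq)

text \<open>A projective involution that fixes a point fixes others as well.\<close>

lemma involution_is_dual:
  assumes d: "d \<in> IsomX" "d \<cdot> d = ione" and u: "\<exists>!P. P \<in> X \<and> d P = P"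
  shows "\<exists>h\<in>SL3. d = dual_isom h"
  using d(1)
proof (cases rule: IsomX_cases)
  case (proj g)
  then have "proj_isom (g ** g) = proj_isom (mat 1)" using d(2) by (simp add: proj_proj isom_one)
  then have gg: "g ** g = mat 1" using proj_inj[OF SL3_mult SL3_one] proj(1) by blast
  obtain P where P: "P \<in> X" "d P = P" using u by blast
  then have "g \<star> P = P" using proj by (simp add: proj_isom_apply)
  from involution_fixes_two[OF proj(1) gg P(1) this] obtain Q where "Q \<in> X" "Q \<noteq> P" "g \<star> Q = Q" by blast
  then have "d Q = Q" "Q \<in> X" "Q \<noteq> P" using proj by (simp_all add: proj_isom_apply)
  then show ?thesis using u P by blast
qed blast

text \<open>An involution of the free product is conjugate to \<open>\<sigma>2\<close>, whose image is a duality, and conjugates of dualities are dualities.\<close>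

lemma faithful_rep_no_projective_involution:
  assumes \<rho>: "\<rho> \<in> hom Z3Z2 isom_group" "inj \<rho>" "\<exists>!P. P \<in> X \<and> \<rho> \<sigma>2 P = P"
    and h: "h \<in> SL3" "proj_isom h \<in> range \<rho>" "h ** h = mat 1"
  shows "h = mat 1"
proof -
  obtain w where w: "proj_isom h = \<rho> w" using h by blast
  obtain u where u: "w = abs_z3z2 u" using z3z2.abs_induct[of "\<lambda>w. \<exists>u. w = abs_z3z2 u"] by blast
  have one: "word_one = abs_z3z2 []" by (simp add: word_one_def)
  have s2: "\<sigma>2 = abs_z3z2 [S2]" by (simp add: \<sigma>2_def)
  have "\<rho> (word_mult w w) = \<rho> word_one"
    unfolding rep_mult[OF \<rho>(1)] w[symmetric] rep_one[OF \<rho>(1)] using h by (simp add: proj_proj isom_one)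
  then have "word_mult w w = word_one" using \<rho>(2) by (simp add: inj_eq)
  then have "word_eq (u @ u) []" unfolding u one by (simp add: abs_z3z2_append[symmetric] z3z2.abs_eq_iff)
  then consider "word_eq u []" | "cj u [S2]" using involution_in_free_product by blast
  then show ?thesis
  proof cases
    case 1
    then have "w = word_one" unfolding u one by (simp add: z3z2.abs_eq_iff)
    then have "proj_isom h = proj_isom (mat 1)" using w rep_one[OF \<rho>(1)] by (simp add: isom_one)
    then show ?thesis using proj_inj h SL3_one by blast
  next
    case 2
    then obtain x where "word_eq u (x @ [S2] @ winv x)" unfolding cj_def by blast
    then have wx: "w = word_mult (abs_z3z2 x) (word_mult \<sigma>2 (abs_z3z2 (winv x)))"
      unfolding u s2 abs_z3z2_append[symmetric] by (simp add: z3z2.abs_eq_iff)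
    have "word_eq (x @ winv x) []" by (rule winv_right)
    then have "word_mult (abs_z3z2 x) (abs_z3z2 (winv x)) = word_one"
      unfolding one abs_z3z2_append[symmetric] by (simp add: z3z2.abs_eq_iff)
    then have xx: "\<rho> (abs_z3z2 x) \<cdot> \<rho> (abs_z3z2 (winv x)) = ione"
      using rep_mult[OF \<rho>(1)] rep_one[OF \<rho>(1)] by metis
    have "word_mult \<sigma>2 \<sigma>2 = word_one" unfolding s2 one abs_z3z2_append[symmetric] z3z2.abs_eq_iff using word_eq.square by simp
    then have "\<rho> \<sigma>2 \<cdot> \<rho> \<sigma>2 = ione"
      using rep_mult[OF \<rho>(1)] rep_one[OF \<rho>(1)] by metis
    then obtain d where d: "d \<in> SL3" "\<rho> \<sigma>2 = dual_isom d" using involution_is_dual[OF rep_closed[OF \<rho>(1)] _ \<rho>(3)] by blast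
    have e: "proj_isom h = \<rho> (abs_z3z2 x) \<cdot> (dual_isom d \<cdot> \<rho> (abs_z3z2 (winv x)))"
      unfolding w wx rep_mult[OF \<rho>(1)] d(2) ..
    obtain a where a: "a \<in> SL3" "\<rho> (abs_z3z2 x) = proj_isom a \<or> \<rho> (abs_z3z2 x) = dual_isom a"
      using isometry_classification[OF rep_closed[OF \<rho>(1)]] by blast
    obtain b where b: "b \<in> SL3" "\<rho> (abs_z3z2 (winv x)) = proj_isom b \<or> \<rho> (abs_z3z2 (winv x)) = dual_isom b"
      using isometry_classification[OF rep_closed[OF \<rho>(1)]] by blast
    have mixed: "\<not> (proj_isom p = dual_isom q)" "\<not> (dual_isom q = proj_isom p)" if "p \<in> SL3" "q \<in> SL3" for p q
      using proj_not_dual[OF that] by metis+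
    have "\<rho> (abs_z3z2 x) = proj_isom a \<and> \<rho> (abs_z3z2 (winv x)) = proj_isom b \<or> \<rho> (abs_z3z2 x) = dual_isom a \<and> \<rho> (abs_z3z2 (winv x)) = dual_isom b"
      using a b xx mixed by (auto simp: proj_dual dual_proj isom_one SL3_mult SL3_one)
    then have "\<exists>q\<in>SL3. proj_isom h = dual_isom q"
      using e a(1) b(1) d(1) by (auto simp: proj_proj proj_dual dual_proj dual_dual SL3_mult)
    then show ?thesis using mixed h(1) by blast
  qed
qed

theorem representation_patterns:
  assumes "\<rho> \<in> df_reps"
  shows "\<exists>Y1 Y2. Y1 \<noteq> Y2 \<and>
        (\<forall>Y\<in>{Y1, Y2}. geodesic_pattern Y \<and> infinite Y \<and> embedded Y \<and>
          finite_index_in (range \<rho>) (IsomY Y) \<and> embedded (flat_pattern Y)) \<and>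
        range \<rho> = IsomY Y1 \<and> range \<rho> = IsomY Y2 \<and> \<not> isometric_patterns Y1 Y2"
proof (rule group_is_symmetry_group)
  have r: "\<rho> \<in> hom Z3Z2 isom_group" "inj \<rho>" "\<exists>!P. P \<in> X \<and> \<rho> \<sigma>2 P = P" using assms by (auto simp: df_reps_def)
  show "subgroup (range \<rho>) isom_group"
    using group_hom.img_is_subgroup[OF rep_group_hom[OF r(1)]] by (simp add: Z3Z2_def)
  show "countable (range \<rho>)" using countable_z3z2 by (rule countable_image)
  show "infinite (range \<rho>)" using infinite_z3z2 finite_imageD[OF _ r(2)] by blast
  show "h = mat 1" if "h \<in> SL3" "proj_isom h \<in> range \<rho>" "h ** h = mat 1" for h
    using faithful_rep_no_projective_involution[OF r that] .
qed

section \<open>Words as projective transformations and dualities\<close>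

text \<open>\<open>(a, False)\<close> stands for the projective transformation \<open>a\<close> and \<open>(a, True)\<close> for the duality
  \<open>a \<circ> std_polarity\<close>.\<close>

fun smul :: "mat3 \<times> bool \<Rightarrow> mat3 \<times> bool \<Rightarrow> mat3 \<times> bool" where
  "smul (a, \<sigma>) (b, \<tau>) = (a ** (if \<sigma> then ct b else b), \<sigma> \<noteq> \<tau>)"

fun iso_of :: "mat3 \<times> bool \<Rightarrow> mat3 \<Rightarrow> mat3" where
  "iso_of (a, \<sigma>) = (if \<sigma> then dual_isom a else proj_isom a)"

text \<open>The induced action on points, tagged \<open>False\<close>, and lines, tagged \<open>True\<close> and given by their normal vectors.\<close>

fun act :: "mat3 \<times> bool \<Rightarrow> (real^3) \<times> bool \<Rightarrow> (real^3) \<times> bool" where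
  "act (a, \<sigma>) (v, \<tau>) = ((if \<sigma> = \<tau> then a else ct a) *v v, \<sigma> \<noteq> \<tau>)"

lemma smul_SL3: "fst m \<in> SL3 \<Longrightarrow> fst n \<in> SL3 \<Longrightarrow> fst (smul m n) \<in> SL3"
  by (cases m; cases n) (simp add: SL3_mult)

lemma iso_of_smul: "fst m \<in> SL3 \<Longrightarrow> fst n \<in> SL3 \<Longrightarrow> iso_of (smul m n) = iso_of m \<cdot> iso_of n"
  by (cases m; cases n) (auto simp: proj_proj proj_dual dual_proj dual_dual)

lemma iso_of_IsomX: "fst m \<in> SL3 \<Longrightarrow> iso_of m \<in> IsomX"
  by (cases m) simp

lemma smul_assoc: "fst l \<in> SL3 \<Longrightarrow> fst m \<in> SL3 \<Longrightarrow> fst n \<in> SL3 \<Longrightarrow> smul (smul l m) n = smul l (smul m n)"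
  by (cases l; cases m; cases n) (auto simp: ct_mult ct_ct matrix_mul_assoc)

lemma act_smul: "fst m \<in> SL3 \<Longrightarrow> fst n \<in> SL3 \<Longrightarrow> act (smul m n) z = act m (act n z)"
  by (cases m; cases n; cases z) (auto simp: ct_mult ct_ct matrix_vector_mul_assoc)

fun letter :: "mat3 \<Rightarrow> mat3 \<Rightarrow> gen \<Rightarrow> mat3 \<times> bool" where
  "letter T h S3 = (T, False)"
| "letter T h S2 = (h, True)"

fun val :: "mat3 \<Rightarrow> mat3 \<Rightarrow> gen list \<Rightarrow> mat3 \<times> bool" where
  "val T h [] = (mat 1, False)"
| "val T h (x # u) = smul (letter T h x) (val T h u)"

definition repr :: "mat3 \<Rightarrow> mat3 \<Rightarrow> z3z2 \<Rightarrow> mat3 \<Rightarrow> mat3" where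
  "repr T h w = iso_of (val T h (rep_z3z2 w))"

locale rotation_polarity =
  fixes T h :: mat3
  assumes T: "T \<in> SL3" "T ** T ** T = mat 1" and h: "h \<in> SL3" "h ** ct h = mat 1"
begin

lemma letter_SL3: "fst (letter T h x) \<in> SL3"
  using T h by (cases x) auto

lemma val_SL3: "fst (val T h u) \<in> SL3"
  by (induction u) (simp_all add: SL3_one smul_SL3 letter_SL3)

lemma val_append: "val T h (u @ v) = smul (val T h u) (val T h v)"
proof (induction u)
  case Nil then show ?case by (cases "val T h v") simp
next
  case (Cons x u) then show ?case by (simp add: smul_assoc letter_SL3 val_SL3)
qed

lemma val_weq: "word_eq u v \<Longrightarrow> val T h u = val T h v"
proof (induction rule: word_eq.induct)
  case cube show ?case using T by (simp add: matrix_mul_assoc)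
next
  case square show ?case using h by simp
qed (simp_all add: val_append)

lemma repr_abs: "repr T h (abs_z3z2 u) = iso_of (val T h u)"
proof -
  have "abs_z3z2 (rep_z3z2 (abs_z3z2 u)) = abs_z3z2 u" by (rule Quotient_abs_rep[OF Quotient_z3z2])
  then have "word_eq (rep_z3z2 (abs_z3z2 u)) u" by (simp add: z3z2.abs_eq_iff)
  then show ?thesis unfolding repr_def by (simp add: val_weq)
qed

lemma repr_hom: "repr T h \<in> hom Z3Z2 isom_group"
proof (rule homI)
  show "repr T h x \<in> IsomX" for x unfolding repr_def by (rule iso_of_IsomX[OF val_SL3])
  fix x y
  show "repr T h (x \<otimes>\<^bsub>Z3Z2\<^esub> y) = repr T h x \<cdot> repr T h y"
  proof (induction x rule: z3z2.abs_induct, induction y rule: z3z2.abs_induct)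
    fix u v
    show "repr T h (abs_z3z2 u \<otimes>\<^bsub>Z3Z2\<^esub> abs_z3z2 v) = repr T h (abs_z3z2 u) \<cdot> repr T h (abs_z3z2 v)"
      by (simp add: Z3Z2_def abs_z3z2_append[symmetric] repr_abs val_append iso_of_smul val_SL3)
  qed
qed

lemma repr_generators: "repr T h \<sigma>3 = proj_isom T" "repr T h \<sigma>2 = dual_isom h"
  unfolding \<sigma>3_def \<sigma>2_def by (simp_all add: repr_abs)

lemma repr_unique:
  assumes \<rho>: "\<rho> \<in> hom Z3Z2 isom_group" "\<rho> \<sigma>3 = proj_isom T" "\<rho> \<sigma>2 = dual_isom h"
  shows "\<rho> = repr T h"
proof
  fix w
  show "\<rho> w = repr T h w"
  proof (induction w rule: z3z2.abs_induct)
    fix u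
    show "\<rho> (abs_z3z2 u) = repr T h (abs_z3z2 u)"
    proof (induction u)
      case Nil
      have "\<rho> (abs_z3z2 []) = ione" using rep_one[OF \<rho>(1)] by (simp add: word_one_def)
      then show ?case by (simp add: repr_abs isom_one)
    next
      case (Cons x u)
      have "\<rho> (abs_z3z2 [x]) = iso_of (letter T h x)"
        using \<rho>(2,3) by (cases x) (simp_all add: \<sigma>3_def \<sigma>2_def)
      moreover have "\<rho> (abs_z3z2 (x # u)) = \<rho> (abs_z3z2 [x]) \<cdot> \<rho> (abs_z3z2 u)"
        using rep_mult[OF \<rho>(1), of "abs_z3z2 [x]" "abs_z3z2 u"] abs_z3z2_append[of "[x]" u] by simp
      ultimately show ?case
        using Cons by (simp add: repr_abs iso_of_smul letter_SL3 val_SL3)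
    qed
  qed
qed

end

lemma rotation_polarity_conj:
  assumes "rotation_polarity T h" and g: "g \<in> SL3"
  shows "rotation_polarity (g ** T ** adj g) (g \<star> h)"
proof -
  interpret rotation_polarity T h by fact
  have c: "ct (transpose g) = adj g" by (simp add: ct_def adj_transpose)
  have "(g ** T ** adj g) ** (g ** T ** adj g) ** (g ** T ** adj g) = g ** (T ** (adj g ** (g ** (T ** (adj g ** (g ** (T ** adj g)))))))"
    by (simp add: matrix_mul_assoc)
  also have "\<dots> = g ** ((T ** T ** T) ** adj g)" unfolding SL3_cancel(3)[OF g] by (simp add: matrix_mul_assoc)
  also have "\<dots> = mat 1" using T g by (simp add: SL3_cancel)
  finally have 1: "(g ** T ** adj g) ** (g ** T ** adj g) ** (g ** T ** adj g) = mat 1" .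
  have tc: "transpose g ** ct g = mat 1"
    using SL3_cancel(1)[OF g] by (simp add: ct_def flip: matrix_transpose_mul)
  have "(g \<star> h) ** ct (g \<star> h) = g ** (h ** ((transpose g ** ct g) ** (ct h ** adj g)))"
    by (simp add: ct_mult c matrix_mul_assoc)
  also have "\<dots> = g ** ((h ** ct h) ** adj g)" unfolding tc by (simp add: matrix_mul_assoc)
  also have "\<dots> = mat 1" using h g by (simp add: SL3_cancel)
  finally show ?thesis using 1 T h g by (simp add: rotation_polarity_def SL3_mult SL3_transpose)
qed

lemma repr_conj:
  assumes rp: "rotation_polarity T h" and g: "g \<in> SL3"
  shows "repr (g ** T ** adj g) (g \<star> h) =
    (\<lambda>w. proj_isom g \<cdot> repr T h w \<cdot> iinv (proj_isom g))"
proof -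
  interpret rotation_polarity T h by fact
  interpret c: rotation_polarity "g ** T ** adj g" "g \<star> h" by (rule rotation_polarity_conj[OF assms])
  let ?f = "proj_isom g"
  have f: "?f \<in> IsomX" using g by simp
  have inv: "iinv ?f = proj_isom (adj g)"
    using g by (intro iso.inv_equality) (simp_all add: proj_proj SL3_cancel isom_one)
  have cX: "repr T h w \<in> IsomX" for w by (rule rep_closed[OF repr_hom])
  have "(\<lambda>w. ?f \<cdot> repr T h w \<cdot> iinv ?f) = repr (g ** T ** adj g) (g \<star> h)"
  proof (rule c.repr_unique)
    show "(\<lambda>w. ?f \<cdot> repr T h w \<cdot> iinv ?f) \<in> hom Z3Z2 isom_group"
    proof (rule homI)
      fix x y
      have c: "iinv ?f \<cdot> (?f \<cdot> k) = k" if "k \<in> IsomX" for k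
        using that f by (simp flip: iso.m_assoc)
      show "?f \<cdot> repr T h (x \<otimes>\<^bsub>Z3Z2\<^esub> y) \<cdot> iinv ?f =
        ?f \<cdot> repr T h x \<cdot> iinv ?f \<cdot> (?f \<cdot> repr T h y \<cdot> iinv ?f)"
        using f cX by (simp add: rep_mult[OF repr_hom] Z3Z2_def iso.m_assoc c)
    qed (use f cX in simp)
    have c: "ct (adj g) = transpose g" using g ct_ct[OF SL3_transpose[OF g]] by (simp add: ct_def adj_transpose)
    show "?f \<cdot> repr T h \<sigma>3 \<cdot> iinv ?f = proj_isom (g ** T ** adj g)"
      unfolding inv repr_generators using g T by (simp add: proj_proj SL3_mult)
    show "?f \<cdot> repr T h \<sigma>2 \<cdot> iinv ?f = dual_isom (g \<star> h)"
      unfolding inv repr_generators using g h by (simp add: proj_dual dual_proj SL3_mult c)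
  qed
  then show ?thesis by simp
qed

lemma conj_class_conj:
  assumes \<rho>: "\<And>w. \<rho> w \<in> IsomX" and f: "f \<in> IsomX"
  shows "conj_class (\<lambda>w. f \<cdot> \<rho> w \<cdot> iinv f) = conj_class \<rho>"
proof -
  have sub: "conj_class (\<lambda>w. f \<cdot> \<rho> w \<cdot> iinv f) \<subseteq> conj_class \<rho>" if \<rho>: "\<And>w. \<rho> w \<in> IsomX" and f: "f \<in> IsomX" for \<rho> f
  proof
    fix \<eta> assume "\<eta> \<in> conj_class (\<lambda>w. f \<cdot> \<rho> w \<cdot> iinv f)"
    then obtain k where k: "k \<in> IsomX" "\<eta> = (\<lambda>w. k \<cdot> (f \<cdot> \<rho> w \<cdot> iinv f) \<cdot> iinv k)"
      unfolding conj_class_def by blast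
    have "\<eta> = (\<lambda>w. (k \<cdot> f) \<cdot> \<rho> w \<cdot> iinv (k \<cdot> f))" using k \<rho> f by (simp add: iso.m_assoc iso.inv_mult_group)
    moreover have "k \<cdot> f \<in> IsomX" using k f by simp
    ultimately show "\<eta> \<in> conj_class \<rho>" unfolding conj_class_def by blast
  qed
  have c: "iinv f \<cdot> (f \<cdot> k) = k" if "k \<in> IsomX" for k using that f by (simp flip: iso.m_assoc)
  have "(\<lambda>w. iinv f \<cdot> (f \<cdot> \<rho> w \<cdot> iinv f) \<cdot> iinv (iinv f)) = \<rho>" using \<rho> f by (simp add: iso.m_assoc c)
  then show ?thesis using sub[of \<rho> f] sub[of "\<lambda>w. f \<cdot> \<rho> w \<cdot> iinv f" "iinv f"] \<rho> f by simp
qed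

section \<open>Ping-pong\<close>

text \<open>The polarity exchanges points and lines. A point is near if it is in \<open>A\<close> and far if it is in \<open>B\<close>; a line is near or far if
  its image under the polarity is in \<open>B\<close> or in \<open>A\<close>. The polarity maps near to far, and by \<open>TB\<close> and \<open>TA\<close> both rotations map far to near. A
  product of blocks ends with a rotation applied to something far. It cannot bring a point of \<open>N\<close> back to \<open>N\<close>, as the inverse rotation takes
  points of \<open>N\<close> to points that are not far.\<close>

locale ping_pong = rotation_polarity +
  fixes A B N :: "(real^3) set"
  assumes TB: "\<And>v. v \<in> B \<Longrightarrow> T *v v \<in> A" "\<And>v. v \<in> B \<Longrightarrow> adj T *v v \<in> A"
    and TA: "\<And>v. v \<in> A \<Longrightarrow> (h ** ct T ** ct h) *v v \<in> B" "\<And>v. v \<in> A \<Longrightarrow> (h ** ct (adj T) ** ct h) *v v \<in> B"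
    and N: "N \<subseteq> A" "\<And>v. v \<in> N \<Longrightarrow> T *v v \<notin> B" "\<And>v. v \<in> N \<Longrightarrow> adj T *v v \<notin> B"
    and disj: "A \<inter> B = {}"
begin

definition near :: "(real^3) \<times> bool \<Rightarrow> bool" where
  "near z \<longleftrightarrow> (if snd z then h *v fst z \<in> B else fst z \<in> A)"

definition far :: "(real^3) \<times> bool \<Rightarrow> bool" where
  "far z \<longleftrightarrow> (if snd z then h *v fst z \<in> A else fst z \<in> B)"

definition rot :: "bool \<Rightarrow> mat3" where
  "rot b = (if b then T else adj T)"

lemma rot_SL3: "rot b \<in> SL3"
  using T by (simp add: rot_def)

lemma rot_inverse: "rot (\<not> b) ** rot b = mat 1"
  using T by (simp add: rot_def SL3_cancel)

lemma val_block: "val T h (block b) = smul (rot b, False) (h, True)"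
proof -
  have "adj T ** (T ** (T ** T)) = T ** T" using SL3_cancel(3)[OF T(1)] .
  then have "T ** T = adj T" using T(2) by (simp add: matrix_mul_assoc)
  then show ?thesis by (simp add: block_def rot_def matrix_mul_assoc)
qed

lemma ct_h: "ct h ** h = mat 1"
  using h matrix_left_right_inverse by blast

lemma near_far: "near z \<Longrightarrow> far (act (h, True) z)"
  using h by (cases z) (auto simp: near_def far_def matrix_vector_mul_assoc)

lemma far_near: "far z \<Longrightarrow> near (act (rot b, False) z)"
proof (cases z)
  case (Pair v \<tau>)
  assume f: "far z"
  show ?thesis
  proof (cases \<tau>)
    case False then show ?thesis using f TB Pair by (simp add: near_def far_def rot_def)
  next
    case True
    then have "(h ** ct (rot b) ** ct h) *v (h *v v) \<in> B"
      using f TA Pair by (simp add: far_def rot_def)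
    moreover have "(h ** ct (rot b) ** ct h) *v (h *v v) = h *v (ct (rot b) *v v)"
      using ct_h by (simp add: matrix_vector_mul_assoc flip: matrix_mul_assoc)
    ultimately show ?thesis using True Pair by (simp add: near_def)
  qed
qed

lemma act_block: "act (val T h (block b)) z = act (rot b, False) (act (h, True) z)"
  unfolding val_block using rot_SL3 h by (simp add: act_smul del: act.simps smul.simps)

lemma act_blocks: "act (val T h (blocks (b # bs))) z = act (rot b, False) (act (h, True) (act (val T h (blocks bs)) z))"
  by (simp add: val_append act_smul val_SL3 act_block del: act.simps)

lemma near_blocks: "near z \<Longrightarrow> near (act (val T h (blocks bs)) z)"
proof (induction bs)
  case Nil then show ?case by (cases z; cases "snd z") simp_all
next
  case (Cons b bs) then show ?case unfolding act_blocks by (intro far_near near_far)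
qed

lemma blocks_move:
  assumes p: "p = [] \<or> p = [S2]" "p = [] \<Longrightarrow> bs \<noteq> []" and val: "val T h (p @ blocks bs) = (M, False)" and x: "x \<in> N"
  shows "M *v x \<notin> N"
proof
  assume MN: "M *v x \<in> N"
  have nx: "near (x, False)" using x N(1) by (auto simp: near_def)
  have Mx: "act (val T h (p @ blocks bs)) (x, False) = (M *v x, False)" unfolding val by simp
  show False
  proof (cases "p = []")
    case True
    then obtain b bs' where bs: "bs = b # bs'" using p(2) by (cases bs) auto
    obtain v \<tau> where z: "act (h, True) (act (val T h (blocks bs')) (x, False)) = (v, \<tau>)" by fastforce
    have f: "far (v, \<tau>)" unfolding z[symmetric] by (intro near_far near_blocks nx)
    have "(M *v x, False) = act (rot b, False) (v, \<tau>)"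
      using Mx unfolding True bs append_Nil act_blocks z by (rule HOL.sym)
    then have t: "\<not> \<tau>" and e: "M *v x = rot b *v v" by (cases \<tau>; simp)+
    have "rot (\<not> b) *v (M *v x) = v" unfolding e matrix_vector_mul_assoc rot_inverse by simp
    moreover have "v \<in> B" using f t by (simp add: far_def)
    ultimately have "rot (\<not> b) *v (M *v x) \<in> B" by simp
    moreover have "rot (\<not> b) *v (M *v x) \<notin> B" unfolding rot_def using N(2,3)[OF MN] by (cases b) simp_all
    ultimately show False by blast
  next
    case False
    then have "p = [S2]" using p by blast
    then have "act (val T h (p @ blocks bs)) (x, False) = act (h, True) (act (val T h (blocks bs)) (x, False))"
      using h val_SL3 by (simp add: act_smul del: act.simps)
    then have "far (act (val T h (p @ blocks bs)) (x, False))" using near_far[OF near_blocks[OF nx]] by simp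
    then have "M *v x \<in> B" unfolding Mx by (simp add: far_def)
    then show False using MN N(1) disj by blast
  qed
qed

text \<open>A normal form whose first applied letter is a rotation is conjugated by the polarity first, which replaces \<open>M\<close> by its
  action on lines.\<close>

lemma nontrivial_moves:
  assumes u: "\<not> word_eq u []" and val: "val T h u = (M, False)"
  shows "(\<forall>x\<in>N. M *v x \<notin> N) \<or> (\<forall>x\<in>N. (h ** ct M ** ct h) *v x \<notin> N)"
proof -
  obtain p bs q where p: "p = [] \<or> p = [S2]" and q: "q = [] \<or> q = [S3] \<or> q = [S3, S3]" and uw: "word_eq u (p @ blocks bs @ q)"
    using normal_form[of u] by blast
  have v: "val T h (p @ blocks bs @ q) = (M, False)" using val_weq[OF uw] val by simp
  show ?thesis
  proof (cases "q = []")
    case True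
    have "p = [] \<Longrightarrow> bs \<noteq> []" using u uw True by auto
    then have "val T h (p @ blocks bs) = (M, False)" "p = [] \<Longrightarrow> bs \<noteq> []" using v True by simp_all
    then show ?thesis using blocks_move[OF p] by blast
  next
    case False
    then have "q @ [S2] = block True \<or> q @ [S2] = block False" using q by (auto simp: block_def)
    then obtain b where b: "q @ [S2] = block b" by blast
    have conj: "val T h ([S2] @ (p @ blocks bs @ q) @ [S2]) = (h ** ct M ** ct h, False)"
      unfolding val_append[of "[S2]"] val_append[of _ "[S2]"] v using h by (simp add: matrix_mul_assoc ct_mult)
    have "[S2] @ (p @ blocks bs @ q) @ [S2] = [S2] @ p @ blocks bs @ (q @ [S2])" by simp
    also have "\<dots> = [S2] @ p @ blocks (bs @ [b])" unfolding b by simp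
    finally have e: "[S2] @ (p @ blocks bs @ q) @ [S2] = [S2] @ p @ blocks (bs @ [b])" .
    show ?thesis
    proof (cases "p = []")
      case True
      then have "val T h ([S2] @ blocks (bs @ [b])) = (h ** ct M ** ct h, False)" using conj unfolding e by simp
      then show ?thesis using blocks_move[of "[S2]" "bs @ [b]"] by blast
    next
      case False
      then have "word_eq ([S2] @ p @ blocks (bs @ [b])) ([] @ blocks (bs @ [b]))"
        using p weq_cong[OF word_eq.square weq_refl[of "blocks (bs @ [b])"]] by auto
      from val_weq[OF this] have "val T h ([] @ blocks (bs @ [b])) = (h ** ct M ** ct h, False)"
        using conj unfolding e by simp
      then show ?thesis using blocks_move[of "[]" "bs @ [b]"] by blast
    qed
  qed
qed

end

section \<open>Discreteness\<close>

lemma isom_PiE: "f \<in> IsomX \<Longrightarrow> f \<in> (\<Pi>\<^sub>E P\<in>X. X)"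
  unfolding PiE_def using Bij_imp_funcset[OF IsomX_Bij] Bij_imp_extensional[OF IsomX_Bij] by (intro IntI)

lemma isom_topspace: "topspace isom_topology = IsomX"
  unfolding isom_topology_def using isom_PiE by (auto simp: Int_absorb1)

lemma evaluation_continuous: "P \<in> X \<Longrightarrow> continuous_map isom_topology (top_of_set X) (\<lambda>f. f P)"
  unfolding isom_topology_def
  by (intro continuous_map_from_subtopology continuous_map_product_projection)

lemma open_evaluation_condition:
  fixes F :: "mat3 \<times> mat3 \<Rightarrow> 'a::topological_space"
  assumes F: "continuous_on UNIV F" and W: "open W" and P: "P \<in> X" "Q \<in> X"
  shows "openin isom_topology {f \<in> IsomX. F (f P, f Q) \<in> W}"
proof -
  have e: "continuous_map isom_topology euclidean (\<lambda>f. f R)" if "R \<in> X" for R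
    using evaluation_continuous[OF that] by (simp add: continuous_map_in_subtopology)
  have "continuous_map isom_topology euclidean (F \<circ> (\<lambda>f. (f P, f Q)))"
  proof (rule continuous_map_compose)
    show "continuous_map isom_topology euclidean (\<lambda>f. (f P, f Q))"
      using continuous_map_pairedI[OF e[OF P(1)] e[OF P(2)]] by (simp add: euclidean_product_topology)
    show "continuous_map euclidean euclidean F" using F by simp
  qed
  from openin_continuous_map_preimage[OF this, of W] W show ?thesis unfolding isom_topspace by simp
qed

lemma isometry_continuous:
  assumes "f \<in> IsomX" shows "continuous_map (top_of_set X) (top_of_set X) f"
proof -
  obtain g where g: "g \<in> SL3" "f = proj_isom g \<or> f = dual_isom g" using isometry_classification[OF assms] by blast
  have "continuous_on X (\<lambda>P. g \<star> P)" "continuous_on X (\<lambda>P. g \<star> adj P)"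
    by (intro continuous_intros)+
  then have "continuous_on X f"
    using g continuous_on_cong[OF HOL.refl, of X f] by (auto simp: proj_isom_apply dual_isom_apply)
  then show ?thesis using IsomX_X[OF assms] by (auto simp: continuous_map_in_subtopology)
qed

lemma left_translation_continuous:
  assumes f: "f \<in> IsomX"
  shows "continuous_map isom_topology isom_topology (\<lambda>k. f \<cdot> k)"
proof -
  have "continuous_map isom_topology (product_topology (\<lambda>_. top_of_set X) X) (\<lambda>k. f \<cdot> k)"
    unfolding continuous_map_componentwise
  proof (intro conjI ballI)
    show "(\<lambda>k. f \<cdot> k) ` topspace isom_topology \<subseteq> extensional X"
      using isom_PiE[OF iso.m_closed[OF f]] by (auto simp: isom_topspace PiE_def)
    fix P assume P: "P \<in> X"
    have "continuous_map isom_topology (top_of_set X) (f \<circ> (\<lambda>k. k P))"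
      by (rule continuous_map_compose[OF evaluation_continuous[OF P] isometry_continuous[OF f]])
    then show "continuous_map isom_topology (top_of_set X) (\<lambda>k. (f \<cdot> k) P)"
      by (rule continuous_map_eq) (simp add: isom_topspace isom_mult_apply f P)
  qed
  then show ?thesis
    using f by (subst (2) isom_topology_def) (auto simp: continuous_map_in_subtopology isom_topspace)
qed

text \<open>If \<open>V\<close> contains no nontrivial element of the image, its translates isolate all other elements.\<close>

lemma discrete_faithful:
  assumes \<rho>: "\<rho> \<in> hom Z3Z2 isom_group" and V: "openin isom_topology V" "ione \<in> V"
    and iso: "\<And>w. \<rho> w \<in> V \<Longrightarrow> w = word_one"
  shows "inj \<rho>" "subtopology isom_topology (range \<rho>) = discrete_topology (range \<rho>)"
proof -
  interpret r: group_hom Z3Z2 isom_group \<rho> by (rule rep_group_hom[OF \<rho>])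
  have one: "\<one>\<^bsub>Z3Z2\<^esub> = word_one" and car: "carrier Z3Z2 = UNIV" by (simp_all add: Z3Z2_def)
  have sep: "\<rho> w = \<rho> z" if "iinv (\<rho> w) \<cdot> \<rho> z \<in> V" for w z
  proof -
    have e: "\<rho> (inv\<^bsub>Z3Z2\<^esub> w \<otimes>\<^bsub>Z3Z2\<^esub> z) = iinv (\<rho> w) \<cdot> \<rho> z" by (simp add: car)
    then have "inv\<^bsub>Z3Z2\<^esub> w \<otimes>\<^bsub>Z3Z2\<^esub> z = word_one" using iso that by metis
    then have "iinv (\<rho> w) \<cdot> \<rho> z = ione" using e r.hom_one one by metis
    then show ?thesis using iso.inv_equality[of "iinv (\<rho> w)" "\<rho> z"] rep_closed[OF \<rho>]
      by (metis iso.inv_closed iso.inv_comm iso.inv_inv)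
  qed
  show "inj \<rho>"
  proof (rule r.inj_on_one_iff[THEN iffD2, unfolded car one, rule_format])
    fix w assume "\<rho> w = ione"
    then show "w = word_one" using iso V(2) by simp
  qed
  have "openin (subtopology isom_topology (range \<rho>)) {f}" if "f \<in> range \<rho>" for f
  proof -
    obtain w where w: "f = \<rho> w" using \<open>f \<in> range \<rho>\<close> by blast
    let ?U = "{k \<in> topspace isom_topology. iinv (\<rho> w) \<cdot> k \<in> V}"
    have wX: "\<rho> w \<in> IsomX" by (rule rep_closed[OF \<rho>])
    have "openin isom_topology ?U"
      by (rule openin_continuous_map_preimage[OF left_translation_continuous V(1)]) (use wX in simp)
    moreover have "?U \<inter> range \<rho> = {f}"
      using sep[symmetric] V(2) wX by (auto simp: w isom_topspace)
    ultimately show ?thesis unfolding openin_subtopology by blast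
  qed
  then show "subtopology isom_topology (range \<rho>) = discrete_topology (range \<rho>)"
    using discrete_topology_unique[of "range \<rho>" "subtopology isom_topology (range \<rho>)"] rep_closed[OF \<rho>]
    by (auto simp: isom_topspace)
qed

text \<open>\<open>ell x\<close> is elongated in the direction \<open>x\<close>. Its image, compared with that of the ball, shows where the point \<open>x\<close> is
  mapped.\<close>

definition outer :: "real^3 \<Rightarrow> mat3" where "outer x = (\<chi> i j. x$i * x$j)"

definition ell :: "real^3 \<Rightarrow> mat3" where
  "ell x = (1 / root 3 (1 + x \<bullet> x)) *\<^sub>R (mat 1 + outer x)"

definition probe :: "real^3 \<Rightarrow> mat3 \<times> mat3 \<Rightarrow> real^3" where
  "probe x = (\<lambda>(P, Q). root 3 (1 + x \<bullet> x) *\<^sub>R ((P ** adj Q) *v x) - x)"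

lemma one_plus_norm: "1 + x \<bullet> x > 0" for x :: "real^3"
  using inner_ge_zero[of x] by linarith

lemma outer_vec: "outer x *v v = (x \<bullet> v) *\<^sub>R x"
  by (simp add: outer_def vec3_eq_iff vmult3 inner3 algebra_simps)

lemma ell_X: "ell x \<in> X"
proof (rule positive_definite_in_X)
  have r: "root 3 (1 + x \<bullet> x) > 0" using one_plus_norm by simp
  show "transpose (ell x) = ell x" by (simp add: ell_def mat3_eq_iff outer_def mat1_entry)
  have "det (mat 1 + outer x) = 1 + x \<bullet> x" by (simp add: det_3 mat1_entry outer_def inner3 algebra_simps)
  then show "det (ell x) = 1" using r one_plus_norm[of x]
    by (simp add: ell_def det_scaleR power_divide real_root_pow_pos2 order.strict_implies_order)
  show "v \<bullet> (ell x *v v) > 0" if "v \<noteq> 0" for v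
  proof -
    have "v \<bullet> (ell x *v v) = (v \<bullet> v + (x \<bullet> v)\<^sup>2) / root 3 (1 + x \<bullet> x)"
      by (simp add: ell_def scaleR_matrix_vector_assoc[symmetric] matrix_vector_mult_add_rdistrib outer_vec inner_add_right
          power2_eq_square inner_commute)
    moreover have "v \<bullet> v + (x \<bullet> v)\<^sup>2 > 0" using that by (simp add: add_pos_nonneg)
    ultimately show ?thesis using r by simp
  qed
qed

text \<open>\<open>probe\<close> recovers \<open>M x x\<^sup>T M\<^sup>-\<^sup>1\<close> from the images of \<open>ell x\<close> and the ball under \<open>M\<close> and applies it to \<open>x\<close>, so its value is a
  multiple of \<open>M x\<close>.\<close>

lemma probe_conj:
  assumes M: "M \<in> SL3"
  shows "probe x (M \<star> ell x, M ** transpose M) = (x \<bullet> (adj M *v x)) *\<^sub>R (M *v x)"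
proof -
  have r: "root 3 (1 + x \<bullet> x) > 0" using one_plus_norm by simp
  have t: "transpose M ** adj (transpose M) = mat 1" using SL3_cancel(2)[OF SL3_transpose[OF M]] .
  have "M \<star> ell x ** adj (M ** transpose M) = M ** ell x ** (transpose M ** adj (transpose M)) ** adj M"
    by (simp add: adj_mat_mult matrix_mul_assoc)
  then have e: "M \<star> ell x ** adj (M ** transpose M) = M ** ell x ** adj M" unfolding t by simp
  have "M ** ell x ** adj M *v x = M *v (ell x *v (adj M *v x))" by (simp add: matrix_vector_mul_assoc matrix_mul_assoc)
  also have "ell x *v (adj M *v x) = (1 / root 3 (1 + x \<bullet> x)) *\<^sub>R (adj M *v x + (x \<bullet> (adj M *v x)) *\<^sub>R x)"
    by (simp add: ell_def scaleR_matrix_vector_assoc[symmetric] matrix_vector_mult_add_rdistrib outer_vec)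
  also have "M *v \<dots> = (1 / root 3 (1 + x \<bullet> x)) *\<^sub>R (M *v (adj M *v x) + (x \<bullet> (adj M *v x)) *\<^sub>R (M *v x))"
    by (simp add: matrix_vector_mult_scaleR matrix_vector_right_distrib)
  also have "M *v (adj M *v x) = x" using SL3_cancel(2)[OF M] by (simp add: matrix_vector_mul_assoc)
  finally show ?thesis unfolding probe_def using r e by (simp add: algebra_simps)
qed

lemma continuous_on_mat_vec:
  fixes A :: "'a::topological_space \<Rightarrow> mat3"
  assumes "continuous_on S A" "continuous_on S f"
  shows "continuous_on S (\<lambda>t. A t *v f t)"
  unfolding matrix_vector_mult_def
  by (intro continuous_on_vec_lambda continuous_on_sum continuous_on_mult continuous_on_component assms)

lemma continuous_probe: "continuous_on UNIV (probe x)"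
proof -
  have "continuous_on UNIV (\<lambda>z. root 3 (1 + x \<bullet> x) *\<^sub>R ((fst z ** adj (snd z)) *v x) - x)"
    by (intro continuous_intros continuous_on_mat_vec)
  then show ?thesis by (simp add: probe_def case_prod_beta')
qed

lemma ell_dual: "adj (ell x) \<in> X" "adj (adj (ell x)) = ell x"
  using X_adj[OF ell_X] X_det[OF ell_X] by (simp_all add: adj_adj)

text \<open>The topology on isometries is that of pointwise convergence on \<open>X\<close>. Three conditions on the images of finitely many
  ellipsoids keep dualities away and control the motion of the point \<open>x\<close> and of the corresponding line.\<close>

lemma separating_neighbourhood:
  assumes N: "open N" "x \<in> N" "\<And>k v. k \<noteq> 0 \<Longrightarrow> k *\<^sub>R v \<in> N \<longleftrightarrow> v \<in> N" "0 \<notin> N"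
    and h: "h \<in> SL3" "h ** ct h = mat 1"
  shows "\<exists>V. openin isom_topology V \<and> ione \<in> V \<and>
    (\<forall>f\<in>V. \<exists>M\<in>SL3. f = proj_isom M \<and> M *v x \<in> N \<and> (h ** ct M ** ct h) *v x \<in> N)"
proof -
  define y where "y = ct h *v x"
  \<comment> \<open>The traces of \<open>P0\<close> and of its dual are \<open>8 + 1/16\<close> and \<open>33/2\<close>, so the bound 10 below separates them.\<close>
  define P0 :: mat3 where "P0 = m3 4 0 0 0 4 0 0 0 (1/16)"
  have P0: "P0 \<in> X"
  proof -
    have "P0 = m3 2 0 0 0 2 0 0 0 (1/4) ** transpose (m3 2 0 0 0 2 0 0 0 (1/4))"
      by (simp add: P0_def mat3_eq_iff mult3)
    moreover have "m3 2 0 0 0 2 0 0 0 (1/4) \<in> SL3" by (simp add: SL3_def det_3)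
    ultimately show ?thesis unfolding X_def by blast
  qed
  define V where "V = {f \<in> IsomX. probe x (f (ell x), f (mat 1)) \<in> N} \<inter>
     {f \<in> IsomX. h *v probe y (adj (f (adj (ell y))), adj (f (mat 1))) \<in> N} \<inter>
     {f \<in> IsomX. trace (f P0 ** adj (f (mat 1))) < 10}"
  have hy: "h *v y = x" using h by (simp add: y_def matrix_vector_mul_assoc)
  have x0: "x \<noteq> 0" "y \<noteq> 0" using N(2,4) hy by auto
  have adj1: "adj (mat 1) = (mat 1 :: mat3)" by (simp add: adj_def mat3_eq_iff mat1_entry)
  show ?thesis
  proof (intro exI[of _ V] conjI ballI)
    have 1: "openin isom_topology {f \<in> IsomX. probe x (f (ell x), f (mat 1)) \<in> N}"
      by (rule open_evaluation_condition[OF continuous_probe N(1) ell_X one_in_X])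
    have "openin isom_topology {f \<in> IsomX. (\<lambda>z. h *v probe y (adj (fst z), adj (snd z))) (f (adj (ell y)), f (mat 1)) \<in> N}"
    proof (rule open_evaluation_condition[OF _ N(1) ell_dual(1) one_in_X])
      have "continuous_on UNIV (\<lambda>z :: mat3 \<times> mat3. probe y (adj (fst z), adj (snd z)))"
        by (rule continuous_on_compose2[OF continuous_probe]) (auto intro!: continuous_intros)
      then show "continuous_on UNIV (\<lambda>z :: mat3 \<times> mat3. h *v probe y (adj (fst z), adj (snd z)))"
        by (intro continuous_on_mat_vec continuous_on_const)
    qed
    moreover have "openin isom_topology {f \<in> IsomX. (\<lambda>z. trace (fst z ** adj (snd z))) (f P0, f (mat 1)) \<in> {..<10}}"
      by (rule open_evaluation_condition[OF _ open_lessThan P0 one_in_X]) (intro continuous_intros)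
    ultimately show "openin isom_topology V" using 1 unfolding V_def by (auto intro!: openin_Int)
    have one: "ione P = P" if "P \<in> X" for P using that by (simp add: isom_one proj_isom_apply)
    have pr: "probe z (ell z, mat 1) = (z \<bullet> z) *\<^sub>R z" for z using probe_conj[OF SL3_one, of z] by (simp add: adj1)
    show "ione \<in> V"
      unfolding V_def using N(2,3) x0 P0 one_in_X ell_X ell_dual
      by (simp add: one pr adj1 hy matrix_vector_mult_scaleR) (simp add: P0_def trace3)
    fix f assume f: "f \<in> V"
    then have fX: "f \<in> IsomX" by (simp add: V_def)
    have "\<exists>M\<in>SL3. f = proj_isom M"
      using fX
    proof (cases rule: IsomX_cases)
      case (dual M)
      have t: "transpose M ** adj (transpose M) = mat 1" using SL3_cancel(2)[OF SL3_transpose[OF dual(1)]] .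
      have "f P0 ** adj (f (mat 1)) = M ** adj P0 ** (transpose M ** adj (transpose M)) ** adj M"
        using dual P0 one_in_X by (simp add: dual_isom_apply adj1 adj_mat_mult matrix_mul_assoc)
      then have "trace (f P0 ** adj (f (mat 1))) = trace (M ** adj P0 ** adj M)" unfolding t by simp
      also have "\<dots> = trace (adj P0 ** adj M ** M)" by (simp add: trace_mul_sym[of M] flip: matrix_mul_assoc)
      also have "\<dots> = trace (adj P0)" using SL3_cancel(1)[OF dual(1)] by (simp flip: matrix_mul_assoc)
      also have "\<dots> = 33 / 2" by (simp add: P0_def adj_def trace3)
      finally show ?thesis using f by (simp add: V_def)
    qed blast
    then obtain M where M: "M \<in> SL3" "f = proj_isom M" by blast
    have "probe x (f (ell x), f (mat 1)) \<in> N" using f by (simp add: V_def)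
    then have "(x \<bullet> (adj M *v x)) *\<^sub>R (M *v x) \<in> N"
      using M ell_X one_in_X by (simp add: proj_isom_apply probe_conj)
    then have 1: "M *v x \<in> N" using N(3,4) by (metis scaleR_zero_left)
    have "h *v probe y (adj (f (adj (ell y))), adj (f (mat 1))) \<in> N" using f by (simp add: V_def)
    moreover have "adj (f (adj (ell y))) = ct M ** ell y ** transpose (ct M)" "adj (f (mat 1)) = ct M ** transpose (ct M)"
      using M ell_dual one_in_X adj_conj[of M "mat 1"] by (simp_all add: proj_isom_apply adj_conj adj1)
    ultimately have "h *v ((y \<bullet> (adj (ct M) *v y)) *\<^sub>R (ct M *v y)) \<in> N" using M by (simp add: probe_conj)
    then have "(y \<bullet> (adj (ct M) *v y)) *\<^sub>R (h *v (ct M *v y)) \<in> N" by (simp add: matrix_vector_mult_scaleR)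
    then have "h *v (ct M *v y) \<in> N" using N(3,4) by (metis scaleR_zero_left)
    then have "(h ** ct M ** ct h) *v x \<in> N" by (simp add: y_def matrix_vector_mul_assoc matrix_mul_assoc)
    then show "\<exists>M\<in>SL3. f = proj_isom M \<and> M *v x \<in> N \<and> (h ** ct M ** ct h) *v x \<in> N" using M 1 by blast
  qed
qed

text \<open>Conjugating by \<open>g\<close> with \<open>h = g g\<^sup>T\<close> gives the standard polarity, and a positive definite matrix that is its own inverse is 1.\<close>

lemma polarity_fixed_point:
  assumes h: "h \<in> X" shows "\<exists>!P. P \<in> X \<and> dual_isom h P = P"
proof -
  obtain g where g: "g \<in> SL3" "h = g ** transpose g" using h unfolding X_def by blast
  have hS: "h \<in> SL3" using X_det[OF h] by (simp add: SL3_def)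
  show ?thesis
  proof (rule ex1I[of _ h])
    show "h \<in> X \<and> dual_isom h h = h" using h hS X_symmetric[OF h] by (simp add: dual_isom_apply SL3_cancel)
    fix P assume P: "P \<in> X \<and> dual_isom h P = P"
    define Q where "Q = adj g ** P ** transpose (adj g)"
    have Q: "Q \<in> X" using P g X_act[of P "adj g"] by (simp add: Q_def)
    have P_Q: "P = g \<star> Q"
    proof -
      have "g \<star> Q = (g ** adj g) \<star> P"
        by (simp add: Q_def matrix_mul_assoc matrix_transpose_mul)
      then show ?thesis using g by (simp add: SL3_cancel)
    qed
    have a: "transpose g ** ct g = mat 1" using SL3_cancel(1)[OF g(1)] by (simp add: ct_def flip: matrix_transpose_mul)
    have b: "transpose (ct g) ** g = mat 1" using SL3_cancel(1)[OF g(1)] by (simp add: ct_def)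
    have "P = h \<star> adj P" using P dual_isom_apply[OF hS, of P] by metis
    also have "\<dots> = g ** (transpose g ** ct g) ** adj Q ** (transpose (ct g) ** g) ** transpose g"
      unfolding P_Q adj_conj g(2) by (simp add: matrix_mul_assoc matrix_transpose_mul)
    finally have "g \<star> Q = g \<star> adj Q" unfolding a b P_Q by simp
    then have "g ** Q = g ** adj Q"
      using g matrix_cancel_right[of "transpose g" "g ** Q" "g ** adj Q"] by (simp add: SL3_def)
    then have "Q = adj Q" using g matrix_cancel_left[of g Q "adj Q"] by (simp add: SL3_def)
    then have QQ: "Q ** Q = mat 1" using adj_mult(1)[of Q] X_det[OF Q] by simp
    have "Q *v w = w" for w
    proof (rule ccontr)
      assume ne: "Q *v w \<noteq> w"
      define v where "v = Q *v w - w"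
      have "Q *v v = - v" using QQ by (simp add: v_def matrix_vector_mult_diff_distrib matrix_vector_mul_assoc)
      then have "v \<bullet> (Q *v v) = - (v \<bullet> v)" by simp
      then show False using X_positive[OF Q, of v] ne inner_ge_zero[of v] by (auto simp: v_def[symmetric]) (simp add: v_def)
    qed
    then have "Q = mat 1" by (simp add: matrix_eq)
    then show "P = h" using P_Q g by simp
  qed
qed

text \<open>Elements close to the identity do not move the open cone \<open>N\<close> off itself, neither by their action on points nor by that on
  lines, but nontrivial elements of the image do one of the two.\<close>

lemma ping_pong_df:
  assumes "ping_pong T h A B N" and hX: "h \<in> X"
    and C: "open N" "N \<noteq> {}" "\<And>k v. k \<noteq> 0 \<Longrightarrow> k *\<^sub>R v \<in> N \<longleftrightarrow> v \<in> N" "0 \<notin> N"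
  shows "repr T h \<in> df_reps"
proof -
  interpret ping_pong T h A B N by fact
  obtain x where x: "x \<in> N" using C(2) by blast
  obtain V where V: "openin isom_topology V" "ione \<in> V"
    "\<And>f. f \<in> V \<Longrightarrow> \<exists>M\<in>SL3. f = proj_isom M \<and> M *v x \<in> N \<and> (h ** ct M ** ct h) *v x \<in> N"
    using separating_neighbourhood[OF C(1) x C(3,4) h] by blast
  have "w = word_one" if "repr T h w \<in> V" for w
    using that
  proof (induction w rule: z3z2.abs_induct)
    fix u assume u: "repr T h (abs_z3z2 u) \<in> V"
    obtain M where M: "M \<in> SL3" "repr T h (abs_z3z2 u) = proj_isom M" "M *v x \<in> N" "(h ** ct M ** ct h) *v x \<in> N"
      using V(3)[OF u] by blast
    obtain a \<sigma> where a: "val T h u = (a, \<sigma>)" by fastforce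
    have aS: "a \<in> SL3" using val_SL3[of u] a by simp
    have "iso_of (a, \<sigma>) = proj_isom M" using M(2) a by (simp add: repr_abs)
    then have "\<not> \<sigma>" "a = M" using proj_not_dual[OF M(1) aS] proj_inj[OF aS M(1)] by (auto split: if_splits)
    then have "val T h u = (M, False)" using a by simp
    then have "word_eq u []" using nontrivial_moves[of u M] M(3,4) x by blast
    then show "abs_z3z2 u = word_one" by (simp add: word_one_def z3z2.abs_eq_iff)
  qed
  from discrete_faithful[OF repr_hom V(1,2) this]
  show ?thesis using repr_hom repr_generators polarity_fixed_point[OF hX] by (simp add: df_reps_def)
qed

section \<open>The representations of the standard marked boxes\<close>

text \<open>Coordinates in which the box is the square with corners \<open>(\<plusminus>1, \<plusminus>1)\<close> in the affine plane of height 1, with top \<open>(t, 1)\<close> and bottom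
  \<open>(b, -1)\<close>. \<open>rotm\<close> is the rotation \<open>T\<^sub>M\<close> and \<open>polm\<close> the inverse of the polarity \<open>\<delta>\<^sub>M\<close>, up to scaling.\<close>

definition rotm :: "real \<Rightarrow> real \<Rightarrow> mat3" where
  "rotm t b = m3
     (2 * (1 - t*b)) (- (1 - t*t) * b - 2 * (t - b)) (- (1 - t*t) * b)
     (2 * (t - b)) (1 - t*t - 2 * (1 - t*b)) (1 - t*t)
     (2 * (t - b)) (- (1 - t*t) - 2 * (1 - t*b)) (- (1 - t*t))"

definition polm :: "real \<Rightarrow> real \<Rightarrow> mat3" where
  "polm t b = m3 2 (b - t) (- (t + b)) (b - t) (1 - t*b) 0 (- (t + b)) 0 (1 + t*b)"

text \<open>Normalization to determinant 1; a real cube root exists for negative determinants, too.\<close>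

definition unim :: "mat3 \<Rightarrow> mat3" where
  "unim A = (1 / root 3 (det A)) *\<^sub>R A"

definition box_rot :: "real \<Rightarrow> real \<Rightarrow> mat3" where "box_rot t b = unim (rotm t b)"

definition box_pol :: "real \<Rightarrow> real \<Rightarrow> mat3" where "box_pol t b = adj (unim (polm t b))"

text \<open>The corners of the box, its centre \<open>vc\<close>, top and bottom, and the two points \<open>vu\<close>, \<open>vv\<close> of Pappus' configuration.\<close>

definition vp :: "real^3" where "vp = vector [-1, 1, 1]"
definition vq :: "real^3" where "vq = vector [1, 1, 1]"
definition vr :: "real^3" where "vr = vector [1, -1, 1]"
definition vs :: "real^3" where "vs = vector [-1, -1, 1]"
definition vc :: "real^3" where "vc = vector [0, 0, 1]"
definition vt :: "real \<Rightarrow> real^3" where "vt t = vector [t, 1, 1]"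
definition vb :: "real \<Rightarrow> real^3" where "vb b = vector [b, -1, 1]"
definition vu :: "real \<Rightarrow> real \<Rightarrow> real^3" where "vu t b = vector [1 - t*b, t - b, 2 - t - b]"
definition vv :: "real \<Rightarrow> real \<Rightarrow> real^3" where "vv t b = vector [- (1 - t*b), - (t - b), 2 + t + b]"

lemmas vdefs = vp_def vq_def vr_def vs_def vc_def vt_def vb_def vu_def vv_def

lemma rotm_images:
  "rotm t b *v vp = (- 2 * (1 + t)) *\<^sub>R vu t b" "rotm t b *v vq = (- 2 * (1 - t)) *\<^sub>R vv t b"
  "rotm t b *v vr = (2 * (1 + t) * (1 - b)) *\<^sub>R vq" "rotm t b *v vs = (2 * (1 - t) * (1 + b)) *\<^sub>R vp"
  "rotm t b *v vu t b = (- 2 * (1 - t) * (1 + t) * (1 - b)) *\<^sub>R vs"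
  "rotm t b *v vv t b = (- 2 * (1 - t) * (1 + t) * (1 + b)) *\<^sub>R vr"
  "rotm t b *v vt t = (- 4 * (1 - t) * (1 + t)) *\<^sub>R vc" "rotm t b *v vc = (- (1 - t) * (1 + t)) *\<^sub>R vb b"
  "rotm t b *v vb b = (2 * (1 - b) * (1 + b)) *\<^sub>R vt t"
  by (simp_all add: vec3_eq_iff vmult3 rotm_def vdefs) (algebra+)?

lemma det_rotm: "det (rotm t b) = 8 * ((1 - t) * (1 + t))\<^sup>2 * ((1 - b) * (1 + b))"
  by (simp add: det_3 rotm_def) algebra

lemma det_polm: "det (polm t b) = 2 * ((1 - t) * (1 + t)) * ((1 - b) * (1 + b))"
  by (simp add: det_3 polm_def) algebra

lemma rotm_cube: "rotm t b ** rotm t b ** rotm t b = det (rotm t b) *\<^sub>R mat 1"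
  unfolding det_rotm by (simp add: mat3_eq_iff mult3 rotm_def mat1_entry) (intro conjI; algebra)

lemma adj_rotm_images:
  "adj (rotm t b) *v vp = (4 * (1 - t) * (1 + t) * (1 + t) * (1 - b)) *\<^sub>R vs"
  "adj (rotm t b) *v vq = (4 * (1 - t) * (1 + t) * (1 - t) * (1 + b)) *\<^sub>R vr"
  "adj (rotm t b) *v vr = (- 4 * (1 - t) * (1 + t) * (1 - b)) *\<^sub>R vv t b"
  "adj (rotm t b) *v vs = (- 4 * (1 - t) * (1 + t) * (1 + b)) *\<^sub>R vu t b"
  by (simp_all add: vec3_eq_iff vmult3 rotm_def adj_def vdefs) (intro conjI; algebra)+

definition J :: mat3 where "J = m3 1 0 0 0 0 (-1) 0 1 0"

text \<open>The polarity conjugates the rotation of \<open>(t, b)\<close> to a map which is, up to the symmetry \<open>J\<close>, the rotation of \<open>(b, - t)\<close>.\<close>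

lemma rotm_duality:
  "transpose (rotm t b) ** polm t b ** J ** rotm b (- t) = (4 * ((1 - t) * (1 + t)) * ((1 - b) * (1 + b))) *\<^sub>R (polm t b ** J)"
  by (simp add: mat3_eq_iff mult3 rotm_def polm_def J_def) (intro conjI; algebra)

lemma unim_SL3: "det A \<noteq> 0 \<Longrightarrow> unim A \<in> SL3"
  by (simp add: SL3_def unim_def det_scaleR power_divide odd_real_root_pow)

lemma unim_vec: "unim A *v v = (1 / root 3 (det A)) *\<^sub>R (A *v v)"
  by (simp add: unim_def scaleR_matrix_vector_assoc)

definition regA :: "(real^3) set" where "regA = {v. \<bar>v$1\<bar> < \<bar>v$3\<bar> \<and> \<bar>v$2\<bar> < \<bar>v$3\<bar>}"
definition regB :: "(real^3) set" where "regB = {v. \<bar>v$1\<bar> < \<bar>v$2\<bar> \<and> \<bar>v$3\<bar> < \<bar>v$2\<bar>}"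

lemma reg_scale: "k \<noteq> 0 \<Longrightarrow> k *\<^sub>R v \<in> regA \<longleftrightarrow> v \<in> regA" "k \<noteq> 0 \<Longrightarrow> k *\<^sub>R v \<in> regB \<longleftrightarrow> v \<in> regB"
  by (simp_all add: regA_def regB_def abs_mult)

definition incone :: "real^3 \<Rightarrow> bool" where
  "incone v \<longleftrightarrow> \<bar>v$1\<bar> \<le> v$3 \<and> \<bar>v$2\<bar> \<le> v$3"

text \<open>\<open>regB\<close> is the union of the open cone on \<open>vp\<close>, \<open>vq\<close>, \<open>- vr\<close>, \<open>- vs\<close> and its negative, so it suffices to
  look at the images of the corners. They may lie on the boundary of the target, but one of them is inside.\<close>

lemma corner_images:
  assumes c: "incone (N *v vp)" "incone (N *v vq)" "incone (- (N *v vr))" "incone (- (N *v vs))"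
    and strict: "w \<in> {N *v vp, - (N *v vr)}" "\<bar>w$1\<bar> < w$3" "\<bar>w$2\<bar> < w$3" and v: "v \<in> regB"
  shows "N *v v \<in> regA"
proof -
  have pos: "N *v v \<in> regA" if v: "\<bar>v$1\<bar> < v$2" "\<bar>v$3\<bar> < v$2" for v
  proof -
    define wp wq wr ws where "wp = (v$2 - v$1) * (v$2 + v$3)" and "wq = (v$2 + v$1) * (v$2 + v$3)"
      and "wr = (v$2 - v$1) * (v$2 - v$3)" and "ws = (v$2 + v$1) * (v$2 - v$3)"
    have w: "wp > 0" "wq > 0" "wr > 0" "ws > 0" using v by (simp_all add: wp_def wq_def wr_def ws_def)
    have e: "4 * v$2 * (N *v v)$i = wp * (N *v vp)$i + wq * (N *v vq)$i + wr * (- (N *v vr))$i + ws * (- (N *v vs))$i" for i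
      by (simp add: vmult3 vdefs wp_def wq_def wr_def ws_def algebra_simps)
    have key: "\<sigma> * (4 * v$2 * (N *v v)$i) < 4 * v$2 * (N *v v)$3" if s: "\<sigma> = 1 \<or> \<sigma> = -1" and i: "i = 1 \<or> i = 2" for \<sigma> i
    proof -
      define d where "d x = x$3 - \<sigma> * x$i" for x :: "real^3"
      have dn: "d x \<ge> 0" if "incone x" for x using that s i by (auto simp: d_def incone_def)
      have "d w > 0" using strict s i by (auto simp: d_def)
      then have "d (N *v vp) > 0 \<or> d (- (N *v vr)) > 0" using strict(1) by auto
      then have "wp * d (N *v vp) > 0 \<or> wr * d (- (N *v vr)) > 0" using w by auto
      moreover have "wp * d (N *v vp) \<ge> 0" "wq * d (N *v vq) \<ge> 0" "wr * d (- (N *v vr)) \<ge> 0" "ws * d (- (N *v vs)) \<ge> 0"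
        using dn c w by simp_all
      ultimately have "wp * d (N *v vp) + wq * d (N *v vq) + wr * d (- (N *v vr)) + ws * d (- (N *v vs)) > 0" by linarith
      also have "wp * d (N *v vp) + wq * d (N *v vq) + wr * d (- (N *v vr)) + ws * d (- (N *v vs)) = 4 * v$2 * (N *v v)$3 - \<sigma> * (4 * v$2 * (N *v v)$i)"
        unfolding e d_def by (simp add: algebra_simps)
      finally show ?thesis by simp
    qed
    have "v$2 > 0" using v by linarith
    then have "\<sigma> * (N *v v)$i < (N *v v)$3" if "\<sigma> = 1 \<or> \<sigma> = -1" "i = 1 \<or> i = 2" for \<sigma> i
      using key[OF that] by (simp add: mult.left_commute)
    from this[of 1 1] this[of "-1" 1] this[of 1 2] this[of "-1" 2] show ?thesis by (simp add: regA_def) linarith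
  qed
  show ?thesis
  proof (cases "v$2 > 0")
    case True then show ?thesis using v by (intro pos) (simp_all add: regB_def)
  next
    case False
    then have "N *v (- v) \<in> regA" using v by (intro pos) (auto simp: regB_def)
    moreover have "N *v (- v) = - (N *v v)" by (simp add: vec3_eq_iff vmult3)
    ultimately show ?thesis using reg_scale(1)[of "-1" "N *v v"] by simp
  qed
qed

locale marked_square =
  fixes t b :: real
  assumes tb: "- 1 < t" "t < 1" "- 1 < b" "b < 1"
begin

lemma pos: "1 - t > 0" "1 + t > 0" "1 - b > 0" "1 + b > 0"
  using tb by simp_all

lemma pos2: "(1 - t) * (1 - b) > 0" "(1 - t) * (1 + b) > 0" "(1 + t) * (1 - b) > 0" "(1 + t) * (1 + b) > 0"
  using pos by simp_all

lemma det_rotm_pos: "det (rotm t b) > 0" and det_polm_pos: "det (polm t b) > 0"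
  using pos by (simp_all add: det_rotm det_polm)

lemma vu_cone: "\<bar>(vu t b)$1\<bar> < (vu t b)$3" "\<bar>(vu t b)$2\<bar> < (vu t b)$3"
  and vv_cone: "\<bar>(vv t b)$1\<bar> < (vv t b)$3" "\<bar>(vv t b)$2\<bar> < (vv t b)$3"
  using pos pos2 by (simp_all add: vdefs abs_less_iff algebra_simps)

lemma incone_scale: "k \<ge> 0 \<Longrightarrow> incone v \<Longrightarrow> incone (k *\<^sub>R v)"
  by (simp add: incone_def abs_mult mult_left_mono)

lemma incone_corners: "incone vp" "incone vq" "incone vr" "incone vs" "incone (vu t b)" "incone (vv t b)"
  using vu_cone vv_cone by (auto simp: incone_def vp_def vq_def vr_def vs_def)

lemma rotm_regB: assumes v: "v \<in> regB" shows "rotm t b *v v \<in> regA"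
proof -
  have n: "(- rotm t b) *v x = - (rotm t b *v x)" for x
    by (simp add: vec3_eq_iff vmult3)
  have "(- rotm t b) *v v \<in> regA"
  proof (rule corner_images[where w = "(2 * (1 + t)) *\<^sub>R vu t b"])
    show "(2 * (1 + t)) *\<^sub>R vu t b \<in> {- rotm t b *v vp, - (- rotm t b *v vr)}" unfolding n rotm_images by (simp only: scaleR_minus_left minus_minus mult_minus_left insert_iff simp_thms)
    show "\<bar>((2 * (1 + t)) *\<^sub>R vu t b) $ 1\<bar> < ((2 * (1 + t)) *\<^sub>R vu t b) $ 3"
      "\<bar>((2 * (1 + t)) *\<^sub>R vu t b) $ 2\<bar> < ((2 * (1 + t)) *\<^sub>R vu t b) $ 3"
      unfolding vector_scaleR_component real_scaleR_def abs_mult using vu_cone pos by simp_all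
    have "incone ((2 * (1 + t)) *\<^sub>R vu t b)" "incone ((2 * (1 - t)) *\<^sub>R vv t b)"
      "incone ((2 * (1 + t) * (1 - b)) *\<^sub>R vq)" "incone ((2 * (1 - t) * (1 + b)) *\<^sub>R vp)"
      using pos by (intro incone_scale incone_corners; simp)+
    then show "incone (- rotm t b *v vp)" "incone (- rotm t b *v vq)" "incone (- (- rotm t b *v vr))" "incone (- (- rotm t b *v vs))"
      unfolding n rotm_images by (simp_all only: scaleR_minus_left minus_minus mult_minus_left)
  qed (rule v)
  then show ?thesis unfolding n using reg_scale(1)[of "-1" "rotm t b *v v"] by simp
qed

lemma adj_rotm_regB: assumes v: "v \<in> regB" shows "adj (rotm t b) *v v \<in> regA"
proof (rule corner_images[where w = "(4 * (1 - t) * (1 + t) * (1 - b)) *\<^sub>R vv t b"])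
  have k: "4 * (1 - t) * (1 + t) * (1 - b) > 0" using pos by simp
  show "(4 * (1 - t) * (1 + t) * (1 - b)) *\<^sub>R vv t b \<in> {adj (rotm t b) *v vp, - (adj (rotm t b) *v vr)}"
    unfolding adj_rotm_images by (simp only: scaleR_minus_left minus_minus mult_minus_left insert_iff simp_thms)
  show "\<bar>((4 * (1 - t) * (1 + t) * (1 - b)) *\<^sub>R vv t b) $ 1\<bar> < ((4 * (1 - t) * (1 + t) * (1 - b)) *\<^sub>R vv t b) $ 3"
    "\<bar>((4 * (1 - t) * (1 + t) * (1 - b)) *\<^sub>R vv t b) $ 2\<bar> < ((4 * (1 - t) * (1 + t) * (1 - b)) *\<^sub>R vv t b) $ 3"
    unfolding vector_scaleR_component real_scaleR_def abs_mult[of "4 * (1 - t) * (1 + t) * (1 - b)"] abs_of_pos[OF k]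
    by (intro mult_strict_left_mono vv_cone k)+
  have "incone ((4 * (1 - t) * (1 + t) * (1 + t) * (1 - b)) *\<^sub>R vs)"
    "incone ((4 * (1 - t) * (1 + t) * (1 - t) * (1 + b)) *\<^sub>R vr)"
    "incone ((4 * (1 - t) * (1 + t) * (1 - b)) *\<^sub>R vv t b)" "incone ((4 * (1 - t) * (1 + t) * (1 + b)) *\<^sub>R vu t b)"
    using pos by (intro incone_scale incone_corners; simp)+
  then show "incone (adj (rotm t b) *v vp)" "incone (adj (rotm t b) *v vq)" "incone (- (adj (rotm t b) *v vr))" "incone (- (adj (rotm t b) *v vs))"
    unfolding adj_rotm_images by (simp_all only: scaleR_minus_left minus_minus mult_minus_left)
qed (rule v)

text \<open>Points of \<open>regA\<close> that neither rotation brings into \<open>regB\<close>. A strict inequality between two coordinates of the image makes this an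
  open condition.\<close>

definition moved :: "(real^3) set" where
  "moved = {v \<in> regA. \<bar>(rotm t b *v v)$2\<bar> < \<bar>(rotm t b *v v)$1\<bar> \<and> \<bar>(adj (rotm t b) *v v)$2\<bar> < \<bar>(adj (rotm t b) *v v)$1\<bar>}"

lemma open_moved: "open moved"
proof -
  have "continuous_on UNIV (\<lambda>v. (M *v v) $ i)" for M :: mat3 and i
    by (intro continuous_on_component continuous_on_mat_vec continuous_on_const continuous_on_id)
  then show ?thesis unfolding moved_def regA_def
    by (auto intro!: open_Collect_conj open_Collect_less continuous_intros)
qed

text \<open>The condition holds at the boundary point \<open>(1, 0, 1)\<close> of \<open>regA\<close>, hence at points of \<open>regA\<close> close to it.\<close>

lemma moved_nonempty: "moved \<noteq> {}"
proof -
  let ?W = "{v. \<bar>(rotm t b *v v)$2\<bar> < \<bar>(rotm t b *v v)$1\<bar> \<and> \<bar>(adj (rotm t b) *v v)$2\<bar> < \<bar>(adj (rotm t b) *v v)$1\<bar>}"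
  have "continuous_on UNIV (\<lambda>v. (M *v v) $ i)" for M :: mat3 and i
    by (intro continuous_on_component continuous_on_mat_vec continuous_on_const continuous_on_id)
  then have W: "open ?W" by (auto intro!: open_Collect_conj open_Collect_less continuous_intros)
  let ?x = "vector [1, 0, 1] :: real^3"
  have "?x \<in> ?W"
  proof -
    have x: "?x = (1/2) *\<^sub>R (vq + vr)" by (simp add: vec3_eq_iff vdefs)
    have A: "adj (rotm t b) *v ?x = (2 * (1 - t) * (1 + t)) *\<^sub>R (((1 - t) * (1 + b)) *\<^sub>R vr - (1 - b) *\<^sub>R vv t b)"
      unfolding x by (simp add: matrix_vector_mult_scaleR matrix_vector_right_distrib adj_rotm_images algebra_simps)
    have "rotm t b *v ?x = (1/2) *\<^sub>R (rotm t b *v vq + rotm t b *v vr)"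
      unfolding x by (simp only: matrix_vector_mult_scaleR matrix_vector_right_distrib)
    then have R: "rotm t b *v ?x = ((1 + t) * (1 - b)) *\<^sub>R vq - (1 - t) *\<^sub>R vv t b"
      unfolding rotm_images by (simp add: vec3_eq_iff algebra_simps)
    let ?a = "((1 - t) * (1 + b)) *\<^sub>R vr - (1 - b) *\<^sub>R vv t b" and ?r = "((1 + t) * (1 - b)) *\<^sub>R vq - (1 - t) *\<^sub>R vv t b"
    have r: "?r$1 - ?r$2 = (1 - t) * ((1 - t) * (1 + b))" "?r$1 + ?r$2 = 2 * ((1 + t) * (1 - b)) + (1 - t) * ((1 + t) * (1 - b))"
      and a: "?a$1 - ?a$2 = 2 * ((1 - t) * (1 + b)) + (1 - b) * ((1 - t) * (1 + b))" "?a$1 + ?a$2 = (1 - b) * ((1 + t) * (1 - b))"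
      by (simp_all add: vdefs algebra_simps)
    have "?r$1 - ?r$2 > 0" "?r$1 + ?r$2 > 0" unfolding r by (intro mult_pos_pos add_pos_pos pos; simp)+
    then have 1: "\<bar>?r$2\<bar> < \<bar>?r$1\<bar>" by linarith
    have "?a$1 - ?a$2 > 0" "?a$1 + ?a$2 > 0" unfolding a by (intro mult_pos_pos add_pos_pos pos; simp)+
    then have 2: "\<bar>?a$2\<bar> < \<bar>?a$1\<bar>" by linarith
    have k: "2 * (1 - t) * (1 + t) > 0" using pos by simp
    have 3: "\<bar>(k *\<^sub>R w)$2\<bar> < \<bar>(k *\<^sub>R w)$1\<bar>" if "\<bar>w$2\<bar> < \<bar>w$1\<bar>" "k > 0" for k and w :: "real^3"
      using that by (simp add: abs_mult)
    show ?thesis unfolding mem_Collect_eq A R using 1 3[OF 2 k] by blast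
  qed
  then obtain e where e: "e > 0" "ball ?x e \<subseteq> ?W" using W open_contains_ball by blast
  define d where "d = min (e / 2) (1 / 2)"
  have d: "d > 0" "d < e" "d < 1" using e by (auto simp: d_def min_def)
  let ?y = "vector [1 - d, 0, 1] :: real^3"
  have "?x - ?y = d *\<^sub>R axis 1 1" by (simp add: vec3_eq_iff axis_def)
  then have "dist ?x ?y = d" using d by (simp add: dist_norm)
  then have "?y \<in> ?W" using e d by (intro subsetD[OF e(2)]) simp
  moreover have "?y \<in> regA" using d by (simp add: regA_def)
  ultimately have "?y \<in> moved" by (simp add: moved_def)
  then show ?thesis by blast
qed

end

lemma J_regions: "v \<in> regA \<Longrightarrow> transpose J *v v \<in> regB" "v \<in> regA \<Longrightarrow> J *v v \<in> regB" "J ** transpose J = mat 1"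
  by (auto simp: regA_def regB_def J_def vmult3 mat3_eq_iff mult3 mat1_entry)

lemma scaled_mult_vec: "(k *\<^sub>R A) *v v = k *\<^sub>R (A *v v)" for A :: mat3
  by (simp add: scaleR_matrix_vector_assoc)

context marked_square begin

lemma polm_symmetric: "transpose (polm t b) = polm t b"
  by (simp add: mat3_eq_iff polm_def)

lemma unim_polm_X: "unim (polm t b) \<in> X"
proof (rule positive_definite_in_X)
  show "transpose (unim (polm t b)) = unim (polm t b)" by (simp add: unim_def polm_symmetric)
  show "det (unim (polm t b)) = 1" using unim_SL3[of "polm t b"] det_polm_pos by (simp add: SL3_def)
  fix v :: "real^3" assume v: "v \<noteq> 0"
  have a: "1 - t*b > 0" "1 + t*b > 0" using pos pos2 by (simp_all add: algebra_simps)
  let ?x = "v$1" and ?y = "v$2" and ?z = "v$3"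
  define Q where "Q = v \<bullet> (polm t b *v v)"
  have "(1 - t*b) * (1 + t*b) * Q = (1 + t*b) * ((1 - t*b) * ?y + (b - t) * ?x)\<^sup>2
     + (1 - t*b) * ((1 + t*b) * ?z - (t + b) * ?x)\<^sup>2 + det (polm t b) * ?x\<^sup>2"
    unfolding det_polm Q_def by (simp add: inner3 vmult3 polm_def power2_eq_square) algebra
  also have "\<dots> > 0"
  proof (cases "?x = 0")
    case False
    then have "det (polm t b) * ?x\<^sup>2 > 0" using det_polm_pos by simp
    moreover have "(1 + t*b) * ((1 - t*b) * ?y + (b - t) * ?x)\<^sup>2 \<ge> 0" "(1 - t*b) * ((1 + t*b) * ?z - (t + b) * ?x)\<^sup>2 \<ge> 0"
      using a by simp_all
    ultimately show ?thesis by linarith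
  next
    case True
    then have "?y \<noteq> 0 \<or> ?z \<noteq> 0" using v by (simp add: vec3_eq_iff)
    then have "(1 + t*b) * ((1 - t*b) * ?y)\<^sup>2 > 0 \<or> (1 - t*b) * ((1 + t*b) * ?z)\<^sup>2 > 0" using a by auto
    moreover have "(1 + t*b) * ((1 - t*b) * ?y)\<^sup>2 \<ge> 0" "(1 - t*b) * ((1 + t*b) * ?z)\<^sup>2 \<ge> 0" using a by simp_all
    ultimately show ?thesis using True by simp linarith
  qed
  finally have "Q > 0" using a by (intro zero_less_mult_pos[of "(1 - t*b) * (1 + t*b)" Q]) simp_all
  then show "v \<bullet> (unim (polm t b) *v v) > 0"
    using det_polm_pos by (simp add: unim_vec Q_def)
qed

lemma box_pol_X: "box_pol t b \<in> X"
  unfolding box_pol_def by (rule X_adj[OF unim_polm_X])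

lemma box_pol_SL3: "box_pol t b \<in> SL3"
  using X_det[OF box_pol_X] by (simp add: SL3_def)

lemma ct_box_pol: "ct (box_pol t b) = unim (polm t b)"
  using X_det[OF unim_polm_X] X_symmetric[OF unim_polm_X] by (simp add: box_pol_def ct_def adj_adj)

lemma unim_polm_SL3: "unim (polm t b) \<in> SL3"
  using X_det[OF unim_polm_X] by (simp add: SL3_def)

lemma box_rot_SL3: "box_rot t b \<in> SL3"
  unfolding box_rot_def using det_rotm_pos by (intro unim_SL3) simp

lemma rotation_polarity: "rotation_polarity (box_rot t b) (box_pol t b)"
proof
  show "box_rot t b \<in> SL3" "box_pol t b \<in> SL3" by (rule box_rot_SL3 box_pol_SL3)+
  show "box_pol t b ** ct (box_pol t b) = mat 1"
    unfolding ct_box_pol unfolding box_pol_def by (rule SL3_cancel(1)[OF unim_polm_SL3])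
  have "(root 3 (det (rotm t b)))^3 = det (rotm t b)" by (rule odd_real_root_pow) simp
  then show "box_rot t b ** box_rot t b ** box_rot t b = mat 1"
    using det_rotm_pos by (simp add: box_rot_def unim_def rotm_cube power3_eq_cube mult.assoc)
qed

lemma box_rot_vec: "\<exists>k. k \<noteq> 0 \<and> (\<forall>v. box_rot t b *v v = k *\<^sub>R (rotm t b *v v))"
  using det_rotm_pos by (intro exI[of _ "1 / root 3 (det (rotm t b))"]) (simp add: box_rot_def unim_vec)

lemma adj_box_rot_vec: "\<exists>k. k \<noteq> 0 \<and> (\<forall>v. adj (box_rot t b) *v v = k *\<^sub>R (adj (rotm t b) *v v))"
proof -
  have "adj (c *\<^sub>R A) = (c * c) *\<^sub>R adj A" for c and A :: mat3
    by (simp add: adj_def mat3_eq_iff algebra_simps)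
  then show ?thesis using det_rotm_pos
    by (intro exI[of _ "(1 / root 3 (det (rotm t b))) * (1 / root 3 (det (rotm t b)))"])
       (simp add: box_rot_def unim_def scaled_mult_vec)
qed

text \<open>Consequences of \<open>rotm_duality\<close> for the normalized matrices and for both rotations.\<close>

lemma dual_rotation:
  obtains k l where "k \<noteq> 0" "l \<noteq> 0"
    "box_pol t b ** ct (box_rot t b) ** ct (box_pol t b) ** J = k *\<^sub>R (J ** rotm b (- t))"
    "box_pol t b ** ct (adj (box_rot t b)) ** ct (box_pol t b) ** J = l *\<^sub>R (J ** adj (rotm b (- t)))"
proof -
  let ?T = "box_rot t b" and ?S = "unim (polm t b)" and ?h = "box_pol t b" and ?R = "rotm b (- t)"
  interpret d: marked_square b "- t" by unfold_locales (use tb in simp_all)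
  define c where "c = (1 / root 3 (det (rotm t b))) * (4 * ((1 - t) * (1 + t)) * ((1 - b) * (1 + b)))"
  have c: "c \<noteq> 0" using det_rotm_pos pos by (simp add: c_def)
  have hS: "?h ** ?S = mat 1" unfolding box_pol_def by (rule SL3_cancel(1)[OF unim_polm_SL3])
  have "transpose ?T ** ?S ** J ** ?R = ((1 / root 3 (det (rotm t b))) * (1 / root 3 (det (polm t b)))) *\<^sub>R (transpose (rotm t b) ** polm t b ** J ** ?R)"
    by (simp add: box_rot_def unim_def)
  also have "\<dots> = c *\<^sub>R (?S ** J)" unfolding rotm_duality by (simp add: c_def unim_def)
  finally have main: "transpose ?T ** ?S ** J ** ?R = c *\<^sub>R (?S ** J)" .
  have ctT: "ct ?T ** transpose ?T = mat 1"
    using SL3_cancel(2)[OF box_rot_SL3] by (simp add: ct_def flip: matrix_transpose_mul)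
  have "ct ?T ** (transpose ?T ** ?S ** J ** ?R) = ?S ** J ** ?R"
    using ctT by (simp add: matrix_mul_assoc)
  then have "c *\<^sub>R (ct ?T ** ?S ** J) = ?S ** J ** ?R" unfolding main by (simp add: matrix_mul_assoc)
  then have "?h ** (c *\<^sub>R (ct ?T ** ?S ** J)) = ?h ** (?S ** J ** ?R)" by simp
  then have "c *\<^sub>R (?h ** ct ?T ** ?S ** J) = J ** ?R" using hS by (simp add: matrix_mul_assoc)
  then have "(1/c) *\<^sub>R (c *\<^sub>R (?h ** ct ?T ** ?S ** J)) = (1/c) *\<^sub>R (J ** ?R)" by simp
  then have 1: "?h ** ct ?T ** ?S ** J = (1/c) *\<^sub>R (J ** ?R)" using c by simp
  have d: "det ?R \<noteq> 0" using d.det_rotm_pos by simp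
  have cta: "ct (adj ?T) = transpose ?T" using adj_adj[of ?T] box_rot_SL3 by (simp add: ct_def SL3_def)
  have "?h ** (transpose ?T ** ?S ** J ** ?R) ** adj ?R = ?h ** (c *\<^sub>R (?S ** J)) ** adj ?R" unfolding main ..
  then have "?h ** transpose ?T ** ?S ** J ** (?R ** adj ?R) = c *\<^sub>R ((?h ** ?S) ** J ** adj ?R)"
    by (simp add: matrix_mul_assoc)
  then have "det ?R *\<^sub>R (?h ** transpose ?T ** ?S ** J) = c *\<^sub>R (J ** adj ?R)"
    unfolding hS adj_mult by simp
  then have "(1 / det ?R) *\<^sub>R (det ?R *\<^sub>R (?h ** transpose ?T ** ?S ** J)) = (1 / det ?R) *\<^sub>R (c *\<^sub>R (J ** adj ?R))" by simp
  then have 2: "?h ** ct (adj ?T) ** ?S ** J = (c / det ?R) *\<^sub>R (J ** adj ?R)" using d unfolding cta by simp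
  show thesis
    by (rule that[of "1/c" "c / det ?R"]) (use c d 1 2 in \<open>simp_all add: ct_box_pol\<close>)
qed

text \<open>The conditions on lines follow from those on points for \<open>(b, - t)\<close>, as \<open>J\<close> exchanges the two regions.\<close>

lemma box_ping_pong: "ping_pong (box_rot t b) (box_pol t b) regA regB moved"
proof -
  interpret rotation_polarity "box_rot t b" "box_pol t b" by (rule rotation_polarity)
  interpret d: marked_square b "- t" by unfold_locales (use tb in simp_all)
  obtain k1 where k1: "k1 \<noteq> 0" "\<And>v. box_rot t b *v v = k1 *\<^sub>R (rotm t b *v v)" using box_rot_vec by blast
  obtain k2 where k2: "k2 \<noteq> 0" "\<And>v. adj (box_rot t b) *v v = k2 *\<^sub>R (adj (rotm t b) *v v)" using adj_box_rot_vec by blast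
  obtain k l where kl: "k \<noteq> 0" "l \<noteq> 0"
    "box_pol t b ** ct (box_rot t b) ** ct (box_pol t b) ** J = k *\<^sub>R (J ** rotm b (- t))"
    "box_pol t b ** ct (adj (box_rot t b)) ** ct (box_pol t b) ** J = l *\<^sub>R (J ** adj (rotm b (- t)))"
    by (rule dual_rotation)
  have JJ: "J *v (transpose J *v v) = v" for v using J_regions(3) by (simp add: matrix_vector_mul_assoc)
  show ?thesis
  proof
    fix v assume "v \<in> regB"
    then show "box_rot t b *v v \<in> regA" "adj (box_rot t b) *v v \<in> regA"
      using rotm_regB adj_rotm_regB k1 k2 by (simp_all add: reg_scale)
  next
    fix v assume v: "v \<in> regA"
    have m: "M *v v = (M ** J) *v (transpose J *v v)" for M :: mat3
      using JJ by (simp flip: matrix_vector_mul_assoc)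
    have "J *v (rotm b (- t) *v (transpose J *v v)) \<in> regB" "J *v (adj (rotm b (- t)) *v (transpose J *v v)) \<in> regB"
      using d.rotm_regB d.adj_rotm_regB J_regions v by blast+
    then show "box_pol t b ** ct (box_rot t b) ** ct (box_pol t b) *v v \<in> regB"
      "box_pol t b ** ct (adj (box_rot t b)) ** ct (box_pol t b) *v v \<in> regB"
      unfolding m[of "box_pol t b ** ct (box_rot t b) ** ct (box_pol t b)"] m[of "box_pol t b ** ct (adj (box_rot t b)) ** ct (box_pol t b)"] kl
      using kl(1,2) by (simp_all add: scaled_mult_vec reg_scale flip: matrix_vector_mul_assoc)
  next
    show "moved \<subseteq> regA" by (auto simp: moved_def)
    fix v assume "v \<in> moved"
    then have "rotm t b *v v \<notin> regB" "adj (rotm t b) *v v \<notin> regB" by (auto simp: moved_def regB_def)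
    then show "box_rot t b *v v \<notin> regB" "adj (box_rot t b) *v v \<notin> regB" using k1 k2 by (simp_all add: reg_scale)
  next
    show "regA \<inter> regB = {}" by (auto simp: regA_def regB_def)
  qed
qed

theorem box_rep_df: "repr (box_rot t b) (box_pol t b) \<in> df_reps"
proof (rule ping_pong_df[OF box_ping_pong box_pol_X open_moved moved_nonempty])
  show "k *\<^sub>R v \<in> moved \<longleftrightarrow> v \<in> moved" if "k \<noteq> 0" for k v
    using that by (simp add: moved_def reg_scale matrix_vector_mult_scaleR abs_mult)
  show "0 \<notin> moved" by (simp add: moved_def regA_def)
qed

end

section \<open>Incidence geometry of marked boxes\<close>

abbreviation pt :: "real^3 \<Rightarrow> psub" where "pt v \<equiv> span {v}"

lemma pt_range: "pt v = range (\<lambda>k. k *\<^sub>R v)"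
  by (rule span_singleton)

lemma pt_eqD: assumes "pt v = pt w" shows "\<exists>k. v = k *\<^sub>R w"
  using assms span_base[of v "{v}"] unfolding pt_range by blast

lemma pt_scale: "k \<noteq> 0 \<Longrightarrow> pt (k *\<^sub>R v) = pt v"
proof -
  assume k: "k \<noteq> 0"
  show ?thesis
  proof
    show "pt (k *\<^sub>R v) \<subseteq> pt v" by (rule span_minimal) (simp_all add: span_scale span_base)
    have "(1 / k) *\<^sub>R (k *\<^sub>R v) \<in> pt (k *\<^sub>R v)" by (rule span_scale) (simp add: span_base)
    then show "pt v \<subseteq> pt (k *\<^sub>R v)" using k by (intro span_minimal) simp_all
  qed
qed

lemma image_span: "(*v) g ` span S = span ((*v) g ` S)" for g :: mat3
  by (rule span_linear_image[symmetric]) (rule matrix_vector_mul_linear)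

lemma image_pt: "(*v) g ` pt v = pt (g *v v)" for g :: mat3
  by (simp add: image_span)

lemma join_pt: "join (pt a) (pt b) = span {a, b}"
proof
  have "pt a \<subseteq> span {a, b}" "pt b \<subseteq> span {a, b}" by (rule span_mono; simp)+
  then show "join (pt a) (pt b) \<subseteq> span {a, b}" unfolding join_def by (intro span_minimal) simp_all
  show "span {a, b} \<subseteq> join (pt a) (pt b)" unfolding join_def by (rule span_mono) (simp add: span_base)
qed

lemma cr_basis: "(cr a b \<bullet> cr a b) *\<^sub>R y = (cr y b \<bullet> cr a b) *\<^sub>R a + (cr a y \<bullet> cr a b) *\<^sub>R b + (cr a b \<bullet> y) *\<^sub>R cr a b"
  by (simp add: vec3_eq_iff cr_def inner3) (intro conjI; algebra)

lemma cr_perp: "cr a b \<bullet> a = 0" "cr a b \<bullet> b = 0"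
  by (simp_all add: cr_def inner3 algebra_simps)

text \<open>A line of the projective plane is given by its normal vector, and the vector product computes joins and meets.\<close>

lemma join_plane:
  assumes k: "cr a b = k *\<^sub>R n" and n: "cr a b \<noteq> 0"
  shows "join (pt a) (pt b) = {y. n \<bullet> y = 0}"
proof -
  have k0: "k \<noteq> 0" using k n by auto
  have "span {a, b} = {y. cr a b \<bullet> y = 0}"
  proof
    show "span {a, b} \<subseteq> {y. cr a b \<bullet> y = 0}"
      by (rule span_minimal) (use cr_perp in \<open>auto simp: subspace_hyperplane\<close>)
    show "{y. cr a b \<bullet> y = 0} \<subseteq> span {a, b}"
    proof
      fix y assume "y \<in> {y. cr a b \<bullet> y = 0}"
      then have "(cr a b \<bullet> cr a b) *\<^sub>R y = (cr y b \<bullet> cr a b) *\<^sub>R a + (cr a y \<bullet> cr a b) *\<^sub>R b"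
        using cr_basis[of a b y] by simp
      moreover have "(cr y b \<bullet> cr a b) *\<^sub>R a + (cr a y \<bullet> cr a b) *\<^sub>R b \<in> span {a, b}"
        by (intro span_add span_scale span_base) simp_all
      ultimately have "(1 / (cr a b \<bullet> cr a b)) *\<^sub>R ((cr a b \<bullet> cr a b) *\<^sub>R y) \<in> span {a, b}" by (simp only: span_scale)
      then show "y \<in> span {a, b}" using n by simp
    qed
  qed
  then show ?thesis unfolding join_pt k using k0 by simp
qed

lemma meet_planes:
  assumes k: "cr n m = k *\<^sub>R x" and x: "cr n m \<noteq> 0"
  shows "{y. n \<bullet> y = 0} \<inter> {y. m \<bullet> y = 0} = pt x"
proof -
  have k0: "k \<noteq> 0" using k x by auto
  have "{y. n \<bullet> y = 0} \<inter> {y. m \<bullet> y = 0} = pt (cr n m)"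
  proof
    show "pt (cr n m) \<subseteq> {y. n \<bullet> y = 0} \<inter> {y. m \<bullet> y = 0}"
      unfolding pt_range using cr_perp[of n m] by (auto simp: inner_commute)
    show "{y. n \<bullet> y = 0} \<inter> {y. m \<bullet> y = 0} \<subseteq> pt (cr n m)"
    proof
      fix y assume y: "y \<in> {y. n \<bullet> y = 0} \<inter> {y. m \<bullet> y = 0}"
      have "(cr n m \<bullet> cr n m) *\<^sub>R y = (cr n m \<bullet> y) *\<^sub>R cr n m + (n \<bullet> y) *\<^sub>R cr m (cr n m) + (m \<bullet> y) *\<^sub>R cr (cr n m) n"
        by (simp add: vec3_eq_iff cr_def inner3) (intro conjI; algebra)
      then have "(1 / (cr n m \<bullet> cr n m)) *\<^sub>R ((cr n m \<bullet> cr n m) *\<^sub>R y) = ((cr n m \<bullet> y) / (cr n m \<bullet> cr n m)) *\<^sub>R cr n m" using y by simp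
      then show "y \<in> pt (cr n m)" unfolding pt_range using x by (metis (no_types, lifting) inner_eq_zero_iff nonzero_eq_divide_eq rangeI scaleR_one scaleR_scaleR)
    qed
  qed
  then show ?thesis unfolding k using pt_scale[OF k0] by simp
qed

definition std_box :: "real \<Rightarrow> real \<Rightarrow> psub box" where
  "std_box t b = map_box pt (Box vp vq vr vs (vt t) (vb b))"

lemma pt_neq: "cr v w \<noteq> 0 \<Longrightarrow> pt v \<noteq> pt w"
proof
  assume c: "cr v w \<noteq> 0" and "pt v = pt w"
  then obtain k where "v = k *\<^sub>R w" using pt_eqD by blast
  then show False using c by (simp add: cr_def vec3_eq_iff)
qed

context marked_square begin

lemma std_joins:
  "join (pt (vt t)) (pt vr) = {y. vector [2, 1 - t, - 1 - t] \<bullet> y = 0}"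
  "join (pt (vt t)) (pt vs) = {y. vector [2, - 1 - t, 1 - t] \<bullet> y = 0}"
  "join (pt (vb b)) (pt vq) = {y. vector [- 2, 1 - b, 1 + b] \<bullet> y = 0}"
  "join (pt (vb b)) (pt vp) = {y. vector [2, 1 + b, 1 - b] \<bullet> y = 0}"
  "join (pt vp) (pt vr) = {y. vector [1, 1, 0] \<bullet> y = 0}"
  "join (pt vq) (pt vs) = {y. vector [1, - 1, 0] \<bullet> y = 0}"
  "join (pt vr) (pt vs) = {y. vector [0, 1, 1] \<bullet> y = 0}"
  "join (pt vp) (pt vq) = {y. vector [0, 1, - 1] \<bullet> y = 0}"
  by (rule join_plane[where k = 1] join_plane[where k = "- 1"] join_plane[where k = 2] join_plane[where k = "- 2"];
      simp add: cr_def vdefs vec3_eq_iff; fail)+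

lemma std_points:
  "join (pt (vt t)) (pt vr) \<inter> join (pt (vb b)) (pt vq) = pt (vu t b)"
  "join (pt (vt t)) (pt vs) \<inter> join (pt (vb b)) (pt vp) = pt (vv t b)"
  "join (pt vp) (pt vr) \<inter> join (pt vq) (pt vs) = pt vc"
proof -
  have n: "1 - t*b \<noteq> 0" "t*b \<noteq> 1" using pos pos2 by (auto simp: algebra_simps)
  show "join (pt (vt t)) (pt vr) \<inter> join (pt (vb b)) (pt vq) = pt (vu t b)" unfolding std_joins
    by (rule meet_planes[where k = 2]) (use n in \<open>simp_all add: cr_def vdefs vec3_eq_iff algebra_simps\<close>)
  show "join (pt (vt t)) (pt vs) \<inter> join (pt (vb b)) (pt vp) = pt (vv t b)" unfolding std_joins
    by (rule meet_planes[where k = 2]) (use n in \<open>simp_all add: cr_def vdefs vec3_eq_iff algebra_simps\<close>)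
  show "join (pt vp) (pt vr) \<inter> join (pt vq) (pt vs) = pt vc" unfolding std_joins
    by (rule meet_planes[where k = "- 2"]) (simp_all add: cr_def vdefs vec3_eq_iff)
qed

lemma std_boxes:
  "box_i (std_box t b) = Box (pt vs) (pt vr) (pt vp) (pt vq) (pt (vb b)) (pt (vt t))"
  "box_t (std_box t b) = Box (pt vp) (pt vq) (pt (vu t b)) (pt (vv t b)) (pt (vt t)) (pt vc)"
  "box_b (std_box t b) = Box (pt (vu t b)) (pt (vv t b)) (pt vs) (pt vr) (pt vc) (pt (vb b))"
  by (simp_all add: std_box_def std_points)

lemma box_rot_images:
  "pt (box_rot t b *v vp) = pt (vu t b)" "pt (box_rot t b *v vq) = pt (vv t b)" "pt (box_rot t b *v vr) = pt vq" "pt (box_rot t b *v vs) = pt vp"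
  "pt (box_rot t b *v vu t b) = pt vs" "pt (box_rot t b *v vv t b) = pt vr" "pt (box_rot t b *v vt t) = pt vc"
  "pt (box_rot t b *v vc) = pt (vb b)" "pt (box_rot t b *v vb b) = pt (vt t)"
proof -
  obtain k where k: "k \<noteq> 0" "\<And>v. box_rot t b *v v = k *\<^sub>R (rotm t b *v v)" using box_rot_vec by blast
  have s: "pt (box_rot t b *v v) = pt w" if "rotm t b *v v = c *\<^sub>R w" "c \<noteq> 0" for v w c
    using that k pt_scale[of "k * c" w] by simp
  show "pt (box_rot t b *v vp) = pt (vu t b)" "pt (box_rot t b *v vq) = pt (vv t b)" "pt (box_rot t b *v vr) = pt vq" "pt (box_rot t b *v vs) = pt vp"
    "pt (box_rot t b *v vu t b) = pt vs" "pt (box_rot t b *v vv t b) = pt vr" "pt (box_rot t b *v vt t) = pt vc"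
    "pt (box_rot t b *v vc) = pt (vb b)" "pt (box_rot t b *v vb b) = pt (vt t)"
    by (rule s, rule rotm_images, use pos in simp)+
qed

lemma std_distinct: "pt vp \<noteq> pt vs" "pt vr \<noteq> pt vs" "pt (vu t b) \<noteq> pt (vv t b)"
proof -
  show "pt vp \<noteq> pt vs" "pt vr \<noteq> pt vs" by (rule pt_neq; simp add: cr_def vdefs vec3_eq_iff)+
  have "(cr (vu t b) (vv t b))$2 = - 4 * (1 - t*b)" by (simp add: cr_def vdefs) algebra
  then have "(cr (vu t b) (vv t b))$2 \<noteq> 0" using pos pos2 by (simp add: algebra_simps)
  then show "pt (vu t b) \<noteq> pt (vv t b)" by (intro pt_neq) auto
qed

lemma std_rotation: "box_rotation (std_box t b) (box_rot t b)"
proof -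
  interpret rotation_polarity "box_rot t b" "box_pol t b" by (rule rotation_polarity)
  have "box_rot t b \<noteq> mat 1"
  proof
    assume "box_rot t b = mat 1"
    then have "pt vs = pt vp" using box_rot_images(4) by simp
    then show False using std_distinct(1) by simp
  qed
  moreover have "map_box ((`) ((*v) (box_rot t b))) (box_i (std_box t b)) = box_t (std_box t b)"
    "map_box ((`) ((*v) (box_rot t b))) (box_t (std_box t b)) = box_b (std_box t b)"
    "map_box ((`) ((*v) (box_rot t b))) (box_b (std_box t b)) = box_i (std_box t b)"
    unfolding std_boxes box.map image_pt box_rot_images by (rule HOL.refl)+
  ultimately show ?thesis
    unfolding box_rotation_def same_box_def using T by simp
qed

text \<open>Four points in general position determine a projective transformation.\<close>

lemma fixes_corners:
  assumes "pt (A *v vp) = pt vp" "pt (A *v vq) = pt vq" "pt (A *v vr) = pt vr" "pt (A *v vs) = pt vs" and A: "A \<in> SL3"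
  shows "A = mat 1"
proof -
  obtain a where a: "A *v vp = a *\<^sub>R vp" using pt_eqD[OF assms(1)] by blast
  obtain b where b: "A *v vq = b *\<^sub>R vq" using pt_eqD[OF assms(2)] by blast
  obtain c where c: "A *v vr = c *\<^sub>R vr" using pt_eqD[OF assms(3)] by blast
  obtain d where d: "A *v vs = d *\<^sub>R vs" using pt_eqD[OF assms(4)] by blast
  have "A = d *\<^sub>R mat 1"
  proof -
    have 1: "- A$1$1 + A$1$2 + A$1$3 = - a" "A$1$1 + A$1$2 + A$1$3 = b" "A$1$1 - A$1$2 + A$1$3 = c" "- A$1$1 - A$1$2 + A$1$3 = - d"
      and 2: "- A$2$1 + A$2$2 + A$2$3 = a" "A$2$1 + A$2$2 + A$2$3 = b" "A$2$1 - A$2$2 + A$2$3 = - c" "- A$2$1 - A$2$2 + A$2$3 = - d"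
      and 3: "- A$3$1 + A$3$2 + A$3$3 = a" "A$3$1 + A$3$2 + A$3$3 = b" "A$3$1 - A$3$2 + A$3$3 = c" "- A$3$1 - A$3$2 + A$3$3 = d"
      using a b c d by (simp_all add: vec3_eq_iff vmult3 vdefs)
    \<comment> \<open>Each row gives the relation of the corners \<open>vp + vr = vq + vs\<close> for the corresponding coordinates.\<close>
    have e1: "c - a = b - d" using 1 by linarith
    have e2: "a - c = b - d" using 2 by linarith
    have e3: "a + c = b + d" using 3 by linarith
    have e: "a = d" "b = d" "c = d" using e1 e2 e3 by linarith+
    have "A$1$1 = d" "A$1$2 = 0" "A$1$3 = 0" using 1 unfolding e by linarith+
    moreover have "A$2$1 = 0" "A$2$2 = d" "A$2$3 = 0" using 2 unfolding e by linarith+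
    moreover have "A$3$1 = 0" "A$3$2 = 0" "A$3$3 = d" using 3 unfolding e by linarith+
    ultimately show ?thesis by (simp add: mat3_eq_iff mat1_entry)
  qed
  moreover from this have "d ^ 3 = 1" using A by (simp add: SL3_def det_scaleR)
  ultimately show ?thesis using cube_eq_1[of d] by simp
qed

text \<open>If \<open>T\<close> reverses the orientation of the first box, it does so in all three steps, and then \<open>T\<^sup>3\<close> maps \<open>vs\<close> to \<open>vr\<close>.
  Otherwise \<open>T\<close> agrees with \<open>box_rot\<close> on the four corners.\<close>

lemma std_rotation_unique:
  assumes T: "box_rotation (std_box t b) T" shows "T = box_rot t b"
proof -
  have TS: "T \<in> SL3" "T ** T ** T = mat 1"
    and i: "same_box (box_t (std_box t b)) (map_box ((`) ((*v) T)) (box_i (std_box t b)))"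
      "same_box (box_b (std_box t b)) (map_box ((`) ((*v) T)) (box_t (std_box t b)))"
      "same_box (box_i (std_box t b)) (map_box ((`) ((*v) T)) (box_b (std_box t b)))"
    using T by (auto simp: box_rotation_def)
  have step: "pt (T *v (T *v v)) = pt (T *v w)" if "pt (T *v v) = pt w" for v w
    using that image_pt[of T "T *v v"] image_pt[of T w] by metis
  have "pt (T *v vs) = pt vp \<and> pt (T *v vr) = pt vq \<and> pt (T *v vp) = pt (vu t b) \<and> pt (T *v vq) = pt (vv t b) \<or>
     pt (T *v vs) = pt vq \<and> pt (T *v vr) = pt vp \<and> pt (T *v vp) = pt (vv t b) \<and> pt (T *v vq) = pt (vu t b)"
    using i(1) unfolding std_boxes by (auto simp: same_box_def image_pt)
  moreover have "pt (T *v vp) = pt (vu t b) \<and> pt (T *v vu t b) = pt vs \<or> pt (T *v vp) = pt (vv t b) \<and> pt (T *v vu t b) = pt vr"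
    using i(2) unfolding std_boxes by (auto simp: same_box_def image_pt)
  ultimately consider (straight) "pt (T *v vs) = pt vp" "pt (T *v vr) = pt vq" "pt (T *v vp) = pt (vu t b)" "pt (T *v vq) = pt (vv t b)"
    | (swapped) "pt (T *v vs) = pt vq" "pt (T *v vq) = pt (vu t b)" "pt (T *v vu t b) = pt vr"
    using std_distinct(3) by metis
  then show ?thesis
  proof cases
    case swapped
    have "pt (T *v (T *v (T *v vs))) = pt vr"
      using step[OF swapped(1)] step swapped(2,3) image_pt[of T] by metis
    then have "pt vs = pt vr" using TS(2) by (simp add: matrix_vector_mul_assoc matrix_mul_assoc)
    then show ?thesis using std_distinct(2) by simp
  next
    case straight
    let ?R = "box_rot t b"
    have c: "pt (adj ?R *v (T *v v)) = pt v" if "pt (T *v v) = pt (?R *v v)" for v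
    proof -
      have "pt (adj ?R *v (T *v v)) = pt (adj ?R *v (?R *v v))"
        using that image_pt[of "adj ?R" "T *v v"] image_pt[of "adj ?R" "?R *v v"] by metis
      then show ?thesis using SL3_cancel(1)[OF box_rot_SL3] by (simp add: matrix_vector_mul_assoc)
    qed
    have "adj ?R ** T = mat 1"
      using c straight box_rot_images box_rot_SL3 TS(1)
      by (intro fixes_corners) (simp_all add: SL3_mult flip: matrix_vector_mul_assoc)
    then have "?R ** (adj ?R ** T) = ?R" by simp
    then show ?thesis using SL3_cancel(4)[OF box_rot_SL3] by metis
  qed
qed

end

lemma plane_comp: "(pt v)\<^sup>\<bottom> = {y. v \<bullet> y = 0}"
  unfolding orthogonal_comp_def orthogonal_def pt_range by (auto simp: inner_commute dest: spec[of _ "1::real"])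

lemma comp_image:
  assumes g: "g \<in> SL3" shows "((*v) g ` W)\<^sup>\<bottom> = (*v) (ct g) ` (W\<^sup>\<bottom>)"
proof -
  have a: "transpose g ** ct g = mat 1" using SL3_cancel(1)[OF g] by (simp add: ct_def flip: matrix_transpose_mul)
  have b: "ct g ** transpose g = mat 1" using SL3_cancel(2)[OF g] by (simp add: ct_def flip: matrix_transpose_mul)
  have mem: "y \<in> ((*v) g ` W)\<^sup>\<bottom> \<longleftrightarrow> transpose g *v y \<in> W\<^sup>\<bottom>" for y
    unfolding orthogonal_comp_def orthogonal_def by (auto simp: inner3 vmult3 algebra_simps)
  show ?thesis
  proof
    show "((*v) g ` W)\<^sup>\<bottom> \<subseteq> (*v) (ct g) ` (W\<^sup>\<bottom>)"
    proof
      fix y assume "y \<in> ((*v) g ` W)\<^sup>\<bottom>"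
      then have "transpose g *v y \<in> W\<^sup>\<bottom>" unfolding mem .
      moreover have "y = ct g *v (transpose g *v y)" using b by (simp add: matrix_vector_mul_assoc)
      ultimately show "y \<in> (*v) (ct g) ` (W\<^sup>\<bottom>)" by blast
    qed
    show "(*v) (ct g) ` (W\<^sup>\<bottom>) \<subseteq> ((*v) g ` W)\<^sup>\<bottom>"
      using a by (auto simp: mem matrix_vector_mul_assoc)
  qed
qed

lemma dual_act_pt: assumes g: "g \<in> SL3" shows "dual_act g (pt v) = {y. (ct g *v v) \<bullet> y = 0}"
proof -
  have c: "ct g \<in> SL3" using g by simp
  have "((*v) (ct g) ` pt v)\<^sup>\<bottom> = (*v) (ct (ct g)) ` ((pt v)\<^sup>\<bottom>)" by (rule comp_image[OF c])
  then show ?thesis using g by (simp add: dual_act_def ct_ct image_pt plane_comp)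
qed

lemma elliptic_dual: assumes h: "h \<in> X" shows "dual_isom h \<in> elliptic_polarities"
proof -
  obtain g where g: "g \<in> SL3" "h = g ** transpose g" using h unfolding X_def by blast
  have std: "std_polarity = dual_isom (mat 1)"
  proof (rule extensionalityI[of _ X])
    show "std_polarity \<in> extensional X" "dual_isom (mat 1) \<in> extensional X"
      by (simp_all add: std_polarity_def dual_isom_def)
    show "std_polarity P = dual_isom (mat 1) P" if "P \<in> X" for P
      using that by (simp add: dual_isom_apply SL3_one std_polarity_def X_inv_adj)
  qed
  have inv: "iinv (proj_isom g) = proj_isom (adj g)"
    using g by (intro iso.inv_equality) (simp_all add: proj_proj SL3_cancel isom_one)
  have c: "ct (adj g) = transpose g" using adj_adj[of g] g by (simp add: ct_def SL3_def)
  have "dual_isom h = proj_isom g \<cdot> std_polarity \<cdot> iinv (proj_isom g)"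
    unfolding inv std using g by (simp add: proj_dual dual_proj SL3_one c)
  then show ?thesis unfolding elliptic_polarities_def using g by (auto intro!: exI[of _ "proj_isom g"])
qed

definition polarity_acts :: "psub box \<Rightarrow> mat3 \<Rightarrow> bool" where
  "polarity_acts M g \<longleftrightarrow> (case M of Box p q r s t b \<Rightarrow> dual_act g p = join b q \<and> dual_act g q = join b p \<and>
     dual_act g r = join t s \<and> dual_act g s = join t r \<and> dual_act g t = join r s \<and> dual_act g b = join p q)"

lemma box_polarity_iff: "box_polarity M g \<longleftrightarrow> g \<in> SL3 \<and> dual_isom g \<in> elliptic_polarities \<and> polarity_acts M g"
  by (cases M) (simp add: polarity_acts_def)

context marked_square begin

lemma polm_images:
  "polm t b *v vp = (1 + t) *\<^sub>R vector [- 2, 1 - b, 1 + b]" "polm t b *v vq = (1 - t) *\<^sub>R vector [2, 1 + b, 1 - b]"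
  "polm t b *v vr = (1 - b) *\<^sub>R vector [2, - 1 - t, 1 - t]" "polm t b *v vs = (- (1 + b)) *\<^sub>R vector [2, 1 - t, - 1 - t]"
  "polm t b *v vt t = ((1 - t) * (1 + t)) *\<^sub>R vector [0, 1, 1]" "polm t b *v vb b = (- (1 - b) * (1 + b)) *\<^sub>R vector [0, 1, - 1]"
  by (simp_all add: vec3_eq_iff vmult3 polm_def vdefs algebra_simps)

lemma box_pol_act:
  assumes "polm t b *v v = k *\<^sub>R n" "k \<noteq> 0" shows "dual_act (box_pol t b) (pt v) = {y. n \<bullet> y = 0}"
  unfolding dual_act_pt[OF box_pol_SL3] ct_box_pol unim_vec assms(1) using assms(2) det_polm_pos by simp

lemma std_polarity_acts: "polarity_acts (std_box t b) (box_pol t b)"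
proof -
  have "dual_act (box_pol t b) (pt vp) = {y. vector [- 2, 1 - b, 1 + b] \<bullet> y = 0}"
    "dual_act (box_pol t b) (pt vq) = {y. vector [2, 1 + b, 1 - b] \<bullet> y = 0}"
    "dual_act (box_pol t b) (pt vr) = {y. vector [2, - 1 - t, 1 - t] \<bullet> y = 0}"
    "dual_act (box_pol t b) (pt vs) = {y. vector [2, 1 - t, - 1 - t] \<bullet> y = 0}"
    "dual_act (box_pol t b) (pt (vt t)) = {y. vector [0, 1, 1] \<bullet> y = 0}"
    "dual_act (box_pol t b) (pt (vb b)) = {y. vector [0, 1, - 1] \<bullet> y = 0}"
    by (rule box_pol_act, rule polm_images, use pos in simp)+
  then show ?thesis by (simp add: polarity_acts_def std_box_def std_joins)
qed

lemma std_box_polarity: "box_polarity (std_box t b) (box_pol t b)"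
  unfolding box_polarity_iff using std_polarity_acts box_pol_SL3 elliptic_dual[OF box_pol_X] by simp

text \<open>The images of the four corners determine the polarity.\<close>

lemma std_polarity_unique:
  assumes g: "g \<in> SL3" "polarity_acts (std_box t b) g" shows "g = box_pol t b"
proof -
  let ?S = "ct (box_pol t b)" and ?h = "box_pol t b"
  have eq: "dual_act g (pt v) = dual_act ?h (pt v)" if "v \<in> {vp, vq, vr, vs}" for v
    using that g(2) std_polarity_acts by (auto simp: polarity_acts_def std_box_def)
  have S: "?S \<in> SL3" using box_pol_SL3 by simp
  have G: "ct g \<in> SL3" using g by simp
  have line: "pt n = pt m" if "{y. n \<bullet> y = 0} = {y. m \<bullet> y = 0}" for n m :: "real^3"
  proof -
    have "(pt n)\<^sup>\<bottom> = (pt m)\<^sup>\<bottom>" using that by (simp add: plane_comp)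
    then show ?thesis by (metis orthogonal_comp_self subspace_span)
  qed
  have fix1: "pt ((adj ?S ** ct g) *v v) = pt v" if "v \<in> {vp, vq, vr, vs}" for v
  proof -
    have "pt (ct g *v v) = pt (?S *v v)"
      using eq[OF that] unfolding dual_act_pt[OF g(1)] dual_act_pt[OF box_pol_SL3] by (rule line)
    then have "pt (adj ?S *v (ct g *v v)) = pt (adj ?S *v (?S *v v))" by (metis image_pt)
    then show ?thesis using SL3_cancel(1)[OF S] by (simp add: matrix_vector_mul_assoc)
  qed
  have "adj ?S ** ct g = mat 1"
    by (rule fixes_corners) (use fix1 S G in \<open>simp_all add: SL3_mult\<close>)
  then have "?S ** (adj ?S ** ct g) = ?S" by simp
  then have "ct g = ?S" using SL3_cancel(4)[OF S] by metis
  then show ?thesis using ct_ct[OF g(1)] ct_ct[OF box_pol_SL3] by metis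
qed

end

section \<open>All marked boxes are projectively standard\<close>

definition tr_box :: "mat3 \<Rightarrow> psub box \<Rightarrow> psub box" where
  "tr_box g = map_box ((`) ((*v) g))"

lemma tr_box_mult: "tr_box a (tr_box b M) = tr_box (a ** b) M"
  by (cases M) (simp add: tr_box_def image_image matrix_vector_mul_assoc)

lemma tr_box_one: "tr_box (mat 1) M = M"
  by (cases M) (simp add: tr_box_def)

lemma tr_box_inj: assumes "g \<in> SL3" "tr_box g M = tr_box g N" shows "M = N"
proof -
  have "tr_box (adj g) (tr_box g M) = tr_box (adj g) (tr_box g N)" using assms by simp
  then show ?thesis using assms(1) by (simp add: tr_box_mult SL3_cancel tr_box_one)
qed

lemma image_join: "(*v) g ` join x y = join ((*v) g ` x) ((*v) g ` y)" for g :: mat3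
  by (simp add: join_def image_span image_Un)

lemma image_meet: "g \<in> SL3 \<Longrightarrow> (*v) g ` (x \<inter> y) = (*v) g ` x \<inter> (*v) g ` y"
  by (rule image_Int) (auto intro!: injI mult_vec_cancel[of g] simp: SL3_def)

lemma tr_box_ops:
  assumes g: "g \<in> SL3"
  shows "box_i (tr_box g M) = tr_box g (box_i M)" "box_t (tr_box g M) = tr_box g (box_t M)"
    "box_b (tr_box g M) = tr_box g (box_b M)" "box_swap (tr_box g M) = tr_box g (box_swap M)"
  by (cases M; simp add: tr_box_def image_join image_meet[OF g])+

lemma tr_same_box: "g \<in> SL3 \<Longrightarrow> same_box (tr_box g M) (tr_box g N) \<longleftrightarrow> same_box M N"
  unfolding same_box_def using tr_box_ops(4)[of g M] tr_box_inj[of g] by metis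

lemma rotation_pullback:
  assumes g: "g \<in> SL3" and T: "box_rotation (tr_box g M) T"
  shows "box_rotation M (adj g ** T ** g)"
proof -
  define T' where "T' = adj g ** T ** g"
  have gT: "g ** T' = T ** g" using SL3_cancel(4)[OF g, of "T ** g"] by (simp add: T'_def matrix_mul_assoc)
  have TS: "T \<in> SL3" "T \<noteq> mat 1" "T ** T ** T = mat 1" using T by (auto simp: box_rotation_def)
  have x: "g ** (T' ** N) = T ** (g ** N)" for N using gT by (metis matrix_mul_assoc)
  have "g ** (T' ** T' ** T') = T ** (T ** (T ** g))" by (simp only: x gT flip: matrix_mul_assoc)
  then have "g ** (T' ** T' ** T') = g ** mat 1" using TS by (simp add: matrix_mul_assoc)
  then have c: "T' ** T' ** T' = mat 1" using matrix_cancel_left[of g "T' ** T' ** T'" "mat 1"] g by (simp only: SL3_def mem_Collect_eq) simp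
  have n: "T' \<noteq> mat 1"
  proof
    assume "T' = mat 1"
    then have "mat 1 ** g = T ** g" using gT by simp
    then show False using matrix_cancel_right[of g "mat 1" T] g TS(2) by (simp add: SL3_def)
  qed
  have sb: "same_box N (tr_box T' N')" if "same_box (tr_box g N) (tr_box T (tr_box g N'))" for N N'
  proof -
    have "tr_box T (tr_box g N') = tr_box g (tr_box T' N')" unfolding tr_box_mult gT ..
    then show ?thesis using that tr_same_box[OF g] by simp
  qed
  have "T' \<in> SL3" using g TS(1) by (simp add: T'_def SL3_mult)
  then show ?thesis
    using T c n sb unfolding T'_def[symmetric] box_rotation_def tr_box_ops[OF g] tr_box_def[of T, symmetric] tr_box_def[of T', symmetric]
    by blast
qed

lemma polarity_pullback:
  assumes g: "g \<in> SL3" and k: "k \<in> SL3" "polarity_acts (tr_box g M) k"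
  shows "polarity_acts M (adj g ** k ** ct g)"
proof -
  have d: "dual_act (adj g ** k ** ct g) W = (*v) (adj g) ` dual_act k ((*v) g ` W)" for W
    unfolding dual_act_def comp_image[OF g] by (simp add: image_image matrix_vector_mul_assoc matrix_mul_assoc)
  have c: "(*v) (adj g) ` join ((*v) g ` x) ((*v) g ` y) = join x y" for x y
    unfolding image_join[symmetric] using g by (simp add: image_image matrix_vector_mul_assoc SL3_cancel)
  show ?thesis
    using k(2) by (cases M) (simp add: polarity_acts_def tr_box_def d c)
qed

lemma noncollinear_independent:
  assumes n: "n \<bullet> a = 1" "n \<bullet> b = 1" "n \<bullet> c = 1" and nc: "\<not> collinear {a, b, c}"
  shows "cr a b \<bullet> c \<noteq> 0"
proof
  assume z: "cr a b \<bullet> c = 0"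
  have "b = (n \<bullet> b) *\<^sub>R a - cr n (cr a b)" if "n \<bullet> a = 1" "n \<bullet> b = 1"
  proof -
    have "cr n (cr a b) = (n \<bullet> b) *\<^sub>R a - (n \<bullet> a) *\<^sub>R b" by (simp add: vec3_eq_iff cr_def inner3 algebra_simps)
    then show ?thesis using that by simp
  qed
  then have ab: "b = a - cr n (cr a b)" using n by simp
  show False
  proof (cases "cr a b = 0")
    case True
    then have "b = a" using ab by (simp add: cr_def vec3_eq_iff)
    then show False using nc by simp
  next
    case False
    define N where "N = cr a b \<bullet> cr a b"
    have N: "N \<noteq> 0" using False by (simp add: N_def)
    have e: "N *\<^sub>R c = (cr c b \<bullet> cr a b) *\<^sub>R a + (cr a c \<bullet> cr a b) *\<^sub>R b"
      using cr_basis[of a b c] z by (simp add: N_def)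
    define \<alpha> \<beta> where "\<alpha> = (cr c b \<bullet> cr a b) / N" and "\<beta> = (cr a c \<bullet> cr a b) / N"
    have "(1 / N) *\<^sub>R (N *\<^sub>R c) = (1 / N) *\<^sub>R ((cr c b \<bullet> cr a b) *\<^sub>R a + (cr a c \<bullet> cr a b) *\<^sub>R b)" unfolding e ..
    then have c: "c = \<alpha> *\<^sub>R a + \<beta> *\<^sub>R b" using N by (simp add: \<alpha>_def \<beta>_def scaleR_add_right)
    have "n \<bullet> c = \<alpha> * (n \<bullet> a) + \<beta> * (n \<bullet> b)" unfolding c by (simp add: inner_add_right)
    then have "\<beta> = 1 - \<alpha>" using n by simp
    then have "collinear {a, c, b}" unfolding collinear_3_expand using c by blast
    then show False using nc by (simp add: insert_commute)
  qed
qed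

text \<open>The diagonals cross in an interior point. This provides representatives \<open>P\<close>, \<open>Q\<close>, \<open>R\<close>, \<open>S\<close> of the corners, with positive factors, which
  satisfy \<open>P + R = Q + S\<close>, the relation between the corners of the square. A linear map therefore carries the square to the given box, and the
  positive factors put the images of top and bottom between the right corners.\<close>

lemma normalization:
  assumes "convex_marked_box M"
  obtains g t b where "g \<in> SL3" "marked_square t b" "M = tr_box g (std_box t b)"
proof -
  obtain n p q r s t b where M: "M = map_box pt (Box p q r s t b)" and n: "\<forall>v\<in>{p, q, r, s, t, b}. n \<bullet> v = 1"
    and cq: "convex_quad p q r s" and t: "t \<in> open_segment p q" and b: "b \<in> open_segment r s"
    using assms unfolding convex_marked_box_def by blast
  obtain x where x: "x \<in> open_segment p r" "x \<in> open_segment q s" using cq unfolding convex_quad_def by blast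
  obtain \<alpha> where \<alpha>: "0 < \<alpha>" "\<alpha> < 1" "x = (1 - \<alpha>) *\<^sub>R p + \<alpha> *\<^sub>R r" using x(1) unfolding in_segment by blast
  obtain \<beta> where \<beta>: "0 < \<beta>" "\<beta> < 1" "x = (1 - \<beta>) *\<^sub>R q + \<beta> *\<^sub>R s" using x(2) unfolding in_segment by blast
  obtain \<nu> where \<nu>: "0 < \<nu>" "\<nu> < 1" "t = (1 - \<nu>) *\<^sub>R p + \<nu> *\<^sub>R q" using t unfolding in_segment by blast
  obtain \<mu> where \<mu>: "0 < \<mu>" "\<mu> < 1" "b = (1 - \<mu>) *\<^sub>R r + \<mu> *\<^sub>R s" using b unfolding in_segment by blast
  \<comment> \<open>Representatives of the corners that satisfy the linear relation between the corners of the square.\<close>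
  define P Q R S where "P = (1 - \<alpha>) *\<^sub>R p" and "Q = (1 - \<beta>) *\<^sub>R q" and "R = \<alpha> *\<^sub>R r" and "S = \<beta> *\<^sub>R s"
  have "P + R = Q + S" unfolding P_def Q_def R_def S_def \<alpha>(3)[symmetric] by (rule \<beta>(3))
  then have sum: "S = P + R - Q" by simp
  define G where "G = cols ((1/2) *\<^sub>R (Q - P)) ((1/2) *\<^sub>R (P - S)) ((1/2) *\<^sub>R (P + R))"
  have G: "G *v vp = P" "G *v vq = Q" "G *v vr = R" "G *v vs = S"
    by (simp_all add: G_def cols_def vec3_eq_iff vmult3 vdefs sum algebra_simps)
  have "cr p q \<bullet> r \<noteq> 0" using noncollinear_independent[of n p q r] n cq by (simp add: convex_quad_def)
  moreover have "det G = - (1/4) * (cr P Q \<bullet> R)"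
    by (simp add: G_def cols_def det_3 sum cr_def inner3 field_simps)
  moreover have "cr P Q \<bullet> R = (1 - \<alpha>) * (1 - \<beta>) * \<alpha> * (cr p q \<bullet> r)"
    unfolding P_def Q_def R_def by (simp add: cr_def inner3) algebra
  ultimately have dG: "det G \<noteq> 0" using \<alpha> \<beta> by simp
  define g where "g = unim G"
  have g: "g \<in> SL3" unfolding g_def by (rule unim_SL3[OF dG])
  have gv: "(*v) g ` pt v = pt (k *\<^sub>R (G *v v))" if "k \<noteq> 0" for k v
    unfolding image_pt g_def unim_vec using dG that by (simp add: pt_scale)
  define a1 c1 a2 c2 where "a1 = (1 - \<nu>) / (1 - \<alpha>)" and "c1 = \<nu> / (1 - \<beta>)" and "a2 = (1 - \<mu>) / \<alpha>" and "c2 = \<mu> / \<beta>"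
  have pos: "a1 > 0" "c1 > 0" "a2 > 0" "c2 > 0" using \<alpha> \<beta> \<nu> \<mu> by (simp_all add: a1_def c1_def a2_def c2_def)
  define \<tau> \<kappa> where "\<tau> = (c1 - a1) / (a1 + c1)" and "\<kappa> = (a2 - c2) / (a2 + c2)"
  have ms: "marked_square \<tau> \<kappa>"
    by unfold_locales (use pos in \<open>simp_all add: \<tau>_def \<kappa>_def field_simps\<close>)
  have "t = a1 *\<^sub>R P + c1 *\<^sub>R Q" using \<alpha> \<beta> \<nu>(3) by (simp add: a1_def c1_def P_def Q_def)
  moreover have "a1 *\<^sub>R vp + c1 *\<^sub>R vq = (a1 + c1) *\<^sub>R vt \<tau>" using pos by (simp add: vec3_eq_iff vdefs \<tau>_def)
  ultimately have t': "t = (a1 + c1) *\<^sub>R (G *v vt \<tau>)"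
    unfolding G[symmetric] by (simp flip: matrix_vector_mult_scaleR matrix_vector_right_distrib)
  have "b = a2 *\<^sub>R R + c2 *\<^sub>R S" using \<alpha> \<beta> \<mu>(3) by (simp add: a2_def c2_def R_def S_def)
  moreover have "a2 *\<^sub>R vr + c2 *\<^sub>R vs = (a2 + c2) *\<^sub>R vb \<kappa>" using pos by (simp add: vec3_eq_iff vdefs \<kappa>_def)
  ultimately have b': "b = (a2 + c2) *\<^sub>R (G *v vb \<kappa>)"
    unfolding G[symmetric] by (simp flip: matrix_vector_mult_scaleR matrix_vector_right_distrib)
  have "(*v) g ` pt vp = pt p" "(*v) g ` pt vq = pt q" "(*v) g ` pt vr = pt r" "(*v) g ` pt vs = pt s"
    using gv[of 1] \<alpha> \<beta> by (simp_all add: G P_def Q_def R_def S_def pt_scale)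
  moreover have "(*v) g ` pt (vt \<tau>) = pt t" "(*v) g ` pt (vb \<kappa>) = pt b"
    using gv[of "a1 + c1" "vt \<tau>"] gv[of "a2 + c2" "vb \<kappa>"] pos t' b' by simp_all
  ultimately have "M = tr_box g (std_box \<tau> \<kappa>)" by (simp add: M tr_box_def std_box_def)
  then show thesis using that g ms by blast
qed

lemma std_box_convex: assumes "marked_square t b" shows "convex_marked_box (std_box t b)"
proof -
  interpret marked_square t b by fact
  have d: "vp $ 3 = 1" "vq $ 3 = 1" "vr $ 3 = 1" "vs $ 3 = 1" "(vt t) $ 3 = 1" "(vb b) $ 3 = 1" by (simp_all add: vdefs)
  have nc: "\<not> collinear {vp, vq, vr}" "\<not> collinear {vq, vr, vs}" "\<not> collinear {vr, vs, vp}" "\<not> collinear {vs, vp, vq}"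
    unfolding collinear_3_expand by (auto simp: vec3_eq_iff vdefs)
  have "vc \<in> open_segment vp vr" "vc \<in> open_segment vq vs"
    unfolding in_segment by (auto intro!: exI[of _ "1/2"] simp: vec3_eq_iff vdefs)
  then have "open_segment vp vr \<inter> open_segment vq vs \<noteq> {}" by blast
  moreover have "vt t \<in> open_segment vp vq"
    unfolding in_segment using tb by (intro conjI exI[of _ "(1 + t) / 2"]) (simp_all add: vec3_eq_iff vdefs field_simps)
  moreover have "vb b \<in> open_segment vr vs"
    unfolding in_segment using tb by (intro conjI exI[of _ "(1 - b) / 2"]) (simp_all add: vec3_eq_iff vdefs field_simps)
  moreover have "\<forall>v\<in>{vp, vq, vr, vs, vt t, vb b}. axis 3 1 \<bullet> v = 1"
    using d by (simp add: inner_axis inner_commute[of "axis 3 1"])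
  ultimately show ?thesis
    unfolding convex_marked_box_def std_box_def convex_quad_def using nc by blast
qed

abbreviation params :: "(real \<times> real) set" where "params \<equiv> {-1<..<1} \<times> {-1<..<1}"

definition box_rep :: "real \<times> real \<Rightarrow> z3z2 \<Rightarrow> mat3 \<Rightarrow> mat3" where
  "box_rep z = repr (box_rot (fst z) (snd z)) (box_pol (fst z) (snd z))"

text \<open>Rotation and polarity of a marked box are determined by it, hence carried along by the projective transformation that
  makes the box standard.\<close>

lemma pappus_rep_class:
  assumes M: "convex_marked_box M" and \<rho>: "pappus_rep M \<rho>"
  shows "\<exists>t b. marked_square t b \<and> conj_class \<rho> = conj_class (box_rep (t, b))"
proof -
  obtain g t b where g: "g \<in> SL3" and ms: "marked_square t b" and Mg: "M = tr_box g (std_box t b)"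
    using normalization[OF M] by blast
  interpret marked_square t b by fact
  obtain T k where T: "box_rotation M T" "\<rho> \<sigma>3 = proj_isom T" and k: "box_polarity M k" "\<rho> \<sigma>2 = dual_isom k"
    and hom: "\<rho> \<in> hom Z3Z2 isom_group"
    using \<rho> unfolding pappus_rep_def by blast
  have kS: "k \<in> SL3" "polarity_acts M k" using k(1) by (simp_all add: box_polarity_iff)
  have "adj g ** T ** g = box_rot t b"
    using std_rotation_unique rotation_pullback[OF g] T(1) unfolding Mg by blast
  then have "g ** (adj g ** (T ** g)) ** adj g = g ** box_rot t b ** adj g" by (simp add: matrix_mul_assoc)
  then have "T ** (g ** adj g) = g ** box_rot t b ** adj g" unfolding SL3_cancel(4)[OF g] by (simp add: matrix_mul_assoc)
  then have Te: "T = g ** box_rot t b ** adj g" using g by (simp add: SL3_cancel)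
  have tc: "ct g ** transpose g = mat 1" using SL3_cancel(2)[OF g] by (simp add: ct_def flip: matrix_transpose_mul)
  have "adj g ** k ** ct g = box_pol t b"
  proof (rule std_polarity_unique)
    show "adj g ** k ** ct g \<in> SL3" using g kS by (simp add: SL3_mult)
    show "polarity_acts (std_box t b) (adj g ** k ** ct g)" using polarity_pullback[OF g kS(1)] kS(2) unfolding Mg .
  qed
  then have "g \<star> (adj g ** (k ** ct g)) = g \<star> box_pol t b" by (simp add: matrix_mul_assoc)
  then have "k ** (ct g ** transpose g) = g \<star> box_pol t b" unfolding SL3_cancel(4)[OF g] by (simp add: matrix_mul_assoc)
  then have ke: "k = g \<star> box_pol t b" unfolding tc by simp
  interpret rp: rotation_polarity T k unfolding Te ke by (rule rotation_polarity_conj[OF rotation_polarity g])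
  interpret r0: rotation_polarity "box_rot t b" "box_pol t b" by (rule rotation_polarity)
  have "\<rho> = repr T k" by (rule rp.repr_unique[OF hom T(2) k(2)])
  also have "\<dots> = (\<lambda>w. proj_isom g \<cdot> box_rep (t, b) w \<cdot> iinv (proj_isom g))"
    unfolding Te ke box_rep_def fst_conv snd_conv by (rule repr_conj[OF rotation_polarity g])
  finally have e: "\<rho> = (\<lambda>w. proj_isom g \<cdot> box_rep (t, b) w \<cdot> iinv (proj_isom g))" .
  have "conj_class \<rho> = conj_class (box_rep (t, b))"
    unfolding e by (rule conj_class_conj) (use g rep_closed[OF r0.repr_hom] in \<open>simp_all add: box_rep_def\<close>)
  then show ?thesis using ms by blast
qed

lemma Pappus_eq: "Pappus = (\<lambda>z. conj_class (box_rep z)) ` params"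
proof
  show "Pappus \<subseteq> (\<lambda>z. conj_class (box_rep z)) ` params"
  proof
    fix c assume "c \<in> Pappus"
    then obtain \<rho> M where "c = conj_class \<rho>" "convex_marked_box M" "pappus_rep M \<rho>" unfolding Pappus_def by blast
    then obtain t b where "marked_square t b" "c = conj_class (box_rep (t, b))" using pappus_rep_class by blast
    then show "c \<in> (\<lambda>z. conj_class (box_rep z)) ` params"
      by (auto simp: marked_square_def)
  qed
  show "(\<lambda>z. conj_class (box_rep z)) ` params \<subseteq> Pappus"
  proof
    fix c assume "c \<in> (\<lambda>z. conj_class (box_rep z)) ` params"
    then obtain t b where c: "c = conj_class (box_rep (t, b))" "marked_square t b" by (auto simp: marked_square_def)
    interpret marked_square t b by fact
    interpret r: rotation_polarity "box_rot t b" "box_pol t b" by (rule rotation_polarity)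
    have "pappus_rep (std_box t b) (box_rep (t, b))"
      unfolding pappus_rep_def box_rep_def using r.repr_hom r.repr_generators std_rotation std_box_polarity by auto
    then show "c \<in> Pappus" unfolding Pappus_def using c std_box_convex by blast
  qed
qed

section \<open>The Barbot component\<close>

lemma continuous_on_transpose:
  fixes A :: "'a::topological_space \<Rightarrow> mat3"
  assumes "continuous_on S A" shows "continuous_on S (\<lambda>t. transpose (A t))"
  using assms unfolding continuous_entries[of S "\<lambda>t. transpose (A t)"] continuous_entries[of S A] by simp

lemma continuous_on_val:
  assumes "continuous_on S T" "continuous_on S h"
  shows "continuous_on S (\<lambda>z. fst (val (T z) (h z) u)) \<and> (\<exists>\<sigma>. \<forall>z\<in>S. snd (val (T z) (h z) u) = \<sigma>)"
proof (induction u)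
  case (Cons x u)
  then obtain \<sigma> where c: "continuous_on S (\<lambda>z. fst (val (T z) (h z) u))" and s: "\<forall>z\<in>S. snd (val (T z) (h z) u) = \<sigma>" by blast
  have ct: "continuous_on S (\<lambda>z. ct (fst (val (T z) (h z) u)))"
    unfolding ct_def by (intro continuous_on_transpose continuous_on_adj c)
  have e: "val (T z) (h z) (x # u) = (case x of S3 \<Rightarrow> (T z ** fst (val (T z) (h z) u), snd (val (T z) (h z) u))
     | S2 \<Rightarrow> (h z ** ct (fst (val (T z) (h z) u)), \<not> snd (val (T z) (h z) u)))" for z
    by (cases x; cases "val (T z) (h z) u") auto
  show ?case
    unfolding e using s assms c ct by (cases x) (auto intro!: continuous_on_matrix_mult)
next
  case Nil then show ?case by (auto intro: exI[of _ False])
qed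

lemma continuous_box_pair:
  "continuous_on params (\<lambda>z. box_rot (fst z) (snd z))"
  "continuous_on params (\<lambda>z. box_pol (fst z) (snd z))"
proof -
  have m: "continuous_on S (\<lambda>z. rotm (fst z) (snd z))" "continuous_on S (\<lambda>z. polm (fst z) (snd z))" for S
    unfolding continuous_entries[of S "\<lambda>z. rotm (fst z) (snd z)"] continuous_entries[of S "\<lambda>z. polm (fst z) (snd z)"] forall_3
    unfolding rotm_def polm_def m3_entry by (intro conjI continuous_intros)+
  have nz: "det (rotm (fst z) (snd z)) \<noteq> 0" "det (polm (fst z) (snd z)) \<noteq> 0" if "z \<in> params" for z
  proof -
    interpret marked_square "fst z" "snd z" by unfold_locales (use that in auto)
    show "det (rotm (fst z) (snd z)) \<noteq> 0" "det (polm (fst z) (snd z)) \<noteq> 0" using det_rotm_pos det_polm_pos by simp_all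
  qed
  have u: "continuous_on S (\<lambda>z. unim (A z))" if "continuous_on S A" "\<And>z. z \<in> S \<Longrightarrow> det (A z) \<noteq> 0" for S and A :: "real \<times> real \<Rightarrow> mat3"
  proof -
    have e: "continuous_on S (\<lambda>z. A z $ i $ j)" for i j using that(1) continuous_entries by blast
    have "continuous_on S (\<lambda>z. det (A z))"
      unfolding det_3 by (intro continuous_on_add continuous_on_diff continuous_on_mult e)
    then show ?thesis unfolding unim_def using that by (intro continuous_intros) auto
  qed
  show "continuous_on params (\<lambda>z. box_rot (fst z) (snd z))"
    unfolding box_rot_def by (rule u[OF m(1)]) (rule nz(1))
  have "continuous_on params (\<lambda>z. unim (polm (fst z) (snd z)))"
    by (rule u[OF m(2)]) (rule nz(2))
  then show "continuous_on params (\<lambda>z. box_pol (fst z) (snd z))"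
    unfolding box_pol_def by (rule continuous_on_adj)
qed

lemma box_rep_df_reps: "z \<in> params \<Longrightarrow> box_rep z \<in> df_reps"
  unfolding box_rep_def by (rule marked_square.box_rep_df) (auto simp: marked_square_def)

lemma box_rep_continuous: "continuous_map (top_of_set params) rep_topology box_rep"
proof -
  have X: "box_rep z w \<in> IsomX" if "z \<in> params" for z w
    using box_rep_df_reps[OF that] by (intro rep_closed) (simp add: df_reps_def)
  have c: "continuous_on params (\<lambda>z. box_rep z w P)" if P: "P \<in> X" for w P
  proof -
    let ?v = "\<lambda>z. val (box_rot (fst z) (snd z)) (box_pol (fst z) (snd z)) (rep_z3z2 w)"
    obtain \<sigma> where v: "continuous_on params (\<lambda>z. fst (?v z))" "\<And>z. z \<in> params \<Longrightarrow> snd (?v z) = \<sigma>"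
      using continuous_on_val[OF continuous_box_pair, of "rep_z3z2 w"] by blast
    have S: "fst (?v z) \<in> SL3" if "z \<in> params" for z
    proof -
      interpret marked_square "fst z" "snd z" by unfold_locales (use that in auto)
      interpret rotation_polarity "box_rot (fst z) (snd z)" "box_pol (fst z) (snd z)" by (rule rotation_polarity)
      show ?thesis by (rule val_SL3)
    qed
    have "continuous_on params (\<lambda>z. fst (?v z) ** (if \<sigma> then adj P else P) ** transpose (fst (?v z)))"
      by (intro continuous_on_matrix_mult continuous_on_transpose v(1) continuous_on_const)
    then show ?thesis
    proof (rule continuous_on_eq)
      fix z assume z: "z \<in> params"
      obtain a where a: "?v z = (a, \<sigma>)" using v(2)[OF z] by (cases "?v z") auto
      have "a \<in> SL3" using S[OF z] a by simp
      then show "fst (?v z) ** (if \<sigma> then adj P else P) ** transpose (fst (?v z)) = box_rep z w P"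
        unfolding box_rep_def repr_def a using P by (simp add: proj_isom_apply dual_isom_apply)
    qed
  qed
  have w: "continuous_map (top_of_set params) isom_topology (\<lambda>z. box_rep z w)" for w
  proof -
    have "continuous_map (top_of_set params) (product_topology (\<lambda>_. top_of_set X) X) (\<lambda>z. box_rep z w)"
      unfolding continuous_map_componentwise
    proof (intro conjI ballI)
      show "(\<lambda>z. box_rep z w) ` topspace (top_of_set params) \<subseteq> extensional X"
        using isom_PiE[OF X] by (auto simp: PiE_def)
      fix P assume P: "P \<in> X"
      show "continuous_map (top_of_set params) (top_of_set X) (\<lambda>z. box_rep z w P)"
        using c[OF P] IsomX_X[OF X P] by (auto simp: continuous_map_in_subtopology)
    qed
    then show ?thesis using X by (auto simp: isom_topology_def continuous_map_in_subtopology)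
  qed
  then show ?thesis
    unfolding rep_topology_def continuous_map_in_subtopology continuous_map_componentwise_UNIV
    using box_rep_df_reps by auto
qed

lemma Pappus_connected: "connectedin DFR_topology Pappus"
proof -
  have "connectedin (top_of_set params) params"
    by (simp add: connectedin_subtopology connected_Times)
  then have "connectedin rep_topology (box_rep ` params)"
    by (rule connectedin_continuous_map_image[OF box_rep_continuous])
  then have "connectedin DFR_topology (conj_class ` box_rep ` params)"
    by (rule connectedin_continuous_map_image[OF quotient_imp_continuous_map[OF quotient_map_conj_class]])
  then show ?thesis by (simp add: Pappus_eq image_image)
qed

lemma Pappus_nonempty: "Pappus \<noteq> {}"
  unfolding Pappus_eq by (auto simp: greaterThanLessThan_empty_iff)

text \<open>The Pappus classes form a nonempty connected set, so exactly one component contains it, and \<open>Barbot\<close> does denote a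
  component.\<close>

lemma Barbot_component: "Barbot \<in> connected_components_of DFR_topology"
proof -
  have sub: "Pappus \<subseteq> topspace DFR_topology" by (rule connectedin_subset_topspace[OF Pappus_connected])
  then have "topspace DFR_topology \<noteq> {}" using Pappus_nonempty by blast
  then have "DFR_topology \<noteq> trivial_topology" by (simp add: null_topspace_iff_trivial)
  then obtain C where C: "C \<in> connected_components_of DFR_topology" "Pappus \<subseteq> C"
    using exists_connected_component_of_superset[OF Pappus_connected] by blast
  have "Barbot = C" unfolding Barbot_def
  proof (rule the_equality)
    show "C \<in> connected_components_of DFR_topology \<and> Pappus \<subseteq> C" using C by blast
    fix C' assume C': "C' \<in> connected_components_of DFR_topology \<and> Pappus \<subseteq> C'"
    then have "C' \<inter> C \<noteq> {}" using C(2) Pappus_nonempty by blast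
    then show "C' = C" using connected_components_of_overlap[of C' DFR_topology C] C(1) C' by blast
  qed
  then show ?thesis using C(1) by simp
qed

theorem theorem1p2:
  shows "\<exists>U. openin (subtopology DFR_topology (Barbot - Pappus)) U \<and>
    (subtopology DFR_topology (Barbot - Pappus)) closure_of U = Barbot - Pappus \<and>
    (\<forall>\<rho>\<in>df_reps. conj_class \<rho> \<in> Barbot - Pappus \<longrightarrow>
      (\<exists>Y1 Y2. Y1 \<noteq> Y2 \<and>
        (\<forall>Y\<in>{Y1, Y2}. geodesic_pattern Y \<and> infinite Y \<and> embedded Y \<and>
          finite_index_in (range \<rho>) (IsomY Y) \<and> embedded (flat_pattern Y)) \<and>
        (conj_class \<rho> \<in> U \<longrightarrow>
          range \<rho> = IsomY Y1 \<and> range \<rho> = IsomY Y2 \<and> \<not> isometric_patterns Y1 Y2)))"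
proof -
  let ?W = "Barbot - Pappus"
  have sub: "?W \<subseteq> topspace DFR_topology" using connected_components_of_subset[OF Barbot_component] by blast
  then have top: "topspace (subtopology DFR_topology ?W) = ?W" by (simp add: Int_absorb1)
  have o: "openin (subtopology DFR_topology ?W) ?W" using sub by (simp add: openin_subtopology_refl)
  have c: "(subtopology DFR_topology ?W) closure_of ?W = ?W"
    using closure_of_topspace[of "subtopology DFR_topology ?W"] unfolding top .
  show ?thesis
  proof (intro exI[of _ ?W] conjI o c ballI impI)
    fix \<rho> assume "\<rho> \<in> df_reps"
    from representation_patterns[OF this]
    show "\<exists>Y1 Y2. Y1 \<noteq> Y2 \<and>
        (\<forall>Y\<in>{Y1, Y2}. geodesic_pattern Y \<and> infinite Y \<and> embedded Y \<and>
          finite_index_in (range \<rho>) (IsomY Y) \<and> embedded (flat_pattern Y)) \<and>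
        (conj_class \<rho> \<in> ?W \<longrightarrow>
          range \<rho> = IsomY Y1 \<and> range \<rho> = IsomY Y2 \<and> \<not> isometric_patterns Y1 Y2)" by blast
  qed
qed

end
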